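(* Let $(y_h,b_h)_{h>0}$ be a sequence of minimizers of the discrete problems of minimizing $E_{\delta,\varepsilon,h}$ among all discrete admissible pairs in $V_h$, possibly up to tolerances $\varepsilon_{\rm tol}$ that vanish as $h\to0$. If an accumulation point $(y,b)\in V$ of the sequence is such that there exists a sequence $\sigma\to 0$ such that $$h^2\varepsilon_1^{-1}+\sigma^2\varepsilon_2^{-1}+h^2[y,b]_\sigma^2\,\varepsilon_2^{-1}\to 0\quad\text{as }h\to 0,$$ then every weak accumulation point $(y,b)\in V$ of the sequence as $(\delta,\varepsilon,h)\to 0$ minimizes the constrained energy functional $E$.
   Context: Let $L>0$, $V=H^2(0,L;\mathbb{R}^3)\times H^1(0,L;\mathbb{R}^3)$, and let $L_{\rm bc}$ be a bounded linear operator on $V$ that depends only on the boundary values (at $0$ and $L$) of $y$, $y'$ and $b$; $\ell_{\rm bc}$ is given data. Set $$\mathcal{A}_{\rm frame}=\{(y,b)\in V:\ [y',b,y'\times b]\in SO(3)\text{ a.e. in }(0,L),\ L_{\rm bc}[y,b]=\ell_{\rm bc}\}.$$ A pair $(y,b)$ is called admissible if $(y,b)\in\mathcal{A}_{\rm frame}$ and $y'\cdot b'=0$ a.e. The function $\overline{Q}$ is $\overline{Q}(\alpha,\beta)=(\alpha^2+\beta^2)^2/\alpha^2$ if $|\alpha|\ge|\beta|$ and $\overline{Q}(\alpha,\beta)=4\beta^2$ if $|\alpha|\le|\beta|$ (value $0$ at $(0,0)$). The constrained functional is $E[y,b]=\int_0^L\overline{Q}(|y''|,|b'|)\,dx$,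 to be minimized among admissible pairs $(y,b)$. For admissible $(y,b)$ and $\sigma>0$, $(y_\sigma,b_\sigma)\in[C^\infty(0,L;\mathbb{R}^3)]^2\cap\mathcal{A}_{\rm frame}$ denotes a smooth approximating frame with $$\|y-y_\sigma\|_{H^2(0,L)}+\|b-b_\sigma\|_{H^1(0,L)}+\|y_\sigma'\cdot b_\sigma'\|_{L^2(0,L)}\le\sigma,$$ and $[y,b]_\sigma=\|y_\sigma\|_{H^3(0,L)}+\|b_\sigma\|_{H^2(0,L)}$. Regularized modulus: for every $\delta>0$ a function $|\cdot|_\delta\in C^2(\mathbb{R};\mathbb{R}_{\ge0})$ is given such that, with constants $c_0,c_1,c_2,c_{\rm uni}$ independent of $\delta$, $|x|_\delta\ge c_0\delta$, $\big|(|\cdot|_\delta)'\big|\le c_1$, $\big|(|\cdot|_\delta)''\big|\le c_2\delta^{-1}$, and $\big||x|_\delta-|x|\big|\le c_{\rm uni}\delta$ for all $x\in\mathbb{R}$. Set $$\psi_\delta(\alpha^2,\beta^2)=|\alpha^2-\beta^2|_\delta+\frac{4\beta^4}{\alpha^2+\beta^2+|\alpha^2-\beta^2|_\delta}.$$ Discretization: $\mathcal{T}_h$ is a quasiuniform family (minimal element length $\ge c\,h$) of partitions $0=x_0<x_1<\dots<x_N=L$ of $(0,L)$ with maximal element length $h$. $\mathcal{S}^{p,k}(\mathcal{T}_h)$ is the space of $C^k$ functions on $[0,L]$ that are polynomials of degree at most $p$ on each element. $V_h=\mathcal{S}^{3,1}(\mathcal{T}_h)^3\times\mathcal{S}^{1,0}(\mathcal{T}_h)^3\subset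 V$. A pair $(y_h,b_h)\in V_h$ is called discrete admissible if $|y_h'(x_j)|=|b_h(x_j)|=1$ for $j=0,\dots,N$ and $L_{\rm bc}[y_h,b_h]=\ell_{\rm bc}$. For parameters $\delta>0$ and $\varepsilon=(\varepsilon_1,\varepsilon_2)$, $\varepsilon_1,\varepsilon_2>0$, and discrete admissible pairs, $$E_{\delta,\varepsilon,h}[y_h,b_h]=\frac12\int_0^L|y_h''|^2+5|b_h'|^2+\psi_\delta(|y_h''|^2,|b_h'|^2)\,dx+\frac1{2\varepsilon_1}\int_0^L(y_h'\cdot b_h)^2dx+\frac1{2\varepsilon_2}\int_0^L(y_h'\cdot b_h')^2dx.$$ Being a minimizer up to the tolerance $\varepsilon_{\rm tol}$ means $E_{\delta,\varepsilon,h}[y_h,b_h]\le E_{\delta,\varepsilon,h}[\widetilde y_h,\widetilde b_h]+\varepsilon_{\rm tol}$ for all discrete admissible $(\widetilde y_h,\widetilde b_h)\in V_h$. *)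

theory Defs
  imports "HOL-Analysis.Analysis"
begin

section \<open>Smooth functions and Sobolev spaces on an interval\<close>

text \<open>On a closed interval the derivatives at the endpoints are one-sided.\<close>

primrec Ck_on :: "nat \<Rightarrow> real set \<Rightarrow> (real \<Rightarrow> 'a::real_normed_vector) \<Rightarrow> bool" where
  "Ck_on 0 S f \<longleftrightarrow> continuous_on S f"
| "Ck_on (Suc k) S f \<longleftrightarrow>
     (\<exists>g. (\<forall>x\<in>S. (f has_vector_derivative g x) (at x within S)) \<and> Ck_on k S g)"

definition Cinf_on :: "real set \<Rightarrow> (real \<Rightarrow> 'a::real_normed_vector) \<Rightarrow> bool" where
  "Cinf_on S f \<longleftrightarrow> (\<forall>k. Ck_on k S f)"

definition test_function :: "real \<Rightarrow> (real \<Rightarrow> real) \<Rightarrow> bool" where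
  "test_function L \<phi> \<longleftrightarrow> Cinf_on UNIV \<phi> \<and>
     (\<exists>a b. 0 < a \<and> a < b \<and> b < L \<and> (\<forall>x. x \<notin> {a..b} \<longrightarrow> \<phi> x = 0))"

abbreviation leb_int :: "real \<Rightarrow> real measure" where
  "leb_int L \<equiv> lebesgue_on {0<..<L}"

definition sq_integrable :: "real \<Rightarrow> (real \<Rightarrow> 'a::euclidean_space) \<Rightarrow> bool" where
  "sq_integrable L f \<longleftrightarrow>
     f \<in> borel_measurable (leb_int L) \<and> integrable (leb_int L) (\<lambda>x. (norm (f x))\<^sup>2)"

definition L2norm :: "real \<Rightarrow> (real \<Rightarrow> 'a::euclidean_space) \<Rightarrow> real" where
  "L2norm L f = sqrt (\<integral>x. (norm (f x))\<^sup>2 \<partial>leb_int L)"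

text \<open>Only weak derivatives that are square integrable are considered.  Elements of Sobolev
  spaces are arbitrary representatives of their classes modulo null sets, so that \<open>wderiv\<close>,
  which selects a weak derivative, is determined up to null sets.\<close>

definition has_weak_deriv ::
  "real \<Rightarrow> (real \<Rightarrow> 'a::euclidean_space) \<Rightarrow> (real \<Rightarrow> 'a) \<Rightarrow> bool" where
  "has_weak_deriv L f g \<longleftrightarrow> sq_integrable L g \<and>
     (\<forall>\<phi>. test_function L \<phi> \<longrightarrow>
        (\<integral>x. deriv \<phi> x *\<^sub>R f x \<partial>leb_int L) = - (\<integral>x. \<phi> x *\<^sub>R g x \<partial>leb_int L))"

definition wderiv :: "real \<Rightarrow> (real \<Rightarrow> 'a::euclidean_space) \<Rightarrow> real \<Rightarrow> 'a" where
  "wderiv L f = (SOME g. has_weak_deriv L f g)"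

primrec sobolev :: "nat \<Rightarrow> real \<Rightarrow> (real \<Rightarrow> 'a::euclidean_space) \<Rightarrow> bool" where
  "sobolev 0 L f \<longleftrightarrow> sq_integrable L f"
| "sobolev (Suc k) L f \<longleftrightarrow> sq_integrable L f \<and> (\<exists>g. has_weak_deriv L f g \<and> sobolev k L g)"

definition Hnorm :: "nat \<Rightarrow> real \<Rightarrow> (real \<Rightarrow> 'a::euclidean_space) \<Rightarrow> real" where
  "Hnorm k L f = sqrt (\<Sum>j\<le>k. (L2norm L ((wderiv L ^^ j) f))\<^sup>2)"

text \<open>The continuous representative on \<open>[0,L]\<close> of a class in \<open>H\<^sup>1(0,L)\<close>; it gives
  meaning to boundary values.\<close>

definition cts_rep :: "real \<Rightarrow> (real \<Rightarrow> 'a::euclidean_space) \<Rightarrow> real \<Rightarrow> 'a" where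
  "cts_rep L f = (SOME g. continuous_on {0..L} g \<and> (AE x in leb_int L. g x = f x))"

section \<open>Framed curves\<close>

type_synonym framing = "(real \<Rightarrow> real^3) \<times> (real \<Rightarrow> real^3)"

definition V :: "real \<Rightarrow> framing set" where
  "V L = {(y, b). sobolev 2 L y \<and> sobolev 1 L b}"

definition Vnorm :: "real \<Rightarrow> framing \<Rightarrow> real" where
  "Vnorm L v = Hnorm 2 L (fst v) + Hnorm 1 L (snd v)"

definition bounded_linear_V :: "real \<Rightarrow> (framing \<Rightarrow> 'c::real_normed_vector) \<Rightarrow> bool" where
  "bounded_linear_V L F \<longleftrightarrow>
     (\<forall>y b z d. \<forall>s t. (y, b) \<in> V L \<longrightarrow> (z, d) \<in> V L \<longrightarrow>
        F (\<lambda>x. s *\<^sub>R y x + t *\<^sub>R z x, \<lambda>x. s *\<^sub>R b x + t *\<^sub>R d x)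
          = s *\<^sub>R F (y, b) + t *\<^sub>R F (z, d)) \<and>
     (\<exists>K. \<forall>v\<in>V L. norm (F v) \<le> K * Vnorm L v)"

definition weakly_tendsto_V :: "real \<Rightarrow> (nat \<Rightarrow> framing) \<Rightarrow> framing \<Rightarrow> bool" where
  "weakly_tendsto_V L vs v \<longleftrightarrow>
     (\<forall>F :: framing \<Rightarrow> real. bounded_linear_V L F \<longrightarrow> (\<lambda>n. F (vs n)) \<longlonglongrightarrow> F v)"

definition weak_accumulation_point :: "real \<Rightarrow> (nat \<Rightarrow> framing) \<Rightarrow> framing \<Rightarrow> bool" where
  "weak_accumulation_point L vs v \<longleftrightarrow>
     v \<in> V L \<and> (\<exists>r :: nat \<Rightarrow> nat. strict_mono r \<and> weakly_tendsto_V L (vs \<circ> r) v)"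

definition boundary_values :: "real \<Rightarrow> framing \<Rightarrow> (real^3) list" where
  "boundary_values L = (\<lambda>(y, b).
     [cts_rep L y 0, cts_rep L y L,
      cts_rep L (wderiv L y) 0, cts_rep L (wderiv L y) L,
      cts_rep L b 0, cts_rep L b L])"

definition boundary_operator :: "real \<Rightarrow> (framing \<Rightarrow> 'c::real_normed_vector) \<Rightarrow> bool" where
  "boundary_operator L Lbc \<longleftrightarrow> bounded_linear_V L Lbc \<and>
     (\<forall>v\<in>V L. \<forall>w\<in>V L. boundary_values L v = boundary_values L w \<longrightarrow> Lbc v = Lbc w)"

text \<open>\<open>vector\<close> lists the rows of a matrix, hence the transposition.\<close>

definition frame_matrix :: "real^3 \<Rightarrow> real^3 \<Rightarrow> real^3^3" where
  "frame_matrix t b = transpose (vector [t, b, cross3 t b])"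

definition A_frame ::
  "real \<Rightarrow> (framing \<Rightarrow> 'c::real_normed_vector) \<Rightarrow> 'c \<Rightarrow> framing set" where
  "A_frame L Lbc lbc = {(y, b). (y, b) \<in> V L \<and>
     (AE x in leb_int L. rotation_matrix (frame_matrix (wderiv L y x) (b x))) \<and>
     Lbc (y, b) = lbc}"

definition admissible ::
  "real \<Rightarrow> (framing \<Rightarrow> 'c::real_normed_vector) \<Rightarrow> 'c \<Rightarrow> framing set" where
  "admissible L Lbc lbc = {(y, b). (y, b) \<in> A_frame L Lbc lbc \<and>
     (AE x in leb_int L. wderiv L y x \<bullet> wderiv L b x = 0)}"

definition Qbar :: "real \<Rightarrow> real \<Rightarrow> real" where
  "Qbar \<alpha> \<beta> =
     (if \<alpha> = 0 \<and> \<beta> = 0 then 0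
      else if \<bar>\<beta>\<bar> \<le> \<bar>\<alpha>\<bar> then (\<alpha>\<^sup>2 + \<beta>\<^sup>2)\<^sup>2 / \<alpha>\<^sup>2
      else 4 * \<beta>\<^sup>2)"

definition energy :: "real \<Rightarrow> framing \<Rightarrow> real" where
  "energy L = (\<lambda>(y, b).
     \<integral>x. Qbar (norm (wderiv L (wderiv L y) x)) (norm (wderiv L b x)) \<partial>leb_int L)"

definition is_minimizer ::
  "real \<Rightarrow> (framing \<Rightarrow> 'c::real_normed_vector) \<Rightarrow> 'c \<Rightarrow> framing \<Rightarrow> bool" where
  "is_minimizer L Lbc lbc v \<longleftrightarrow> v \<in> admissible L Lbc lbc \<and>
     (\<forall>w\<in>admissible L Lbc lbc. energy L v \<le> energy L w)"

text \<open>\<open>w\<close> is a possible choice of the smooth frame \<open>(y\<^sub>\<sigma>, b\<^sub>\<sigma>)\<close> that approximates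
  \<open>v = (y, b)\<close>.  Smoothness on the open interval does not imply integrability up to the
  endpoints; the \<open>H\<^sup>3\<close> and \<open>H\<^sup>2\<close> conditions say that \<open>frame_size\<close>, written
  \<open>[y, b]\<^sub>\<sigma>\<close> in mathematical notation, is finite.\<close>

definition smooth_approx_frame ::
  "real \<Rightarrow> (framing \<Rightarrow> 'c::real_normed_vector) \<Rightarrow> 'c \<Rightarrow> framing \<Rightarrow> real \<Rightarrow> framing \<Rightarrow> bool"
where
  "smooth_approx_frame L Lbc lbc v \<sigma> w \<longleftrightarrow>
     w \<in> A_frame L Lbc lbc \<and>
     Cinf_on {0<..<L} (fst w) \<and> Cinf_on {0<..<L} (snd w) \<and>
     sobolev 3 L (fst w) \<and> sobolev 2 L (snd w) \<and>
     Hnorm 2 L (\<lambda>x. fst v x - fst w x) + Hnorm 1 L (\<lambda>x. snd v x - snd w x)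
       + L2norm L (\<lambda>x. wderiv L (fst w) x \<bullet> wderiv L (snd w) x) \<le> \<sigma>"

definition frame_size :: "real \<Rightarrow> framing \<Rightarrow> real" where
  "frame_size L w = Hnorm 3 L (fst w) + Hnorm 2 L (snd w)"

section \<open>Regularization and discretization\<close>

text \<open>\<open>m \<delta> x\<close> stands for \<open>|x|\<^sub>\<delta>\<close>.\<close>

definition regularized_modulus ::
  "(real \<Rightarrow> real \<Rightarrow> real) \<Rightarrow> real \<Rightarrow> real \<Rightarrow> real \<Rightarrow> real \<Rightarrow> bool" where
  "regularized_modulus m c0 c1 c2 cuni \<longleftrightarrow> 0 < c0 \<and>
     (\<forall>\<delta>>0. \<exists>m' m''. continuous_on UNIV m'' \<and>
        (\<forall>x. (m \<delta> has_real_derivative m' x) (at x) \<and>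
             (m' has_real_derivative m'' x) (at x) \<and>
             0 \<le> m \<delta> x \<and> c0 * \<delta> \<le> m \<delta> x \<and>
             \<bar>m' x\<bar> \<le> c1 \<and> \<bar>m'' x\<bar> \<le> c2 / \<delta> \<and>
             \<bar>m \<delta> x - \<bar>x\<bar>\<bar> \<le> cuni * \<delta>))"

text \<open>The arguments \<open>s\<close> and \<open>t\<close> are the squares \<open>\<alpha>\<^sup>2\<close> and \<open>\<beta>\<^sup>2\<close>.\<close>

definition psi :: "(real \<Rightarrow> real \<Rightarrow> real) \<Rightarrow> real \<Rightarrow> real \<Rightarrow> real \<Rightarrow> real" where
  "psi m \<delta> s t = m \<delta> (s - t) + 4 * t\<^sup>2 / (s + t + m \<delta> (s - t))"

text \<open>A partition is given by its number \<open>N\<close> of elements and its nodes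
  \<open>X 0 < X 1 < \<dots> < X N\<close>; the values \<open>X j\<close> for \<open>j > N\<close> are irrelevant.\<close>

definition is_partition :: "real \<Rightarrow> nat \<Rightarrow> (nat \<Rightarrow> real) \<Rightarrow> real \<Rightarrow> bool" where
  "is_partition L N X h \<longleftrightarrow> 0 < N \<and> X 0 = 0 \<and> X N = L \<and> (\<forall>j<N. X j < X (Suc j)) \<and>
     h = Max ((\<lambda>j. X (Suc j) - X j) ` {..<N})"

definition quasiuniform :: "(nat \<Rightarrow> nat) \<Rightarrow> (nat \<Rightarrow> nat \<Rightarrow> real) \<Rightarrow> (nat \<Rightarrow> real) \<Rightarrow> bool" where
  "quasiuniform N X h \<longleftrightarrow>
     (\<exists>c>0. \<forall>n. \<forall>j<N n. c * h n \<le> X n (Suc j) - X n j)"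

definition spline_space ::
  "nat \<Rightarrow> nat \<Rightarrow> real \<Rightarrow> nat \<Rightarrow> (nat \<Rightarrow> real) \<Rightarrow> (real \<Rightarrow> real) set" where
  "spline_space p k L N X = {f. Ck_on k {0..L} f \<and>
     (\<forall>j<N. \<exists>a :: nat \<Rightarrow> real. \<forall>x\<in>{X j..X (Suc j)}. f x = (\<Sum>i\<le>p. a i * x ^ i))}"

definition V_h :: "real \<Rightarrow> nat \<Rightarrow> (nat \<Rightarrow> real) \<Rightarrow> framing set" where
  "V_h L N X = {(y, b). \<forall>i. (\<lambda>x. y x $ i) \<in> spline_space 3 1 L N X \<and>
                            (\<lambda>x. b x $ i) \<in> spline_space 1 0 L N X}"

definition discrete_admissible ::
  "real \<Rightarrow> (framing \<Rightarrow> 'c::real_normed_vector) \<Rightarrow> 'c \<Rightarrow> nat \<Rightarrow> (nat \<Rightarrow> real) \<Rightarrow> framing set" where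
  "discrete_admissible L Lbc lbc N X = {(y, b). (y, b) \<in> V_h L N X \<and>
     (\<forall>j\<le>N. norm (vector_derivative y (at (X j) within {0..L})) = 1 \<and> norm (b (X j)) = 1) \<and>
     Lbc (y, b) = lbc}"

text \<open>On \<open>V_h\<close> the energy depends on the mesh only through its domain.\<close>

definition discrete_energy ::
  "real \<Rightarrow> (real \<Rightarrow> real \<Rightarrow> real) \<Rightarrow> real \<Rightarrow> real \<Rightarrow> real \<Rightarrow> framing \<Rightarrow> real" where
  "discrete_energy L m \<delta> \<epsilon>1 \<epsilon>2 = (\<lambda>(y, b).
     1 / 2 * (\<integral>x. (norm (wderiv L (wderiv L y) x))\<^sup>2 + 5 * (norm (wderiv L b x))\<^sup>2
                   + psi m \<delta> ((norm (wderiv L (wderiv L y) x))\<^sup>2) ((norm (wderiv L b x))\<^sup>2) \<partial>leb_int L)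
     + 1 / (2 * \<epsilon>1) * (\<integral>x. (wderiv L y x \<bullet> b x)\<^sup>2 \<partial>leb_int L)
     + 1 / (2 * \<epsilon>2) * (\<integral>x. (wderiv L y x \<bullet> wderiv L b x)\<^sup>2 \<partial>leb_int L))"

definition minimizer_up_to ::
  "real \<Rightarrow> (framing \<Rightarrow> 'c::real_normed_vector) \<Rightarrow> 'c \<Rightarrow> (real \<Rightarrow> real \<Rightarrow> real) \<Rightarrow>
   nat \<Rightarrow> (nat \<Rightarrow> real) \<Rightarrow> real \<Rightarrow> real \<Rightarrow> real \<Rightarrow> real \<Rightarrow> framing \<Rightarrow> bool" where
  "minimizer_up_to L Lbc lbc m N X \<delta> \<epsilon>1 \<epsilon>2 tol v \<longleftrightarrow>
     v \<in> discrete_admissible L Lbc lbc N X \<and>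
     (\<forall>w\<in>discrete_admissible L Lbc lbc N X.
        discrete_energy L m \<delta> \<epsilon>1 \<epsilon>2 v \<le> discrete_energy L m \<delta> \<epsilon>1 \<epsilon>2 w + tol)"

end

theory Submission
  imports Defs
begin

text \<open>A weak limit of discrete frames of bounded energy is admissible, and its energy is bounded by the
  limit of the discrete energies, since \<open>Qbar\<close> is the square of a norm and hence lies above its
  tangents.  It remains to approximate an arbitrary admissible frame \<open>(T, B)\<close> by discrete frames.  Under
  \<open>h\<^sup>2 / \<epsilon>1 \<rightarrow> 0\<close> and \<open>h\<^sup>2 / \<epsilon>2 \<rightarrow> 0\<close>, interpolation makes both penalty terms vanish as soon as
  the frame is Lipschitz continuous.  A general admissible frame is made Lipschitz continuous without
  changing its boundary values or its constraints by a change of the parameter with density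
  \<open>g = 1 + e - (c + p \<bullet> T)\<close>, where \<open>e\<close> is large where \<open>\<bar>T'\<bar> + \<bar>B'\<bar>\<close> is large.  The new curve has the
  old end points if and only if the integrals of \<open>g\<close> and \<open>g T\<close> over \<open>(0, L)\<close> equal those of \<open>1\<close> and
  \<open>T\<close>.  These conditions are linear in \<open>g\<close>, and they are always solvable with a small correction
  \<open>(c, p)\<close>, because the moments of \<open>e\<close> against \<open>(1, T)\<close> lie in the range of the Gram matrix of
  \<open>(1, T)\<close>.\<close>

subsection \<open>Integrals over an interval\<close>

text \<open>The rate hypothesis speaks of one accumulation point, whereas minimality compares with
  every admissible frame, for which no smooth approximation of controlled size is given. It enters
  through two consequences: that point is admissible, so that the discrete energies are bounded by
  those of recovery frames, and, since |y'| = 1 forces \<open>frame_size\<close> to be at least sqrt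
  L, both quotients of h^2 by \<epsilon>1 and \<epsilon>2 tend to 0. This leaves room for errors of
  order h in y' \<bullet> b and y' \<bullet> b'. The obstacle is regularity. Mollifying an
  admissible frame destroys the pointwise constraints |T| = |B| = 1 and T \<bullet> B = T \<bullet>
  B' = 0; a change of parameter respects all of them, but moves the end point of the curve, hence
  the moment conditions. Energies converge under interpolation because the increments of (T, B) obey
  Jensen's inequality on every element. The only further contribution to y'' is the defect of the
  trapezoidal rule in the Hermite cubic. It is merely bounded on a single element, but small in the
  square sum, since the derivative of T in the new parameter is close to a continuous function in
  L2.\<close>

lemma finite_leb_int [simp]: "finite_measure (leb_int L)"
  by (simp add: finite_measure_lebesgue_on)

lemma sigma_finite_leb_int [simp]: "sigma_finite_measure (leb_int L)"
  using finite_measure.axioms(1) finite_leb_int by blast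

lemma measurable_leb_int_ident [measurable]: "(\<lambda>x. x) \<in> borel_measurable (leb_int L)"
  by (metis id_borel_measurable_lebesgue_on id_def measurable_cong)

lemma borel_measurable_leb_int:
  "f \<in> borel_measurable borel \<Longrightarrow> f \<in> borel_measurable (leb_int L)"
  using measurable_compose[OF measurable_leb_int_ident] by blast

lemma borel_measurable_leb_int_continuous:
  fixes f :: "real \<Rightarrow> 'a::{second_countable_topology, topological_space}"
  assumes "continuous_on {0..L} f"
  shows "f \<in> borel_measurable (leb_int L)"
  by (intro continuous_imp_measurable_on_sets_lebesgue continuous_on_subset[OF assms]) auto

lemma measure_leb_int: "0 \<le> L \<Longrightarrow> measure (leb_int L) (space (leb_int L)) = L"
  by (simp add: measure_restrict_space)

lemma integrable_const_leb_int [simp]: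
  "integrable (leb_int L) (\<lambda>x. c :: 'a::{banach, second_countable_topology})"
  by (simp add: finite_measure.integrable_const)

lemma integral_const_leb_int:
  "0 \<le> L \<Longrightarrow> (\<integral>x. c \<partial>leb_int L) = L *\<^sub>R (c :: 'a::euclidean_space)"
  using measure_leb_int[of L] by simp

lemma integrable_bounded_leb_int:
  fixes f :: "real \<Rightarrow> 'a::euclidean_space"
  assumes "f \<in> borel_measurable (leb_int L)" "\<And>x. 0 < x \<Longrightarrow> x < L \<Longrightarrow> norm (f x) \<le> B"
  shows "integrable (leb_int L) f"
  by (rule finite_measure.integrable_const_bound[OF finite_leb_int, of _ B])
     (use assms in \<open>auto simp: AE_restrict_space_iff\<close>)

lemma integrable_continuous_leb_int:
  fixes f :: "real \<Rightarrow> 'a::euclidean_space"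
  assumes "continuous_on {0..L} f"
  shows "integrable (leb_int L) f"
proof -
  have "bounded (f ` {0..L})"
    using assms compact_continuous_image compact_imp_bounded by blast
  then obtain B where "\<And>x. x \<in> {0..L} \<Longrightarrow> norm (f x) \<le> B"
    by (meson bounded_iff imageI)
  then show ?thesis
    using assms by (intro integrable_bounded_leb_int[where B = B] borel_measurable_leb_int_continuous) auto
qed

text \<open>The quadratic polynomial t \<mapsto> \<integral>(t f - g)^2 is nonnegative. Its value at
  the minimizer C / A is B - C^2 / A; for A = 0 it is affine in t and would take the value -1 at t =
  (B + 1) / (2 C) if C were nonzero.\<close>

lemma Cauchy_Schwarz_integral:
  fixes f g :: "'b \<Rightarrow> real"
  assumes [measurable]: "f \<in> borel_measurable M" "g \<in> borel_measurable M"
    and f: "integrable M (\<lambda>x. (f x)\<^sup>2)" and g: "integrable M (\<lambda>x. (g x)\<^sup>2)"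
  shows "integrable M (\<lambda>x. f x * g x)"
    and "(\<integral>x. f x * g x \<partial>M)\<^sup>2 \<le> (\<integral>x. (f x)\<^sup>2 \<partial>M) * (\<integral>x. (g x)\<^sup>2 \<partial>M)"
proof -
  have ptw: "\<bar>u * w\<bar> \<le> u\<^sup>2 + w\<^sup>2" for u w :: real
  proof -
    have "0 \<le> (\<bar>u\<bar> - \<bar>w\<bar>)\<^sup>2" "0 \<le> \<bar>u\<bar> * \<bar>w\<bar>" by (simp, simp)
    then show ?thesis unfolding power2_diff abs_mult power2_abs by linarith
  qed
  show fg: "integrable M (\<lambda>x. f x * g x)"
    by (rule Bochner_Integration.integrable_bound[OF Bochner_Integration.integrable_add[OF f g]])
       (use ptw in auto)
  define A B C where "A = (\<integral>x. (f x)\<^sup>2 \<partial>M)" and "B = (\<integral>x. (g x)\<^sup>2 \<partial>M)"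
    and "C = (\<integral>x. f x * g x \<partial>M)"
  have quad: "0 \<le> t\<^sup>2 * A - 2 * t * C + B" for t
  proof -
    have "0 \<le> (\<integral>x. (t * f x - g x)\<^sup>2 \<partial>M)" by simp
    also have "\<dots> = (\<integral>x. t\<^sup>2 * (f x)\<^sup>2 - 2 * t * (f x * g x) + (g x)\<^sup>2 \<partial>M)"
      by (intro Bochner_Integration.integral_cong refl) (simp add: power2_eq_square algebra_simps)
    also have "\<dots> = t\<^sup>2 * A - 2 * t * C + B"
      unfolding A_def B_def C_def using f g fg by simp
    finally show ?thesis .
  qed
  have "0 \<le> A" "0 \<le> B" by (auto simp: A_def B_def)
  have "C\<^sup>2 \<le> A * B"
  proof (cases "A = 0")
    case True
    have "C = 0"
    proof (rule ccontr)
      assume "C \<noteq> 0"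
      then show False using quad[of "(B + 1) / (2 * C)"] True by simp
    qed
    then show ?thesis using True by simp
  next
    case False
    then have "0 < A" using \<open>0 \<le> A\<close> by simp
    have "0 \<le> B - C\<^sup>2 / A" using quad[of "C / A"] False
      by (simp add: power2_eq_square field_simps)
    then show ?thesis using \<open>0 < A\<close> by (simp add: field_simps)
  qed
  then show "(\<integral>x. f x * g x \<partial>M)\<^sup>2 \<le> (\<integral>x. (f x)\<^sup>2 \<partial>M) * (\<integral>x. (g x)\<^sup>2 \<partial>M)"
    by (simp add: A_def B_def C_def)
qed

section \<open>Square integrable functions and the L2 norm\<close>

lemma sq_integrableD:
  assumes "sq_integrable L f"
  shows "f \<in> borel_measurable (leb_int L)" "integrable (leb_int L) (\<lambda>x. (norm (f x))\<^sup>2)"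
  using assms by (auto simp: sq_integrable_def)

lemma sq_integrable_imp_integrable:
  assumes "sq_integrable L f"
  shows "integrable (leb_int L) f"
proof -
  note [measurable] = sq_integrableD(1)[OF assms]
  have "integrable (leb_int L) (\<lambda>x. norm (f x) * 1)"
    by (rule Cauchy_Schwarz_integral) (use sq_integrableD[OF assms] in auto)
  then show ?thesis using integrable_norm_iff[of f] by simp
qed

lemma sq_integrable_bounded:
  assumes "f \<in> borel_measurable (leb_int L)" "\<And>x. 0 < x \<Longrightarrow> x < L \<Longrightarrow> norm (f x) \<le> B"
  shows "sq_integrable L f"
  unfolding sq_integrable_def using assms
  by (auto intro!: integrable_bounded_leb_int[where B = "B\<^sup>2"] power_mono)

lemma sq_integrable_continuous:
  fixes f :: "real \<Rightarrow> 'a::euclidean_space"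
  assumes "continuous_on {0..L} f"
  shows "sq_integrable L f"
  unfolding sq_integrable_def using assms
  by (auto intro!: borel_measurable_leb_int_continuous integrable_continuous_leb_int continuous_intros)

lemma sq_integrable_domin:
  fixes f :: "real \<Rightarrow> 'a::euclidean_space" and g :: "real \<Rightarrow> 'b::euclidean_space"
  assumes "sq_integrable L g" "f \<in> borel_measurable (leb_int L)"
    and le: "AE x in leb_int L. norm (f x) \<le> C * norm (g x)"
  shows "sq_integrable L f"
proof -
  note [measurable] = sq_integrableD(1)[OF assms(1)] assms(2)
  have "integrable (leb_int L) (\<lambda>x. (norm (f x))\<^sup>2)"
  proof (rule Bochner_Integration.integrable_bound)
    show "integrable (leb_int L) (\<lambda>x. C\<^sup>2 * (norm (g x))\<^sup>2)"
      using sq_integrableD[OF assms(1)] by simp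
    show "AE x in leb_int L. norm ((norm (f x))\<^sup>2) \<le> norm (C\<^sup>2 * (norm (g x))\<^sup>2)"
      using le
    proof eventually_elim
      case (elim x)
      have "(norm (f x))\<^sup>2 \<le> (C * norm (g x))\<^sup>2"
        using elim by (intro power_mono) auto
      then show ?case by (simp add: power_mult_distrib)
    qed
  qed auto
  then show ?thesis by (simp add: sq_integrable_def)
qed

lemma sq_integrable_add:
  fixes f g :: "real \<Rightarrow> 'a::euclidean_space"
  assumes "sq_integrable L f" "sq_integrable L g"
  shows "sq_integrable L (\<lambda>x. f x + g x)"
proof -
  note [measurable] = sq_integrableD(1)[OF assms(1)] sq_integrableD(1)[OF assms(2)]
  have "integrable (leb_int L) (\<lambda>x. (norm (f x + g x))\<^sup>2)"
  proof (rule Bochner_Integration.integrable_bound)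
    show "integrable (leb_int L) (\<lambda>x. 2 * (norm (f x))\<^sup>2 + 2 * (norm (g x))\<^sup>2)"
      using sq_integrableD(2)[OF assms(1)] sq_integrableD(2)[OF assms(2)] by simp
    have "(norm (f x + g x))\<^sup>2 \<le> 2 * (norm (f x))\<^sup>2 + 2 * (norm (g x))\<^sup>2" for x
    proof -
      have "(norm (f x + g x))\<^sup>2 \<le> (norm (f x) + norm (g x))\<^sup>2"
        by (intro power_mono norm_triangle_ineq) auto
      moreover have "0 \<le> (norm (f x) - norm (g x))\<^sup>2" by simp
      ultimately show ?thesis by (simp add: power2_sum power2_diff)
    qed
    then show "AE x in leb_int L. norm ((norm (f x + g x))\<^sup>2)
        \<le> norm (2 * (norm (f x))\<^sup>2 + 2 * (norm (g x))\<^sup>2)"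
      by (intro AE_I2) (auto intro: order_trans)
  qed auto
  then show ?thesis by (simp add: sq_integrable_def)
qed

lemma sq_integrable_scaleR:
  fixes f :: "real \<Rightarrow> 'a::euclidean_space"
  assumes "sq_integrable L f"
  shows "sq_integrable L (\<lambda>x. c *\<^sub>R f x)"
proof (rule sq_integrable_domin[OF assms, where C = "\<bar>c\<bar>"])
  show "(\<lambda>x. c *\<^sub>R f x) \<in> borel_measurable (leb_int L)"
    using sq_integrableD(1)[OF assms] by simp
qed auto

lemma sq_integrable_diff:
  fixes f g :: "real \<Rightarrow> 'a::euclidean_space"
  assumes "sq_integrable L f" "sq_integrable L g"
  shows "sq_integrable L (\<lambda>x. f x - g x)"
  using sq_integrable_add[OF assms(1) sq_integrable_scaleR[OF assms(2), of "-1"]] by simp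

lemma sq_integrable_norm:
  fixes f :: "real \<Rightarrow> 'a::euclidean_space"
  assumes "sq_integrable L f" shows "sq_integrable L (\<lambda>x. norm (f x))"
  using assms by (auto simp: sq_integrable_def)

lemma sq_integrable_norm_mult:
  fixes f :: "real \<Rightarrow> 'a::euclidean_space" and g :: "real \<Rightarrow> 'b::euclidean_space"
  assumes "sq_integrable L f" "sq_integrable L g"
  shows "integrable (leb_int L) (\<lambda>x. norm (f x) * norm (g x))"
    and "(\<integral>x. norm (f x) * norm (g x) \<partial>leb_int L) \<le> L2norm L f * L2norm L g"
proof -
  note [measurable] = sq_integrableD(1)[OF assms(1)] sq_integrableD(1)[OF assms(2)]
  note CS = Cauchy_Schwarz_integral[of "\<lambda>x. norm (f x)" "leb_int L" "\<lambda>x. norm (g x)"]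
  show "integrable (leb_int L) (\<lambda>x. norm (f x) * norm (g x))"
    by (rule CS) (use assms sq_integrableD in auto)
  have "(\<integral>x. norm (f x) * norm (g x) \<partial>leb_int L)\<^sup>2
      \<le> (\<integral>x. (norm (f x))\<^sup>2 \<partial>leb_int L) * (\<integral>x. (norm (g x))\<^sup>2 \<partial>leb_int L)"
    by (rule CS) (use assms sq_integrableD in auto)
  then show "(\<integral>x. norm (f x) * norm (g x) \<partial>leb_int L) \<le> L2norm L f * L2norm L g"
    unfolding L2norm_def real_sqrt_mult[symmetric] by (rule real_le_rsqrt)
qed

lemma sq_integrable_inner:
  fixes f g :: "real \<Rightarrow> 'a::euclidean_space"
  assumes "sq_integrable L f" "sq_integrable L g"
  shows "integrable (leb_int L) (\<lambda>x. f x \<bullet> g x)"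
    and "\<bar>\<integral>x. f x \<bullet> g x \<partial>leb_int L\<bar> \<le> L2norm L f * L2norm L g"
proof -
  note [measurable] = sq_integrableD(1)[OF assms(1)] sq_integrableD(1)[OF assms(2)]
  note n = sq_integrable_norm_mult[OF assms]
  show i: "integrable (leb_int L) (\<lambda>x. f x \<bullet> g x)"
    by (rule Bochner_Integration.integrable_bound[OF n(1)]) (auto simp: Cauchy_Schwarz_ineq2)
  have "\<bar>\<integral>x. f x \<bullet> g x \<partial>leb_int L\<bar> \<le> (\<integral>x. \<bar>f x \<bullet> g x\<bar> \<partial>leb_int L)"
    by (rule integral_abs_bound)
  also have "\<dots> \<le> (\<integral>x. norm (f x) * norm (g x) \<partial>leb_int L)"
    using i n by (intro integral_mono) (auto simp: Cauchy_Schwarz_ineq2)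
  finally show "\<bar>\<integral>x. f x \<bullet> g x \<partial>leb_int L\<bar> \<le> L2norm L f * L2norm L g" using n(2) by linarith
qed

lemma L2norm_nonneg [simp]: "0 \<le> L2norm L f"
  by (simp add: L2norm_def)

lemma L2norm_power2: "(L2norm L f)\<^sup>2 = (\<integral>x. (norm (f x))\<^sup>2 \<partial>leb_int L)"
  by (simp add: L2norm_def)

lemma L2norm_cong_AE:
  assumes "AE x in leb_int L. f x = g x"
    "f \<in> borel_measurable (leb_int L)" "g \<in> borel_measurable (leb_int L)"
  shows "L2norm L f = L2norm L g"
proof -
  have "(\<integral>x. (norm (f x))\<^sup>2 \<partial>leb_int L) = (\<integral>x. (norm (g x))\<^sup>2 \<partial>leb_int L)"
    using assms by (intro integral_cong_AE) auto
  then show ?thesis by (simp add: L2norm_def)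
qed

lemma integral_norm_le_L2norm:
  fixes f :: "real \<Rightarrow> 'a::euclidean_space"
  assumes "sq_integrable L f" "0 \<le> L"
  shows "(\<integral>x. norm (f x) \<partial>leb_int L) \<le> sqrt L * L2norm L f"
proof -
  have one: "sq_integrable L (\<lambda>x. 1::real)" by (rule sq_integrable_bounded[where B = 1]) auto
  have "(\<integral>x. norm (f x) * norm (1::real) \<partial>leb_int L) \<le> L2norm L (\<lambda>x. norm (f x)) * L2norm L (\<lambda>x. 1::real)"
    using sq_integrable_norm_mult(2)[OF sq_integrable_norm[OF assms(1)] one] by simp
  moreover have "L2norm L (\<lambda>x. 1::real) = sqrt L"
    unfolding L2norm_def using integral_const_leb_int[OF assms(2), of "1::real"] by simp
  moreover have "L2norm L (\<lambda>x. norm (f x)) = L2norm L f" by (simp add: L2norm_def)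
  ultimately show ?thesis by (simp add: mult.commute)
qed

text \<open>Cutting off inside one integral over (0, L) gives a primitive on the whole real line,
  equal to 0 left of 0 and to the full integral right of L. Increments over any subinterval become
  integrals against one and the same measure.\<close>

definition prim :: "real \<Rightarrow> (real \<Rightarrow> 'a::euclidean_space) \<Rightarrow> real \<Rightarrow> 'a" where
  "prim L g x = (\<integral>s. (if s \<le> x then g s else 0) \<partial>leb_int L)"

lemma integrable_if_leb_int:
  fixes g :: "real \<Rightarrow> 'a::euclidean_space"
  assumes "integrable (leb_int L) g" and [measurable]: "Measurable.pred borel P"
  shows "integrable (leb_int L) (\<lambda>s. if P s then g s else 0)"
proof (rule Bochner_Integration.integrable_bound[OF assms(1)])
  have [measurable]: "Measurable.pred (leb_int L) P"
    using measurable_compose[OF measurable_leb_int_ident assms(2)] by simp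
  note [measurable] = borel_measurable_integrable[OF assms(1)]
  show "(\<lambda>s. if P s then g s else 0) \<in> borel_measurable (leb_int L)" by measurable
qed auto

lemma prim_diff:
  fixes g :: "real \<Rightarrow> 'a::euclidean_space"
  assumes "integrable (leb_int L) g" "x \<le> y"
  shows "prim L g y - prim L g x = (\<integral>s. (if x < s \<and> s \<le> y then g s else 0) \<partial>leb_int L)"
  unfolding prim_def
  by (subst Bochner_Integration.integral_diff[symmetric])
     (use assms in \<open>auto intro!: integrable_if_leb_int Bochner_Integration.integral_cong\<close>)

lemma prim_0: "x \<le> 0 \<Longrightarrow> prim L g x = 0"
proof -
  assume "x \<le> 0"
  then have "prim L g x = (\<integral>s. 0 \<partial>leb_int L)"
    unfolding prim_def by (intro Bochner_Integration.integral_cong) auto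
  then show ?thesis by simp
qed

lemma prim_L: "L \<le> x \<Longrightarrow> prim L g x = (\<integral>s. g s \<partial>leb_int L)"
  unfolding prim_def by (intro Bochner_Integration.integral_cong) auto

lemma norm_prim_diff_le:
  fixes g :: "real \<Rightarrow> 'a::euclidean_space"
  assumes "integrable (leb_int L) g" "x \<le> y"
  shows "norm (prim L g y - prim L g x) \<le> prim L (\<lambda>s. norm (g s)) y - prim L (\<lambda>s. norm (g s)) x"
proof -
  have "norm (\<integral>s. (if x < s \<and> s \<le> y then g s else 0) \<partial>leb_int L)
      \<le> (\<integral>s. norm (if x < s \<and> s \<le> y then g s else 0) \<partial>leb_int L)"
    by (rule integral_norm_bound)
  also have "\<dots> = (\<integral>s. (if x < s \<and> s \<le> y then norm (g s) else 0) \<partial>leb_int L)"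
    by (intro Bochner_Integration.integral_cong) auto
  finally show ?thesis using assms by (simp add: prim_diff)
qed

lemma L2norm_interval_le:
  assumes "x \<le> y"
  shows "L2norm L (\<lambda>s. if x < s \<and> s \<le> y then 1 else (0::real)) \<le> sqrt (y - x)"
proof -
  have "(\<integral>s. (norm (if x < s \<and> s \<le> y then 1 else (0::real)))\<^sup>2 \<partial>leb_int L)
      = (\<integral>s. indicator {x<..y} s \<partial>leb_int L)"
    by (intro Bochner_Integration.integral_cong) auto
  also have "\<dots> = measure (leb_int L) ({x<..y} \<inter> {0<..<L})"
    by simp
  also have "\<dots> = measure lebesgue ({x<..y} \<inter> {0<..<L})"
    by (subst measure_restrict_space) auto
  also have "\<dots> \<le> measure lebesgue {x<..y}"
  proof (rule measure_mono_fmeasurable)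
    show "{x<..y} \<in> lmeasurable" by (rule bounded_set_imp_lmeasurable) (auto intro: bounded_subset[of "{x..y}"])
  qed auto
  also have "\<dots> = y - x" using assms by (simp add: measure_def)
  finally have "(\<integral>s. (norm (if x < s \<and> s \<le> y then 1 else (0::real)))\<^sup>2 \<partial>leb_int L) \<le> y - x" .
  then show ?thesis unfolding L2norm_def by (rule real_sqrt_le_mono)
qed

text \<open>Cauchy-Schwarz against the indicator of (x, y], whose L2 norm is at most sqrt (y - x).
  This Hoelder bound with exponent 1/2 later keeps discrete tangents and directors close to unit
  length between the nodes.\<close>

lemma prim_Holder:
  fixes g :: "real \<Rightarrow> 'a::euclidean_space"
  assumes g: "sq_integrable L g" and "x \<le> y"
  shows "norm (prim L g y - prim L g x) \<le> sqrt (y - x) * L2norm L g"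
proof -
  let ?i = "\<lambda>s. if x < s \<and> s \<le> y then 1 else (0::real)"
  have i: "sq_integrable L ?i"
    by (rule sq_integrable_bounded[where B = 1]) (auto intro!: borel_measurable_leb_int)
  have int: "integrable (leb_int L) g" using g by (rule sq_integrable_imp_integrable)
  have "norm (prim L g y - prim L g x) \<le> (\<integral>s. (if x < s \<and> s \<le> y then norm (g s) else 0) \<partial>leb_int L)"
    using norm_prim_diff_le[OF int \<open>x \<le> y\<close>] prim_diff[OF integrable_norm[OF int] \<open>x \<le> y\<close>] by simp
  also have "\<dots> = (\<integral>s. norm (?i s) * norm (norm (g s)) \<partial>leb_int L)"
    by (intro Bochner_Integration.integral_cong) auto
  also have "\<dots> \<le> L2norm L ?i * L2norm L (\<lambda>s. norm (g s))"
    by (rule sq_integrable_norm_mult(2)[OF i sq_integrable_norm[OF g]])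
  also have "\<dots> \<le> sqrt (y - x) * L2norm L g"
    using L2norm_interval_le[OF \<open>x \<le> y\<close>, of L] \<open>x \<le> y\<close> by (intro mult_mono) (simp_all add: L2norm_def)
  finally show ?thesis .
qed

lemma continuous_on_prim:
  fixes g :: "real \<Rightarrow> 'a::euclidean_space"
  assumes g: "sq_integrable L g"
  shows "continuous_on S (prim L g)"
proof -
  have bd: "dist (prim L g y) (prim L g x) \<le> sqrt \<bar>y - x\<bar> * L2norm L g" for x y
    using prim_Holder[OF g, of x y] prim_Holder[OF g, of y x]
    by (cases "x \<le> y") (auto simp: dist_norm norm_minus_commute)
  have "isCont (prim L g) x" for x
    unfolding isCont_def
  proof (rule metric_tendsto_imp_tendsto[of "\<lambda>y. sqrt \<bar>y - x\<bar> * L2norm L g" 0])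
    show "((\<lambda>y. sqrt \<bar>y - x\<bar> * L2norm L g) \<longlongrightarrow> 0) (at x)"
      by (auto intro!: tendsto_eq_intros)
    show "\<forall>\<^sub>F y in at x. dist (prim L g y) (prim L g x) \<le> dist (sqrt \<bar>y - x\<bar> * L2norm L g) 0"
      using bd by (auto intro!: always_eventually simp: abs_mult)
  qed
  then show ?thesis by (simp add: continuous_at_imp_continuous_on)
qed

text \<open>The fundamental theorem is applied to the gauge integral: the integral over (0, L) is
  turned into one, and the half-open and the closed interval differ only in {0, a, L}. The finite
  set \<open>S\<close> later holds the nodes of a mesh, where derivatives of splines may
  jump.\<close>

lemma integral_interval_FTC:
  fixes F :: "real \<Rightarrow> 'a::euclidean_space"
  assumes ab: "0 \<le> a" "a \<le> b" "b \<le> L" and "finite S"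
    and "\<And>x. x \<in> {a<..<b} - S \<Longrightarrow> (F has_vector_derivative f x) (at x)"
    and "continuous_on {a..b} F"
    and f: "integrable (leb_int L) f"
  shows "(\<integral>s. (if a < s \<and> s \<le> b then f s else 0) \<partial>leb_int L) = F b - F a"
proof -
  have F: "(f has_integral (F b - F a)) {a..b}"
    by (rule fundamental_theorem_of_calculus_interior_strong[OF \<open>finite S\<close>]) (use assms in auto)
  have "((\<lambda>s. if a < s \<and> s \<le> b then f s else 0) has_integral
      (\<integral>s. (if a < s \<and> s \<le> b then f s else 0) \<partial>leb_int L)) {0<..<L}"
    by (rule has_integral_integral_lebesgue_on) (use f in \<open>auto intro!: integrable_if_leb_int\<close>)
  then have "((\<lambda>s. if s \<in> {a<..b} \<inter> {0<..<L} then f s else 0) has_integral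
      (\<integral>s. (if a < s \<and> s \<le> b then f s else 0) \<partial>leb_int L)) UNIV"
    by (subst (asm) has_integral_restrict_UNIV[symmetric])
       (auto elim!: has_integral_eq_rhs has_integral_cong[THEN iffD1, rotated] intro!: ext)
  then have "(f has_integral (\<integral>s. (if a < s \<and> s \<le> b then f s else 0) \<partial>leb_int L))
      ({a<..b} \<inter> {0<..<L})"
    by (simp only: has_integral_restrict_UNIV)
  then have "(f has_integral (\<integral>s. (if a < s \<and> s \<le> b then f s else 0) \<partial>leb_int L)) {a..b}"
  proof (rule has_integral_spike_set_eq[THEN iffD1, rotated -1])
    show "negligible {x \<in> {a<..b} \<inter> {0<..<L} - {a..b}. f x \<noteq> 0}"
      "negligible {x \<in> {a..b} - {a<..b} \<inter> {0<..<L}. f x \<noteq> 0}"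
      by (rule negligible_subset[of "{0, a, L}"]; use ab in auto)+
  qed
  then show ?thesis using F has_integral_unique by blast
qed

lemma prim_FTC:
  fixes F :: "real \<Rightarrow> 'a::euclidean_space"
  assumes "0 \<le> a" "a \<le> b" "b \<le> L" "finite S"
    and "\<And>x. x \<in> {a<..<b} - S \<Longrightarrow> (F has_vector_derivative f x) (at x)"
    and "continuous_on {a..b} F"
    and "integrable (leb_int L) f"
  shows "prim L f b - prim L f a = F b - F a"
  using integral_interval_FTC[OF assms] prim_diff[OF assms(7,2)] by simp

text \<open>Fubini on the triangle s \<le> x. Both factors are merely integrable, and f x times g s
  is the dominating function on the square; the inner integrals over s \<le> x and s < x agree
  because a point is a null set.\<close>

lemma integral_prim_by_parts:
  fixes g :: "real \<Rightarrow> 'a::euclidean_space" and f :: "real \<Rightarrow> real"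
  assumes f: "integrable (leb_int L) f" and g: "integrable (leb_int L) g"
  shows "(\<integral>x. f x *\<^sub>R prim L g x \<partial>leb_int L) = (\<integral>s. (prim L f L - prim L f s) *\<^sub>R g s \<partial>leb_int L)"
proof -
  interpret pair_sigma_finite "leb_int L" "leb_int L"
    by (simp add: pair_sigma_finite_def)
  note [measurable] = borel_measurable_integrable[OF g] borel_measurable_integrable[OF f]
  let ?f = "\<lambda>x s. f x *\<^sub>R (if s \<le> x then g s else 0)"
  have [measurable]: "(\<lambda>(x, s). ?f x s) \<in> borel_measurable (leb_int L \<Otimes>\<^sub>M leb_int L)"
    by measurable
  have "integrable (leb_int L \<Otimes>\<^sub>M leb_int L) (\<lambda>(x, s). f x *\<^sub>R g s)"
  proof (rule Fubini_integrable)
    show "integrable (leb_int L) (\<lambda>x. \<integral>y. norm (case (x, y) of (x, s) \<Rightarrow> f x *\<^sub>R g s) \<partial>leb_int L)"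
      using g f by simp
  qed (use g in auto)
  then have int: "integrable (leb_int L \<Otimes>\<^sub>M leb_int L) (\<lambda>(x, s). ?f x s)"
    by (rule Bochner_Integration.integrable_bound) auto
  have "(\<integral>x. f x *\<^sub>R prim L g x \<partial>leb_int L) = (\<integral>x. (\<integral>s. ?f x s \<partial>leb_int L) \<partial>leb_int L)"
    unfolding prim_def using g
    by (intro Bochner_Integration.integral_cong refl) (auto simp del: scaleR_conv_of_real)
  also have "\<dots> = (\<integral>s. (\<integral>x. ?f x s \<partial>leb_int L) \<partial>leb_int L)"
    by (rule Fubini_integral[OF int, symmetric])
  also have "\<dots> = (\<integral>s. (prim L f L - prim L f s) *\<^sub>R g s \<partial>leb_int L)"
  proof (intro Bochner_Integration.integral_cong refl)
    fix s assume "s \<in> space (leb_int L)"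
    then have s: "0 < s" "s < L" by auto
    have "(\<integral>x. ?f x s \<partial>leb_int L) = (\<integral>x. (if s \<le> x then f x else 0) *\<^sub>R g s \<partial>leb_int L)"
      by (intro Bochner_Integration.integral_cong) auto
    also have "\<dots> = (\<integral>x. (if s \<le> x then f x else 0) \<partial>leb_int L) *\<^sub>R g s"
      using f by (intro integral_scaleR_left integrable_if_leb_int) auto
    also have "(\<integral>x. (if s \<le> x then f x else 0) \<partial>leb_int L)
        = (\<integral>x. (if s < x \<and> x \<le> L then f x else 0) \<partial>leb_int L)"
    proof (rule integral_cong_AE)
      have "AE x in leb_int L. x \<noteq> s"
        by (rule AE_I[of _ _ "{s}"]) (use s in \<open>auto simp: emeasure_restrict_space sets_restrict_space_iff\<close>)
      then show "AE x in leb_int L. (if s \<le> x then f x else 0) = (if s < x \<and> x \<le> L then f x else 0)"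
        using AE_space by eventually_elim auto
    qed (use f in \<open>auto intro!: borel_measurable_integrable integrable_if_leb_int\<close>)
    also have "\<dots> = prim L f L - prim L f s"
      using prim_diff[OF f, of s L] s by simp
    finally show "(\<integral>x. ?f x s \<partial>leb_int L) = (prim L f L - prim L f s) *\<^sub>R g s" .
  qed
  finally show ?thesis .
qed

lemma integral_by_parts_prim:
  fixes g :: "real \<Rightarrow> 'a::euclidean_space" and \<phi> \<phi>' :: "real \<Rightarrow> real"
  assumes g: "integrable (leb_int L) g"
    and d: "\<And>x. x \<in> {0<..<L} \<Longrightarrow> (\<phi> has_vector_derivative \<phi>' x) (at x)"
    and c: "continuous_on {0..L} \<phi>" and c': "continuous_on {0..L} \<phi>'"
  shows "(\<integral>x. \<phi>' x *\<^sub>R prim L g x \<partial>leb_int L) = (\<integral>s. (\<phi> L - \<phi> s) *\<^sub>R g s \<partial>leb_int L)"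
proof -
  have f: "integrable (leb_int L) \<phi>'" by (rule integrable_continuous_leb_int[OF c'])
  have "prim L \<phi>' L - prim L \<phi>' s = \<phi> L - \<phi> s" if "0 < s" "s < L" for s
    by (rule prim_FTC[of _ _ _ "{}"]) (use that d f in \<open>auto intro: continuous_on_subset[OF c]\<close>)
  then show ?thesis
    unfolding integral_prim_by_parts[OF f g] by (intro Bochner_Integration.integral_cong) auto
qed

subsection \<open>Smooth bump functions\<close>

lemma Ck_on_const: "Ck_on k S (\<lambda>x. c)"
  by (induction k arbitrary: c) (auto intro!: exI[of _ "\<lambda>x. 0"] derivative_eq_intros)

lemma Ck_on_SucD: "Ck_on (Suc k) S f \<Longrightarrow> Ck_on k S f"
proof (induction k arbitrary: f)
  case 0
  then obtain g where "\<forall>x\<in>S. (f has_vector_derivative g x) (at x within S)" by auto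
  then show ?case
    by (auto simp: continuous_on_eq_continuous_within intro: has_vector_derivative_continuous)
next
  case (Suc k)
  then show ?case by (metis Ck_on.simps(2))
qed

lemma Ck_on_add: "Ck_on k S f \<Longrightarrow> Ck_on k S g \<Longrightarrow> Ck_on k S (\<lambda>x. f x + g x)"
proof (induction k arbitrary: f g)
  case 0
  then show ?case by (auto intro: continuous_intros)
next
  case (Suc k)
  then obtain f' g' where
    "\<forall>x\<in>S. (f has_vector_derivative f' x) (at x within S)" "Ck_on k S f'"
    "\<forall>x\<in>S. (g has_vector_derivative g' x) (at x within S)" "Ck_on k S g'" by auto
  then show ?case using Suc.IH
    by (auto intro!: exI[of _ "\<lambda>x. f' x + g' x"] has_vector_derivative_add)
qed

lemma Ck_on_mult:
  fixes f g :: "real \<Rightarrow> real"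
  shows "Ck_on k S f \<Longrightarrow> Ck_on k S g \<Longrightarrow> Ck_on k S (\<lambda>x. f x * g x)"
proof (induction k arbitrary: f g)
  case 0
  then show ?case by (auto intro: continuous_intros)
next
  case (Suc k)
  then obtain f' g' where
    "\<forall>x\<in>S. (f has_vector_derivative f' x) (at x within S)" "Ck_on k S f'"
    "\<forall>x\<in>S. (g has_vector_derivative g' x) (at x within S)" "Ck_on k S g'" by auto
  moreover have "Ck_on k S f" "Ck_on k S g" using Suc.prems by (auto intro: Ck_on_SucD simp del: Ck_on.simps)
  ultimately show ?case using Suc.IH
    by (auto intro!: exI[of _ "\<lambda>x. f x * g' x + f' x * g x"] has_vector_derivative_mult Ck_on_add)
qed

lemma Ck_on_diff:
  fixes f g :: "real \<Rightarrow> real"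
  assumes "Ck_on k S f" "Ck_on k S g"
  shows "Ck_on k S (\<lambda>x. f x - g x)"
  using Ck_on_add[OF assms(1) Ck_on_mult[OF Ck_on_const[of k S "-1"] assms(2)]] by simp

lemma Ck_on_power:
  fixes f :: "real \<Rightarrow> real"
  shows "Ck_on k S f \<Longrightarrow> Ck_on k S (\<lambda>x. f x ^ n)"
  by (induction n) (auto intro: Ck_on_const Ck_on_mult)

lemma Ck_on_affine:
  fixes f :: "real \<Rightarrow> real"
  shows "Ck_on k UNIV f \<Longrightarrow> Ck_on k UNIV (\<lambda>x. f (c * x + d))"
proof (induction k arbitrary: f)
  case 0
  then have "continuous_on UNIV f" by simp
  then have "continuous_on UNIV (f \<circ> (\<lambda>x. c * x + d))"
    by (intro continuous_on_compose continuous_intros) (auto intro: continuous_on_subset)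
  then show ?case by (simp add: o_def)
next
  case (Suc k)
  then obtain f' where f': "\<forall>x. (f has_real_derivative f' x) (at x)" "Ck_on k UNIV f'"
    by (auto simp: has_real_derivative_iff_has_vector_derivative)
  have "((\<lambda>x. f (c * x + d)) has_real_derivative f' (c * x + d) * c) (at x)" for x
    by (rule DERIV_chain2[OF f'(1)[rule_format]]) (auto intro!: derivative_eq_intros)
  moreover have "Ck_on k UNIV (\<lambda>x. f' (c * x + d) * c)"
    using Suc.IH[OF f'(2)] by (intro Ck_on_mult Ck_on_const)
  ultimately show ?case
    by (auto simp: has_real_derivative_iff_has_vector_derivative intro!: exI[of _ "\<lambda>x. f' (c * x + d) * c"])
qed

text \<open>The functions p(1/x) exp(-1/x), extended by 0 to x \<le> 0. With the polynomial as a
  parameter the class is closed under differentiation, so one derivative formula yields smoothness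
  of every order by induction.\<close>

definition flat_exp :: "real poly \<Rightarrow> real \<Rightarrow> real" where
  "flat_exp p x = (if 0 < x then poly p (1 / x) * exp (- (1 / x)) else 0)"

lemma tendsto_poly_mult_exp_minus: "((\<lambda>u. poly p u * exp (- u)) \<longlongrightarrow> (0::real)) at_top"
proof -
  have "((\<lambda>u. \<Sum>i\<le>degree p. coeff p i * (u ^ i / exp u)) \<longlongrightarrow> (\<Sum>i\<le>degree p. coeff p i * 0)) at_top"
    by (intro tendsto_sum tendsto_mult tendsto_const tendsto_power_div_exp_0)
  then show ?thesis
    by (simp add: poly_altdef exp_minus sum_distrib_right divide_inverse mult.assoc)
qed

lemma tendsto_flat_exp_0: "((\<lambda>h. flat_exp p h) \<longlongrightarrow> 0) (at 0)"
proof (rule filterlim_split_at)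
  show "((\<lambda>h. flat_exp p h) \<longlongrightarrow> 0) (at_left 0)"
    by (rule tendsto_eventually) (auto simp: flat_exp_def eventually_at_left_field intro!: exI[of _ "-1"])
  have "((\<lambda>h. poly p (1 / h) * exp (- (1 / h))) \<longlongrightarrow> 0) (at_right 0)"
    using filterlim_compose[OF tendsto_poly_mult_exp_minus filterlim_inverse_at_top_right]
    by (simp add: inverse_eq_divide)
  then show "((\<lambda>h. flat_exp p h) \<longlongrightarrow> 0) (at_right 0)"
    by (rule Lim_transform_eventually)
       (auto simp: flat_exp_def eventually_at_right_field intro!: exI[of _ 1])
qed

lemma has_real_derivative_flat_exp:
  "(flat_exp p has_real_derivative flat_exp ([:0, 0, 1:] * (p - pderiv p)) x) (at x)"
proof -
  consider "x < 0" | "x = 0" | "0 < x" by linarith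
  then show ?thesis
  proof cases
    case 1
    have "((\<lambda>x. 0) has_real_derivative 0) (at x)" by simp
    then have "(flat_exp p has_real_derivative 0) (at x)"
      by (rule has_field_derivative_transform_within_open[of _ _ _ "{..<0}"])
         (use 1 in \<open>auto simp: flat_exp_def\<close>)
    then show ?thesis using 1 by (simp add: flat_exp_def)
  next
    case 2
    \<comment> \<open>Dividing by h multiplies the polynomial in 1/h by its variable, which is
      \<open>pCons 0 p\<close>; the difference quotient at 0 is thus again a member of the
      class.\<close>
    have "((\<lambda>h. flat_exp (pCons 0 p) h) \<longlongrightarrow> 0) (at 0)" by (rule tendsto_flat_exp_0)
    then have "((\<lambda>h. flat_exp p h / h) \<longlongrightarrow> 0) (at 0)"
      by (rule Lim_transform_eventually) (auto simp: flat_exp_def intro!: always_eventually)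
    then show ?thesis using 2 by (simp add: DERIV_def flat_exp_def)
  next
    case 3
    have "((\<lambda>x. poly p (1 / x) * exp (- (1 / x))) has_real_derivative
        poly ([:0, 0, 1:] * (p - pderiv p)) (1 / x) * exp (- (1 / x))) (at x)"
      using 3 by (auto intro!: derivative_eq_intros DERIV_chain2[OF poly_DERIV]
          simp: field_simps power2_eq_square)
    then have "(flat_exp p has_real_derivative
        poly ([:0, 0, 1:] * (p - pderiv p)) (1 / x) * exp (- (1 / x))) (at x)"
      by (rule has_field_derivative_transform_within_open[of _ _ _ "{0<..}"])
         (use 3 in \<open>auto simp: flat_exp_def\<close>)
    then show ?thesis using 3 by (simp add: flat_exp_def)
  qed
qed

lemma Ck_on_flat_exp: "Ck_on k UNIV (flat_exp p)"
proof (induction k arbitrary: p)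
  case 0
  show ?case
    unfolding Ck_on.simps
    by (intro continuous_at_imp_continuous_on ballI DERIV_isCont[OF has_real_derivative_flat_exp])
next
  case (Suc k)
  then show ?case using has_real_derivative_flat_exp
    by (auto simp: has_real_derivative_iff_has_vector_derivative simp del: mult_pCons_left)
qed

definition bump :: "real \<Rightarrow> real \<Rightarrow> real \<Rightarrow> real" where
  "bump a b x = flat_exp 1 (x - a) * flat_exp 1 (b - x)"

lemma Ck_on_bump: "Ck_on k UNIV (bump a b)"
  using Ck_on_mult[OF Ck_on_affine[OF Ck_on_flat_exp[of k 1], of 1 "-a"]
      Ck_on_affine[OF Ck_on_flat_exp[of k 1], of "-1" b]]
  by (simp add: bump_def[abs_def])

lemma bump_outside: "x \<notin> {a<..<b} \<Longrightarrow> bump a b x = 0"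
  by (auto simp: bump_def flat_exp_def)

lemma bump_pos: "x \<in> {a<..<b} \<Longrightarrow> 0 < bump a b x"
  by (auto simp: bump_def flat_exp_def)

lemma bump_bounds: "0 \<le> bump a b x" "bump a b x < 1"
proof -
  have *: "0 \<le> flat_exp 1 x" "flat_exp 1 x < 1" for x by (auto simp: flat_exp_def)
  show "0 \<le> bump a b x" using * by (simp add: bump_def)
  have "bump a b x \<le> flat_exp 1 (b - x)"
    unfolding bump_def using * by (intro mult_left_le_one_le) (auto simp: less_imp_le)
  then show "bump a b x < 1" using *(2)[of "b - x"] by linarith
qed

lemma test_functionD:
  assumes "test_function L \<phi>"
  obtains \<phi>' where "\<And>x. (\<phi> has_real_derivative \<phi>' x) (at x)" "continuous_on UNIV \<phi>'" "deriv \<phi> = \<phi>'"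
proof -
  have "Ck_on (Suc 0) UNIV \<phi>" using assms by (auto simp: test_function_def Cinf_on_def simp del: Ck_on.simps)
  then obtain g where g: "\<And>x. (\<phi> has_real_derivative g x) (at x)" "continuous_on UNIV g"
    by (auto simp: has_real_derivative_iff_has_vector_derivative)
  then have "deriv \<phi> = g" by (auto intro!: ext DERIV_imp_deriv)
  with g that show ?thesis by blast
qed

lemma test_function_continuous: "test_function L \<phi> \<Longrightarrow> continuous_on S \<phi>"
  using Ck_on.simps(1)[of UNIV \<phi>] continuous_on_subset
  by (fastforce simp: test_function_def Cinf_on_def)

text \<open>Since \<open>bump a b\<close> lies in [0, 1) and is positive exactly on (a, b), the
  powers of 1 - \<open>bump a b\<close> tend to 0 there and equal 1 elsewhere. These test functions
  therefore converge pointwise to the indicator of (a, b) and stay in [0, 1], which suits dominated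
  convergence.\<close>

lemma test_function_indicator_approx:
  assumes "0 < a" "a < b" "b < L"
  shows "test_function L (\<lambda>x. 1 - (1 - bump a b x) ^ n)"
  unfolding test_function_def Cinf_on_def
proof (intro conjI allI)
  show "Ck_on k UNIV (\<lambda>x. 1 - (1 - bump a b x) ^ n)" for k
    by (intro Ck_on_diff Ck_on_const Ck_on_power Ck_on_bump)
  show "\<exists>a' b'. 0 < a' \<and> a' < b' \<and> b' < L \<and> (\<forall>x. x \<notin> {a'..b'} \<longrightarrow> 1 - (1 - bump a b x) ^ n = 0)"
    by (rule exI[of _ a], rule exI[of _ b]) (use assms in \<open>auto simp: bump_outside\<close>)
qed

lemma indicator_approx_tendsto:
  "(\<lambda>n. 1 - (1 - bump a b x) ^ n) \<longlonglongrightarrow> (if a < x \<and> x < b then 1 else 0)"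
proof (cases "a < x \<and> x < b")
  case True
  have "(\<lambda>n. (1 - bump a b x) ^ n) \<longlonglongrightarrow> 0"
    by (rule LIMSEQ_realpow_zero) (use bump_bounds[of a b x] bump_pos[of x a b] True in auto)
  then have "(\<lambda>n. 1 - (1 - bump a b x) ^ n) \<longlonglongrightarrow> 1 - 0" by (intro tendsto_diff tendsto_const)
  then show ?thesis using True by simp
next
  case False
  then show ?thesis by (auto simp: bump_outside)
qed

lemma indicator_approx_abs_le: "\<bar>1 - (1 - bump a b x) ^ n\<bar> \<le> 1"
  using bump_bounds[of a b x] power_le_one[of "1 - bump a b x" n] zero_le_power[of "1 - bump a b x" n]
  by auto

subsection \<open>The fundamental lemma of the calculus of variations\<close>

text \<open>A Dynkin system argument: open intervals are stable under intersection and generate the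
  Borel sets, and the sets over which u integrates to 0 are closed under complements, by
  \<open>zero'\<close>, and under countable disjoint unions. A Lebesgue set differs from an F-sigma
  set by a null set, so all measurable sets are reached.\<close>

lemma integral_interval_zero_imp_AE_zero:
  fixes u :: "real \<Rightarrow> 'a::euclidean_space"
  assumes u: "integrable (leb_int L) u"
    and zero: "\<And>a b. (\<integral>x. (if a < x \<and> x < b then u x else 0) \<partial>leb_int L) = 0"
    and zero': "(\<integral>x. u x \<partial>leb_int L) = 0"
  shows "AE x in leb_int L. u x = 0"
proof (rule sigma_finite_measure.density_zero[OF sigma_finite_leb_int u])
  note [measurable] = borel_measurable_integrable[OF u]
  have "sets (borel :: real measure) = sets (sigma UNIV (range (\<lambda>(a, b). {a<..<b})))"
    using borel_eq_box[where 'a = real] by (simp add: box_real case_prod_unfold)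
  then have gen: "sets borel = sigma_sets UNIV (range (\<lambda>(a, b). {a<..<b::real}))"
    by simp
  have borel: "(\<integral>x. indicator A x *\<^sub>R u x \<partial>leb_int L) = 0" if "A \<in> sets borel" for A
  proof -
    have A: "A \<in> sigma_sets UNIV (range (\<lambda>(a, b). {a<..<b}))"
      using that unfolding gen .
    have "Int_stable (range (\<lambda>(a, b). {a<..<b::real}))"
    proof (rule Int_stableI)
      fix A B :: "real set"
      assume "A \<in> range (\<lambda>(a, b). {a<..<b})" "B \<in> range (\<lambda>(a, b). {a<..<b})"
      then obtain a b c d where "A = {a<..<b}" "B = {c<..<d}" by auto
      then have "A \<inter> B = (\<lambda>(a, b). {a<..<b}) (max a c, min b d)" by auto
      then show "A \<inter> B \<in> range (\<lambda>(a, b). {a<..<b})" by blast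
    qed
    moreover have "range (\<lambda>(a, b). {a<..<b::real}) \<subseteq> Pow UNIV" by simp
    ultimately show ?thesis using A
    proof (induction rule: sigma_sets_induct_disjoint)
      case (basic A)
      then obtain a b where A: "A = {a<..<b}" by auto
      have "(\<integral>x. indicator A x *\<^sub>R u x \<partial>leb_int L) = (\<integral>x. (if a < x \<and> x < b then u x else 0) \<partial>leb_int L)"
        by (intro Bochner_Integration.integral_cong) (auto simp: A)
      then show ?case using zero by simp
    next
      case empty
      show ?case by simp
    next
      case (compl A)
      have A: "A \<in> sets borel"
        using compl(1) unfolding gen .
      have i: "integrable (leb_int L) (\<lambda>x. indicator A x *\<^sub>R u x)"
        by (rule Bochner_Integration.integrable_bound[OF u])
           (use A in \<open>auto simp: indicator_def intro!: borel_measurable_scaleR borel_measurable_leb_int\<close>)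
      have "(\<integral>x. indicator (UNIV - A) x *\<^sub>R u x \<partial>leb_int L)
          = (\<integral>x. u x - indicator A x *\<^sub>R u x \<partial>leb_int L)"
        by (intro Bochner_Integration.integral_cong) (auto simp: indicator_def)
      also have "\<dots> = 0" using u i compl zero' by simp
      finally show ?case .
    next
      case (union A)
      have A: "A i \<in> sets borel" for i
        using union(2) unfolding gen by auto
      have A': "A i \<inter> {0<..<L} \<in> sets (leb_int L)" for i
        using A by (auto simp: sets_restrict_space_iff)
      have cut: "(\<integral>x. indicator B x *\<^sub>R u x \<partial>leb_int L) = (LINT x:(B \<inter> {0<..<L})|leb_int L. u x)" for B
        unfolding set_lebesgue_integral_def
        by (intro Bochner_Integration.integral_cong) (auto simp: indicator_def)
      have "(LINT x:(\<Union>i. A i \<inter> {0<..<L})|leb_int L. u x) = (\<Sum>i. (LINT x:(A i \<inter> {0<..<L})|leb_int L. u x))"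
      proof (rule lebesgue_integral_countable_add[OF A'])
        show "set_integrable (leb_int L) (\<Union>i. A i \<inter> {0<..<L}) u"
          unfolding set_integrable_def
          by (rule integrable_mult_indicator[OF sets.countable_UN u]) (use A' in auto)
      qed (use union(1) in \<open>auto simp: disjoint_family_on_def\<close>)
      then show ?case using union(3) by (simp add: cut)
    qed
  qed
  fix A assume "A \<in> sets (leb_int L)"
  then have "A \<in> sets lebesgue" by (auto simp: sets_restrict_space)
  then obtain C T where C: "fsigma C" "T \<in> null_sets lebesgue" "C \<union> T = A"
    by (rule lebesgue_set_almost_fsigma)
  have Cb: "C \<in> sets borel" using C(1) by (auto elim!: fsigma.cases)
  have "AE x in lebesgue. x \<notin> T" using C(2) by (rule AE_not_in)
  then have "AE x in leb_int L. x \<notin> T" by (subst AE_restrict_space_iff) auto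
  then have eq: "AE x in leb_int L. indicator A x *\<^sub>R u x = indicator C x *\<^sub>R u x"
    by eventually_elim (use C(3) in \<open>auto simp: indicator_def\<close>)
  have "(\<integral>x. indicator A x *\<^sub>R u x \<partial>leb_int L) = (\<integral>x. indicator C x *\<^sub>R u x \<partial>leb_int L)"
    by (rule integral_cong_AE[OF _ _ eq])
       (use \<open>A \<in> sets (leb_int L)\<close> Cb in \<open>auto intro!: borel_measurable_scaleR borel_measurable_leb_int borel_measurable_indicator\<close>)
  then show "set_lebesgue_integral (leb_int L) A u = 0"
    using borel[OF Cb] by (simp add: set_lebesgue_integral_def)
qed

lemma fundamental_lemma:
  fixes u :: "real \<Rightarrow> 'a::euclidean_space"
  assumes u: "integrable (leb_int L) u"
    and test: "\<And>\<phi>. test_function L \<phi> \<Longrightarrow> (\<integral>x. \<phi> x *\<^sub>R u x \<partial>leb_int L) = 0"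
  shows "AE x in leb_int L. u x = 0"
proof -
  note [measurable] = borel_measurable_integrable[OF u]
  have inner: "(\<integral>x. (if a < x \<and> x < b then u x else 0) \<partial>leb_int L) = 0"
    if "0 < a" "b < L" for a b
  proof (cases "a < b")
    case True
    let ?\<psi> = "\<lambda>n x. 1 - (1 - bump a b x) ^ n"
    have tf: "test_function L (?\<psi> n)" for n
      using test_function_indicator_approx that True by blast
    have [measurable]: "?\<psi> n \<in> borel_measurable (leb_int L)" for n
      by (rule borel_measurable_leb_int_continuous[OF test_function_continuous[OF tf]])
    have "(\<lambda>n. \<integral>x. ?\<psi> n x *\<^sub>R u x \<partial>leb_int L) \<longlonglongrightarrow> (\<integral>x. (if a < x \<and> x < b then 1 else 0) *\<^sub>R u x \<partial>leb_int L)"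
    proof (rule integral_dominated_convergence[where w = "\<lambda>x. norm (u x)"])
      show "AE x in leb_int L. (\<lambda>n. ?\<psi> n x *\<^sub>R u x) \<longlonglongrightarrow> (if a < x \<and> x < b then 1 else 0) *\<^sub>R u x"
        by (intro AE_I2 tendsto_scaleR indicator_approx_tendsto tendsto_const)
      show "AE x in leb_int L. norm (?\<psi> n x *\<^sub>R u x) \<le> norm (u x)" for n
        using indicator_approx_abs_le[of a b] by (intro AE_I2) (simp add: mult_left_le_one_le)
    qed (use u in auto)
    then have "(\<integral>x. (if a < x \<and> x < b then 1 else 0) *\<^sub>R u x \<partial>leb_int L) = 0"
      using test[OF tf] by (simp add: LIMSEQ_const_iff)
    moreover have "(\<lambda>x. (if a < x \<and> x < b then 1 else 0) *\<^sub>R u x) = (\<lambda>x. if a < x \<and> x < b then u x else 0)"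
      by auto
    ultimately show ?thesis by simp
  next
    case False
    have "(\<lambda>x. if a < x \<and> x < b then u x else 0) = (\<lambda>x. 0)" using False by (auto simp: fun_eq_iff)
    then show ?thesis by simp
  qed
  have all: "(\<integral>x. (if a < x \<and> x < b then u x else 0) \<partial>leb_int L) = 0" for a b
  proof (cases "0 < L")
    case True
    \<comment> \<open>Test functions vanish near 0 and L, so \<open>inner\<close> only covers
      intervals bounded away from the ends; truncation by \<open>c n\<close> and dominated
      convergence remove this restriction.\<close>
    define c where "c n = L / real (n + 2)" for n
    have c0: "c \<longlonglongrightarrow> 0"
      unfolding c_def by (rule tendsto_divide_0[OF tendsto_const])
        (intro filterlim_at_top_imp_at_infinity filterlim_compose[OF filterlim_real_sequentially] filterlim_add_const_nat_at_top)
    have cpos: "0 < c n" for n using True by (simp add: c_def)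
    have "(\<lambda>n. \<integral>x. (if max a (c n) < x \<and> x < min b (L - c n) then u x else 0) \<partial>leb_int L)
        \<longlonglongrightarrow> (\<integral>x. (if a < x \<and> x < b then u x else 0) \<partial>leb_int L)"
    proof (rule integral_dominated_convergence[where w = "\<lambda>x. norm (u x)"])
      show "AE x in leb_int L. (\<lambda>n. if max a (c n) < x \<and> x < min b (L - c n) then u x else 0)
          \<longlonglongrightarrow> (if a < x \<and> x < b then u x else 0)"
      proof (rule AE_I2)
        fix x assume "x \<in> space (leb_int L)"
        then have x: "0 < x" "0 < L - x" by auto
        have "\<forall>\<^sub>F n in sequentially. c n < x" "\<forall>\<^sub>F n in sequentially. c n < L - x"
          using order_tendstoD(2)[OF c0] x by auto
        then have "\<forall>\<^sub>F n in sequentially. (if max a (c n) < x \<and> x < min b (L - c n) then u x else 0)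
            = (if a < x \<and> x < b then u x else 0)"
          by eventually_elim auto
        then show "(\<lambda>n. if max a (c n) < x \<and> x < min b (L - c n) then u x else 0)
          \<longlonglongrightarrow> (if a < x \<and> x < b then u x else 0)"
          by (rule tendsto_eventually)
      qed
    qed (use u in \<open>auto intro!: borel_measurable_integrable integrable_if_leb_int\<close>)
    moreover have "(\<integral>x. (if max a (c n) < x \<and> x < min b (L - c n) then u x else 0) \<partial>leb_int L) = 0" for n
      by (rule inner) (use cpos[of n] in auto)
    ultimately show ?thesis by (simp add: LIMSEQ_const_iff)
  next
    case False
    have "(\<integral>x. (if a < x \<and> x < b then u x else 0) \<partial>leb_int L) = (\<integral>x. 0 \<partial>leb_int L)"
      by (rule Bochner_Integration.integral_cong) (use False in auto)
    then show ?thesis by simp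
  qed
  have "(\<integral>x. u x \<partial>leb_int L) = (\<integral>x. (if 0 < x \<and> x < L then u x else 0) \<partial>leb_int L)"
    by (rule Bochner_Integration.integral_cong) auto
  then show ?thesis using integral_interval_zero_imp_AE_zero[OF u] all by simp
qed

subsection \<open>Weak derivatives and primitives\<close>

text \<open>The boundary terms vanish because a test function is 0 at both ends; for the same reason
  \<phi>' has mean zero and the constant c drops out.\<close>

lemma has_weak_deriv_prim:
  fixes g :: "real \<Rightarrow> 'a::euclidean_space"
  assumes g: "sq_integrable L g" and f: "AE x in leb_int L. f x = c + prim L g x"
    and fm: "f \<in> borel_measurable (leb_int L)" and "0 \<le> L"
  shows "has_weak_deriv L f g"
  unfolding has_weak_deriv_def
proof (intro conjI allI impI g)
  fix \<phi> assume tf: "test_function L \<phi>"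
  then obtain \<phi>' where d: "\<And>x. (\<phi> has_real_derivative \<phi>' x) (at x)" and c': "continuous_on UNIV \<phi>'"
    and der: "deriv \<phi> = \<phi>'" by (rule test_functionD) blast
  have c'': "continuous_on {0..L} \<phi>'" using c' continuous_on_subset by blast
  note gi = sq_integrable_imp_integrable[OF g]
  have \<phi>0: "\<phi> L = 0" "\<phi> 0 = 0" using tf by (fastforce simp: test_function_def)+
  have [measurable]: "\<phi>' \<in> borel_measurable (leb_int L)" by (rule borel_measurable_leb_int_continuous[OF c''])
  have [measurable]: "prim L g \<in> borel_measurable (leb_int L)"
    by (rule borel_measurable_leb_int_continuous[OF continuous_on_prim[OF g]])
  note fm[measurable]
  have "(\<integral>x. deriv \<phi> x *\<^sub>R f x \<partial>leb_int L) = (\<integral>x. \<phi>' x *\<^sub>R c + \<phi>' x *\<^sub>R prim L g x \<partial>leb_int L)"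
    unfolding der using f by (intro integral_cong_AE) (auto elim!: eventually_mono simp: scaleR_add_right)
  also have "\<dots> = (\<integral>x. \<phi>' x *\<^sub>R c \<partial>leb_int L) + (\<integral>x. \<phi>' x *\<^sub>R prim L g x \<partial>leb_int L)"
    using continuous_on_prim[OF g]
    by (intro Bochner_Integration.integral_add integrable_continuous_leb_int continuous_intros c'')
  also have "(\<integral>x. \<phi>' x *\<^sub>R prim L g x \<partial>leb_int L) = (\<integral>s. (\<phi> L - \<phi> s) *\<^sub>R g s \<partial>leb_int L)"
    using d by (intro integral_by_parts_prim gi c'' test_function_continuous[OF tf])
      (auto simp: has_real_derivative_iff_has_vector_derivative)
  also have "(\<integral>x. \<phi>' x *\<^sub>R c \<partial>leb_int L) = (\<integral>x. \<phi>' x \<partial>leb_int L) *\<^sub>R c"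
    using integrable_continuous_leb_int[OF c''] by (intro integral_scaleR_left) auto
  also have "(\<integral>x. \<phi>' x \<partial>leb_int L) = prim L \<phi>' L - prim L \<phi>' 0"
    by (simp add: prim_0 prim_L)
  also have "\<dots> = \<phi> L - \<phi> 0"
    using d \<open>0 \<le> L\<close> by (intro prim_FTC[of _ _ _ "{}"] test_function_continuous[OF tf] integrable_continuous_leb_int c'')
      (auto simp: has_real_derivative_iff_has_vector_derivative)
  finally show "(\<integral>x. deriv \<phi> x *\<^sub>R f x \<partial>leb_int L) = - (\<integral>x. \<phi> x *\<^sub>R g x \<partial>leb_int L)"
    by (simp add: \<phi>0)
qed

text \<open>Compact support is the point: the primitive vanishes to the left of the support of
  \<theta>, and to the right of it because \<theta> has mean zero.\<close>

lemma test_function_primitive: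
  assumes tf: "test_function L \<theta>" and zero: "(\<integral>x. \<theta> x \<partial>leb_int L) = 0"
  shows "test_function L (prim L \<theta>)" "deriv (prim L \<theta>) = \<theta>"
proof -
  obtain a b where ab: "0 < a" "a < b" "b < L" and out: "\<And>x. x \<notin> {a..b} \<Longrightarrow> \<theta> x = 0"
    using tf by (auto simp: test_function_def)
  have c: "continuous_on S \<theta>" for S by (rule test_function_continuous[OF tf])
  have int: "integrable (leb_int L) \<theta>" by (rule integrable_continuous_leb_int[OF c])
  have zout: "prim L \<theta> x = 0" if "x \<notin> {a..b}" for x
  proof -
    have "x < a \<or> b < x" using that by auto
    then consider "x < a" | "b < x" by blast
    then show ?thesis
    proof cases
      case 1
      have "prim L \<theta> x = (\<integral>s. 0 \<partial>leb_int L)"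
        unfolding prim_def by (rule Bochner_Integration.integral_cong) (use 1 out in auto)
      then show ?thesis by simp
    next
      case 2
      have "prim L \<theta> x = (\<integral>s. \<theta> s \<partial>leb_int L)"
        unfolding prim_def by (rule Bochner_Integration.integral_cong) (use 2 out in auto)
      then show ?thesis using zero by simp
    qed
  qed
  have der: "(prim L \<theta> has_vector_derivative \<theta> x) (at x)" for x
  proof (cases "x \<in> {a..b}")
    case True
    obtain G where G: "\<And>x. x \<in> {0..L} \<Longrightarrow> (G has_vector_derivative \<theta> x) (at x within {0..L})"
      using antiderivative_continuous[OF c] by metis
    have G': "(G has_vector_derivative \<theta> x) (at x)" if "x \<in> {0<..<L}" for x
      using G[of x] that by (simp add: at_within_Icc_at)
    have Gc: "continuous_on {0..L} G"
      unfolding continuous_on_eq_continuous_within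
      by (intro ballI has_vector_derivative_continuous[OF G])
    have eq: "G y - G 0 = prim L \<theta> y" if "y \<in> {0<..<L}" for y
    proof -
      have "prim L \<theta> y - prim L \<theta> 0 = G y - G 0"
        by (rule prim_FTC[of _ _ _ "{}"]) (use that G' int in \<open>auto intro: continuous_on_subset[OF Gc]\<close>)
      then show ?thesis by (simp add: prim_0)
    qed
    have "((\<lambda>y. G y - G 0) has_vector_derivative \<theta> x) (at x)"
      using G'[of x] True ab by (auto intro!: derivative_eq_intros)
    then show ?thesis
      by (rule has_vector_derivative_transform_within_open[of _ _ _ "{0<..<L}"]) (use True ab eq in auto)
  next
    case False
    have "((\<lambda>x. 0) has_vector_derivative \<theta> x) (at x)" using out[OF False] by simp
    then show ?thesis
      by (rule has_vector_derivative_transform_within_open[of _ _ _ "-{a..b}"]) (use False zout in auto)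
  qed
  have "Ck_on k UNIV (prim L \<theta>)" for k
  proof (cases k)
    case 0
    have "continuous_on UNIV (prim L \<theta>)"
      using der by (auto intro!: continuous_at_imp_continuous_on has_vector_derivative_continuous)
    then show ?thesis using 0 by simp
  next
    case (Suc k')
    then show ?thesis using der tf by (auto simp: test_function_def Cinf_on_def)
  qed
  then show "test_function L (prim L \<theta>)"
    unfolding test_function_def Cinf_on_def using ab zout by auto
  show "deriv (prim L \<theta>) = \<theta>"
    using der by (auto intro!: ext DERIV_imp_deriv simp: has_real_derivative_iff_has_vector_derivative)
qed

lemma test_function_lincomb:
  assumes "test_function L \<phi>" "test_function L \<psi>"
  shows "test_function L (\<lambda>x. \<phi> x - c * \<psi> x)"
proof -
  obtain a b a' b' where ab: "0 < a" "a < b" "b < L" "\<And>x. x \<notin> {a..b} \<Longrightarrow> \<phi> x = 0"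
    and ab': "0 < a'" "a' < b'" "b' < L" "\<And>x. x \<notin> {a'..b'} \<Longrightarrow> \<psi> x = 0"
    using assms unfolding test_function_def by blast
  show ?thesis
    unfolding test_function_def Cinf_on_def
  proof (intro conjI allI)
    show "Ck_on k UNIV (\<lambda>x. \<phi> x - c * \<psi> x)" for k
      using assms by (intro Ck_on_diff Ck_on_mult Ck_on_const) (auto simp: test_function_def Cinf_on_def)
    show "\<exists>a b. 0 < a \<and> a < b \<and> b < L \<and> (\<forall>x. x \<notin> {a..b} \<longrightarrow> \<phi> x - c * \<psi> x = 0)"
    proof (rule exI[of _ "min a a'"], rule exI[of _ "max b b'"], intro conjI allI impI)
      fix x assume "x \<notin> {min a a'..max b b'}"
      then have "x \<notin> {a..b}" "x \<notin> {a'..b'}" by auto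
      then show "\<phi> x - c * \<psi> x = 0" using ab(4) ab'(4) by simp
    qed (use ab ab' in auto)
  qed
qed

text \<open>The du Bois-Reymond lemma: u = f - \<open>prim L g\<close> has weak derivative zero. A
  test function \<psi> minus the multiple k \<rho> with the same integral is the derivative of a
  test function, so u minus its \<rho>-average c integrates to 0 against every \<psi>.\<close>

lemma has_weak_deriv_imp_prim:
  fixes f g :: "real \<Rightarrow> 'a::euclidean_space"
  assumes f: "sq_integrable L f" and w: "has_weak_deriv L f g" and "0 < L"
  obtains c where "AE x in leb_int L. f x = c + prim L g x"
proof -
  have g: "sq_integrable L g" using w by (simp add: has_weak_deriv_def)
  have pg: "sq_integrable L (prim L g)" by (rule sq_integrable_continuous[OF continuous_on_prim[OF g]])
  have pgm[measurable]: "prim L g \<in> borel_measurable (leb_int L)" using pg by (rule sq_integrableD)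
  note fi = sq_integrable_imp_integrable[OF f] and pgi = sq_integrable_imp_integrable[OF pg]
  define u where "u x = f x - prim L g x" for x
  have u: "integrable (leb_int L) u" unfolding u_def using fi pgi by simp
  note [measurable] = borel_measurable_integrable[OF fi] borel_measurable_integrable[OF u]
  have wp: "has_weak_deriv L (prim L g) g"
    by (rule has_weak_deriv_prim[where c = 0, OF g]) (use \<open>0 < L\<close> in auto)
  have mult: "integrable (leb_int L) (\<lambda>x. \<phi> x *\<^sub>R k x)"
    if c: "continuous_on {0..L} \<phi>" and k: "integrable (leb_int L) k" for \<phi> :: "real \<Rightarrow> real" and k :: "real \<Rightarrow> 'a"
  proof -
    obtain B where B: "\<And>x. x \<in> {0..L} \<Longrightarrow> norm (\<phi> x) \<le> B"
      using compact_imp_bounded[OF compact_continuous_image[OF c compact_Icc]]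
      by (meson bounded_iff imageI)
    note [measurable] = borel_measurable_leb_int_continuous[OF c] borel_measurable_integrable[OF k]
    have "integrable (leb_int L) (\<lambda>x. B * norm (k x))" using k by simp
    then show ?thesis
      by (rule Bochner_Integration.integrable_bound)
         (use B in \<open>auto intro!: AE_I2 mult_right_mono intro: order_trans[OF _ abs_ge_self]\<close>)
  qed
  have zero: "(\<integral>x. deriv \<phi> x *\<^sub>R u x \<partial>leb_int L) = 0" if tf: "test_function L \<phi>" for \<phi>
  proof -
    obtain \<phi>' where c': "continuous_on UNIV \<phi>'" and der: "deriv \<phi> = \<phi>'"
      using tf by (rule test_functionD) blast
    have "continuous_on {0..L} (deriv \<phi>)" using c' der continuous_on_subset by blast
    then have "(\<integral>x. deriv \<phi> x *\<^sub>R u x \<partial>leb_int L)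
        = (\<integral>x. deriv \<phi> x *\<^sub>R f x \<partial>leb_int L) - (\<integral>x. deriv \<phi> x *\<^sub>R prim L g x \<partial>leb_int L)"
      unfolding u_def scaleR_diff_right
      by (intro Bochner_Integration.integral_diff mult fi pgi)
    then show ?thesis using w wp tf by (simp add: has_weak_deriv_def)
  qed
  \<comment> \<open>With exponent 1 this is the bump itself, in the form already known to be a test
    function; what matters is that its integral is nonzero.\<close>
  define \<rho> where "\<rho> x = 1 - (1 - bump (L/3) (L/2) x) ^ 1" for x
  have \<rho>: "test_function L \<rho>"
    unfolding \<rho>_def using \<open>0 < L\<close> by (intro test_function_indicator_approx) auto
  define r where "r = (\<integral>x. \<rho> x \<partial>leb_int L)"
  have \<rho>i: "integrable (leb_int L) \<rho>" by (rule integrable_continuous_leb_int[OF test_function_continuous[OF \<rho>]])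
  have "r \<noteq> 0"
  proof
    assume "r = 0"
    then have "AE x in leb_int L. \<rho> x = 0"
      using integral_nonneg_eq_0_iff_AE[OF \<rho>i] bump_bounds(1) unfolding r_def \<rho>_def by simp
    then have "AE x in leb_int L. x \<notin> {L/3<..<L/2}"
    proof eventually_elim
      case (elim x)
      then show ?case using bump_pos[of x "L/3" "L/2"] by (auto simp: \<rho>_def)
    qed
    then have "AE x in lebesgue. \<not> (x \<in> {L/3<..<L/2})"
      by (subst (asm) AE_restrict_space_iff) (use \<open>0 < L\<close> in \<open>auto elim!: eventually_mono\<close>)
    then have "emeasure lebesgue {L/3<..<L/2} = 0"
      by (subst (asm) AE_iff_null_sets[symmetric]) auto
    then show False using \<open>0 < L\<close> by simp
  qed
  define c where "c = (1 / r) *\<^sub>R (\<integral>x. \<rho> x *\<^sub>R u x \<partial>leb_int L)"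
  have "AE x in leb_int L. u x - c = 0"
  proof (rule fundamental_lemma)
    show "integrable (leb_int L) (\<lambda>x. u x - c)" using u by simp
    fix \<psi> assume \<psi>: "test_function L \<psi>"
    have \<psi>i: "integrable (leb_int L) \<psi>" by (rule integrable_continuous_leb_int[OF test_function_continuous[OF \<psi>]])
    define k where "k = (\<integral>x. \<psi> x \<partial>leb_int L) / r"
    have tf: "test_function L (\<lambda>x. \<psi> x - k * \<rho> x)" by (rule test_function_lincomb[OF \<psi> \<rho>])
    have "(\<integral>x. \<psi> x - k * \<rho> x \<partial>leb_int L) = 0"
      using \<psi>i \<rho>i \<open>r \<noteq> 0\<close> by (simp add: k_def r_def)
    from test_function_primitive[OF tf this] have test0: "(\<integral>x. (\<psi> x - k * \<rho> x) *\<^sub>R u x \<partial>leb_int L) = 0"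
      using zero by metis
    have \<psi>u: "integrable (leb_int L) (\<lambda>x. \<psi> x *\<^sub>R u x)" "integrable (leb_int L) (\<lambda>x. \<rho> x *\<^sub>R u x)"
      using mult u test_function_continuous \<psi> \<rho> by blast+
    have "0 = (\<integral>x. \<psi> x *\<^sub>R u x - k *\<^sub>R (\<rho> x *\<^sub>R u x) \<partial>leb_int L)"
      using test0 by (simp add: scaleR_diff_left)
    also have "\<dots> = (\<integral>x. \<psi> x *\<^sub>R u x \<partial>leb_int L) - k *\<^sub>R (\<integral>x. \<rho> x *\<^sub>R u x \<partial>leb_int L)"
      using \<psi>u(1) integrable_scaleR_right[OF \<psi>u(2), of k]
      by (subst Bochner_Integration.integral_diff) (simp_all only: integral_scaleR_right)
    finally have "(\<integral>x. \<psi> x *\<^sub>R u x \<partial>leb_int L) = k *\<^sub>R (\<integral>x. \<rho> x *\<^sub>R u x \<partial>leb_int L)"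
      by simp
    also have "\<dots> = (\<integral>x. \<psi> x \<partial>leb_int L) *\<^sub>R c"
      by (simp add: k_def c_def divide_inverse)
    also have "\<dots> = (\<integral>x. \<psi> x *\<^sub>R c \<partial>leb_int L)"
      using \<psi>i by (intro integral_scaleR_left[symmetric]) auto
    finally show "(\<integral>x. \<psi> x *\<^sub>R (u x - c) \<partial>leb_int L) = 0"
      using \<psi>u \<psi>i by (simp add: scaleR_diff_right)
  qed
  then have "AE x in leb_int L. f x = c + prim L g x"
    by eventually_elim (simp add: u_def algebra_simps)
  then show ?thesis by (rule that)
qed

lemma has_weak_deriv_unique:
  fixes f g g' :: "real \<Rightarrow> 'a::euclidean_space"
  assumes "has_weak_deriv L f g" "has_weak_deriv L f g'"
  shows "AE x in leb_int L. g x = g' x"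
proof -
  have g: "integrable (leb_int L) g" "integrable (leb_int L) g'"
    using assms by (auto simp: has_weak_deriv_def intro: sq_integrable_imp_integrable)
  have "AE x in leb_int L. g x - g' x = 0"
  proof (rule fundamental_lemma)
    show "integrable (leb_int L) (\<lambda>x. g x - g' x)" using g by simp
    fix \<phi> assume tf: "test_function L \<phi>"
    have c: "continuous_on {0..L} \<phi>" by (rule test_function_continuous[OF tf])
    have \<phi>: "sq_integrable L \<phi>" by (rule sq_integrable_continuous[OF c])
    have mult: "integrable (leb_int L) (\<lambda>x. \<phi> x *\<^sub>R k x)" if "sq_integrable L k" for k :: "real \<Rightarrow> 'a"
    proof -
      note [measurable] = sq_integrableD(1)[OF \<phi>] sq_integrableD(1)[OF that]
      show ?thesis
        by (rule Bochner_Integration.integrable_bound[OF sq_integrable_norm_mult(1)[OF \<phi> that]]) auto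
    qed
    have "(\<integral>x. \<phi> x *\<^sub>R g x \<partial>leb_int L) = (\<integral>x. \<phi> x *\<^sub>R g' x \<partial>leb_int L)"
      using assms tf by (simp add: has_weak_deriv_def)
    then show "(\<integral>x. \<phi> x *\<^sub>R (g x - g' x) \<partial>leb_int L) = 0"
      using assms mult by (simp add: scaleR_diff_right has_weak_deriv_def)
  qed
  then show ?thesis by simp
qed

lemma has_weak_deriv_wderiv: "has_weak_deriv L f g \<Longrightarrow> has_weak_deriv L f (wderiv L f)"
  unfolding wderiv_def by (rule someI[of "has_weak_deriv L f"])

lemma wderiv_AE_eq: "has_weak_deriv L f g \<Longrightarrow> AE x in leb_int L. wderiv L f x = g x"
  using has_weak_deriv_unique has_weak_deriv_wderiv by blast

subsection \<open>Representatives of Sobolev functions\<close>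

lemma has_weak_deriv_cong_AE:
  assumes "has_weak_deriv L f g" "AE x in leb_int L. f x = f' x"
    and [measurable]: "f \<in> borel_measurable (leb_int L)" "f' \<in> borel_measurable (leb_int L)"
  shows "has_weak_deriv L f' g"
  unfolding has_weak_deriv_def
proof (intro conjI allI impI)
  show "sq_integrable L g" using assms(1) by (simp add: has_weak_deriv_def)
  fix \<phi> assume tf: "test_function L \<phi>"
  then obtain \<phi>' where c': "continuous_on UNIV \<phi>'" and der: "deriv \<phi> = \<phi>'"
    by (rule test_functionD) blast
  have [measurable]: "\<phi>' \<in> borel_measurable (leb_int L)"
    by (rule borel_measurable_leb_int_continuous[OF continuous_on_subset[OF c']]) simp
  have "(\<integral>x. deriv \<phi> x *\<^sub>R f' x \<partial>leb_int L) = (\<integral>x. deriv \<phi> x *\<^sub>R f x \<partial>leb_int L)"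
    unfolding der using assms(2) by (intro integral_cong_AE) (auto elim!: eventually_mono)
  then show "(\<integral>x. deriv \<phi> x *\<^sub>R f' x \<partial>leb_int L) = - (\<integral>x. \<phi> x *\<^sub>R g x \<partial>leb_int L)"
    using assms(1) tf by (simp add: has_weak_deriv_def)
qed

text \<open>f is the absolutely continuous representative of an H1 function with derivative g: the
  identity holds at every point of [0, L], so that end points and nodes can be evaluated, while g
  matters only up to null sets. Outside [0, L] nothing is said about f.\<close>

definition is_prim :: "real \<Rightarrow> (real \<Rightarrow> 'a::euclidean_space) \<Rightarrow> (real \<Rightarrow> 'a) \<Rightarrow> bool" where
  "is_prim L f g \<longleftrightarrow> sq_integrable L g \<and> (\<forall>x\<in>{0..L}. f x = f 0 + prim L g x)"

lemma is_prim_eq: "is_prim L f g \<Longrightarrow> x \<in> {0..L} \<Longrightarrow> f x = f 0 + prim L g x"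
  unfolding is_prim_def by blast

lemma is_prim_sq: "is_prim L f g \<Longrightarrow> sq_integrable L g"
  by (simp add: is_prim_def)

lemma is_prim_diff:
  assumes "is_prim L f g" "0 \<le> x" "x \<le> y" "y \<le> L"
  shows "f y - f x = prim L g y - prim L g x"
  using is_prim_eq[OF assms(1), of x] is_prim_eq[OF assms(1), of y] assms by simp

lemma is_prim_continuous: "is_prim L f g \<Longrightarrow> continuous_on {0..L} f"
proof -
  assume fg: "is_prim L f g"
  have "continuous_on {0..L} (\<lambda>x. f 0 + prim L g x)"
    by (intro continuous_intros continuous_on_prim is_prim_sq[OF fg])
  then show ?thesis by (rule continuous_on_eq) (rule is_prim_eq[OF fg, symmetric])
qed

lemma is_prim_cong_AE:
  assumes "is_prim L f g" "AE x in leb_int L. g x = g' x" "g' \<in> borel_measurable (leb_int L)"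
  shows "is_prim L f g'"
proof -
  note [measurable] = assms(3) sq_integrableD(1)[of L g]
  have g: "sq_integrable L g" using assms(1) by (rule is_prim_sq)
  have g': "sq_integrable L g'"
    by (rule sq_integrable_domin[OF g assms(3), of 1]) (use assms(2) in auto)
  have "prim L g x = prim L g' x" for x
    unfolding prim_def using assms(2)
    by (intro integral_cong_AE)
       (auto intro!: borel_measurable_integrable integrable_if_leb_int
         sq_integrable_imp_integrable[OF g] sq_integrable_imp_integrable[OF g'] elim!: eventually_mono)
  then show ?thesis using assms(1) g' unfolding is_prim_def by metis
qed

lemma is_prim_weak_deriv:
  assumes "is_prim L f g" "AE x in leb_int L. h x = f x" "h \<in> borel_measurable (leb_int L)" "0 \<le> L"
  shows "has_weak_deriv L h g"
proof (rule has_weak_deriv_prim[where c = "f 0"])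
  show "sq_integrable L g" using assms(1) by (rule is_prim_sq)
  show "AE x in leb_int L. h x = f 0 + prim L g x"
    using assms(2) AE_space
  proof eventually_elim
    case (elim x)
    then show ?case using is_prim_eq[OF assms(1), of x] by simp
  qed
qed (use assms in auto)

lemma is_prim_sq_integrable:
  assumes "is_prim L f g" shows "sq_integrable L f" "sq_integrable L g"
  using sq_integrable_continuous[OF is_prim_continuous[OF assms]] is_prim_sq[OF assms] by auto

lemma weak_deriv_imp_is_prim:
  assumes "sq_integrable L f" "has_weak_deriv L f g" "0 < L"
  obtains h where "is_prim L h g" "AE x in leb_int L. f x = h x"
proof -
  obtain c where "AE x in leb_int L. f x = c + prim L g x"
    using has_weak_deriv_imp_prim[OF assms] .
  moreover have "is_prim L (\<lambda>x. c + prim L g x) g"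
    using assms(2) by (auto simp: is_prim_def has_weak_deriv_def prim_0)
  ultimately show ?thesis using that by blast
qed

lemma prim_lincomb:
  assumes "integrable (leb_int L) f" "integrable (leb_int L) g"
  shows "prim L (\<lambda>x. s *\<^sub>R f x + t *\<^sub>R g x) y = s *\<^sub>R prim L f y + t *\<^sub>R prim L g y"
proof -
  have "prim L (\<lambda>x. s *\<^sub>R f x + t *\<^sub>R g x) y
     = (\<integral>x. s *\<^sub>R (if x \<le> y then f x else 0) + t *\<^sub>R (if x \<le> y then g x else 0) \<partial>leb_int L)"
    unfolding prim_def by (intro Bochner_Integration.integral_cong) auto
  also have "\<dots> = (\<integral>x. s *\<^sub>R (if x \<le> y then f x else 0) \<partial>leb_int L)
      + (\<integral>x. t *\<^sub>R (if x \<le> y then g x else 0) \<partial>leb_int L)"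
    using assms
    by (intro Bochner_Integration.integral_add Bochner_Integration.integrable_scaleR_right integrable_if_leb_int) auto
  finally show ?thesis by (simp add: prim_def)
qed

lemma is_prim_lincomb:
  assumes "is_prim L f f'" "is_prim L g g'"
  shows "is_prim L (\<lambda>x. s *\<^sub>R f x + t *\<^sub>R g x) (\<lambda>x. s *\<^sub>R f' x + t *\<^sub>R g' x)"
proof -
  note sq = is_prim_sq[OF assms(1)] is_prim_sq[OF assms(2)]
  show ?thesis
    unfolding is_prim_def
  proof (intro conjI ballI)
    show "sq_integrable L (\<lambda>x. s *\<^sub>R f' x + t *\<^sub>R g' x)"
      by (intro sq_integrable_add sq_integrable_scaleR sq)
    show "s *\<^sub>R f x + t *\<^sub>R g x = s *\<^sub>R f 0 + t *\<^sub>R g 0 + prim L (\<lambda>x. s *\<^sub>R f' x + t *\<^sub>R g' x) x"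
      if "x \<in> {0..L}" for x
      using is_prim_eq[OF assms(1) that] is_prim_eq[OF assms(2) that]
      by (simp add: prim_lincomb[OF sq_integrable_imp_integrable[OF sq(1)] sq_integrable_imp_integrable[OF sq(2)]] scaleR_add_right)
  qed
qed

lemma has_weak_deriv_lincomb:
  fixes f g :: "real \<Rightarrow> 'a::euclidean_space"
  assumes "sq_integrable L f" "has_weak_deriv L f f'" "sq_integrable L g" "has_weak_deriv L g g'" "0 < L"
  shows "has_weak_deriv L (\<lambda>x. s *\<^sub>R f x + t *\<^sub>R g x) (\<lambda>x. s *\<^sub>R f' x + t *\<^sub>R g' x)"
proof -
  obtain F where F: "is_prim L F f'" "AE x in leb_int L. f x = F x"
    using weak_deriv_imp_is_prim[OF assms(1,2,5)] .
  obtain G where G: "is_prim L G g'" "AE x in leb_int L. g x = G x"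
    using weak_deriv_imp_is_prim[OF assms(3,4,5)] .
  show ?thesis
  proof (rule is_prim_weak_deriv[OF is_prim_lincomb[OF F(1) G(1)]])
    show "AE x in leb_int L. s *\<^sub>R f x + t *\<^sub>R g x = s *\<^sub>R F x + t *\<^sub>R G x"
      using F(2) G(2) by eventually_elim simp
    show "(\<lambda>x. s *\<^sub>R f x + t *\<^sub>R g x) \<in> borel_measurable (leb_int L)"
      using sq_integrableD(1)[OF assms(1)] sq_integrableD(1)[OF assms(3)] by measurable
  qed (use assms in auto)
qed

lemma sobolev_weak_deriv:
  assumes "sobolev (Suc k) L f"
  shows "sq_integrable L f" "has_weak_deriv L f (wderiv L f)" "sq_integrable L (wderiv L f)"
proof -
  show f: "sq_integrable L f" using assms by simp
  show "has_weak_deriv L f (wderiv L f)" using assms has_weak_deriv_wderiv by auto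
  then show "sq_integrable L (wderiv L f)" by (simp add: has_weak_deriv_def)
qed

lemma sobolev_cong_AE:
  assumes "sobolev k L f" "AE x in leb_int L. f x = g x" "g \<in> borel_measurable (leb_int L)"
  shows "sobolev k L g"
proof (cases k)
  case 0
  then show ?thesis using assms by (auto intro: sq_integrable_domin[of L f _ 1])
next
  case (Suc k')
  then have f: "sq_integrable L f" using assms by simp
  have "sq_integrable L g"
    by (rule sq_integrable_domin[OF f assms(3), of 1]) (use assms(2) in auto)
  then show ?thesis
    using assms Suc has_weak_deriv_cong_AE[OF _ assms(2) sq_integrableD(1)[OF f] assms(3)] by auto
qed

text \<open>\<open>sobolev\<close> asks for some weak derivative, \<open>wderiv\<close> picks one by
  choice; uniqueness up to null sets transfers the remaining regularity from one to the
  other.\<close>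

lemma sobolev_Suc_wderiv:
  assumes "sobolev (Suc k) L f" shows "sobolev k L (wderiv L f)"
proof -
  obtain g where g: "has_weak_deriv L f g" "sobolev k L g" using assms by auto
  have "AE x in leb_int L. g x = wderiv L f x"
    using wderiv_AE_eq[OF g(1)] by eventually_elim simp
  then show ?thesis
    using sobolev_cong_AE[OF g(2)] sq_integrableD(1)[OF sobolev_weak_deriv(3)[OF assms]] by blast
qed

lemma V_D:
  assumes "v \<in> V L"
  shows "sq_integrable L (fst v)" "sq_integrable L (wderiv L (fst v))"
    "sq_integrable L (wderiv L (wderiv L (fst v)))"
    "sq_integrable L (snd v)" "sq_integrable L (wderiv L (snd v))"
    "has_weak_deriv L (fst v) (wderiv L (fst v))"
    "has_weak_deriv L (wderiv L (fst v)) (wderiv L (wderiv L (fst v)))"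
    "has_weak_deriv L (snd v) (wderiv L (snd v))"
proof -
  have y: "sobolev (Suc 1) L (fst v)" and b: "sobolev (Suc 0) L (snd v)"
    using assms by (auto simp: V_def case_prod_unfold numeral_2_eq_2)
  note y' = sobolev_Suc_wderiv[OF y, unfolded One_nat_def]
  show "sq_integrable L (fst v)" "sq_integrable L (wderiv L (fst v))"
    "sq_integrable L (wderiv L (wderiv L (fst v)))"
    "sq_integrable L (snd v)" "sq_integrable L (wderiv L (snd v))"
    "has_weak_deriv L (fst v) (wderiv L (fst v))"
    "has_weak_deriv L (wderiv L (fst v)) (wderiv L (wderiv L (fst v)))"
    "has_weak_deriv L (snd v) (wderiv L (snd v))"
    using sobolev_weak_deriv[OF y] sobolev_weak_deriv[OF y'] sobolev_weak_deriv[OF b] by auto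
qed

text \<open>\<open>Y\<close>, \<open>T\<close>, \<open>B\<close> are the continuous representatives, whereas \<open>K\<close> and \<open>D\<close> are only
  determined up to null sets.\<close>

definition rep :: "real \<Rightarrow> framing \<Rightarrow> (real \<Rightarrow> real^3) \<Rightarrow> (real \<Rightarrow> real^3) \<Rightarrow> (real \<Rightarrow> real^3) \<Rightarrow>
    (real \<Rightarrow> real^3) \<Rightarrow> (real \<Rightarrow> real^3) \<Rightarrow> bool" where
  "rep L v Y T K B D \<longleftrightarrow> v \<in> V L \<and> is_prim L Y T \<and> is_prim L T K \<and> is_prim L B D \<and>
     (AE x in leb_int L. fst v x = Y x) \<and> (AE x in leb_int L. wderiv L (fst v) x = T x) \<and>
     (AE x in leb_int L. wderiv L (wderiv L (fst v)) x = K x) \<and>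
     (AE x in leb_int L. snd v x = B x) \<and> (AE x in leb_int L. wderiv L (snd v) x = D x)"

lemma V_rep:
  assumes "v \<in> V L" "0 < L"
  obtains Y T B where "rep L v Y T (wderiv L (wderiv L (fst v))) B (wderiv L (snd v))"
proof -
  note D = V_D[OF assms(1)]
  obtain T where T: "is_prim L T (wderiv L (wderiv L (fst v)))" "AE x in leb_int L. wderiv L (fst v) x = T x"
    using weak_deriv_imp_is_prim[OF D(2,7) assms(2)] .
  obtain Y where Y: "is_prim L Y (wderiv L (fst v))" "AE x in leb_int L. fst v x = Y x"
    using weak_deriv_imp_is_prim[OF D(1,6) assms(2)] .
  obtain B where B: "is_prim L B (wderiv L (snd v))" "AE x in leb_int L. snd v x = B x"
    using weak_deriv_imp_is_prim[OF D(4,8) assms(2)] .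
  have "is_prim L Y T"
    using is_prim_cong_AE[OF Y(1) T(2)] sq_integrableD is_prim_sq_integrable[OF T(1)] by blast
  then show ?thesis using that T Y B assms(1) by (simp add: rep_def)
qed

lemma is_prim_wderiv:
  assumes "is_prim L f g" "0 \<le> L" shows "AE x in leb_int L. wderiv L f x = g x"
  by (rule wderiv_AE_eq, rule is_prim_weak_deriv[OF assms(1)])
     (use assms is_prim_sq_integrable(1)[OF assms(1)] in \<open>auto dest: sq_integrableD\<close>)

lemma rep_V:
  assumes "is_prim L Y T" "is_prim L T K" "is_prim L B D" "0 \<le> L"
  shows "rep L (Y, B) Y T K B D"
proof -
  note sq = is_prim_sq_integrable[OF assms(1)] is_prim_sq_integrable[OF assms(2)] is_prim_sq_integrable[OF assms(3)]
  note w = is_prim_weak_deriv[OF assms(1) _ sq_integrableD(1)[OF sq(1)] assms(4), simplified]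
    is_prim_weak_deriv[OF assms(2) _ sq_integrableD(1)[OF sq(3)] assms(4), simplified]
    is_prim_weak_deriv[OF assms(3) _ sq_integrableD(1)[OF sq(5)] assms(4), simplified]
  have V: "(Y, B) \<in> V L" unfolding V_def using sq w by (auto simp: numeral_2_eq_2)
  have wm: "wderiv L Y \<in> borel_measurable (leb_int L)" "wderiv L (wderiv L Y) \<in> borel_measurable (leb_int L)"
    using V_D(2,3)[OF V] by (auto dest: sq_integrableD)
  have T: "AE x in leb_int L. wderiv L Y x = T x" by (rule is_prim_wderiv[OF assms(1,4)])
  have "AE x in leb_int L. wderiv L (wderiv L Y) x = K x"
    by (rule wderiv_AE_eq, rule is_prim_weak_deriv[OF assms(2) T wm(1) assms(4)])
  then show ?thesis using V T is_prim_wderiv[OF assms(3,4)] assms by (simp add: rep_def)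
qed

lemma continuous_AE_eq:
  fixes f g :: "real \<Rightarrow> 'a::euclidean_space"
  assumes f: "continuous_on {0..L} f" and g: "continuous_on {0..L} g"
    and eq: "AE x in leb_int L. f x = g x" and "0 < L" "x \<in> {0..L}"
  shows "f x = g x"
proof -
  have c: "continuous_on {0..L} (\<lambda>x. norm (f x - g x))" using f g by (intro continuous_intros)
  have int: "integrable (leb_int L) (\<lambda>x. norm (f x - g x))" by (rule integrable_continuous_leb_int[OF c])
  have "(\<integral>x. norm (f x - g x) \<partial>leb_int L) = (\<integral>x. 0 \<partial>leb_int L)"
    using eq int by (intro integral_cong_AE) (auto elim!: eventually_mono)
  then have "((\<lambda>x. norm (f x - g x)) has_integral 0) {0<..<L}"
    using has_integral_integral_lebesgue_on[OF int] by simp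
  then have "((\<lambda>x. norm (f x - g x)) has_integral 0) (cbox 0 L)"
    using has_integral_Icc_iff_Ioo by (metis box_real(2))
  then have "norm (f x - g x) = 0"
    using has_integral_0_cbox_imp_0[of 0 L "\<lambda>x. norm (f x - g x)" x] c \<open>0 < L\<close> \<open>x \<in> {0..L}\<close>
    by (auto simp: box_real)
  then show ?thesis by simp
qed

text \<open>Two continuous functions that agree a.e. agree on all of [0, L], so the value of the
  chosen representative does not depend on the choice there.\<close>

lemma cts_rep_eq:
  fixes f h :: "real \<Rightarrow> 'a::euclidean_space"
  assumes f: "continuous_on {0..L} f" and eq: "AE x in leb_int L. h x = f x" and "0 < L" "x \<in> {0..L}"
  shows "cts_rep L h x = f x"
proof -
  have "continuous_on {0..L} f \<and> (AE x in leb_int L. f x = h x)"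
    using f eq by (auto elim: eventually_mono)
  then have c: "continuous_on {0..L} (cts_rep L h) \<and> (AE x in leb_int L. cts_rep L h x = h x)"
    unfolding cts_rep_def
    by (rule someI[where P = "\<lambda>g. continuous_on {0..L} g \<and> (AE x in leb_int L. g x = h x)"])
  then have "AE x in leb_int L. cts_rep L h x = h x" by blast
  then have "AE x in leb_int L. cts_rep L h x = f x" using eq by eventually_elim simp
  then show ?thesis using continuous_AE_eq[OF _ f] c assms(3,4) by blast
qed

lemma boundary_values_rep:
  assumes "rep L v Y T K B D" "0 < L"
  shows "boundary_values L v = [Y 0, Y L, T 0, T L, B 0, B L]"
proof -
  have "is_prim L Y T" "is_prim L T K" "is_prim L B D" using assms by (auto simp: rep_def)
  then have c: "continuous_on {0..L} Y" "continuous_on {0..L} T" "continuous_on {0..L} B"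
    using is_prim_continuous by blast+
  note E = cts_rep_eq[OF c(1)] cts_rep_eq[OF c(2)] cts_rep_eq[OF c(3)]
  show ?thesis
    using assms E by (simp add: boundary_values_def rep_def case_prod_unfold)
qed

section \<open>Norms, linear combinations and bounded functionals on V\<close>

lemma Hnorm_ge:
  assumes "j \<le> k" shows "L2norm L ((wderiv L ^^ j) f) \<le> Hnorm k L f"
proof -
  have "(L2norm L ((wderiv L ^^ j) f))\<^sup>2 \<le> (\<Sum>j\<le>k. (L2norm L ((wderiv L ^^ j) f))\<^sup>2)"
    using assms by (intro member_le_sum) auto
  then have "sqrt ((L2norm L ((wderiv L ^^ j) f))\<^sup>2) \<le> Hnorm k L f"
    unfolding Hnorm_def by (rule real_sqrt_le_mono)
  then show ?thesis by simp
qed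

lemma Hnorm_nonneg [simp]: "0 \<le> Hnorm k L f"
  by (simp add: Hnorm_def sum_nonneg)

lemma Hnorm_components:
  "L2norm L y \<le> Hnorm 2 L y" "L2norm L (wderiv L y) \<le> Hnorm 2 L y"
  "L2norm L (wderiv L (wderiv L y)) \<le> Hnorm 2 L y"
  "L2norm L b \<le> Hnorm 1 L b" "L2norm L (wderiv L b) \<le> Hnorm 1 L b"
  using Hnorm_ge[of 0 2 L y] Hnorm_ge[of 1 2 L y] Hnorm_ge[of 2 2 L y] Hnorm_ge[of 0 1 L b] Hnorm_ge[of 1 1 L b]
  by (simp_all add: numeral_2_eq_2)

lemma V_lincomb:
  assumes "(y, b) \<in> V L" "(z, d) \<in> V L" "0 < L"
  shows "(\<lambda>x. s *\<^sub>R y x + t *\<^sub>R z x, \<lambda>x. s *\<^sub>R b x + t *\<^sub>R d x) \<in> V L" (is "(?y, ?b) \<in> _")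
    and "AE x in leb_int L. wderiv L (\<lambda>x. s *\<^sub>R y x + t *\<^sub>R z x) x = s *\<^sub>R wderiv L y x + t *\<^sub>R wderiv L z x"
    and "AE x in leb_int L. wderiv L (wderiv L (\<lambda>x. s *\<^sub>R y x + t *\<^sub>R z x)) x
        = s *\<^sub>R wderiv L (wderiv L y) x + t *\<^sub>R wderiv L (wderiv L z) x"
    and "AE x in leb_int L. wderiv L (\<lambda>x. s *\<^sub>R b x + t *\<^sub>R d x) x = s *\<^sub>R wderiv L b x + t *\<^sub>R wderiv L d x"
proof -
  note v = V_D[OF assms(1), unfolded fst_conv snd_conv] and w = V_D[OF assms(2), unfolded fst_conv snd_conv]
  note 1 = has_weak_deriv_lincomb[OF v(1,6) w(1,6) assms(3), of s t]
    and 2 = has_weak_deriv_lincomb[OF v(2,7) w(2,7) assms(3), of s t]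
    and 3 = has_weak_deriv_lincomb[OF v(4,8) w(4,8) assms(3), of s t]
  note sq = sq_integrable_add[OF sq_integrable_scaleR sq_integrable_scaleR]
  show V: "(?y, ?b) \<in> V L"
    unfolding V_def numeral_2_eq_2 One_nat_def mem_Collect_eq split_conv sobolev.simps
    using 1 2 3 sq[OF v(1) w(1), of s t] sq[OF v(2) w(2), of s t] sq[OF v(3) w(3), of s t]
      sq[OF v(4) w(4), of s t] sq[OF v(5) w(5), of s t]
    by blast
  show e: "AE x in leb_int L. wderiv L ?y x = s *\<^sub>R wderiv L y x + t *\<^sub>R wderiv L z x"
    by (rule wderiv_AE_eq[OF 1])
  show "AE x in leb_int L. wderiv L ?b x = s *\<^sub>R wderiv L b x + t *\<^sub>R wderiv L d x"
    by (rule wderiv_AE_eq[OF 3])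
  have e': "AE x in leb_int L. s *\<^sub>R wderiv L y x + t *\<^sub>R wderiv L z x = wderiv L ?y x"
    using e by eventually_elim simp
  show "AE x in leb_int L. wderiv L (wderiv L ?y) x = s *\<^sub>R wderiv L (wderiv L y) x + t *\<^sub>R wderiv L (wderiv L z) x"
    by (rule wderiv_AE_eq, rule has_weak_deriv_cong_AE[OF 2 e'])
       (use V_D(2)[OF V] sq v w in \<open>auto intro!: sq_integrableD(1)\<close>)
qed

lemma integral_inner_lincomb_AE:
  fixes p f g h :: "real \<Rightarrow> 'a::euclidean_space"
  assumes "sq_integrable L p" "sq_integrable L f" "sq_integrable L g" "sq_integrable L h"
    and "AE x in leb_int L. h x = s *\<^sub>R f x + t *\<^sub>R g x"
  shows "(\<integral>x. p x \<bullet> h x \<partial>leb_int L) = s * (\<integral>x. p x \<bullet> f x \<partial>leb_int L) + t * (\<integral>x. p x \<bullet> g x \<partial>leb_int L)"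
proof -
  note i = sq_integrable_inner(1)[OF assms(1,2)] sq_integrable_inner(1)[OF assms(1,3)]
  note [measurable] = sq_integrableD(1)[OF assms(1)] sq_integrableD(1)[OF assms(2)]
    sq_integrableD(1)[OF assms(3)] sq_integrableD(1)[OF assms(4)]
  have "(\<integral>x. p x \<bullet> h x \<partial>leb_int L) = (\<integral>x. s * (p x \<bullet> f x) + t * (p x \<bullet> g x) \<partial>leb_int L)"
    using assms(5) by (intro integral_cong_AE) (auto elim!: eventually_mono simp: inner_add_right)
  then show ?thesis using i by simp
qed

text \<open>The supply of functionals with which weak convergence is exploited: five L2 pairings,
  one for each of y, y', y'', b, b'. Linearity needs an argument since \<open>wderiv\<close> of a
  sum is only a.e. the sum of the chosen derivatives.\<close>

lemma bounded_linear_V_integral: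
  assumes "0 < L" "sq_integrable L p0" "sq_integrable L p1" "sq_integrable L p2"
    "sq_integrable L q0" "sq_integrable L q1"
  shows "bounded_linear_V L (\<lambda>(y, b). (\<integral>x. p0 x \<bullet> y x \<partial>leb_int L) + (\<integral>x. p1 x \<bullet> wderiv L y x \<partial>leb_int L)
     + (\<integral>x. p2 x \<bullet> wderiv L (wderiv L y) x \<partial>leb_int L)
     + (\<integral>x. q0 x \<bullet> b x \<partial>leb_int L) + (\<integral>x. q1 x \<bullet> wderiv L b x \<partial>leb_int L))"
    (is "bounded_linear_V L ?F")
  unfolding bounded_linear_V_def
proof (intro conjI allI impI)
  fix y b z d s t
  assume v: "(y, b) \<in> V L" and w: "(z, d) \<in> V L"
  note l = V_lincomb[OF v w assms(1), of s t]
  note D = V_D[OF v, unfolded fst_conv snd_conv] V_D[OF w, unfolded fst_conv snd_conv]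
    V_D[OF l(1), unfolded fst_conv snd_conv]
  note i = integral_inner_lincomb_AE[OF assms(2) D(1) D(9) D(17) AE_I2[OF refl]] integral_inner_lincomb_AE[OF assms(3) D(2) D(10) D(18) l(2)]
    integral_inner_lincomb_AE[OF assms(4) D(3) D(11) D(19) l(3)] integral_inner_lincomb_AE[OF assms(5) D(4) D(12) D(20) AE_I2[OF refl]]
    integral_inner_lincomb_AE[OF assms(6) D(5) D(13) D(21) l(4)]
  show "?F (\<lambda>x. s *\<^sub>R y x + t *\<^sub>R z x, \<lambda>x. s *\<^sub>R b x + t *\<^sub>R d x) = s *\<^sub>R ?F (y, b) + t *\<^sub>R ?F (z, d)"
    unfolding split_conv i by (simp add: algebra_simps)
next
  let ?K = "L2norm L p0 + L2norm L p1 + L2norm L p2 + L2norm L q0 + L2norm L q1"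
  have bd: "norm (?F (y, b)) \<le> ?K * Vnorm L (y, b)" if v: "(y, b) \<in> V L" for y b
  proof -
    note D = V_D[OF v, unfolded fst_conv snd_conv]
    have n: "Hnorm 2 L y \<le> Vnorm L (y, b)" "Hnorm 1 L b \<le> Vnorm L (y, b)"
      by (simp_all add: Vnorm_def)
    have step: "\<bar>\<integral>x. p x \<bullet> f x \<partial>leb_int L\<bar> \<le> L2norm L p * Vnorm L (y, b)"
      if "sq_integrable L p" "sq_integrable L f" "L2norm L f \<le> Vnorm L (y, b)" for p f :: "real \<Rightarrow> real^3"
      using sq_integrable_inner(2)[OF that(1,2)] mult_left_mono[OF that(3), of "L2norm L p"] by simp
    note h = Hnorm_components(1)[of L y] Hnorm_components(2)[of L y] Hnorm_components(3)[of L y]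
      Hnorm_components(4)[of L b] Hnorm_components(5)[of L b]
    show ?thesis
      using step[OF assms(2) D(1) order_trans[OF h(1) n(1)]] step[OF assms(3) D(2) order_trans[OF h(2) n(1)]]
        step[OF assms(4) D(3) order_trans[OF h(3) n(1)]] step[OF assms(5) D(4) order_trans[OF h(4) n(2)]]
        step[OF assms(6) D(5) order_trans[OF h(5) n(2)]]
      by (simp add: distrib_right)
  qed
  show "\<exists>K. \<forall>v\<in>V L. norm (?F v) \<le> K * Vnorm L v"
  proof (intro exI[of _ ?K] ballI)
    fix v assume "v \<in> V L"
    then show "norm (?F v) \<le> ?K * Vnorm L v"
      using bd[of "fst v" "snd v"] unfolding prod.collapse by blast
  qed
qed

text \<open>Point evaluation as a pair of L2 pairings: f x is the mean of f plus the integral of its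
  derivative against the kernel s / L - 1_{x < s}, as one sees by writing the mean of f through f L.
  It turns weak convergence into pointwise convergence.\<close>

lemma is_prim_eval:
  fixes f g :: "real \<Rightarrow> 'a::euclidean_space"
  assumes fg: "is_prim L f g" and x: "x \<in> {0..L}" and "0 < L"
  shows "f x \<bullet> e = (\<integral>s. ((1 / L) *\<^sub>R e) \<bullet> f s \<partial>leb_int L)
    + (\<integral>s. ((s / L - (if x < s then 1 else 0)) *\<^sub>R e) \<bullet> g s \<partial>leb_int L)"
proof -
  have g: "sq_integrable L g" and f: "sq_integrable L f" using is_prim_sq_integrable[OF fg] by auto
  note gi = sq_integrable_imp_integrable[OF g] and fi = sq_integrable_imp_integrable[OF f]
  note [measurable] = sq_integrableD(1)[OF g] sq_integrableD(1)[OF f]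
  have sg: "integrable (leb_int L) (\<lambda>s. s *\<^sub>R g s)"
    by (rule Bochner_Integration.integrable_bound[of _ "\<lambda>s. L * norm (g s)"])
       (use gi in \<open>auto intro!: AE_I2 mult_right_mono\<close>)
  have ig: "integrable (leb_int L) (\<lambda>s. if x < s then g s else 0)"
    using gi by (intro integrable_if_leb_int) auto
  have "(\<integral>s. f s \<partial>leb_int L) = (\<integral>s. f 0 + prim L g s \<partial>leb_int L)"
    by (intro Bochner_Integration.integral_cong refl is_prim_eq[OF fg]) auto
  also have "\<dots> = L *\<^sub>R f 0 + (\<integral>s. 1 *\<^sub>R prim L g s \<partial>leb_int L)"
    using integral_const_leb_int[of L "f 0"] \<open>0 < L\<close>
    by (subst Bochner_Integration.integral_add) (auto intro!: integrable_continuous_leb_int continuous_on_prim g)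
  also have "(\<integral>s. 1 *\<^sub>R prim L g s \<partial>leb_int L) = (\<integral>s. (L - s) *\<^sub>R g s \<partial>leb_int L)"
    by (rule integral_by_parts_prim[OF gi]) (auto intro!: derivative_eq_intros)
  also have "\<dots> = L *\<^sub>R (\<integral>s. g s \<partial>leb_int L) - (\<integral>s. s *\<^sub>R g s \<partial>leb_int L)"
    using gi sg by (simp add: scaleR_diff_left)
  finally have 1: "(\<integral>s. f s \<partial>leb_int L) = L *\<^sub>R f L - (\<integral>s. s *\<^sub>R g s \<partial>leb_int L)"
    using is_prim_eq[OF fg, of L] \<open>0 < L\<close> by (simp add: prim_L scaleR_add_right)
  have "prim L g L - prim L g x = (\<integral>s. (if x < s \<and> s \<le> L then g s else 0) \<partial>leb_int L)"
    using x by (intro prim_diff gi) auto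
  also have "\<dots> = (\<integral>s. (if x < s then g s else 0) \<partial>leb_int L)"
    by (rule Bochner_Integration.integral_cong) auto
  finally have 2: "f x = f L - (\<integral>s. (if x < s then g s else 0) \<partial>leb_int L)"
    using is_prim_diff[OF fg, of x L] x by (simp add: algebra_simps)
  have "(\<integral>s. ((s / L - (if x < s then 1 else 0)) *\<^sub>R e) \<bullet> g s \<partial>leb_int L)
      = (\<integral>s. e \<bullet> ((1 / L) *\<^sub>R (s *\<^sub>R g s) - (if x < s then g s else 0)) \<partial>leb_int L)"
    by (rule Bochner_Integration.integral_cong) (auto simp: inner_diff_right algebra_simps)
  also have "\<dots> = e \<bullet> (\<integral>s. (1 / L) *\<^sub>R (s *\<^sub>R g s) - (if x < s then g s else 0) \<partial>leb_int L)"
    by (rule integral_inner_right, rule Bochner_Integration.integrable_diff[OF integrable_scaleR_right[OF sg] ig])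
  also have "(\<integral>s. (1 / L) *\<^sub>R (s *\<^sub>R g s) - (if x < s then g s else 0) \<partial>leb_int L)
      = (1 / L) *\<^sub>R (\<integral>s. s *\<^sub>R g s \<partial>leb_int L) - (\<integral>s. (if x < s then g s else 0) \<partial>leb_int L)"
    using integrable_scaleR_right[OF sg, of "1 / L"] ig
    by (subst Bochner_Integration.integral_diff) (simp_all only: integral_scaleR_right)
  finally have 3: "(\<integral>s. ((s / L - (if x < s then 1 else 0)) *\<^sub>R e) \<bullet> g s \<partial>leb_int L)
    = e \<bullet> ((1 / L) *\<^sub>R (\<integral>s. s *\<^sub>R g s \<partial>leb_int L) - (\<integral>s. (if x < s then g s else 0) \<partial>leb_int L))" .
  have 4: "(\<integral>s. ((1 / L) *\<^sub>R e) \<bullet> f s \<partial>leb_int L) = (1 / L) * (e \<bullet> (\<integral>s. f s \<partial>leb_int L))"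
    using integral_inner_right[of "(1 / L) *\<^sub>R e" "leb_int L" f] fi by simp
  show ?thesis
    unfolding 3 4 1 2 using \<open>0 < L\<close> by (simp add: inner_diff_right inner_diff_left inner_commute right_diff_distrib)
qed

text \<open>Testing with the kernel of \<open>is_prim_eval\<close> gives convergence of the
  continuous representatives at every point, boundary points included; together with uniform bounds
  this plays the role of a compact embedding.\<close>

lemma weak_limit:
  assumes "0 < L" and w: "weakly_tendsto_V L vs v"
    and rn: "\<And>n. rep L (vs n) (Y n) (T n) (K n) (B n) (D n)" and r: "rep L v Y' T' K' B' D'"
  shows "\<And>p. sq_integrable L p \<Longrightarrow> (\<lambda>n. \<integral>x. p x \<bullet> K n x \<partial>leb_int L) \<longlonglongrightarrow> (\<integral>x. p x \<bullet> K' x \<partial>leb_int L)"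
    and "\<And>p. sq_integrable L p \<Longrightarrow> (\<lambda>n. \<integral>x. p x \<bullet> D n x \<partial>leb_int L) \<longlonglongrightarrow> (\<integral>x. p x \<bullet> D' x \<partial>leb_int L)"
    and "\<And>x. x \<in> {0..L} \<Longrightarrow> (\<lambda>n. Y n x) \<longlonglongrightarrow> Y' x"
    and "\<And>x. x \<in> {0..L} \<Longrightarrow> (\<lambda>n. T n x) \<longlonglongrightarrow> T' x"
    and "\<And>x. x \<in> {0..L} \<Longrightarrow> (\<lambda>n. B n x) \<longlonglongrightarrow> B' x"
proof -
  have z: "sq_integrable L (\<lambda>x. 0 :: real^3)" by (rule sq_integrable_bounded[where B = 0]) auto
  have cong: "(\<integral>x. p x \<bullet> f x \<partial>leb_int L) = (\<integral>x. p x \<bullet> g x \<partial>leb_int L)"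
    if "sq_integrable L p" "sq_integrable L f" "sq_integrable L g" "AE x in leb_int L. f x = g x"
    for p f g :: "real \<Rightarrow> real^3"
    using that sq_integrableD(1)[OF that(1)] sq_integrableD(1)[OF that(2)] sq_integrableD(1)[OF that(3)]
    by (intro integral_cong_AE) (auto elim: eventually_mono)
  have F: "(\<integral>x. p0 x \<bullet> fst u x \<partial>leb_int L) = (\<integral>x. p0 x \<bullet> Y x \<partial>leb_int L)"
     "(\<integral>x. p0 x \<bullet> wderiv L (fst u) x \<partial>leb_int L) = (\<integral>x. p0 x \<bullet> T x \<partial>leb_int L)"
     "(\<integral>x. p0 x \<bullet> wderiv L (wderiv L (fst u)) x \<partial>leb_int L) = (\<integral>x. p0 x \<bullet> K x \<partial>leb_int L)"
     "(\<integral>x. p0 x \<bullet> snd u x \<partial>leb_int L) = (\<integral>x. p0 x \<bullet> B x \<partial>leb_int L)"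
     "(\<integral>x. p0 x \<bullet> wderiv L (snd u) x \<partial>leb_int L) = (\<integral>x. p0 x \<bullet> D x \<partial>leb_int L)"
    if "rep L u Y T K B D" "sq_integrable L p0" for u p0 Y T K B D
  proof -
    have V: "u \<in> V L" and p: "is_prim L Y T" "is_prim L T K" "is_prim L B D"
      using that by (auto simp: rep_def)
    note sq = V_D[OF V] is_prim_sq_integrable[OF p(1)] is_prim_sq_integrable[OF p(2)] is_prim_sq_integrable[OF p(3)]
    show "(\<integral>x. p0 x \<bullet> fst u x \<partial>leb_int L) = (\<integral>x. p0 x \<bullet> Y x \<partial>leb_int L)"
      "(\<integral>x. p0 x \<bullet> wderiv L (fst u) x \<partial>leb_int L) = (\<integral>x. p0 x \<bullet> T x \<partial>leb_int L)"
      "(\<integral>x. p0 x \<bullet> wderiv L (wderiv L (fst u)) x \<partial>leb_int L) = (\<integral>x. p0 x \<bullet> K x \<partial>leb_int L)"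
      "(\<integral>x. p0 x \<bullet> snd u x \<partial>leb_int L) = (\<integral>x. p0 x \<bullet> B x \<partial>leb_int L)"
      "(\<integral>x. p0 x \<bullet> wderiv L (snd u) x \<partial>leb_int L) = (\<integral>x. p0 x \<bullet> D x \<partial>leb_int L)"
      using that sq by (auto simp: rep_def intro!: cong)
  qed
  have lim: "(\<lambda>n. (\<integral>x. p0 x \<bullet> Y n x \<partial>leb_int L) + (\<integral>x. p1 x \<bullet> T n x \<partial>leb_int L)
     + (\<integral>x. p2 x \<bullet> K n x \<partial>leb_int L) + (\<integral>x. q0 x \<bullet> B n x \<partial>leb_int L) + (\<integral>x. q1 x \<bullet> D n x \<partial>leb_int L))
     \<longlonglongrightarrow> (\<integral>x. p0 x \<bullet> Y' x \<partial>leb_int L) + (\<integral>x. p1 x \<bullet> T' x \<partial>leb_int L)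
     + (\<integral>x. p2 x \<bullet> K' x \<partial>leb_int L) + (\<integral>x. q0 x \<bullet> B' x \<partial>leb_int L) + (\<integral>x. q1 x \<bullet> D' x \<partial>leb_int L)"
    if p: "sq_integrable L p0" "sq_integrable L p1" "sq_integrable L p2" "sq_integrable L q0" "sq_integrable L q1"
    for p0 p1 p2 q0 q1 :: "real \<Rightarrow> real^3"
  proof -
    note G = w[unfolded weakly_tendsto_V_def, rule_format, OF bounded_linear_V_integral[OF assms(1) p]]
    show ?thesis
      using G F[OF rn p(1)] F[OF rn p(2)] F[OF rn p(3)] F[OF rn p(4)] F[OF rn p(5)]
        F[OF r p(1)] F[OF r p(2)] F[OF r p(3)] F[OF r p(4)] F[OF r p(5)]
      by (simp add: case_prod_unfold)
  qed
  show "(\<lambda>n. \<integral>x. p x \<bullet> K n x \<partial>leb_int L) \<longlonglongrightarrow> (\<integral>x. p x \<bullet> K' x \<partial>leb_int L)" if "sq_integrable L p" for p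
    using lim[OF z z that z z] by simp
  show "(\<lambda>n. \<integral>x. p x \<bullet> D n x \<partial>leb_int L) \<longlonglongrightarrow> (\<integral>x. p x \<bullet> D' x \<partial>leb_int L)" if "sq_integrable L p" for p
    using lim[OF z z z z that] by simp
  have c: "sq_integrable L (\<lambda>s. (1 / L) *\<^sub>R e)" "sq_integrable L (\<lambda>s. (s / L - (if x < s then 1 else 0)) *\<^sub>R e)"
    for x and e :: "real^3"
  proof -
    show "sq_integrable L (\<lambda>s. (1 / L) *\<^sub>R e)" by (rule sq_integrable_continuous) (intro continuous_intros)
    show "sq_integrable L (\<lambda>s. (s / L - (if x < s then 1 else 0)) *\<^sub>R e)"
    proof (rule sq_integrable_bounded[where B = "norm e"])
      show "(\<lambda>s. (s / L - (if x < s then 1 else 0)) *\<^sub>R e) \<in> borel_measurable (leb_int L)"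
        by (rule borel_measurable_leb_int) measurable
      show "norm ((s / L - (if x < s then 1 else 0)) *\<^sub>R e) \<le> norm e" if "0 < s" "s < L" for s
      proof -
        have "\<bar>s / L - (if x < s then 1 else 0)\<bar> \<le> 1" using that by (auto simp: field_simps abs_le_iff)
        then show ?thesis by (simp add: mult_left_le_one_le)
      qed
    qed
  qed
  have R: "is_prim L (Y n) (T n)" "is_prim L (T n) (K n)" "is_prim L (B n) (D n)"
    "is_prim L Y' T'" "is_prim L T' K'" "is_prim L B' D'" for n
    using rn r by (auto simp: rep_def)
  show "(\<lambda>n. Y n x) \<longlonglongrightarrow> Y' x" if "x \<in> {0..L}" for x
    unfolding tendsto_componentwise_iff[of _ "Y' x"]
    using lim[OF c z z z] is_prim_eval[OF R(1) that assms(1)] is_prim_eval[OF R(4) that assms(1)] by simp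
  show "(\<lambda>n. T n x) \<longlonglongrightarrow> T' x" if "x \<in> {0..L}" for x
    unfolding tendsto_componentwise_iff[of _ "T' x"]
    using lim[OF z c z z] is_prim_eval[OF R(2) that assms(1)] is_prim_eval[OF R(5) that assms(1)] by simp
  show "(\<lambda>n. B n x) \<longlonglongrightarrow> B' x" if "x \<in> {0..L}" for x
    unfolding tendsto_componentwise_iff[of _ "B' x"]
    using lim[OF z z z c] is_prim_eval[OF R(3) that assms(1)] is_prim_eval[OF R(6) that assms(1)] by simp
qed

text \<open>As a default rule it would make the measurability prover look for a factorization of arbitrary
  functions through an interval.\<close>

declare measurable_leb_int_ident [measurable del]

subsection \<open>The energy density\<close>

text \<open>Equal to |b| / |a| if |b| \<le> |a| and a is nonzero, and to 1 if |b| > |a|: the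
  maximizer over [0, 1] of k \<mapsto> (1 - k^2) |a| + 2 k |b|. For a = b = 0, where this function
  vanishes identically, the convention on division gives 0.\<close>

definition opt_k :: "real \<Rightarrow> real \<Rightarrow> real" where
  "opt_k a b = \<bar>b\<bar> / max \<bar>a\<bar> \<bar>b\<bar>"

definition sqrtQ :: "real \<Rightarrow> real \<Rightarrow> real" where
  "sqrtQ a b = (1 - (opt_k a b)\<^sup>2) * \<bar>a\<bar> + 2 * opt_k a b * \<bar>b\<bar>"

lemma opt_k_bounds: "0 \<le> opt_k a b" "opt_k a b \<le> 1"
  by (auto simp: opt_k_def divide_le_eq_1)

lemma sqrtQ_cases:
  "sqrtQ a b = (if \<bar>b\<bar> \<le> \<bar>a\<bar> then \<bar>a\<bar> + b\<^sup>2 / \<bar>a\<bar> else 2 * \<bar>b\<bar>)"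
proof (cases "\<bar>b\<bar> \<le> \<bar>a\<bar>")
  case True
  show ?thesis
  proof (cases "a = 0")
    case False
    with True show ?thesis
      by (simp add: sqrtQ_def opt_k_def max_def field_simps power2_eq_square power3_eq_cube)
  qed (use True in \<open>simp add: sqrtQ_def opt_k_def\<close>)
next
  case False
  then have "opt_k a b = 1" by (auto simp: opt_k_def)
  with False show ?thesis by (simp add: sqrtQ_def)
qed

lemma Qbar_eq_sqrtQ: "Qbar a b = (sqrtQ a b)\<^sup>2"
proof -
  consider "a = 0" "b = 0" | "a \<noteq> 0" "\<bar>b\<bar> \<le> \<bar>a\<bar>" | "\<bar>a\<bar> < \<bar>b\<bar>" by fastforce
  then show ?thesis
  proof cases
    case 2
    then have "\<bar>a\<bar> + b\<^sup>2 / \<bar>a\<bar> = (a\<^sup>2 + b\<^sup>2) / \<bar>a\<bar>"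
      by (simp add: field_simps power2_eq_square abs_mult_self_eq)
    with 2 show ?thesis by (auto simp: Qbar_def sqrtQ_cases power_divide)
  qed (auto simp: Qbar_def sqrtQ_cases power_mult_distrib)
qed

text \<open>The square root of \<open>Qbar\<close> is a supremum of the norms
  \<open>(1 - k\<^sup>2) * \<bar>a\<bar> + 2 * k * \<bar>b\<bar>\<close> over \<open>0 \<le> k \<le> 1\<close>, attained at \<open>opt_k a b\<close>; convexity
  of the energy density in the pair of vectors, Jensen's inequality, and the triangle inequality are
  all read off from this.\<close>

lemma sqrtQ_ge:
  assumes "0 \<le> k" "k \<le> 1"
  shows "(1 - k\<^sup>2) * \<bar>a\<bar> + 2 * k * \<bar>b\<bar> \<le> sqrtQ a b"
proof (cases "\<bar>b\<bar> \<le> \<bar>a\<bar>")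
  case True
  show ?thesis
  proof (cases "a = 0")
    case False
    \<comment> \<open>Completing the square in k around the maximizer |b| / |a|.\<close>
    have "0 \<le> (k * \<bar>a\<bar> - \<bar>b\<bar>)\<^sup>2" by simp
    also have "\<dots> = b\<^sup>2 - (2 * k * \<bar>b\<bar> - k\<^sup>2 * \<bar>a\<bar>) * \<bar>a\<bar>"
      unfolding power2_abs[of b, symmetric] power2_eq_square by (simp only: algebra_simps) simp
    finally have "(2 * k * \<bar>b\<bar> - k\<^sup>2 * \<bar>a\<bar>) * \<bar>a\<bar> \<le> b\<^sup>2" by simp
    then have "2 * k * \<bar>b\<bar> - k\<^sup>2 * \<bar>a\<bar> \<le> b\<^sup>2 / \<bar>a\<bar>" using False by (simp add: pos_le_divide_eq)
    then show ?thesis using True by (simp add: sqrtQ_cases left_diff_distrib)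
  qed (use True in \<open>simp add: sqrtQ_cases\<close>)
next
  case False
  have "0 \<le> 1 - k\<^sup>2" using assms by (simp add: power_le_one)
  then have "(1 - k\<^sup>2) * \<bar>a\<bar> \<le> (1 - k\<^sup>2) * \<bar>b\<bar>" using False by (intro mult_left_mono) auto
  moreover have "0 \<le> (1 - k)\<^sup>2 * \<bar>b\<bar>" by simp
  then have "(1 - k\<^sup>2) * \<bar>b\<bar> + 2 * k * \<bar>b\<bar> \<le> 2 * \<bar>b\<bar>" by (simp add: power2_diff algebra_simps)
  ultimately show ?thesis using False by (simp add: sqrtQ_cases)
qed

lemma sqrtQ_bounds:
  "0 \<le> sqrtQ a b" "\<bar>a\<bar> \<le> sqrtQ a b" "2 * \<bar>b\<bar> \<le> sqrtQ a b" "sqrtQ a b \<le> \<bar>a\<bar> + 2 * \<bar>b\<bar>"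
proof -
  show a: "\<bar>a\<bar> \<le> sqrtQ a b" using sqrtQ_ge[of 0 a b] by simp
  then show "0 \<le> sqrtQ a b" by linarith
  show "2 * \<bar>b\<bar> \<le> sqrtQ a b" using sqrtQ_ge[of 1 a b] by simp
  show "sqrtQ a b \<le> \<bar>a\<bar> + 2 * \<bar>b\<bar>"
    unfolding sqrtQ_def using opt_k_bounds[of a b]
    by (intro add_mono mult_left_le_one_le mult_right_mono) (auto simp: power_le_one)
qed

lemma Qbar_bounds: "0 \<le> Qbar a b" "a\<^sup>2 \<le> Qbar a b" "b\<^sup>2 \<le> Qbar a b" "Qbar a b \<le> 2 * a\<^sup>2 + 8 * b\<^sup>2"
proof -
  show "0 \<le> Qbar a b" by (simp add: Qbar_eq_sqrtQ)
  have "\<bar>a\<bar>\<^sup>2 \<le> (sqrtQ a b)\<^sup>2" by (rule power_mono) (auto simp: sqrtQ_bounds)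
  then show "a\<^sup>2 \<le> Qbar a b" by (simp add: Qbar_eq_sqrtQ)
  have "\<bar>b\<bar>\<^sup>2 \<le> (sqrtQ a b)\<^sup>2" by (rule power_mono) (use sqrtQ_bounds(3)[where a=a and b=b] in auto)
  then show "b\<^sup>2 \<le> Qbar a b" by (simp add: Qbar_eq_sqrtQ)
  have "(sqrtQ a b)\<^sup>2 \<le> (\<bar>a\<bar> + 2 * \<bar>b\<bar>)\<^sup>2" by (rule power_mono) (auto simp: sqrtQ_bounds)
  moreover have "0 \<le> (\<bar>a\<bar> - 2 * \<bar>b\<bar>)\<^sup>2" by simp
  ultimately show "Qbar a b \<le> 2 * a\<^sup>2 + 8 * b\<^sup>2"
    unfolding Qbar_eq_sqrtQ power2_sum power2_diff by (simp add: power_mult_distrib)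
qed

text \<open>Take the k that is optimal for the left side: for fixed k the expression is a seminorm,
  and the coefficient 1 - k^2 of the first component is at most 1. Only the first component is
  perturbed, since the cubic correction of an interpolant enters y'' but not b'.\<close>

lemma sqrtQ_add_le:
  fixes u w z :: "'a::real_normed_vector"
  shows "sqrtQ (norm (u + w)) (norm z) \<le> sqrtQ (norm u) (norm z) + norm w"
proof -
  define k where "k = opt_k (norm (u + w)) (norm z)"
  have k: "0 \<le> k" "k \<le> 1" unfolding k_def by (rule opt_k_bounds)+
  have k2: "0 \<le> 1 - k\<^sup>2" "1 - k\<^sup>2 \<le> 1" using k by (auto simp: power_le_one)
  have "(1 - k\<^sup>2) * norm (u + w) \<le> (1 - k\<^sup>2) * norm u + (1 - k\<^sup>2) * norm w"
    using mult_left_mono[OF norm_triangle_ineq k2(1)] by (simp add: distrib_left)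
  moreover have "(1 - k\<^sup>2) * norm w \<le> norm w" using k2 by (intro mult_left_le_one_le) auto
  ultimately show ?thesis
    using sqrtQ_ge[OF k, of "norm u" "norm z"] unfolding sqrtQ_def[of "norm (u + w)"] k_def[symmetric] by simp
qed

lemma inner_sgn_le_norm:
  fixes u w :: "'a::real_inner" shows "sgn u \<bullet> w \<le> norm w" "sgn u \<bullet> u = norm u"
proof -
  have "sgn u \<bullet> w \<le> norm (sgn u) * norm w" by (rule norm_cauchy_schwarz)
  also have "\<dots> \<le> norm w" by (simp add: norm_sgn)
  finally show "sgn u \<bullet> w \<le> norm w" .
  show "sgn u \<bullet> u = norm u"
    by (cases "u = 0") (simp_all add: sgn_div_norm dot_square_norm power2_eq_square)
qed

text \<open>The weights form a subgradient of the energy density at (u, z). With the k optimal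
  there, the linear form is at most 2 S R, where R is the square root of \<open>Qbar\<close> at (w,
  s), and 2 S R - S^2 \<le> R^2. The second part is Euler's identity for a function homogeneous of
  degree 2. The value \<open>sgn 0 = 0\<close> covers vanishing vectors.\<close>

lemma Qbar_tangent:
  fixes u w :: "'a::real_inner" and z s :: "'b::real_inner"
  defines "k \<equiv> opt_k (norm u) (norm z)" and "S \<equiv> sqrtQ (norm u) (norm z)"
  shows "((2 * S * (1 - k\<^sup>2)) *\<^sub>R sgn u) \<bullet> w + ((4 * S * k) *\<^sub>R sgn z) \<bullet> s - S\<^sup>2 \<le> Qbar (norm w) (norm s)"
    and "((2 * S * (1 - k\<^sup>2)) *\<^sub>R sgn u) \<bullet> u + ((4 * S * k) *\<^sub>R sgn z) \<bullet> z = 2 * S\<^sup>2"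
proof -
  have k: "0 \<le> k" "k \<le> 1" unfolding k_def by (rule opt_k_bounds)+
  have S0: "0 \<le> S" by (simp add: S_def sqrtQ_bounds)
  have k2: "0 \<le> 1 - k\<^sup>2" using k by (auto simp: power_le_one)
  let ?R = "sqrtQ (norm w) (norm s)"
  have "(1 - k\<^sup>2) * (sgn u \<bullet> w) + 2 * k * (sgn z \<bullet> s) \<le> (1 - k\<^sup>2) * norm w + 2 * k * norm s"
    using k k2 by (intro add_mono mult_left_mono inner_sgn_le_norm) auto
  also have "\<dots> \<le> ?R" using sqrtQ_ge[OF k, of "norm w" "norm s"] by simp
  finally have "2 * S * ((1 - k\<^sup>2) * (sgn u \<bullet> w) + 2 * k * (sgn z \<bullet> s)) \<le> 2 * S * ?R"
    using S0 by (intro mult_left_mono) auto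
  moreover have "0 \<le> (?R - S)\<^sup>2" by simp
  ultimately show "((2 * S * (1 - k\<^sup>2)) *\<^sub>R sgn u) \<bullet> w + ((4 * S * k) *\<^sub>R sgn z) \<bullet> s - S\<^sup>2 \<le> Qbar (norm w) (norm s)"
    by (simp add: Qbar_eq_sqrtQ power2_diff algebra_simps)
  have "S = (1 - k\<^sup>2) * norm u + 2 * k * norm z" by (simp add: S_def k_def sqrtQ_def)
  then have "S * ((1 - k\<^sup>2) * norm u + 2 * k * norm z) = S\<^sup>2" by (simp add: power2_eq_square)
  then show "((2 * S * (1 - k\<^sup>2)) *\<^sub>R sgn u) \<bullet> u + ((4 * S * k) *\<^sub>R sgn z) \<bullet> z = 2 * S\<^sup>2"
    by (simp add: inner_sgn_le_norm algebra_simps)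
qed

lemma measurable_opt_k [measurable]:
  assumes [measurable]: "f \<in> borel_measurable M" "g \<in> borel_measurable M"
  shows "(\<lambda>x. opt_k (f x) (g x)) \<in> borel_measurable M"
  unfolding opt_k_def by measurable

lemma measurable_sqrtQ [measurable]:
  assumes [measurable]: "f \<in> borel_measurable M" "g \<in> borel_measurable M"
  shows "(\<lambda>x. sqrtQ (f x) (g x)) \<in> borel_measurable M"
  unfolding sqrtQ_def by measurable

lemma measurable_Qbar [measurable]:
  assumes [measurable]: "f \<in> borel_measurable M" "g \<in> borel_measurable M"
  shows "(\<lambda>x. Qbar (f x) (g x)) \<in> borel_measurable M"
  unfolding Qbar_eq_sqrtQ by measurable

lemma integrable_Qbar:
  fixes f :: "real \<Rightarrow> 'a::euclidean_space" and g :: "real \<Rightarrow> 'b::euclidean_space"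
  assumes "sq_integrable L f" "sq_integrable L g"
  shows "integrable (leb_int L) (\<lambda>x. Qbar (norm (f x)) (norm (g x)))"
proof (rule Bochner_Integration.integrable_bound)
  note [measurable] = sq_integrableD(1)[OF assms(1)] sq_integrableD(1)[OF assms(2)]
  show "integrable (leb_int L) (\<lambda>x. 2 * (norm (f x))\<^sup>2 + 8 * (norm (g x))\<^sup>2)"
    using sq_integrableD(2)[OF assms(1)] sq_integrableD(2)[OF assms(2)] by simp
  show "(\<lambda>x. Qbar (norm (f x)) (norm (g x))) \<in> borel_measurable (leb_int L)" by measurable
  show "AE x in leb_int L. norm (Qbar (norm (f x)) (norm (g x))) \<le> norm (2 * (norm (f x))\<^sup>2 + 8 * (norm (g x))\<^sup>2)"
    using Qbar_bounds(1,4) by (intro AE_I2) auto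
qed

text \<open>The right side is the integrand of the discrete energy with the exact modulus in place
  of the regularized one. At a = b = 0 the quotient is 0 / 0 = 0.\<close>

lemma Qbar_eq_half:
  "Qbar a b = 1 / 2 * (a\<^sup>2 + 5 * b\<^sup>2 + (\<bar>a\<^sup>2 - b\<^sup>2\<bar> + 4 * (b\<^sup>2)\<^sup>2 / (a\<^sup>2 + b\<^sup>2 + \<bar>a\<^sup>2 - b\<^sup>2\<bar>)))"
proof (cases "a = 0 \<and> b = 0")
  case True
  then show ?thesis by (simp add: Qbar_def)
next
  case False
  show ?thesis
  proof (cases "\<bar>b\<bar> \<le> \<bar>a\<bar>")
    case True
    then have "b\<^sup>2 \<le> a\<^sup>2" by (simp add: abs_le_square_iff)
    then have *: "\<bar>a\<^sup>2 - b\<^sup>2\<bar> = a\<^sup>2 - b\<^sup>2" by simp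
    have "a \<noteq> 0" using True False by auto
    then show ?thesis using True False unfolding * Qbar_def
      by (simp add: field_simps power2_eq_square)
  next
    case F: False
    then have "a\<^sup>2 \<le> b\<^sup>2" by (simp add: abs_le_square_iff[symmetric])
    then have *: "\<bar>a\<^sup>2 - b\<^sup>2\<bar> = b\<^sup>2 - a\<^sup>2" by simp
    have "b \<noteq> 0" using F by auto
    then show ?thesis using F unfolding * Qbar_def
      by (simp add: field_simps power2_eq_square)
  qed
qed

section \<open>The error caused by the regularized modulus\<close>

lemma regularized_modulusD:
  assumes "regularized_modulus m c0 c1 c2 cuni" "0 < \<delta>"
  shows "0 < m \<delta> x" "\<bar>m \<delta> x - \<bar>x\<bar>\<bar> \<le> cuni * \<delta>" "continuous_on UNIV (m \<delta>)" "0 \<le> cuni"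
proof -
  obtain m' where c0: "0 < c0" and m: "\<And>x. (m \<delta> has_real_derivative m' x) (at x)" "\<And>x. c0 * \<delta> \<le> m \<delta> x"
      "\<And>x. \<bar>m \<delta> x - \<bar>x\<bar>\<bar> \<le> cuni * \<delta>"
    using assms unfolding regularized_modulus_def by metis
  show "0 < m \<delta> x" using m(2)[of x] mult_pos_pos[OF c0 assms(2)] by linarith
  show "\<bar>m \<delta> x - \<bar>x\<bar>\<bar> \<le> cuni * \<delta>" by (rule m)
  show "continuous_on UNIV (m \<delta>)"
    using m(1) DERIV_isCont by (intro continuous_at_imp_continuous_on) blast
  have "0 \<le> cuni * \<delta>" using m(3)[of 0] by linarith
  then show "0 \<le> cuni" using assms(2) by (simp add: zero_le_mult_iff)
qed

text \<open>The modulus contributes one multiple of cuni \<delta>. The quotient contributes two: its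
  denominators are at least t and 2 t, they differ by the error of the modulus, and 4 t^2 / (2 t^2)
  = 2.\<close>

lemma psi_approx:
  assumes m: "regularized_modulus m c0 c1 c2 cuni" and \<delta>: "0 < \<delta>" and st: "0 \<le> s" "0 \<le> t"
  shows "\<bar>psi m \<delta> s t - (\<bar>s - t\<bar> + 4 * t\<^sup>2 / (s + t + \<bar>s - t\<bar>))\<bar> \<le> 3 * (cuni * \<delta>)"
proof (cases "t = 0")
  case True
  then show ?thesis using regularized_modulusD(2)[OF m \<delta>, of s] regularized_modulusD(4)[OF m \<delta>] \<delta>
    by (simp add: psi_def mult_nonneg_nonneg)
next
  case False
  then have t: "0 < t" using st by simp
  define M where "M = m \<delta> (s - t)"
  define D1 where "D1 = s + t + M"
  define D2 where "D2 = s + t + \<bar>s - t\<bar>"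
  have M: "0 < M" "\<bar>M - \<bar>s - t\<bar>\<bar> \<le> cuni * \<delta>"
    using regularized_modulusD[OF m \<delta>] by (auto simp: M_def)
  have D: "t \<le> D1" "2 * t \<le> D2" using M st by (auto simp: D1_def D2_def)
  have D0: "0 < D1" "0 < D2" using D t by auto
  have "4 * t\<^sup>2 / D1 - 4 * t\<^sup>2 / D2 = 4 * t\<^sup>2 * (D2 - D1) / (D1 * D2)"
    using D0 by (simp add: field_simps)
  then have "\<bar>4 * t\<^sup>2 / D1 - 4 * t\<^sup>2 / D2\<bar> = 4 * t\<^sup>2 * \<bar>D2 - D1\<bar> / (D1 * D2)"
    using D0 by (simp add: abs_mult)
  also have "\<dots> \<le> 4 * t\<^sup>2 * \<bar>D2 - D1\<bar> / (t * (2 * t))"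
    using D D0 t by (intro divide_left_mono mult_mono) auto
  also have "\<dots> = 2 * \<bar>M - \<bar>s - t\<bar>\<bar>"
    using t by (simp add: D1_def D2_def power2_eq_square abs_minus_commute)
  finally have "\<bar>4 * t\<^sup>2 / D1 - 4 * t\<^sup>2 / D2\<bar> \<le> 2 * \<bar>M - \<bar>s - t\<bar>\<bar>" by simp
  moreover have "psi m \<delta> s t = M + 4 * t\<^sup>2 / D1" by (simp add: psi_def M_def D1_def)
  moreover have "\<bar>q + p\<bar> \<le> 3 * c" if "\<bar>p\<bar> \<le> 2 * \<bar>q\<bar>" "\<bar>q\<bar> \<le> c" for p q c :: real
    using that by linarith
  ultimately show ?thesis
    using M(2) unfolding D2_def[symmetric] by (metis add_diff_add)
qed

text \<open>The error of the density is bounded by a constant that does not depend on the frame, so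
  one estimate serves both for the given near-minimizers and for the recovery frames.\<close>

lemma discrete_energy_approx:
  assumes m: "regularized_modulus m c0 c1 c2 cuni" and \<delta>: "0 < \<delta>" and v: "v \<in> V L" and "0 \<le> L"
  shows "\<bar>discrete_energy L m \<delta> \<epsilon>1 \<epsilon>2 v - (energy L v
     + 1 / (2 * \<epsilon>1) * (\<integral>x. (wderiv L (fst v) x \<bullet> snd v x)\<^sup>2 \<partial>leb_int L)
     + 1 / (2 * \<epsilon>2) * (\<integral>x. (wderiv L (fst v) x \<bullet> wderiv L (snd v) x)\<^sup>2 \<partial>leb_int L))\<bar>
    \<le> 3 / 2 * cuni * \<delta> * L"
proof -
  let ?K = "wderiv L (wderiv L (fst v))" and ?D = "wderiv L (snd v)"
  note sq = V_D(3,5)[OF v]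
  note [measurable] = sq_integrableD(1)[OF sq(1)] sq_integrableD(1)[OF sq(2)]
  define Q where "Q x = Qbar (norm (?K x)) (norm (?D x))" for x
  define I where "I x = 1 / 2 * ((norm (?K x))\<^sup>2 + 5 * (norm (?D x))\<^sup>2 + psi m \<delta> ((norm (?K x))\<^sup>2) ((norm (?D x))\<^sup>2))" for x
  define C where "C = 3 / 2 * cuni * \<delta>"
  have [measurable]: "m \<delta> \<in> borel_measurable borel"
    by (rule borel_measurable_continuous_onI[OF regularized_modulusD(3)[OF m \<delta>]])
  have [measurable]: "I \<in> borel_measurable (leb_int L)" "Q \<in> borel_measurable (leb_int L)"
    unfolding I_def psi_def Q_def by measurable
  have bd: "\<bar>I x - Q x\<bar> \<le> C" for x
  proof -
    define k d where "k = (norm (?K x))\<^sup>2" and "d = (norm (?D x))\<^sup>2"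
    define R where "R = \<bar>k - d\<bar> + 4 * d\<^sup>2 / (k + d + \<bar>k - d\<bar>)"
    have "\<bar>psi m \<delta> k d - R\<bar> \<le> 3 * (cuni * \<delta>)"
      unfolding R_def by (rule psi_approx[OF m \<delta>]) (simp_all add: k_def d_def)
    moreover have "2 * I x = k + 5 * d + psi m \<delta> k d" by (simp add: I_def k_def d_def)
    moreover have "2 * Q x = k + 5 * d + R"
      unfolding Q_def Qbar_eq_half k_def[symmetric] d_def[symmetric] R_def[symmetric] by simp
    ultimately have "\<bar>2 * I x - 2 * Q x\<bar> \<le> 3 * (cuni * \<delta>)" by simp
    then show ?thesis unfolding C_def by linarith
  qed
  have Qi: "integrable (leb_int L) Q" unfolding Q_def by (rule integrable_Qbar[OF sq])
  have di: "integrable (leb_int L) (\<lambda>x. I x - Q x)"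
    by (rule integrable_bounded_leb_int[where B = C]) (use bd in auto)
  have Ii: "integrable (leb_int L) I" using Bochner_Integration.integrable_add[OF di Qi] by simp
  have "\<bar>(\<integral>x. I x \<partial>leb_int L) - (\<integral>x. Q x \<partial>leb_int L)\<bar> = \<bar>\<integral>x. I x - Q x \<partial>leb_int L\<bar>"
    using Ii Qi by simp
  also have "\<dots> \<le> (\<integral>x. \<bar>I x - Q x\<bar> \<partial>leb_int L)" by (rule integral_abs_bound)
  also have "\<dots> \<le> (\<integral>x. C \<partial>leb_int L)" using bd di by (intro integral_mono) auto
  also have "\<dots> = C * L" using integral_const_leb_int[OF assms(4), of C] by simp
  finally have "\<bar>(\<integral>x. I x \<partial>leb_int L) - (\<integral>x. Q x \<partial>leb_int L)\<bar> \<le> C * L" .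
  moreover have "(\<integral>x. I x \<partial>leb_int L) = 1 / 2 * (\<integral>x. (norm (?K x))\<^sup>2 + 5 * (norm (?D x))\<^sup>2
      + psi m \<delta> ((norm (?K x))\<^sup>2) ((norm (?D x))\<^sup>2) \<partial>leb_int L)"
    unfolding I_def by simp
  ultimately show ?thesis
    by (simp add: discrete_energy_def energy_def case_prod_unfold Q_def C_def)
qed

subsection \<open>Partitions and splines\<close>

lemma partition_less:
  assumes "is_partition L N X h" "i < j" "j \<le> N" shows "X i < X j"
  using assms(2,3)
proof (induction j)
  case (Suc j)
  have "X j < X (Suc j)" using assms(1) Suc.prems by (simp add: is_partition_def)
  then show ?case using Suc by (cases "i = j") auto
qed simp

lemma partition_le: "is_partition L N X h \<Longrightarrow> i \<le> j \<Longrightarrow> j \<le> N \<Longrightarrow> X i \<le> X j"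
  using partition_less[of L N X h i j] by (cases "i = j") auto

lemma partition_bounds:
  assumes "is_partition L N X h" "j \<le> N" shows "0 \<le> X j" "X j \<le> L"
  using partition_le[OF assms(1), of 0 j] partition_le[OF assms(1), of j N] assms
  by (auto simp: is_partition_def)

lemma partition_width:
  assumes "is_partition L N X h" "j < N" shows "0 < X (Suc j) - X j" "X (Suc j) - X j \<le> h"
  using assms unfolding is_partition_def by (auto intro!: Max_ge)

lemma partition_find:
  assumes p: "is_partition L N X h" and x: "0 \<le> x" "x \<le> L"
  obtains j where "j < N" "X j \<le> x" "x \<le> X (Suc j)"
proof -
  define j where "j = (LEAST j. x \<le> X (Suc j))"
  have N: "0 < N" "X N = L" "X 0 = 0" using p by (auto simp: is_partition_def)
  then have ex: "x \<le> X (Suc (N - 1))" using x by simp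
  have j: "x \<le> X (Suc j)" unfolding j_def using ex by (rule LeastI)
  have "j \<le> N - 1" unfolding j_def using ex by (rule Least_le)
  then have "j < N" using N by simp
  moreover have "X j \<le> x"
  proof (cases j)
    case (Suc i)
    then have "\<not> x \<le> X (Suc i)" using not_less_Least[of i "\<lambda>j. x \<le> X (Suc j)"] by (simp add: j_def)
    then show ?thesis using Suc by simp
  qed (use N x in simp)
  ultimately show ?thesis using that j by blast
qed

lemma partition_unique:
  assumes "is_partition L N X h" "i < N" "j < N" "X i < x" "x < X (Suc i)" "X j < x" "x < X (Suc j)"
  shows "i = j"
proof (rule ccontr)
  assume "i \<noteq> j"
  then consider "Suc i \<le> j" | "Suc j \<le> i" by linarith
  then show False
    using partition_le[OF assms(1), of "Suc i" j] partition_le[OF assms(1), of "Suc j" i] assms by cases auto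
qed

lemma partition_find_interior:
  assumes p: "is_partition L N X h" and x: "0 \<le> x" "x \<le> L" "x \<notin> X ` {..N}"
  obtains j where "j < N" "X j < x" "x < X (Suc j)"
proof -
  obtain j where j: "j < N" "X j \<le> x" "x \<le> X (Suc j)" using partition_find[OF p x(1,2)] .
  moreover have "x \<noteq> X j" "x \<noteq> X (Suc j)" using j x(3) by auto
  ultimately show ?thesis using that by force
qed

text \<open>Elements are open, so at most one summand is nonzero and the value at a node is 0. Such
  functions serve as derivatives, for which the nodes form a null set.\<close>

definition step_fun :: "nat \<Rightarrow> (nat \<Rightarrow> real) \<Rightarrow> (nat \<Rightarrow> real \<Rightarrow> 'a::real_vector) \<Rightarrow> real \<Rightarrow> 'a" where
  "step_fun N X F x = (\<Sum>j<N. if X j < x \<and> x < X (Suc j) then F j x else 0)"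

lemma step_fun_eq:
  assumes "is_partition L N X h" "j < N" "X j < x" "x < X (Suc j)"
  shows "step_fun N X F x = F j x"
proof -
  have "step_fun N X F x = (\<Sum>i<N. if i = j then F i x else 0)"
    unfolding step_fun_def using partition_unique[OF assms(1)] assms by (intro sum.cong) auto
  then show ?thesis using assms(2) by simp
qed

lemma sq_integrable_step_fun:
  fixes F :: "nat \<Rightarrow> real \<Rightarrow> 'a::euclidean_space"
  assumes p: "is_partition L N X h" and F: "\<And>j. j < N \<Longrightarrow> continuous_on UNIV (F j)"
  shows "sq_integrable L (step_fun N X F)"
proof -
  have "\<exists>B. \<forall>x\<in>{0..L}. norm (F j x) \<le> B" if "j < N" for j
  proof -
    have "compact (F j ` {0..L})"
      using F[OF that] by (intro compact_continuous_image) (auto intro: continuous_on_subset)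
    then show ?thesis using compact_imp_bounded by (meson bounded_iff imageI)
  qed
  then obtain B where B: "\<And>j x. j < N \<Longrightarrow> x \<in> {0..L} \<Longrightarrow> norm (F j x) \<le> B j" by metis
  show ?thesis
  proof (rule sq_integrable_bounded)
    show "step_fun N X F \<in> borel_measurable (leb_int L)"
      unfolding step_fun_def[abs_def]
    proof (intro borel_measurable_leb_int borel_measurable_sum)
      fix j assume "j \<in> {..<N}"
      then have [measurable]: "F j \<in> borel_measurable borel"
        using borel_measurable_continuous_onI[OF F] by simp
      show "(\<lambda>x. if X j < x \<and> x < X (Suc j) then F j x else 0) \<in> borel_measurable borel" by measurable
    qed
    show "norm (step_fun N X F x) \<le> (\<Sum>j<N. \<bar>B j\<bar>)" if "0 < x" "x < L" for x
      unfolding step_fun_def using B[of _ x] that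
      by (intro order_trans[OF norm_sum] sum_mono) (auto intro: order_trans[OF _ abs_ge_self])
  qed
qed

lemma is_prim_C1:
  fixes f g :: "real \<Rightarrow> 'a::euclidean_space"
  assumes "\<And>x. x \<in> {0..L} \<Longrightarrow> (f has_vector_derivative g x) (at x within {0..L})" "continuous_on {0..L} g"
  shows "is_prim L f g"
  unfolding is_prim_def
proof (intro conjI ballI)
  show sq: "sq_integrable L g" by (rule sq_integrable_continuous[OF assms(2)])
  fix x assume x: "x \<in> {0..L}"
  have fc: "continuous_on {0..L} f"
    unfolding continuous_on_eq_continuous_within
    by (intro ballI has_vector_derivative_continuous[OF assms(1)])
  have "prim L g x - prim L g 0 = f x - f 0"
  proof (rule prim_FTC[of _ _ _ "{}"])
    show "(f has_vector_derivative g y) (at y)" if "y \<in> {0<..<x} - {}" for y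
      using assms(1)[of y] that x by (simp add: at_within_Icc_at)
  qed (use x fc in \<open>auto intro: continuous_on_subset sq_integrable_imp_integrable[OF sq]\<close>)
  then show "f x = f 0 + prim L g x" by (simp add: prim_0)
qed

text \<open>Continuity of f across the nodes is the only matching condition: the fundamental theorem
  tolerates the nodes as a finite exceptional set.\<close>

lemma is_prim_piecewise:
  fixes f :: "real \<Rightarrow> 'a::euclidean_space"
  assumes p: "is_partition L N X h" and f: "continuous_on {0..L} f"
    and F: "\<And>j x. j < N \<Longrightarrow> (F j has_vector_derivative F' j x) (at x)"
      "\<And>j. j < N \<Longrightarrow> continuous_on UNIV (F' j)"
    and eq: "\<And>j x. j < N \<Longrightarrow> X j < x \<Longrightarrow> x < X (Suc j) \<Longrightarrow> f x = F j x"
  shows "is_prim L f (step_fun N X F')"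
  unfolding is_prim_def
proof (intro conjI ballI)
  show sq: "sq_integrable L (step_fun N X F')" by (rule sq_integrable_step_fun[OF p F(2)])
  fix x assume x: "x \<in> {0..L}"
  have "prim L (step_fun N X F') x - prim L (step_fun N X F') 0 = f x - f 0"
  proof (rule prim_FTC[where S = "X ` {..N}"])
    fix y assume y: "y \<in> {0<..<x} - X ` {..N}"
    then obtain j where j: "j < N" "X j < y" "y < X (Suc j)"
      using partition_find_interior[OF p, of y] x by auto
    have "(f has_vector_derivative F' j y) (at y)"
      by (rule has_vector_derivative_transform_within_open[OF F(1)[OF j(1)], of "{X j<..<X (Suc j)}"])
         (use j eq in auto)
    then show "(f has_vector_derivative step_fun N X F' y) (at y)"
      by (simp add: step_fun_eq[OF p j])
  qed (use x f in \<open>auto intro: continuous_on_subset sq_integrable_imp_integrable[OF sq]\<close>)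
  then show "f x = f 0 + prim L (step_fun N X F') x" by (simp add: prim_0)
qed

lemma V_h_pieces:
  assumes "(y, b) \<in> V_h L N X"
  obtains A C T where
    "\<And>j x. j < N \<Longrightarrow> x \<in> {X j..X (Suc j)} \<Longrightarrow> y x = (\<Sum>i\<le>3. x ^ i *\<^sub>R A j i)"
    "\<And>j x. j < N \<Longrightarrow> x \<in> {X j..X (Suc j)} \<Longrightarrow> b x = (\<Sum>i\<le>1. x ^ i *\<^sub>R C j i)"
    "\<And>x. x \<in> {0..L} \<Longrightarrow> (y has_vector_derivative T x) (at x within {0..L})"
    "continuous_on {0..L} T" "continuous_on {0..L} b"
proof -
  have y: "(\<lambda>x. y x $ c) \<in> spline_space 3 1 L N X" and b: "(\<lambda>x. b x $ c) \<in> spline_space 1 0 L N X" for c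
    using assms by (auto simp: V_h_def)
  have "\<forall>c j. \<exists>a :: nat \<Rightarrow> real. j < N \<longrightarrow> (\<forall>x\<in>{X j..X (Suc j)}. y x $ c = (\<Sum>i\<le>3. a i * x ^ i))"
    using y unfolding spline_space_def by blast
  then obtain a :: "3 \<Rightarrow> nat \<Rightarrow> nat \<Rightarrow> real" where a: "\<And>c j x. j < N \<Longrightarrow> x \<in> {X j..X (Suc j)} \<Longrightarrow> y x $ c = (\<Sum>i\<le>3. a c j i * x ^ i)"
    by metis
  have "\<forall>c j. \<exists>a :: nat \<Rightarrow> real. j < N \<longrightarrow> (\<forall>x\<in>{X j..X (Suc j)}. b x $ c = (\<Sum>i\<le>1. a i * x ^ i))"
    using b unfolding spline_space_def by blast
  then obtain a' :: "3 \<Rightarrow> nat \<Rightarrow> nat \<Rightarrow> real" where a': "\<And>c j x. j < N \<Longrightarrow> x \<in> {X j..X (Suc j)} \<Longrightarrow> b x $ c = (\<Sum>i\<le>1. a' c j i * x ^ i)"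
    by metis
  have "\<forall>c. \<exists>g. (\<forall>x\<in>{0..L}. ((\<lambda>x. y x $ c) has_vector_derivative g x) (at x within {0..L})) \<and> continuous_on {0..L} g"
    using y unfolding spline_space_def by auto
  then obtain T' where T': "\<And>c x. x \<in> {0..L} \<Longrightarrow> ((\<lambda>x. y x $ c) has_vector_derivative T' c x) (at x within {0..L})"
    "\<And>c. continuous_on {0..L} (T' c)" by metis
  show ?thesis
  proof (rule that[of "\<lambda>j i. \<chi> c. a c j i" "\<lambda>j i. \<chi> c. a' c j i" "\<lambda>x. \<chi> c. T' c x"])
    show "(y has_vector_derivative (\<chi> c. T' c x)) (at x within {0..L})" if "x \<in> {0..L}" for x
      unfolding has_vector_derivative_def
    proof (subst has_derivative_componentwise_within, intro ballI)
      fix e :: "real^3" assume "e \<in> Basis"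
      then obtain c where "e = axis c 1" by (auto simp: Basis_vec_def)
      then show "((\<lambda>x. y x \<bullet> e) has_derivative (\<lambda>h. h *\<^sub>R (\<chi> c. T' c x) \<bullet> e)) (at x within {0..L})"
        using T'(1)[OF that, of c] by (simp add: has_vector_derivative_def inner_axis)
    qed
    show "continuous_on {0..L} (\<lambda>x. \<chi> c. T' c x)" by (intro continuous_intros T')
    have "continuous_on {0..L} (\<lambda>x. \<chi> c. b x $ c)"
      by (rule continuous_on_vec_lambda) (use b in \<open>simp add: spline_space_def\<close>)
    then show "continuous_on {0..L} b" by simp
  qed (auto simp: vec_eq_iff a a' mult.commute)
qed

text \<open>The nodal constraints use the classical derivative within [0, L], the energy uses
  \<open>wderiv\<close>. The continuous derivative T of the C1 spline represents both, which lets
  nodal information enter integral estimates.\<close>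

lemma V_h_rep:
  assumes p: "is_partition L N X h" and v: "v \<in> V_h L N X" and "0 < L"
  obtains T K D where "rep L v (fst v) T K (snd v) D"
    "\<And>x. x \<in> {0..L} \<Longrightarrow> vector_derivative (fst v) (at x within {0..L}) = T x"
proof -
  obtain A C T where
    A: "\<And>j x. j < N \<Longrightarrow> x \<in> {X j..X (Suc j)} \<Longrightarrow> fst v x = (\<Sum>i\<le>3. x ^ i *\<^sub>R A j i)" and
    C: "\<And>j x. j < N \<Longrightarrow> x \<in> {X j..X (Suc j)} \<Longrightarrow> snd v x = (\<Sum>i\<le>1. x ^ i *\<^sub>R C j i)" and
    T: "\<And>x. x \<in> {0..L} \<Longrightarrow> (fst v has_vector_derivative T x) (at x within {0..L})"
    "continuous_on {0..L} T" and b: "continuous_on {0..L} (snd v)"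
    using V_h_pieces[of "fst v" "snd v" L N X] v by auto
  have b': "is_prim L (snd v) (step_fun N X (\<lambda>j x. C j 1))"
    by (rule is_prim_piecewise[OF p b, of "\<lambda>j x. \<Sum>i\<le>1. x ^ i *\<^sub>R C j i"])
       (use C in \<open>auto intro!: derivative_eq_intros continuous_intros simp: has_vector_derivative_def\<close>)
  define P where "P j x = A j 1 + (2 * x) *\<^sub>R A j 2 + (3 * x\<^sup>2) *\<^sub>R A j 3" for j and x :: real
  have dA: "((\<lambda>x. \<Sum>i\<le>3. x ^ i *\<^sub>R A j i) has_vector_derivative P j x) (at x)" for j x
    unfolding P_def
    by (auto intro!: derivative_eq_intros simp: numeral_eq_Suc algebra_simps)
  \<comment> \<open>The polynomial coefficients come from the values of y; uniqueness of the
    derivative inside the open element identifies T with the differentiated polynomial.\<close>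
  have TP: "T x = P j x" if j: "j < N" "X j < x" "x < X (Suc j)" for j x
  proof -
    have x: "0 < x" "x < L"
      using j partition_bounds[OF p, of j] partition_bounds[OF p, of "Suc j"] by auto
    then have "(fst v has_vector_derivative T x) (at x)" using T(1)[of x] by (simp add: at_within_Icc_at)
    moreover have "(fst v has_vector_derivative P j x) (at x)"
      by (rule has_vector_derivative_transform_within_open[OF dA[of j], of "{X j<..<X (Suc j)}"])
         (use j A in auto)
    ultimately show ?thesis by (rule vector_derivative_unique_at)
  qed
  have dP: "(P j has_vector_derivative 2 *\<^sub>R A j 2 + (6 * x) *\<^sub>R A j 3) (at x)" for j x
    unfolding P_def[abs_def] by (auto intro!: derivative_eq_intros simp: algebra_simps)
  have T': "is_prim L T (step_fun N X (\<lambda>j x. 2 *\<^sub>R A j 2 + (6 * x) *\<^sub>R A j 3))"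
    by (rule is_prim_piecewise[OF p T(2), of P]) (use TP dP in \<open>auto intro!: continuous_intros\<close>)
  have "rep L (fst v, snd v) (fst v) T (step_fun N X (\<lambda>j x. 2 *\<^sub>R A j 2 + (6 * x) *\<^sub>R A j 3))
      (snd v) (step_fun N X (\<lambda>j x. C j 1))"
    by (rule rep_V[OF is_prim_C1[OF T] T' b']) (use assms in auto)
  moreover have "vector_derivative (fst v) (at x within {0..L}) = T x" if "x \<in> {0..L}" for x
    using vector_derivative_within_closed_interval[OF \<open>0 < L\<close> that T(1)[OF that]] .
  ultimately show ?thesis using that by simp
qed

subsection \<open>Frames and boundary conditions\<close>

text \<open>Orthogonality says that the rows t, b and their cross product form an orthonormal
  system. Both the determinant and the squared length of the cross product equal |t|^2 |b|^2 - (t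
  \<bullet> b)^2 by Lagrange's identity, so the conditions on t and b already make the last row a
  unit vector and the determinant 1.\<close>

lemma rotation_frame_matrix_iff:
  "rotation_matrix (frame_matrix t b) \<longleftrightarrow> norm t = 1 \<and> norm b = 1 \<and> t \<bullet> b = 0"
proof -
  let ?M = "vector [t, b, cross3 t b] :: real^3^3"
  have orth: "orthogonal_matrix (frame_matrix t b) \<longleftrightarrow> (\<forall>i j. ?M $ i \<bullet> ?M $ j = (if i = j then 1 else 0))"
    unfolding frame_matrix_def orthogonal_matrix transpose_transpose
    by (simp add: vec_eq_iff matrix_matrix_mult_def transpose_def mat_def inner_vec_def)
  have cr: "cross3 t b \<bullet> cross3 t b = (t \<bullet> t) * (b \<bullet> b) - (t \<bullet> b)\<^sup>2"
    by (simp add: cross3_def inner_vec_def sum_3 power2_eq_square algebra_simps)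
  have det: "det (frame_matrix t b) = cross3 t b \<bullet> cross3 t b"
    unfolding frame_matrix_def det_transpose
    by (simp add: det_3 cross3_def inner_vec_def sum_3 algebra_simps)
  show ?thesis
    unfolding rotation_matrix_def orth det cr
    by (auto simp: forall_3 dot_cross_self norm_eq_1 inner_commute cr)
qed

lemma energy_rep:
  assumes "rep L v Y T K B D"
  shows "energy L v = (\<integral>x. Qbar (norm (K x)) (norm (D x)) \<partial>leb_int L)"
    and "(\<integral>x. (wderiv L (fst v) x \<bullet> snd v x)\<^sup>2 \<partial>leb_int L) = (\<integral>x. (T x \<bullet> B x)\<^sup>2 \<partial>leb_int L)"
    and "(\<integral>x. (wderiv L (fst v) x \<bullet> wderiv L (snd v) x)\<^sup>2 \<partial>leb_int L) = (\<integral>x. (T x \<bullet> D x)\<^sup>2 \<partial>leb_int L)"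
proof -
  have V: "v \<in> V L" and p: "is_prim L Y T" "is_prim L T K" "is_prim L B D"
    and ae: "AE x in leb_int L. wderiv L (fst v) x = T x" "AE x in leb_int L. wderiv L (wderiv L (fst v)) x = K x"
      "AE x in leb_int L. snd v x = B x" "AE x in leb_int L. wderiv L (snd v) x = D x"
    using assms by (auto simp: rep_def)
  note sq = V_D[OF V] is_prim_sq_integrable[OF p(1)] is_prim_sq_integrable[OF p(2)] is_prim_sq_integrable[OF p(3)]
  note [measurable] = sq(1-5)[THEN sq_integrableD(1)] sq(9-14)[THEN sq_integrableD(1)]
  show "energy L v = (\<integral>x. Qbar (norm (K x)) (norm (D x)) \<partial>leb_int L)"
    unfolding energy_def case_prod_unfold
  proof (rule integral_cong_AE)
    show "AE x in leb_int L. Qbar (norm (wderiv L (wderiv L (fst v)) x)) (norm (wderiv L (snd v) x))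
        = Qbar (norm (K x)) (norm (D x))"
      using ae(2,4) by eventually_elim simp
  qed measurable
  show "(\<integral>x. (wderiv L (fst v) x \<bullet> snd v x)\<^sup>2 \<partial>leb_int L) = (\<integral>x. (T x \<bullet> B x)\<^sup>2 \<partial>leb_int L)"
  proof (rule integral_cong_AE)
    show "AE x in leb_int L. (wderiv L (fst v) x \<bullet> snd v x)\<^sup>2 = (T x \<bullet> B x)\<^sup>2"
      using ae(1,3) by eventually_elim simp
  qed measurable
  show "(\<integral>x. (wderiv L (fst v) x \<bullet> wderiv L (snd v) x)\<^sup>2 \<partial>leb_int L) = (\<integral>x. (T x \<bullet> D x)\<^sup>2 \<partial>leb_int L)"
  proof (rule integral_cong_AE)
    show "AE x in leb_int L. (wderiv L (fst v) x \<bullet> wderiv L (snd v) x)\<^sup>2 = (T x \<bullet> D x)\<^sup>2"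
      using ae(1,4) by eventually_elim simp
  qed measurable
qed

text \<open>Closed conditions on continuous functions that hold a.e. hold everywhere on [0, L]; an
  admissible frame can thus be sampled at any point, as interpolation requires.\<close>

lemma A_frame_rep_iff:
  assumes r: "rep L v Y T K B D" and "0 < L"
  shows "v \<in> A_frame L Lbc lbc \<longleftrightarrow>
    (\<forall>x\<in>{0..L}. norm (T x) = 1 \<and> norm (B x) = 1 \<and> T x \<bullet> B x = 0) \<and> Lbc v = lbc"
proof -
  have V: "v \<in> V L" and p: "is_prim L Y T" "is_prim L T K" "is_prim L B D"
    and ae: "AE x in leb_int L. wderiv L (fst v) x = T x" "AE x in leb_int L. snd v x = B x"
    using r by (auto simp: rep_def)
  have cT: "continuous_on {0..L} T" and cB: "continuous_on {0..L} B"
    using is_prim_continuous[OF p(2)] is_prim_continuous[OF p(3)] .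
  have "(AE x in leb_int L. rotation_matrix (frame_matrix (wderiv L (fst v) x) (snd v x)))
     \<longleftrightarrow> (AE x in leb_int L. norm (T x) = 1 \<and> norm (B x) = 1 \<and> T x \<bullet> B x = 0)"
    unfolding rotation_frame_matrix_iff
  proof (rule eventually_subst)
    show "AE x in leb_int L. (norm (wderiv L (fst v) x) = 1 \<and> norm (snd v x) = 1 \<and> wderiv L (fst v) x \<bullet> snd v x = 0)
       = (norm (T x) = 1 \<and> norm (B x) = 1 \<and> T x \<bullet> B x = 0)"
      using ae by eventually_elim simp
  qed
  also have "\<dots> \<longleftrightarrow> (\<forall>x\<in>{0..L}. norm (T x) = 1 \<and> norm (B x) = 1 \<and> T x \<bullet> B x = 0)" (is "?A \<longleftrightarrow> ?B")
  proof
    assume ?A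
    then have A: "AE x in leb_int L. norm (T x) = 1" "AE x in leb_int L. norm (B x) = 1" "AE x in leb_int L. T x \<bullet> B x = 0"
      by (auto elim: eventually_mono)
    show ?B
    proof (intro ballI conjI)
      fix x assume x: "x \<in> {0..L}"
      show "norm (T x) = 1" by (rule continuous_AE_eq[OF _ _ A(1) assms(2) x]) (intro continuous_intros cT cB)+
      show "norm (B x) = 1" by (rule continuous_AE_eq[OF _ _ A(2) assms(2) x]) (intro continuous_intros cT cB)+
      show "T x \<bullet> B x = 0" by (rule continuous_AE_eq[OF _ _ A(3) assms(2) x]) (intro continuous_intros cT cB)+
    qed
  next
    assume ?B then show ?A by (intro AE_I2) auto
  qed
  finally show ?thesis
    using V by (auto simp: A_frame_def case_prod_unfold)
qed

lemma admissible_rep_iff: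
  assumes r: "rep L v Y T K B D" and "0 < L"
  shows "v \<in> admissible L Lbc lbc \<longleftrightarrow>
    (\<forall>x\<in>{0..L}. norm (T x) = 1 \<and> norm (B x) = 1 \<and> T x \<bullet> B x = 0) \<and> Lbc v = lbc
    \<and> (AE x in leb_int L. T x \<bullet> D x = 0)"
proof -
  have ae: "AE x in leb_int L. wderiv L (fst v) x = T x" "AE x in leb_int L. wderiv L (snd v) x = D x"
    using r by (auto simp: rep_def)
  have "(AE x in leb_int L. wderiv L (fst v) x \<bullet> wderiv L (snd v) x = 0) \<longleftrightarrow> (AE x in leb_int L. T x \<bullet> D x = 0)"
  proof (rule eventually_subst)
    show "AE x in leb_int L. (wderiv L (fst v) x \<bullet> wderiv L (snd v) x = 0) = (T x \<bullet> D x = 0)"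
      using ae by eventually_elim simp
  qed
  then show ?thesis
    using A_frame_rep_iff[OF assms, of Lbc lbc] by (auto simp: admissible_def case_prod_unfold)
qed

section \<open>Stability of the boundary condition under convergence of boundary values\<close>

definition frame_sum :: "'i set \<Rightarrow> ('i \<Rightarrow> real) \<Rightarrow> ('i \<Rightarrow> framing) \<Rightarrow> framing" where
  "frame_sum I c z = (\<lambda>x. \<Sum>i\<in>I. c i *\<^sub>R fst (z i) x, \<lambda>x. \<Sum>i\<in>I. c i *\<^sub>R snd (z i) x)"

lemma zero_in_V: "0 \<le> L \<Longrightarrow> (\<lambda>x. 0, \<lambda>x. 0) \<in> V L"
proof -
  assume "0 \<le> L"
  have "is_prim L (\<lambda>x. 0 :: real^3) (\<lambda>x. 0)" by (rule is_prim_C1) (auto intro!: continuous_intros)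
  from rep_V[OF this this this \<open>0 \<le> L\<close>] show ?thesis by (simp add: rep_def)
qed

text \<open>Membership in V is carried along in the induction because linearity of F is granted on V
  only.\<close>

lemma bounded_linear_V_sum:
  assumes F: "bounded_linear_V L F" and "finite I" and z: "\<And>i. i \<in> I \<Longrightarrow> z i \<in> V L" and "0 < L"
  shows "frame_sum I c z \<in> V L \<and> F (frame_sum I c z) = (\<Sum>i\<in>I. c i *\<^sub>R F (z i))"
  using assms(2) z
proof (induction I rule: finite_induct)
  case empty
  have lin: "F (\<lambda>x. s *\<^sub>R y x + t *\<^sub>R y' x, \<lambda>x. s *\<^sub>R b x + t *\<^sub>R b' x) = s *\<^sub>R F (y, b) + t *\<^sub>R F (y', b')"
    if "(y, b) \<in> V L" "(y', b') \<in> V L" for y b y' b' s t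
    using F that unfolding bounded_linear_V_def by blast
  have "F (\<lambda>x. 0, \<lambda>x. 0) = 0"
    using lin[OF zero_in_V zero_in_V, of 0 0] \<open>0 < L\<close> by simp
  then show ?case using zero_in_V \<open>0 < L\<close> by (simp add: frame_sum_def)
next
  case (insert j I)
  have lin: "F (\<lambda>x. s *\<^sub>R y x + t *\<^sub>R y' x, \<lambda>x. s *\<^sub>R b x + t *\<^sub>R b' x) = s *\<^sub>R F (y, b) + t *\<^sub>R F (y', b')"
    if "(y, b) \<in> V L" "(y', b') \<in> V L" for y b y' b' s t
    using F that unfolding bounded_linear_V_def by blast
  have IH: "frame_sum I c z \<in> V L" "F (frame_sum I c z) = (\<Sum>i\<in>I. c i *\<^sub>R F (z i))"
    using insert by auto
  have zj: "(fst (z j), snd (z j)) \<in> V L" using insert by auto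
  have eq: "frame_sum (insert j I) c z =
     (\<lambda>x. c j *\<^sub>R fst (z j) x + 1 *\<^sub>R fst (frame_sum I c z) x, \<lambda>x. c j *\<^sub>R snd (z j) x + 1 *\<^sub>R snd (frame_sum I c z) x)"
    using insert by (simp add: frame_sum_def)
  have IH': "(fst (frame_sum I c z), snd (frame_sum I c z)) \<in> V L" using IH by simp
  show ?case
    unfolding eq using V_lincomb(1)[OF zj IH' \<open>0 < L\<close>, of "c j" 1] lin[OF zj IH', of "c j" 1] IH insert by simp
qed

text \<open>Weak convergence is tested with real functionals, whereas \<open>Lbc\<close> takes
  values in an arbitrary normed space. Instead, the difference of \<open>vs n\<close> and v has the
  same boundary values as a combination of eighteen fixed Hermite basis frames whose coefficients
  tend to 0. Since \<open>Lbc\<close> depends on boundary values only, its value on the difference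
  is a finite sum that tends to 0.\<close>

lemma boundary_operator_limit:
  assumes bo: "boundary_operator L Lbc" and "0 < L"
    and rn: "\<And>n. rep L (vs n) (Y n) (T n) (K n) (B n) (D n)" and r: "rep L v Y' T' K' B' D'"
    and lim: "\<And>x. x \<in> {0, L} \<Longrightarrow> (\<lambda>n. Y n x) \<longlonglongrightarrow> Y' x" "\<And>x. x \<in> {0, L} \<Longrightarrow> (\<lambda>n. T n x) \<longlonglongrightarrow> T' x"
      "\<And>x. x \<in> {0, L} \<Longrightarrow> (\<lambda>n. B n x) \<longlonglongrightarrow> B' x"
    and Lbc: "\<And>n. Lbc (vs n) = lbc"
  shows "Lbc v = lbc"
proof -
  \<comment> \<open>The Hermite basis on [0, L]: cubics for the values (k = 0, 1) and the slopes (k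
    = 2, 3) of y at 0 and L, affine functions \<open>q\<close> (k = 4, 5) for b. The index k follows
    the order of the list \<open>boundary_values\<close>.\<close>
  define p :: "nat \<Rightarrow> real \<Rightarrow> real" where
    "p k x = (if k = 0 then 1 - 3 * (x / L)^2 + 2 * (x / L)^3 else if k = 1 then 3 * (x / L)^2 - 2 * (x / L)^3
      else if k = 2 then x - 2 * x^2 / L + x^3 / L^2 else if k = 3 then x^3 / L^2 - x^2 / L else 0)" for k x
  define p' :: "nat \<Rightarrow> real \<Rightarrow> real" where
    "p' k x = (if k = 0 then - 6 * x / L^2 + 6 * x^2 / L^3 else if k = 1 then 6 * x / L^2 - 6 * x^2 / L^3
      else if k = 2 then 1 - 4 * x / L + 3 * x^2 / L^2 else if k = 3 then 3 * x^2 / L^2 - 2 * x / L else 0)" for k x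
  define p'' :: "nat \<Rightarrow> real \<Rightarrow> real" where
    "p'' k x = (if k = 0 then - 6 / L^2 + 12 * x / L^3 else if k = 1 then 6 / L^2 - 12 * x / L^3
      else if k = 2 then - 4 / L + 6 * x / L^2 else if k = 3 then 6 * x / L^2 - 2 / L else 0)" for k x
  define q :: "nat \<Rightarrow> real \<Rightarrow> real" where
    "q k x = (if k = 4 then 1 - x / L else if k = 5 then x / L else 0)" for k x
  define q' :: "nat \<Rightarrow> real \<Rightarrow> real" where
    "q' k x = (if k = 4 then - 1 / L else if k = 5 then 1 / L else 0)" for k and x :: real
  have dp: "(p k has_real_derivative p' k x) (at x within S)" for k x S
    unfolding p_def[abs_def] p'_def using \<open>0 < L\<close>
    by (auto intro!: derivative_eq_intros simp: field_simps power2_eq_square power3_eq_cube)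
  have dp': "(p' k has_real_derivative p'' k x) (at x within S)" for k x S
    unfolding p'_def[abs_def] p''_def using \<open>0 < L\<close>
    by (auto intro!: derivative_eq_intros simp: field_simps power2_eq_square power3_eq_cube)
  have dq: "(q k has_real_derivative q' k x) (at x within S)" for k x S
    unfolding q_def[abs_def] q'_def using \<open>0 < L\<close>
    by (auto intro!: derivative_eq_intros simp: field_simps)
  have c: "continuous_on S (p k)" "continuous_on S (p' k)" "continuous_on S (p'' k)" "continuous_on S (q k)" "continuous_on S (q' k)" for k S
    unfolding p_def[abs_def] p'_def[abs_def] p''_def[abs_def] q_def[abs_def] q'_def[abs_def] using \<open>0 < L\<close>
    by (cases "k = 0"; cases "k = 1"; cases "k = 2"; cases "k = 3"; cases "k = 4"; cases "k = 5";
        auto intro!: continuous_intros)+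
  define I where "I = {..<6::nat} \<times> (Basis :: (real^3) set)"
  define z :: "nat \<times> (real^3) \<Rightarrow> framing" where "z = (\<lambda>(k, e). (\<lambda>x. p k x *\<^sub>R e, \<lambda>x. q k x *\<^sub>R e))"
  have sc: "((\<lambda>x. \<Sum>i\<in>I. a i *\<^sub>R (f (fst i) x *\<^sub>R snd i)) has_vector_derivative
      (\<Sum>i\<in>I. a i *\<^sub>R (f' (fst i) x *\<^sub>R snd i))) (at x within S)"
    if "\<And>k x S. (f k has_real_derivative f' k x) (at x within S)"
    for a :: "nat \<times> (real^3) \<Rightarrow> real" and f f' :: "nat \<Rightarrow> real \<Rightarrow> real" and x S
  proof (rule has_vector_derivative_sum)
    fix i :: "nat \<times> (real^3)"
    have bl: "bounded_linear (\<lambda>r. a i *\<^sub>R (r *\<^sub>R snd i))"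
      by (intro bounded_linear_intros)
    show "((\<lambda>x. a i *\<^sub>R (f (fst i) x *\<^sub>R snd i)) has_vector_derivative a i *\<^sub>R (f' (fst i) x *\<^sub>R snd i)) (at x within S)"
      by (rule bounded_linear.has_vector_derivative[OF bl])
         (use that in \<open>simp add: has_real_derivative_iff_has_vector_derivative\<close>)
  qed
  have sumI: "(\<Sum>i\<in>I. (dat (fst i) \<bullet> snd i) *\<^sub>R (f (fst i) *\<^sub>R snd i)) = (\<Sum>k<6. f k *\<^sub>R dat k)"
    for dat :: "nat \<Rightarrow> real^3" and f :: "nat \<Rightarrow> real"
  proof -
    have "(\<Sum>i\<in>I. (dat (fst i) \<bullet> snd i) *\<^sub>R (f (fst i) *\<^sub>R snd i))
      = (\<Sum>k<6. \<Sum>e\<in>Basis. f k *\<^sub>R ((dat k \<bullet> e) *\<^sub>R e))"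
      unfolding I_def by (subst sum.cartesian_product) (auto simp: case_prod_unfold mult.commute)
    also have "\<dots> = (\<Sum>k<6. f k *\<^sub>R dat k)"
      by (simp only: scaleR_sum_right[symmetric] euclidean_representation)
    finally show ?thesis .
  qed
  have zV: "z i \<in> V L" for i
  proof -
    have dpe: "((\<lambda>x. p k x *\<^sub>R e) has_vector_derivative p' k x *\<^sub>R e) (at x within S)"
      "((\<lambda>x. p' k x *\<^sub>R e) has_vector_derivative p'' k x *\<^sub>R e) (at x within S)"
      "((\<lambda>x. q k x *\<^sub>R e) has_vector_derivative q' k x *\<^sub>R e) (at x within S)" for k x S and e :: "real^3"
      using dp dp' dq by (auto intro!: derivative_eq_intros simp: has_real_derivative_iff_has_vector_derivative)
    obtain k e where i: "i = (k, e)" by force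
    have "rep L (\<lambda>x. p k x *\<^sub>R e, \<lambda>x. q k x *\<^sub>R e) (\<lambda>x. p k x *\<^sub>R e) (\<lambda>x. p' k x *\<^sub>R e)
       (\<lambda>x. p'' k x *\<^sub>R e) (\<lambda>x. q k x *\<^sub>R e) (\<lambda>x. q' k x *\<^sub>R e)"
      using \<open>0 < L\<close> by (intro rep_V is_prim_C1 dpe continuous_intros c) auto
    then show ?thesis by (simp add: rep_def z_def i)
  qed
  have bl: "bounded_linear_V L Lbc"
    and dep: "\<And>v w. v \<in> V L \<Longrightarrow> w \<in> V L \<Longrightarrow> boundary_values L v = boundary_values L w \<Longrightarrow> Lbc v = Lbc w"
    using bo unfolding boundary_operator_def by blast+
  define dat where "dat n k = (if k = 0 then Y n 0 - Y' 0 else if k = 1 then Y n L - Y' L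
    else if k = 2 then T n 0 - T' 0 else if k = 3 then T n L - T' L
    else if k = 4 then B n 0 - B' 0 else B n L - B' L)" for n and k :: nat
  have dat0: "(\<lambda>n. dat n k) \<longlonglongrightarrow> 0" for k
    using LIM_zero[OF lim(1)] LIM_zero[OF lim(2)] LIM_zero[OF lim(3)]
    by (cases "k = 0"; cases "k = 1"; cases "k = 2"; cases "k = 3"; cases "k = 4"; simp add: dat_def)
  \<comment> \<open>The left side does not depend on n, so it is the limit of the right
    side.\<close>
  have eq: "lbc - Lbc v = (\<Sum>i\<in>I. (dat n (fst i) \<bullet> snd i) *\<^sub>R Lbc (z i))" for n
  proof -
    define a where "a i = dat n (fst i) \<bullet> snd i" for i
    have fs: "frame_sum I a z \<in> V L" "Lbc (frame_sum I a z) = (\<Sum>i\<in>I. a i *\<^sub>R Lbc (z i))"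
      using bounded_linear_V_sum[OF bl _ zV \<open>0 < L\<close>, of I a] by (auto simp: I_def)
    have fs_eq: "frame_sum I a z = (\<lambda>x. \<Sum>i\<in>I. a i *\<^sub>R (p (fst i) x *\<^sub>R snd i), \<lambda>x. \<Sum>i\<in>I. a i *\<^sub>R (q (fst i) x *\<^sub>R snd i))"
      by (simp add: frame_sum_def z_def case_prod_unfold)
    have "rep L (frame_sum I a z) (\<lambda>x. \<Sum>i\<in>I. a i *\<^sub>R (p (fst i) x *\<^sub>R snd i)) (\<lambda>x. \<Sum>i\<in>I. a i *\<^sub>R (p' (fst i) x *\<^sub>R snd i))
        (\<lambda>x. \<Sum>i\<in>I. a i *\<^sub>R (p'' (fst i) x *\<^sub>R snd i)) (\<lambda>x. \<Sum>i\<in>I. a i *\<^sub>R (q (fst i) x *\<^sub>R snd i))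
        (\<lambda>x. \<Sum>i\<in>I. a i *\<^sub>R (q' (fst i) x *\<^sub>R snd i))"
      unfolding fs_eq using \<open>0 < L\<close>
      by (intro rep_V is_prim_C1 sc dp dp' dq continuous_intros c) auto
    note bvr = boundary_values_rep[OF this \<open>0 < L\<close>]
    have s6: "(\<Sum>i\<in>I. a i *\<^sub>R (f (fst i) *\<^sub>R snd i)) = f 0 *\<^sub>R dat n 0 + f 1 *\<^sub>R dat n 1
        + f 2 *\<^sub>R dat n 2 + f 3 *\<^sub>R dat n 3 + f 4 *\<^sub>R dat n 4 + f 5 *\<^sub>R dat n 5" for f
      unfolding a_def sumI[of "dat n" f] by (simp add: numeral_eq_Suc)
    have vals: "p 0 0 = 1" "p 1 0 = 0" "p 2 0 = 0" "p 3 0 = 0" "p 4 0 = 0" "p 5 0 = 0"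
       "p 0 L = 0" "p 1 L = 1" "p 2 L = 0" "p 3 L = 0" "p 4 L = 0" "p 5 L = 0"
       "p' 0 0 = 0" "p' 1 0 = 0" "p' 2 0 = 1" "p' 3 0 = 0" "p' 4 0 = 0" "p' 5 0 = 0"
       "p' 0 L = 0" "p' 1 L = 0" "p' 2 L = 0" "p' 3 L = 1" "p' 4 L = 0" "p' 5 L = 0"
       "q 0 0 = 0" "q 1 0 = 0" "q 2 0 = 0" "q 3 0 = 0" "q 4 0 = 1" "q 5 0 = 0"
       "q 0 L = 0" "q 1 L = 0" "q 2 L = 0" "q 3 L = 0" "q 4 L = 0" "q 5 L = 1"
      using \<open>0 < L\<close> by (simp_all add: p_def p'_def q_def power2_eq_square power3_eq_cube)
    have bv: "boundary_values L (frame_sum I a z) = [dat n 0, dat n 1, dat n 2, dat n 3, dat n 4, dat n 5]"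
      unfolding bvr s6[of "\<lambda>k. p k 0"] s6[of "\<lambda>k. p k L"] s6[of "\<lambda>k. p' k 0"] s6[of "\<lambda>k. p' k L"]
        s6[of "\<lambda>k. q k 0"] s6[of "\<lambda>k. q k L"] vals by simp
    have Vn: "(fst (vs n), snd (vs n)) \<in> V L" "(fst v, snd v) \<in> V L" using rn[of n] r by (auto simp: rep_def)
    define d :: framing where "d = (\<lambda>x. 1 *\<^sub>R fst (vs n) x + (-1) *\<^sub>R fst v x, \<lambda>x. 1 *\<^sub>R snd (vs n) x + (-1) *\<^sub>R snd v x)"
    note l = V_lincomb[OF Vn \<open>0 < L\<close>, of 1 "-1"]
    have dV: "d \<in> V L" unfolding d_def by (rule l)
    have "rep L d (\<lambda>x. 1 *\<^sub>R Y n x + (-1) *\<^sub>R Y' x) (\<lambda>x. 1 *\<^sub>R T n x + (-1) *\<^sub>R T' x) (\<lambda>x. 1 *\<^sub>R K n x + (-1) *\<^sub>R K' x)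
       (\<lambda>x. 1 *\<^sub>R B n x + (-1) *\<^sub>R B' x) (\<lambda>x. 1 *\<^sub>R D n x + (-1) *\<^sub>R D' x)"
      unfolding rep_def
    proof (intro conjI)
      have "is_prim L (Y n) (T n)" "is_prim L (T n) (K n)" "is_prim L (B n) (D n)"
        "is_prim L Y' T'" "is_prim L T' K'" "is_prim L B' D'"
        using rn[of n] r unfolding rep_def by blast+
      then show "is_prim L (\<lambda>x. 1 *\<^sub>R Y n x + (-1) *\<^sub>R Y' x) (\<lambda>x. 1 *\<^sub>R T n x + (-1) *\<^sub>R T' x)"
        "is_prim L (\<lambda>x. 1 *\<^sub>R T n x + (-1) *\<^sub>R T' x) (\<lambda>x. 1 *\<^sub>R K n x + (-1) *\<^sub>R K' x)"
        "is_prim L (\<lambda>x. 1 *\<^sub>R B n x + (-1) *\<^sub>R B' x) (\<lambda>x. 1 *\<^sub>R D n x + (-1) *\<^sub>R D' x)"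
        by - (rule is_prim_lincomb; assumption)+
      have ae: "AE x in leb_int L. fst (vs n) x = Y n x" "AE x in leb_int L. wderiv L (fst (vs n)) x = T n x"
        "AE x in leb_int L. wderiv L (wderiv L (fst (vs n))) x = K n x" "AE x in leb_int L. snd (vs n) x = B n x"
        "AE x in leb_int L. wderiv L (snd (vs n)) x = D n x"
        using rn[of n] by (auto simp: rep_def)
      have ae': "AE x in leb_int L. fst v x = Y' x" "AE x in leb_int L. wderiv L (fst v) x = T' x"
        "AE x in leb_int L. wderiv L (wderiv L (fst v)) x = K' x" "AE x in leb_int L. snd v x = B' x"
        "AE x in leb_int L. wderiv L (snd v) x = D' x"
        using r by (auto simp: rep_def)
      show "AE x in leb_int L. fst d x = 1 *\<^sub>R Y n x + (-1) *\<^sub>R Y' x"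
        using ae(1) ae'(1) by eventually_elim (simp add: d_def)
      show "AE x in leb_int L. wderiv L (fst d) x = 1 *\<^sub>R T n x + (-1) *\<^sub>R T' x"
        using ae(2) ae'(2) l(2) unfolding d_def fst_conv by eventually_elim simp
      show "AE x in leb_int L. wderiv L (wderiv L (fst d)) x = 1 *\<^sub>R K n x + (-1) *\<^sub>R K' x"
        using ae(3) ae'(3) l(3) unfolding d_def fst_conv by eventually_elim simp
      show "AE x in leb_int L. snd d x = 1 *\<^sub>R B n x + (-1) *\<^sub>R B' x"
        using ae(4) ae'(4) by eventually_elim (simp add: d_def)
      show "AE x in leb_int L. wderiv L (snd d) x = 1 *\<^sub>R D n x + (-1) *\<^sub>R D' x"
        using ae(5) ae'(5) l(4) unfolding d_def snd_conv by eventually_elim simp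
    qed (rule dV)
    from boundary_values_rep[OF this \<open>0 < L\<close>]
    have "boundary_values L d = [dat n 0, dat n 1, dat n 2, dat n 3, dat n 4, dat n 5]"
      by (simp add: dat_def)
    then have "Lbc d = Lbc (frame_sum I a z)" using dep[OF dV fs(1)] bv by simp
    moreover have "Lbc d = 1 *\<^sub>R Lbc (fst (vs n), snd (vs n)) + (-1) *\<^sub>R Lbc (fst v, snd v)"
      unfolding d_def using bl Vn unfolding bounded_linear_V_def by blast
    ultimately show ?thesis using fs Lbc[of n] by (simp add: a_def)
  qed
  have "(\<lambda>n. \<Sum>i\<in>I. (dat n (fst i) \<bullet> snd i) *\<^sub>R Lbc (z i)) \<longlonglongrightarrow> (\<Sum>i\<in>I. (0 \<bullet> snd i) *\<^sub>R Lbc (z i))"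
    by (intro tendsto_sum tendsto_scaleR tendsto_inner dat0 tendsto_const)
  then have "(\<lambda>n::nat. lbc - Lbc v) \<longlonglongrightarrow> 0"
    unfolding eq[symmetric] by simp
  then show ?thesis by (simp add: LIMSEQ_const_iff)
qed

subsection \<open>Limits of discrete frames\<close>

lemma power2_L2norm_le_energy:
  assumes "rep L v Y T K B D"
  shows "(L2norm L K)\<^sup>2 \<le> energy L v" "(L2norm L D)\<^sup>2 \<le> energy L v"
proof -
  have p: "is_prim L T K" "is_prim L B D" using assms by (auto simp: rep_def)
  note sq = is_prim_sq[OF p(1)] is_prim_sq[OF p(2)]
  note i = integrable_Qbar[OF sq]
  show "(L2norm L K)\<^sup>2 \<le> energy L v" "(L2norm L D)\<^sup>2 \<le> energy L v"
    unfolding L2norm_power2 energy_rep(1)[OF assms]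
    using i sq sq_integrableD by (auto intro!: integral_mono Qbar_bounds)
qed

lemma discrete_frame_rep:
  assumes p: "is_partition L N X h" and v: "v \<in> discrete_admissible L Lbc lbc N X" and L: "0 < L"
  obtains Y T K B D where "rep L v Y T K B D" "Lbc v = lbc"
    "\<And>j. j \<le> N \<Longrightarrow> norm (T (X j)) = 1" "\<And>j. j \<le> N \<Longrightarrow> norm (B (X j)) = 1"
proof -
  have Vh: "v \<in> V_h L N X" and nd: "\<And>j. j \<le> N \<Longrightarrow> norm (vector_derivative (fst v) (at (X j) within {0..L})) = 1"
    "\<And>j. j \<le> N \<Longrightarrow> norm (snd v (X j)) = 1" and lbc: "Lbc v = lbc"
    using v by (auto simp: discrete_admissible_def case_prod_unfold)
  obtain T K D where r: "rep L v (fst v) T K (snd v) D"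
    and T: "\<And>x. x \<in> {0..L} \<Longrightarrow> vector_derivative (fst v) (at x within {0..L}) = T x"
    using V_h_rep[OF p Vh L] by blast
  have "norm (T (X j)) = 1" if "j \<le> N" for j
    using nd(1)[OF that] T[of "X j"] partition_bounds[OF p that] by simp
  then show ?thesis using that[OF r lbc] nd(2) by blast
qed

text \<open>The constraint is imposed at nodes only; the Hoelder bound carries it from the left node
  over the element, at the price of sqrt h times a bound on the L2 norm of the derivative.\<close>

lemma norm_near_node:
  fixes T :: "real \<Rightarrow> 'a::euclidean_space"
  assumes p: "is_partition L N X h" and T: "is_prim L T K" and node: "\<And>j. j \<le> N \<Longrightarrow> norm (T (X j)) = 1"
    and K: "L2norm L K \<le> \<kappa>" and x: "x \<in> {0..L}"
  shows "\<bar>norm (T x) - 1\<bar> \<le> sqrt h * \<kappa>"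
proof -
  obtain j where j: "j < N" "X j \<le> x" "x \<le> X (Suc j)" using partition_find[OF p] x by auto
  have b: "0 \<le> X j" using partition_bounds[OF p, of j] j by simp
  have "norm (T x - T (X j)) \<le> sqrt (x - X j) * L2norm L K"
    using is_prim_diff[OF T, of "X j" x] prim_Holder[OF is_prim_sq[OF T], of "X j" x] j b x by simp
  also have "\<dots> \<le> sqrt h * \<kappa>"
    using partition_width(2)[OF p j(1)] j K order_trans[OF L2norm_nonneg K]
    by (intro mult_mono) auto
  finally have "norm (T x - T (X j)) \<le> sqrt h * \<kappa>" .
  then show ?thesis
    using norm_triangle_ineq3[of "T x" "T (X j)"] node[of j] j by simp
qed

text \<open>The bound c controls the L2 norms of \<open>K n\<close> and \<open>D n\<close> and,
  through the factors 1 / \<epsilon>, makes both penalized quantities vanish. The constraints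
  survive because \<open>T n\<close> and \<open>B n\<close> converge pointwise and boundedly; in
  \<open>T n\<close> \<bullet> \<open>D n\<close> one factor converges strongly and the other
  weakly, and the energy is handled by a tangent at the limit.\<close>

lemma limit_of_discrete_frames:
  fixes Lbc :: "framing \<Rightarrow> 'c::real_normed_vector"
  assumes L: "0 < L" and bo: "boundary_operator L Lbc" and m: "regularized_modulus m c0 c1 c2 cuni"
    and p: "\<And>n. is_partition L (N n) (X n) (h n)"
    and pos: "\<And>n. 0 < \<delta> n" "\<And>n. 0 < \<epsilon>1 n" "\<And>n. 0 < \<epsilon>2 n"
    and lim0: "h \<longlonglongrightarrow> 0" "\<delta> \<longlonglongrightarrow> 0" "\<epsilon>1 \<longlonglongrightarrow> 0" "\<epsilon>2 \<longlonglongrightarrow> 0"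
    and v: "\<And>n. v n \<in> discrete_admissible L Lbc lbc (N n) (X n)"
    and weak: "weakly_tendsto_V L v u" and u: "u \<in> V L"
    and bound: "\<And>n. discrete_energy L m (\<delta> n) (\<epsilon>1 n) (\<epsilon>2 n) (v n) \<le> c"
  shows "u \<in> admissible L Lbc lbc" and "energy L u \<le> c"
proof -
  have "\<forall>n. \<exists>Y T K B D. rep L (v n) Y T K B D \<and> Lbc (v n) = lbc
      \<and> (\<forall>j\<le>N n. norm (T (X n j)) = 1) \<and> (\<forall>j\<le>N n. norm (B (X n j)) = 1)"
    using discrete_frame_rep[OF p v L] by metis
  then obtain Y T K B D where rn: "\<And>n. rep L (v n) (Y n) (T n) (K n) (B n) (D n)"
    and lbc: "\<And>n. Lbc (v n) = lbc"
    and node: "\<And>n j. j \<le> N n \<Longrightarrow> norm (T n (X n j)) = 1" "\<And>n j. j \<le> N n \<Longrightarrow> norm (B n (X n j)) = 1"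
    by metis
  obtain Y' T' B' where r: "rep L u Y' T' (wderiv L (wderiv L (fst u))) B' (wderiv L (snd u))"
    using V_rep[OF u L] .
  define K' D' where "K' = wderiv L (wderiv L (fst u))" and "D' = wderiv L (snd u)"
  note r = r[folded K'_def D'_def]
  note wl = weak_limit[OF L weak rn r]
  have P: "is_prim L (Y n) (T n)" "is_prim L (T n) (K n)" "is_prim L (B n) (D n)" "v n \<in> V L" for n
    using rn[of n] by (auto simp: rep_def)
  have P': "is_prim L Y' T'" "is_prim L T' K'" "is_prim L B' D'" using r by (auto simp: rep_def)
  note sq = is_prim_sq_integrable[OF P(2)] is_prim_sq_integrable[OF P(3)]
  note sq' = is_prim_sq_integrable[OF P'(2)] is_prim_sq_integrable[OF P'(3)]
  note [measurable] = sq[THEN sq_integrableD(1)] sq'[THEN sq_integrableD(1)]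
  have cuni: "0 \<le> cuni" using regularized_modulusD(4)[OF m pos(1)] .
  define err where "err n = 3 / 2 * cuni * \<delta> n * L" for n
  have err0: "err \<longlonglongrightarrow> 0" unfolding err_def using lim0(2) by (auto intro!: tendsto_eq_intros)
  define p1 where "p1 n = (\<integral>x. (T n x \<bullet> B n x)\<^sup>2 \<partial>leb_int L)" for n
  define p2 where "p2 n = (\<integral>x. (T n x \<bullet> D n x)\<^sup>2 \<partial>leb_int L)" for n
  have p0: "0 \<le> p1 n" "0 \<le> p2 n" for n by (auto simp: p1_def p2_def)
  have en0: "0 \<le> energy L (v n)" for n
    unfolding energy_rep(1)[OF rn] by (simp add: Qbar_bounds)
  have E: "energy L (v n) + 1 / (2 * \<epsilon>1 n) * p1 n + 1 / (2 * \<epsilon>2 n) * p2 n \<le> c + err n" for n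
    using discrete_energy_approx[OF m pos(1) P(4)[of n], of n "\<epsilon>1 n" "\<epsilon>2 n"] bound[of n] L
    unfolding energy_rep(2,3)[OF rn] p1_def[symmetric] p2_def[symmetric] err_def by linarith
  have q0: "0 \<le> 1 / (2 * \<epsilon>1 n) * p1 n" "0 \<le> 1 / (2 * \<epsilon>2 n) * p2 n" for n
    using p0 pos(2,3)[of n] by auto
  have Een: "energy L (v n) \<le> c + err n" for n using E[of n] q0[of n] by linarith
  have Ep: "p1 n \<le> 2 * \<epsilon>1 n * (c + err n)" "p2 n \<le> 2 * \<epsilon>2 n * (c + err n)" for n
  proof -
    have "1 / (2 * \<epsilon>1 n) * p1 n \<le> c + err n" "1 / (2 * \<epsilon>2 n) * p2 n \<le> c + err n"
      using E[of n] q0[of n] en0[of n] by linarith+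
    then show "p1 n \<le> 2 * \<epsilon>1 n * (c + err n)" "p2 n \<le> 2 * \<epsilon>2 n * (c + err n)"
      using pos(2,3)[of n] by (simp_all add: field_simps)
  qed
  have "(\<lambda>n. 2 * \<epsilon>1 n * (c + err n)) \<longlonglongrightarrow> 2 * 0 * (c + 0)" "(\<lambda>n. 2 * \<epsilon>2 n * (c + err n)) \<longlonglongrightarrow> 2 * 0 * (c + 0)"
    by (intro tendsto_intros lim0 err0)+
  then have up: "(\<lambda>n. 2 * \<epsilon>1 n * (c + err n)) \<longlonglongrightarrow> 0" "(\<lambda>n. 2 * \<epsilon>2 n * (c + err n)) \<longlonglongrightarrow> 0" by simp_all
  have p1_0: "p1 \<longlonglongrightarrow> 0"
    by (rule real_tendsto_sandwich[OF _ _ tendsto_const up(1)]) (use p0 Ep in auto)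
  have p2_0: "p2 \<longlonglongrightarrow> 0"
    by (rule real_tendsto_sandwich[OF _ _ tendsto_const up(2)]) (use p0 Ep in auto)
  obtain \<Delta> where \<Delta>: "\<And>n. err n \<le> \<Delta>"
    using convergent_imp_Bseq[OF convergentI[OF err0]] unfolding Bseq_def
    by (metis abs_le_D1 real_norm_def)
  define \<kappa> where "\<kappa> = sqrt (c + \<Delta>)"
  have \<kappa>: "L2norm L (K n) \<le> \<kappa>" "L2norm L (D n) \<le> \<kappa>" for n
    unfolding \<kappa>_def using power2_L2norm_le_energy[OF rn[of n]] Een[of n] \<Delta>[of n]
    by (auto intro!: real_le_rsqrt)
  have \<kappa>0: "0 \<le> \<kappa>" using order_trans[OF L2norm_nonneg \<kappa>(1)] .
  have near: "\<bar>norm (T n x) - 1\<bar> \<le> sqrt (h n) * \<kappa>" "\<bar>norm (B n x) - 1\<bar> \<le> sqrt (h n) * \<kappa>" if "x \<in> {0..L}" for n x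
    using norm_near_node[OF p P(2) node(1) \<kappa>(1) that] norm_near_node[OF p P(3) node(2) \<kappa>(2) that] by auto
  have h0: "(\<lambda>n. sqrt (h n) * \<kappa>) \<longlonglongrightarrow> 0" using lim0(1) by (auto intro!: tendsto_eq_intros)
  have unit: "norm (T' x) = 1" "norm (B' x) = 1" if x: "x \<in> {0..L}" for x
  proof -
    have "(\<lambda>n. norm (T n x) - 1) \<longlonglongrightarrow> 0" "(\<lambda>n. norm (B n x) - 1) \<longlonglongrightarrow> 0"
      using near[OF x] by (auto intro!: tendsto_rabs_zero_cancel[OF real_tendsto_sandwich[of "\<lambda>_. 0", OF _ _ tendsto_const h0]])
    then have "(\<lambda>n. norm (T n x)) \<longlonglongrightarrow> 1" "(\<lambda>n. norm (B n x)) \<longlonglongrightarrow> 1"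
      by (simp_all add: LIM_zero_iff)
    then show "norm (T' x) = 1" "norm (B' x) = 1"
      using LIMSEQ_unique[OF tendsto_norm[OF wl(4)[OF x]]] LIMSEQ_unique[OF tendsto_norm[OF wl(5)[OF x]]] by auto
  qed
  obtain H where H: "\<And>n. sqrt (h n) * \<kappa> \<le> H"
    using convergent_imp_Bseq[OF convergentI[OF h0]] unfolding Bseq_def
    by (metis abs_le_D1 real_norm_def)
  have Hb: "norm (T n x) \<le> 1 + H" "norm (B n x) \<le> 1 + H" if "x \<in> {0..L}" for n x
    using near[OF that, of n] H[of n] by linarith+
  have H0: "0 \<le> H" using order_trans[OF _ H[of 0]] \<kappa>0 p[of 0] partition_width[OF p[of 0], of 0]
    by (auto simp: is_partition_def)
  have "(\<lambda>n. \<integral>x. (T n x \<bullet> B n x)\<^sup>2 \<partial>leb_int L) \<longlonglongrightarrow> (\<integral>x. (T' x \<bullet> B' x)\<^sup>2 \<partial>leb_int L)"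
  proof (rule integral_dominated_convergence[where w = "\<lambda>x. ((1 + H) * (1 + H))\<^sup>2"])
    show "AE x in leb_int L. (\<lambda>n. (T n x \<bullet> B n x)\<^sup>2) \<longlonglongrightarrow> (T' x \<bullet> B' x)\<^sup>2"
      by (intro AE_I2 tendsto_intros wl(4,5)) auto
    show "AE x in leb_int L. norm ((T n x \<bullet> B n x)\<^sup>2) \<le> ((1 + H) * (1 + H))\<^sup>2" for n
    proof (rule AE_I2)
      fix x assume "x \<in> space (leb_int L)"
      then have x: "x \<in> {0..L}" by auto
      have "\<bar>T n x \<bullet> B n x\<bar> \<le> norm (T n x) * norm (B n x)" by (rule Cauchy_Schwarz_ineq2)
      also have "\<dots> \<le> (1 + H) * (1 + H)" using Hb[OF x] H0 by (intro mult_mono) auto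
      finally have "\<bar>T n x \<bullet> B n x\<bar>\<^sup>2 \<le> ((1 + H) * (1 + H))\<^sup>2" by (intro power_mono) auto
      then show "norm ((T n x \<bullet> B n x)\<^sup>2) \<le> ((1 + H) * (1 + H))\<^sup>2" by simp
    qed
  qed auto
  then have int0: "(\<integral>x. (T' x \<bullet> B' x)\<^sup>2 \<partial>leb_int L) = 0"
    using LIMSEQ_unique p1_0 unfolding p1_def by blast
  have cTB: "continuous_on {0..L} (\<lambda>x. (T' x \<bullet> B' x)\<^sup>2)"
    using is_prim_continuous[OF P'(2)] is_prim_continuous[OF P'(3)] by (intro continuous_intros)
  have "AE x in leb_int L. (T' x \<bullet> B' x)\<^sup>2 = 0"
    using integral_nonneg_eq_0_iff_AE[OF integrable_continuous_leb_int[OF cTB]] int0 by simp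
  then have orth: "T' x \<bullet> B' x = 0" if "x \<in> {0..L}" for x
    using continuous_AE_eq[OF cTB continuous_on_const, of 0] L that by simp
  \<comment> \<open>The sign makes the pairing of \<phi> T' with D' the integral of |T' \<bullet>
    D'|, so that a single weak limit yields the constraint a.e.\<close>
  define \<phi> where "\<phi> x = sgn (T' x \<bullet> D' x)" for x
  have [measurable]: "\<phi> \<in> borel_measurable (leb_int L)" unfolding \<phi>_def[abs_def] by measurable
  have \<phi>1: "\<bar>\<phi> x\<bar> \<le> 1" for x by (simp add: \<phi>_def sgn_if)
  have \<phi>T: "sq_integrable L (\<lambda>x. \<phi> x *\<^sub>R T' x)"
    by (rule sq_integrable_domin[OF sq'(1), where C = 1])
       (use \<phi>1 in \<open>auto simp: mult_left_le_one_le\<close>)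
  have TT0: "(\<lambda>n. L2norm L (\<lambda>x. T' x - T n x)) \<longlonglongrightarrow> 0"
  proof -
    have "(\<lambda>n. \<integral>x. (norm (T' x - T n x))\<^sup>2 \<partial>leb_int L) \<longlonglongrightarrow> (\<integral>x. 0 \<partial>leb_int L)"
    proof (rule integral_dominated_convergence[where w = "\<lambda>x. (2 + H)\<^sup>2"])
      have "(\<lambda>n. (norm (T' x - T n x))\<^sup>2) \<longlonglongrightarrow> (norm (T' x - T' x))\<^sup>2" if "x \<in> {0..L}" for x
        by (intro tendsto_intros wl(4) that)
      then show "AE x in leb_int L. (\<lambda>n. (norm (T' x - T n x))\<^sup>2) \<longlonglongrightarrow> 0"
        by (intro AE_I2) auto
      show "AE x in leb_int L. norm ((norm (T' x - T n x))\<^sup>2) \<le> (2 + H)\<^sup>2" for n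
      proof (rule AE_I2)
        fix x assume "x \<in> space (leb_int L)"
        then have x: "x \<in> {0..L}" by auto
        have "norm (T' x - T n x) \<le> 2 + H"
          using norm_triangle_ineq4[of "T' x" "T n x"] unit(1)[OF x] Hb(1)[OF x, of n] by linarith
        then show "norm ((norm (T' x - T n x))\<^sup>2) \<le> (2 + H)\<^sup>2" by (simp add: power_mono)
      qed
    qed auto
    then show ?thesis unfolding L2norm_def using tendsto_real_sqrt by fastforce
  qed
  have lim1: "(\<lambda>n. \<integral>x. (\<phi> x *\<^sub>R T' x) \<bullet> D n x \<partial>leb_int L) \<longlonglongrightarrow> (\<integral>x. (\<phi> x *\<^sub>R T' x) \<bullet> D' x \<partial>leb_int L)"
    by (rule wl(2)[OF \<phi>T])
  \<comment> \<open>Write T' = (T' - \<open>T n\<close>) + \<open>T n\<close>: the first part is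
    small in L2 and meets the bounded \<open>D n\<close>, the second gives the penalized
    quantity.\<close>
  have est: "\<bar>\<integral>x. (\<phi> x *\<^sub>R T' x) \<bullet> D n x \<partial>leb_int L\<bar>
      \<le> L2norm L (\<lambda>x. T' x - T n x) * \<kappa> + sqrt L * sqrt (p2 n)" for n
  proof -
    have d: "sq_integrable L (\<lambda>x. T' x - T n x)" by (rule sq_integrable_diff[OF sq'(1) sq(1)])
    have b: "sq_integrable L (\<lambda>x. T n x \<bullet> D n x)"
    proof (rule sq_integrable_domin[OF sq(4)[of n], where C = "1 + H"])
      show "AE x in leb_int L. norm (T n x \<bullet> D n x) \<le> (1 + H) * norm (D n x)"
      proof (rule AE_I2)
        fix x assume "x \<in> space (leb_int L)"
        then have "norm (T n x) * norm (D n x) \<le> (1 + H) * norm (D n x)"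
          using Hb(1)[of x n] by (intro mult_right_mono) auto
        then show "norm (T n x \<bullet> D n x) \<le> (1 + H) * norm (D n x)"
          using Cauchy_Schwarz_ineq2[of "T n x" "D n x"] by simp
      qed
    qed measurable
    note i1 = sq_integrable_norm_mult[OF d sq(4)[of n]]
    note i2 = integrable_norm[OF sq_integrable_imp_integrable[OF b]]
    have "\<bar>\<integral>x. (\<phi> x *\<^sub>R T' x) \<bullet> D n x \<partial>leb_int L\<bar> \<le> (\<integral>x. \<bar>(\<phi> x *\<^sub>R T' x) \<bullet> D n x\<bar> \<partial>leb_int L)"
      by (rule integral_abs_bound)
    also have "\<dots> \<le> (\<integral>x. norm (T' x - T n x) * norm (D n x) + norm (T n x \<bullet> D n x) \<partial>leb_int L)"
    proof (rule integral_mono)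
      show "integrable (leb_int L) (\<lambda>x. \<bar>(\<phi> x *\<^sub>R T' x) \<bullet> D n x\<bar>)"
        using sq_integrable_inner(1)[OF \<phi>T sq(4)[of n]] by simp
      show "integrable (leb_int L) (\<lambda>x. norm (T' x - T n x) * norm (D n x) + norm (T n x \<bullet> D n x))"
        using i1(1) i2 by simp
      fix x
      have "\<bar>(\<phi> x *\<^sub>R T' x) \<bullet> D n x\<bar> \<le> \<bar>T' x \<bullet> D n x\<bar>"
        using \<phi>1[of x] by (simp add: abs_mult mult_left_le_one_le)
      also have "\<dots> \<le> \<bar>(T' x - T n x) \<bullet> D n x\<bar> + \<bar>T n x \<bullet> D n x\<bar>"
        by (simp add: inner_diff_left)
      also have "\<bar>(T' x - T n x) \<bullet> D n x\<bar> \<le> norm (T' x - T n x) * norm (D n x)"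
        by (rule Cauchy_Schwarz_ineq2)
      finally show "\<bar>(\<phi> x *\<^sub>R T' x) \<bullet> D n x\<bar> \<le> norm (T' x - T n x) * norm (D n x) + norm (T n x \<bullet> D n x)"
        by simp
    qed
    also have "\<dots> = (\<integral>x. norm (T' x - T n x) * norm (D n x) \<partial>leb_int L) + (\<integral>x. norm (T n x \<bullet> D n x) \<partial>leb_int L)"
      using i1(1) i2 by (rule Bochner_Integration.integral_add)
    also have "\<dots> \<le> L2norm L (\<lambda>x. T' x - T n x) * \<kappa> + sqrt L * sqrt (p2 n)"
    proof (rule add_mono)
      show "(\<integral>x. norm (T' x - T n x) * norm (D n x) \<partial>leb_int L) \<le> L2norm L (\<lambda>x. T' x - T n x) * \<kappa>"
        using i1(2) mult_left_mono[OF \<kappa>(2)[of n] L2norm_nonneg[of L "\<lambda>x. T' x - T n x"]] by linarith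
      have "L2norm L (\<lambda>x. T n x \<bullet> D n x) = sqrt (p2 n)" by (simp add: L2norm_def p2_def)
      then show "(\<integral>x. norm (T n x \<bullet> D n x) \<partial>leb_int L) \<le> sqrt L * sqrt (p2 n)"
        using integral_norm_le_L2norm[OF b] L by simp
    qed
    finally show ?thesis .
  qed
  have gz: "(\<lambda>n. L2norm L (\<lambda>x. T' x - T n x) * \<kappa> + sqrt L * sqrt (p2 n)) \<longlonglongrightarrow> 0"
    using TT0 p2_0 by (auto intro!: tendsto_eq_intros)
  have "(\<lambda>n. \<integral>x. (\<phi> x *\<^sub>R T' x) \<bullet> D n x \<partial>leb_int L) \<longlonglongrightarrow> 0"
    by (rule Lim_null_comparison[OF _ gz], rule always_eventually)
       (intro allI, unfold real_norm_def, rule est)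
  then have "(\<integral>x. (\<phi> x *\<^sub>R T' x) \<bullet> D' x \<partial>leb_int L) = 0" using LIMSEQ_unique lim1 by blast
  moreover have "(\<lambda>x. (\<phi> x *\<^sub>R T' x) \<bullet> D' x) = (\<lambda>x. \<bar>T' x \<bullet> D' x\<bar>)"
    by (auto simp: \<phi>_def sgn_if fun_eq_iff)
  ultimately have "AE x in leb_int L. T' x \<bullet> D' x = 0"
    using integral_nonneg_eq_0_iff_AE[of "leb_int L" "\<lambda>x. \<bar>T' x \<bullet> D' x\<bar>"]
      sq_integrable_inner(1)[OF sq'(1,4)] by simp
  moreover have "Lbc u = lbc"
    by (rule boundary_operator_limit[where vs = v and Y = Y and T = T and K = K and B = B and D = D,
          OF bo L rn r _ _ _ lbc])
       (use wl(3-5) L in auto)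
  ultimately show "u \<in> admissible L Lbc lbc"
    unfolding admissible_rep_iff[OF r L] using unit orth by blast
  \<comment> \<open>The subgradient is taken at the limit (K', D'), so the weights \<open>a\<close>
    and \<open>b\<close> are fixed L2 functions. The lower bound for the energy is then affine in
    (\<open>K n\<close>, \<open>D n\<close>) and passes to the weak limit.\<close>
  define k S where "k x = opt_k (norm (K' x)) (norm (D' x))" and "S x = sqrtQ (norm (K' x)) (norm (D' x))" for x
  define a where "a x = (2 * S x * (1 - (k x)\<^sup>2)) *\<^sub>R sgn (K' x)" for x
  define b where "b x = (4 * S x * k x) *\<^sub>R sgn (D' x)" for x
  have [measurable]: "k \<in> borel_measurable (leb_int L)" "S \<in> borel_measurable (leb_int L)"
    unfolding k_def[abs_def] S_def[abs_def] by measurable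
  have [measurable]: "a \<in> borel_measurable (leb_int L)" "b \<in> borel_measurable (leb_int L)"
    unfolding a_def[abs_def] b_def[abs_def] sgn_div_norm by measurable
  have SS: "(S x)\<^sup>2 = Qbar (norm (K' x)) (norm (D' x))" for x by (simp add: S_def Qbar_eq_sqrtQ)
  have Si: "integrable (leb_int L) (\<lambda>x. (S x)\<^sup>2)" unfolding SS by (rule integrable_Qbar[OF sq'(2,4)])
  have Ssq: "sq_integrable L S" using Si by (simp add: sq_integrable_def)
  have S0: "0 \<le> S x" for x by (simp add: S_def sqrtQ_bounds)
  have k01: "0 \<le> k x" "k x \<le> 1" for x by (simp_all add: k_def opt_k_bounds)
  have asq: "sq_integrable L a"
  proof (rule sq_integrable_domin[OF Ssq, where C = 2])
    have "norm (a x) \<le> 2 * norm (S x)" for x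
    proof -
      have "norm (a x) = \<bar>2 * S x * (1 - (k x)\<^sup>2)\<bar> * norm (sgn (K' x))" by (simp add: a_def)
      also have "\<dots> = 2 * S x * (1 - (k x)\<^sup>2) * norm (sgn (K' x))"
        using S0[of x] k01[of x] by (simp add: power_le_one)
      also have "\<dots> \<le> 2 * S x * 1 * 1"
        using S0[of x] k01[of x] by (intro mult_mono) (auto simp: norm_sgn power_le_one)
      finally show ?thesis using S0[of x] by simp
    qed
    then show "AE x in leb_int L. norm (a x) \<le> 2 * norm (S x)" by simp
  qed measurable
  have bsq: "sq_integrable L b"
  proof (rule sq_integrable_domin[OF Ssq, where C = 4])
    have "norm (b x) \<le> 4 * norm (S x)" for x
    proof -
      have "norm (b x) = \<bar>4 * S x * k x\<bar> * norm (sgn (D' x))" by (simp add: b_def)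
      also have "\<dots> = 4 * S x * k x * norm (sgn (D' x))" using S0[of x] k01[of x] by simp
      also have "\<dots> \<le> 4 * S x * 1 * 1"
        using S0[of x] k01[of x] by (intro mult_mono) (auto simp: norm_sgn)
      finally show ?thesis using S0[of x] by simp
    qed
    then show "AE x in leb_int L. norm (b x) \<le> 4 * norm (S x)" by simp
  qed measurable
  have low: "(\<integral>x. a x \<bullet> K n x \<partial>leb_int L) + (\<integral>x. b x \<bullet> D n x \<partial>leb_int L) - (\<integral>x. (S x)\<^sup>2 \<partial>leb_int L) \<le> c + err n" for n
  proof -
    note i = sq_integrable_inner(1)[OF asq sq(2)[of n]] sq_integrable_inner(1)[OF bsq sq(4)[of n]]
    have "(\<integral>x. a x \<bullet> K n x + b x \<bullet> D n x - (S x)\<^sup>2 \<partial>leb_int L) \<le> energy L (v n)"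
      unfolding energy_rep(1)[OF rn]
    proof (rule integral_mono)
      show "integrable (leb_int L) (\<lambda>x. a x \<bullet> K n x + b x \<bullet> D n x - (S x)\<^sup>2)" using i Si by simp
      show "integrable (leb_int L) (\<lambda>x. Qbar (norm (K n x)) (norm (D n x)))" by (rule integrable_Qbar[OF sq(2,4)])
      show "a x \<bullet> K n x + b x \<bullet> D n x - (S x)\<^sup>2 \<le> Qbar (norm (K n x)) (norm (D n x))" for x
        using Qbar_tangent(1)[of "K' x" "D' x" "K n x" "D n x"]
        unfolding a_def b_def S_def k_def by simp
    qed
    then show ?thesis using i Si Een[of n] by simp
  qed
  have "(\<lambda>n. (\<integral>x. a x \<bullet> K n x \<partial>leb_int L) + (\<integral>x. b x \<bullet> D n x \<partial>leb_int L) - (\<integral>x. (S x)\<^sup>2 \<partial>leb_int L))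
     \<longlonglongrightarrow> (\<integral>x. a x \<bullet> K' x \<partial>leb_int L) + (\<integral>x. b x \<bullet> D' x \<partial>leb_int L) - (\<integral>x. (S x)\<^sup>2 \<partial>leb_int L)"
    by (intro tendsto_intros wl(1)[OF asq] wl(2)[OF bsq])
  \<comment> \<open>By Euler's identity the affine bound tends to 2 \<integral>S^2 - \<integral>S^2,
    the energy of the limit.\<close>
  moreover have "(\<integral>x. a x \<bullet> K' x \<partial>leb_int L) + (\<integral>x. b x \<bullet> D' x \<partial>leb_int L)
      = (\<integral>x. 2 * (S x)\<^sup>2 \<partial>leb_int L)"
  proof -
    have "a x \<bullet> K' x + b x \<bullet> D' x = 2 * (S x)\<^sup>2" for x
      using Qbar_tangent(2)[of "K' x" "D' x"] unfolding a_def b_def S_def k_def by simp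
    then show ?thesis
      using sq_integrable_inner(1)[OF asq sq'(2)] sq_integrable_inner(1)[OF bsq sq'(4)]
      by (simp flip: Bochner_Integration.integral_add)
  qed
  ultimately have "(\<lambda>n. (\<integral>x. a x \<bullet> K n x \<partial>leb_int L) + (\<integral>x. b x \<bullet> D n x \<partial>leb_int L) - (\<integral>x. (S x)\<^sup>2 \<partial>leb_int L))
     \<longlonglongrightarrow> (\<integral>x. (S x)\<^sup>2 \<partial>leb_int L)" by simp
  moreover have "(\<lambda>n. c + err n) \<longlonglongrightarrow> c" using err0 by (auto intro!: tendsto_eq_intros)
  ultimately have "(\<integral>x. (S x)\<^sup>2 \<partial>leb_int L) \<le> c"
    using low by (intro LIMSEQ_le) auto
  then show "energy L u \<le> c" unfolding energy_rep(1)[OF r] SS .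
qed

subsection \<open>Integrals over subintervals\<close>

lemma prim_diff_mono_AE:
  fixes f g :: "real \<Rightarrow> real"
  assumes "integrable (leb_int L) f" "integrable (leb_int L) g" "a \<le> b"
    and "AE x in leb_int L. a < x \<longrightarrow> x \<le> b \<longrightarrow> f x \<le> g x"
  shows "prim L f b - prim L f a \<le> prim L g b - prim L g a"
  unfolding prim_diff[OF assms(1,3)] prim_diff[OF assms(2,3)]
  by (rule integral_mono_AE) (use assms in \<open>auto intro!: integrable_if_leb_int elim!: eventually_mono\<close>)

lemma prim_mono:
  fixes f :: "real \<Rightarrow> real"
  assumes "integrable (leb_int L) f" "\<And>x. 0 < x \<Longrightarrow> x < L \<Longrightarrow> 0 \<le> f x" "a \<le> b"
  shows "prim L f a \<le> prim L f b"
proof -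
  have "prim L (\<lambda>x. 0) b - prim L (\<lambda>x. 0) a \<le> prim L f b - prim L f a"
    by (rule prim_diff_mono_AE) (use assms in auto)
  then show ?thesis by (simp add: prim_def)
qed

lemma prim_scaleR:
  assumes "integrable (leb_int L) f" shows "prim L (\<lambda>x. c *\<^sub>R f x) y = c *\<^sub>R prim L f y"
  using prim_lincomb[OF assms assms, of c 0] by simp

lemma prim_mult:
  fixes f :: "real \<Rightarrow> real"
  assumes "integrable (leb_int L) f" shows "prim L (\<lambda>x. c * f x) y = c * prim L f y"
  using prim_scaleR[OF assms, of c] by simp

lemma prim_add:
  assumes "integrable (leb_int L) f" "integrable (leb_int L) g"
  shows "prim L (\<lambda>x. f x + g x) y = prim L f y + prim L g y"
  using prim_lincomb[OF assms, of 1 1] by simp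

lemma prim_minus:
  assumes "integrable (leb_int L) f" "integrable (leb_int L) g"
  shows "prim L (\<lambda>x. f x - g x) y = prim L f y - prim L g y"
  using prim_lincomb[OF assms, of 1 "-1"] by simp

lemma prim_bounded_linear:
  fixes f :: "real \<Rightarrow> 'a::euclidean_space" and T :: "'a \<Rightarrow> 'b::euclidean_space"
  assumes "bounded_linear T" and f: "integrable (leb_int L) f"
  shows "prim L (\<lambda>x. T (f x)) y = T (prim L f y)"
proof -
  interpret T: bounded_linear T by fact
  have i: "integrable (leb_int L) (\<lambda>s. if s \<le> y then f s else 0)"
    using f by (intro integrable_if_leb_int) auto
  have "(\<lambda>s. T (if s \<le> y then f s else 0)) = (\<lambda>s. if s \<le> y then T (f s) else 0)"
    by (auto simp: T.zero)
  then show ?thesis unfolding prim_def using integral_bounded_linear[OF assms(1) i] by simp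
qed

lemma prim_const_diff:
  fixes c :: "'a::euclidean_space"
  assumes "0 \<le> a" "a \<le> b" "b \<le> L"
  shows "prim L (\<lambda>x. c) b - prim L (\<lambda>x. c) a = (b - a) *\<^sub>R c"
proof -
  have "prim L (\<lambda>x. c) b - prim L (\<lambda>x. c) a = b *\<^sub>R c - a *\<^sub>R c"
    by (rule prim_FTC[of _ _ _ "{}"]) (use assms in \<open>auto intro!: derivative_eq_intros continuous_intros\<close>)
  then show ?thesis by (simp add: scaleR_diff_left)
qed

text \<open>Factor f as (f / sqrt g) sqrt g. With g the density of the new parameter this is
  Cauchy-Schwarz in that parameter, expressed in the old one.\<close>

lemma prim_Cauchy_Schwarz:
  fixes f g :: "real \<Rightarrow> real"
  assumes [measurable]: "f \<in> borel_measurable (leb_int L)" and g: "integrable (leb_int L) g"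
    and pos: "\<And>x. 0 < x \<Longrightarrow> x < L \<Longrightarrow> 0 < g x" and fg: "integrable (leb_int L) (\<lambda>x. (f x)\<^sup>2 / g x)" and "a \<le> b"
    and f: "integrable (leb_int L) f"
  shows "(prim L f b - prim L f a)\<^sup>2
      \<le> (prim L (\<lambda>x. (f x)\<^sup>2 / g x) b - prim L (\<lambda>x. (f x)\<^sup>2 / g x) a) * (prim L g b - prim L g a)"
proof -
  note [measurable] = borel_measurable_integrable[OF g]
  let ?u = "\<lambda>x. if a < x \<and> x \<le> b then f x / sqrt (g x) else 0"
  let ?w = "\<lambda>x. if a < x \<and> x \<le> b then sqrt (g x) else 0"
  have id: "(\<lambda>x. x) \<in> borel_measurable (leb_int L)" by (rule measurable_leb_int_ident)
  have pr: "Measurable.pred (leb_int L) (\<lambda>x. a < x \<and> x \<le> b)" using id by measurable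
  have m: "?u \<in> borel_measurable (leb_int L)" "?w \<in> borel_measurable (leb_int L)"
    using pr by measurable
  have u2: "(\<integral>x. (?u x)\<^sup>2 \<partial>leb_int L) = prim L (\<lambda>x. (f x)\<^sup>2 / g x) b - prim L (\<lambda>x. (f x)\<^sup>2 / g x) a"
    unfolding prim_diff[OF fg \<open>a \<le> b\<close>]
    by (intro Bochner_Integration.integral_cong) (use pos in \<open>auto simp: power_divide less_imp_le\<close>)
  have w2: "(\<integral>x. (?w x)\<^sup>2 \<partial>leb_int L) = prim L g b - prim L g a"
    unfolding prim_diff[OF g \<open>a \<le> b\<close>]
    by (intro Bochner_Integration.integral_cong) (use pos in \<open>auto simp: less_imp_le\<close>)
  have uw: "(\<integral>x. ?u x * ?w x \<partial>leb_int L) = prim L f b - prim L f a"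
    unfolding prim_diff[OF f \<open>a \<le> b\<close>]
  proof (intro Bochner_Integration.integral_cong refl)
    fix x assume "x \<in> space (leb_int L)"
    then have "0 < g x" using pos by auto
    then show "?u x * ?w x = (if a < x \<and> x \<le> b then f x else 0)" by simp
  qed
  have i: "integrable (leb_int L) (\<lambda>x. (?u x)\<^sup>2)"
  proof (rule Bochner_Integration.integrable_cong[THEN iffD1, rotated 2])
    show "integrable (leb_int L) (\<lambda>x. if a < x \<and> x \<le> b then (f x)\<^sup>2 / g x else 0)"
      using fg by (intro integrable_if_leb_int) auto
  qed (use pos in \<open>auto simp: power_divide less_imp_le\<close>)
  have i': "integrable (leb_int L) (\<lambda>x. (?w x)\<^sup>2)"
  proof (rule Bochner_Integration.integrable_cong[THEN iffD1, rotated 2])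
    show "integrable (leb_int L) (\<lambda>x. if a < x \<and> x \<le> b then g x else 0)"
      using g by (intro integrable_if_leb_int) auto
  qed (use pos in \<open>auto simp: less_imp_le\<close>)
  show ?thesis using Cauchy_Schwarz_integral(2)[OF m i i'] unfolding u2 w2 uw .
qed

lemma integrable_mult_continuous:
  fixes f :: "real \<Rightarrow> 'a::euclidean_space" and g :: "real \<Rightarrow> real"
  assumes g: "integrable (leb_int L) g" and f: "continuous_on {0..L} f"
  shows "integrable (leb_int L) (\<lambda>x. g x *\<^sub>R f x)"
proof -
  obtain B where B: "\<And>x. x \<in> {0..L} \<Longrightarrow> norm (f x) \<le> B"
    using compact_imp_bounded[OF compact_continuous_image[OF f compact_Icc]]
    by (meson bounded_iff imageI)
  note [measurable] = borel_measurable_leb_int_continuous[OF f] borel_measurable_integrable[OF g]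
  have "integrable (leb_int L) (\<lambda>x. B * \<bar>g x\<bar>)" using g by simp
  then show ?thesis
  proof (rule Bochner_Integration.integrable_bound)
    show "AE x in leb_int L. norm (g x *\<^sub>R f x) \<le> norm (B * \<bar>g x\<bar>)"
    proof (rule AE_I2)
      fix x assume "x \<in> space (leb_int L)"
      then have "norm (f x) \<le> \<bar>B\<bar>" using B[of x] by auto
      then show "norm (g x *\<^sub>R f x) \<le> norm (B * \<bar>g x\<bar>)"
        using mult_left_mono[of "norm (f x)" "\<bar>B\<bar>" "\<bar>g x\<bar>"] by (simp add: abs_mult mult.commute)
    qed
  qed measurable
qed

text \<open>The integral of the derivative of (G - G a)^2 / 2 for a primitive G that need not be
  differentiable everywhere: integrating the cut-off density by parts against its own primitive
  gives I = P^2 - I, where P is its total integral.\<close>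

lemma prim_times_prim:
  fixes g :: "real \<Rightarrow> real"
  assumes g: "integrable (leb_int L) g" and c: "continuous_on {0..L} (prim L g)"
    and ab: "a \<le> b" "b \<le> L"
  shows "prim L (\<lambda>x. g x * (prim L g x - prim L g a)) b - prim L (\<lambda>x. g x * (prim L g x - prim L g a)) a
    = (prim L g b - prim L g a)\<^sup>2 / 2"
proof -
  define u where "u x = (if a < x \<and> x \<le> b then g x else 0)" for x
  have u: "integrable (leb_int L) u" unfolding u_def using g by (intro integrable_if_leb_int) auto
  have pu: "prim L u x = prim L g x - prim L g a" if "a < x" "x \<le> b" for x
    unfolding prim_diff[OF g less_imp_le[OF that(1)]]
    unfolding prim_def u_def using that by (intro Bochner_Integration.integral_cong) auto
  have puL: "prim L u L = prim L g b - prim L g a"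
    unfolding prim_diff[OF g ab(1)] unfolding prim_def u_def
    by (intro Bochner_Integration.integral_cong) auto
  have gc: "integrable (leb_int L) (\<lambda>x. g x * (prim L g x - prim L g a))"
    using integrable_mult_continuous[OF g continuous_on_diff[OF c continuous_on_const], of "prim L g a"]
    by simp
  have "(\<integral>x. u x * prim L u x \<partial>leb_int L)
      = (\<integral>x. (if a < x \<and> x \<le> b then g x * (prim L g x - prim L g a) else 0) \<partial>leb_int L)"
    by (intro Bochner_Integration.integral_cong) (auto simp: u_def pu)
  then have I: "(\<integral>x. u x * prim L u x \<partial>leb_int L)
      = prim L (\<lambda>x. g x * (prim L g x - prim L g a)) b - prim L (\<lambda>x. g x * (prim L g x - prim L g a)) a"
    using prim_diff[OF gc ab(1)] by simp
  have uu: "integrable (leb_int L) (\<lambda>x. u x * prim L u x)"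
  proof (rule Bochner_Integration.integrable_cong[THEN iffD1, rotated 2])
    show "integrable (leb_int L) (\<lambda>x. if a < x \<and> x \<le> b then g x * (prim L g x - prim L g a) else 0)"
      using gc by (intro integrable_if_leb_int) auto
  qed (auto simp: u_def pu)
  have "(\<integral>x. u x * prim L u x \<partial>leb_int L) = (\<integral>x. (prim L u L - prim L u x) * u x \<partial>leb_int L)"
    using integral_prim_by_parts[OF u u] by simp
  also have "\<dots> = (\<integral>x. prim L u L * u x - u x * prim L u x \<partial>leb_int L)"
    by (simp add: algebra_simps)
  also have "\<dots> = prim L u L * prim L u L - (\<integral>x. u x * prim L u x \<partial>leb_int L)"
    using u uu prim_L[of L L u] by simp
  finally show ?thesis unfolding I puL by (simp add: power2_eq_square)
qed

subsection \<open>Slowing down a frame where its curvature is large\<close>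

text \<open>In the parameter \<open>prim L g\<close> the frame \<open>(T, B)\<close> is Lipschitz continuous.  The two integral
  conditions say that this parameter still runs through \<open>[0, L]\<close> and that the curve with
  tangent \<open>T\<close> in the new parametrization has the same end points as \<open>Y\<close>.\<close>

locale slowed_frame =
  fixes L s M :: real and g :: "real \<Rightarrow> real" and Y T K B D :: "real \<Rightarrow> real^3"
  assumes L: "0 < L" and s: "0 < s" "s \<le> 1 / 2" and M: "0 < M"
    and Y: "is_prim L Y T" and T: "is_prim L T K" and B: "is_prim L B D"
    and unit: "\<And>x. x \<in> {0..L} \<Longrightarrow> norm (T x) = 1" "\<And>x. x \<in> {0..L} \<Longrightarrow> norm (B x) = 1"
    and orth: "\<And>x. x \<in> {0..L} \<Longrightarrow> T x \<bullet> B x = 0" "AE x in leb_int L. T x \<bullet> D x = 0"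
    and g: "sq_integrable L g" and g_ge: "\<And>x. 0 < x \<Longrightarrow> x < L \<Longrightarrow> 1 - s \<le> g x"
    and KD_le: "\<And>x. 0 < x \<Longrightarrow> x < L \<Longrightarrow> norm (K x) + norm (D x) \<le> 2 * M * g x"
    and g_int: "(\<integral>x. g x \<partial>leb_int L) = L" "(\<integral>x. g x *\<^sub>R T x \<partial>leb_int L) = (\<integral>x. T x \<partial>leb_int L)"
begin

section \<open>Estimates on an arc of the slowed frame\<close>

abbreviation "G \<equiv> prim L g"

lemma integrable_g: "integrable (leb_int L) g"
  using g by (rule sq_integrable_imp_integrable)

lemma sq_KD: "sq_integrable L K" "sq_integrable L D"
  using is_prim_sq[OF T] is_prim_sq[OF B] .

lemma integrable_KD: "integrable (leb_int L) K" "integrable (leb_int L) D"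
  using sq_KD by (auto intro: sq_integrable_imp_integrable)

lemma measurable_KDg [measurable]:
  "K \<in> borel_measurable (leb_int L)" "D \<in> borel_measurable (leb_int L)" "g \<in> borel_measurable (leb_int L)"
  using sq_KD g sq_integrableD by blast+

lemma g_pos: "0 < x \<Longrightarrow> x < L \<Longrightarrow> 0 < g x"
  using g_ge[of x] s by linarith

lemma G_ends: "G 0 = 0" "G L = L"
  using g_int(1) by (simp_all add: prim_0 prim_L)

lemma continuous_G: "continuous_on S G"
  by (rule continuous_on_prim[OF g])

lemma G_diff_ge:
  assumes "0 \<le> a" "a \<le> b" "b \<le> L" shows "(1 - s) * (b - a) \<le> G b - G a"
proof -
  have "prim L (\<lambda>x. 1 - s) b - prim L (\<lambda>x. 1 - s) a \<le> G b - G a"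
    by (rule prim_diff_mono_AE) (use assms g_ge integrable_g in \<open>auto intro!: AE_I2\<close>)
  then show ?thesis using prim_const_diff[OF assms, of "1 - s"] by (simp add: mult.commute)
qed

lemma G_mono:
  assumes "0 \<le> a" "a \<le> b" "b \<le> L" shows "G a \<le> G b"
proof -
  have "0 \<le> (1 - s) * (b - a)" using s assms by (intro mult_nonneg_nonneg) auto
  then show ?thesis using G_diff_ge[OF assms] by linarith
qed

lemma norm_prim_le_G:
  assumes f: "integrable (leb_int L) f" "\<And>x. 0 < x \<Longrightarrow> x < L \<Longrightarrow> norm (f x) \<le> C * g x" and ab: "a \<le> b"
  shows "norm (prim L f b - prim L f a) \<le> C * (G b - G a)"
proof -
  have "norm (prim L f b - prim L f a) \<le> prim L (\<lambda>x. norm (f x)) b - prim L (\<lambda>x. norm (f x)) a"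
    by (rule norm_prim_diff_le[OF f(1) ab])
  also have "\<dots> \<le> prim L (\<lambda>x. C * g x) b - prim L (\<lambda>x. C * g x) a"
    by (rule prim_diff_mono_AE) (use assms integrable_g in \<open>auto intro!: AE_I2\<close>)
  finally show ?thesis by (simp add: prim_mult[OF integrable_g] right_diff_distrib)
qed

lemma frame_Lipschitz:
  assumes "0 \<le> a" "a \<le> b" "b \<le> L"
  shows "norm (T b - T a) \<le> 2 * M * (G b - G a)" "norm (B b - B a) \<le> 2 * M * (G b - G a)"
proof -
  have "norm (K x) \<le> 2 * M * g x" "norm (D x) \<le> 2 * M * g x" if "0 < x" "x < L" for x
    using KD_le[OF that] norm_ge_zero[of "K x"] norm_ge_zero[of "D x"] by linarith+
  then show "norm (T b - T a) \<le> 2 * M * (G b - G a)" "norm (B b - B a) \<le> 2 * M * (G b - G a)"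
    using norm_prim_le_G[OF integrable_KD(1), of "2 * M" a b] norm_prim_le_G[OF integrable_KD(2), of "2 * M" a b]
      is_prim_diff[OF T assms] is_prim_diff[OF B assms] assms by auto
qed

text \<open>For the k that is optimal for the increments, they are bounded by the integral of a norm
  lying below the square root S of the energy density; this is Jensen's inequality. Cauchy-Schwarz
  with weight g leaves \<integral>S^2 / g, and g \<ge> 1 - s costs the factor 1 / (1 - s): slowing
  down raises the energy by no more than this.\<close>

lemma element_density:
  assumes ab: "0 \<le> a" "a \<le> b" "b \<le> L"
  shows "(sqrtQ (norm (T b - T a)) (norm (B b - B a)))\<^sup>2
    \<le> (G b - G a) * ((prim L (\<lambda>x. Qbar (norm (K x)) (norm (D x))) b - prim L (\<lambda>x. Qbar (norm (K x)) (norm (D x))) a) / (1 - s))"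
proof -
  define S where "S x = sqrtQ (norm (K x)) (norm (D x))" for x
  have Q: "Qbar (norm (K x)) (norm (D x)) = (S x)\<^sup>2" for x by (simp add: S_def Qbar_eq_sqrtQ)
  have [measurable]: "S \<in> borel_measurable (leb_int L)" unfolding S_def[abs_def] by measurable
  have S2: "integrable (leb_int L) (\<lambda>x. (S x)\<^sup>2)" using integrable_Qbar[OF sq_KD] unfolding Q .
  have Si: "integrable (leb_int L) S"
    by (rule sq_integrable_imp_integrable) (use S2 in \<open>simp add: sq_integrable_def\<close>)
  have S2g: "(S x)\<^sup>2 / g x \<le> 1 / (1 - s) * (S x)\<^sup>2" if "0 < x" "x < L" for x
    using g_ge[OF that] g_pos[OF that] s by (auto simp: divide_simps intro!: mult_left_mono)
  have S2gi: "integrable (leb_int L) (\<lambda>x. (S x)\<^sup>2 / g x)"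
  proof (rule Bochner_Integration.integrable_bound)
    show "integrable (leb_int L) (\<lambda>x. 1 / (1 - s) * (S x)\<^sup>2)" using S2 by simp
    show "AE x in leb_int L. norm ((S x)\<^sup>2 / g x) \<le> norm (1 / (1 - s) * (S x)\<^sup>2)"
    proof (rule AE_I2)
      fix x assume "x \<in> space (leb_int L)"
      then have x: "0 < x" "x < L" by auto
      have "norm ((S x)\<^sup>2 / g x) = (S x)\<^sup>2 / g x" using g_pos[OF x] by simp
      also have "\<dots> \<le> 1 / (1 - s) * (S x)\<^sup>2" by (rule S2g[OF x])
      also have "\<dots> \<le> norm (1 / (1 - s) * (S x)\<^sup>2)" unfolding real_norm_def by (rule abs_ge_self)
      finally show "norm ((S x)\<^sup>2 / g x) \<le> norm (1 / (1 - s) * (S x)\<^sup>2)" .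
    qed
  qed measurable
  define k where "k = opt_k (norm (T b - T a)) (norm (B b - B a))"
  have k: "0 \<le> k" "k \<le> 1" unfolding k_def by (rule opt_k_bounds)+
  have k2: "0 \<le> 1 - k\<^sup>2" using k by (simp add: power_le_one)
  note n = integrable_norm[OF integrable_KD(1)] integrable_norm[OF integrable_KD(2)]
  have "sqrtQ (norm (T b - T a)) (norm (B b - B a)) = (1 - k\<^sup>2) * norm (T b - T a) + 2 * k * norm (B b - B a)"
    by (simp add: sqrtQ_def k_def)
  also have "\<dots> \<le> (1 - k\<^sup>2) * (prim L (\<lambda>x. norm (K x)) b - prim L (\<lambda>x. norm (K x)) a)
      + 2 * k * (prim L (\<lambda>x. norm (D x)) b - prim L (\<lambda>x. norm (D x)) a)"
    using norm_prim_diff_le[OF integrable_KD(1) ab(2)] norm_prim_diff_le[OF integrable_KD(2) ab(2)] k k2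
    by (intro add_mono mult_left_mono) (auto simp: is_prim_diff[OF T ab] is_prim_diff[OF B ab])
  also have "\<dots> = prim L (\<lambda>x. (1 - k\<^sup>2) * norm (K x) + 2 * k * norm (D x)) b
      - prim L (\<lambda>x. (1 - k\<^sup>2) * norm (K x) + 2 * k * norm (D x)) a"
  proof -
    have "prim L (\<lambda>x. (1 - k\<^sup>2) * norm (K x) + 2 * k * norm (D x)) y
        = (1 - k\<^sup>2) * prim L (\<lambda>x. norm (K x)) y + 2 * k * prim L (\<lambda>x. norm (D x)) y" for y
      using n by (subst prim_add) (simp_all only: prim_mult integrable_mult_right)
    then show ?thesis by (simp add: right_diff_distrib)
  qed
  also have "\<dots> \<le> prim L S b - prim L S a"
  proof (rule prim_diff_mono_AE)
    show "AE x in leb_int L. a < x \<longrightarrow> x \<le> b \<longrightarrow> (1 - k\<^sup>2) * norm (K x) + 2 * k * norm (D x) \<le> S x"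
      using sqrtQ_ge[OF k, of "norm (K _)" "norm (D _)"] by (simp add: S_def)
  qed (use n Si ab in auto)
  finally have "(sqrtQ (norm (T b - T a)) (norm (B b - B a)))\<^sup>2 \<le> (prim L S b - prim L S a)\<^sup>2"
    by (intro power_mono) (auto simp: sqrtQ_bounds)
  also have "\<dots> \<le> (prim L (\<lambda>x. (S x)\<^sup>2 / g x) b - prim L (\<lambda>x. (S x)\<^sup>2 / g x) a) * (G b - G a)"
    by (rule prim_Cauchy_Schwarz[OF _ integrable_g g_pos S2gi ab(2) Si]) auto
  also have "\<dots> \<le> (prim L (\<lambda>x. 1 / (1 - s) * (S x)\<^sup>2) b - prim L (\<lambda>x. 1 / (1 - s) * (S x)\<^sup>2) a) * (G b - G a)"
    using S2gi S2 S2g ab G_mono[OF ab]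
    by (intro mult_right_mono prim_diff_mono_AE) (auto intro!: AE_I2)
  finally show ?thesis
    unfolding Q prim_mult[OF S2] by (simp add: diff_divide_distrib mult.commute)
qed

text \<open>The defect of the trapezoidal rule for \<open>T\<close> in the new parameter; it vanishes if the derivative of
  \<open>T\<close> with respect to that parameter is the constant \<open>c\<close>.\<close>

lemma element_defect:
  fixes c :: "real^3"
  assumes ab: "0 \<le> a" "a \<le> b" "b \<le> L" and c: "norm c \<le> 2 * M"
  defines "d \<equiv> prim L (\<lambda>x. g x *\<^sub>R T x) b - prim L (\<lambda>x. g x *\<^sub>R T x) a - ((G b - G a) / 2) *\<^sub>R (T a + T b)"
    and "q \<equiv> (\<lambda>x. (norm (K x - g x *\<^sub>R c))\<^sup>2 / g x)"
  shows "(norm d)\<^sup>2 \<le> 9 / 4 * (G b - G a)^3 * (prim L q b - prim L q a)"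
proof -
  define \<eta> where "\<eta> = G b - G a"
  have \<eta>0: "0 \<le> \<eta>" using G_mono[OF ab] by (simp add: \<eta>_def)
  define f where "f x = K x - g x *\<^sub>R c" for x
  have gc: "integrable (leb_int L) (\<lambda>x. g x *\<^sub>R c)" using integrable_g by simp
  have f: "integrable (leb_int L) f" unfolding f_def using integrable_KD(1) gc by simp
  have [measurable]: "f \<in> borel_measurable (leb_int L)" using f by (rule borel_measurable_integrable)
  have pgc: "prim L (\<lambda>x. g x *\<^sub>R c) x = G x *\<^sub>R c" for x and c :: "real^3"
    using prim_bounded_linear[OF bounded_linear_scaleR_left integrable_g, of c x] .
  \<comment> \<open>The deviation of T from the affine function with slope c in the parameter G. The
    trapezoidal rule is exact on affine functions, so the defect depends on r alone.\<close>
  define r where "r x = T x - T a - (G x - G a) *\<^sub>R c" for x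
  define \<rho> where "\<rho> = prim L (\<lambda>x. norm (f x)) b - prim L (\<lambda>x. norm (f x)) a"
  have r: "norm (r x) \<le> \<rho>" if "a \<le> x" "x \<le> b" for x
  proof -
    have "r x = prim L f x - prim L f a"
      using is_prim_diff[OF T, of a x] that ab
      unfolding f_def prim_minus[OF integrable_KD(1) gc] pgc r_def by (simp add: scaleR_diff_left)
    then have "norm (r x) \<le> prim L (\<lambda>x. norm (f x)) x - prim L (\<lambda>x. norm (f x)) a"
      using norm_prim_diff_le[OF f that(1)] by simp
    also have "\<dots> \<le> \<rho>" unfolding \<rho>_def
      using prim_mono[OF integrable_norm[OF f] _ that(2)] by simp
    finally show ?thesis .
  qed
  have rb: "T b = T a + \<eta> *\<^sub>R c + r b" by (simp add: r_def \<eta>_def)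
  have cT: "continuous_on {0..L} T" by (rule is_prim_continuous[OF T])
  have cr: "continuous_on {0..L} r" unfolding r_def by (intro continuous_intros cT continuous_G)
  have gr: "integrable (leb_int L) (\<lambda>x. g x *\<^sub>R r x)" by (rule integrable_mult_continuous[OF integrable_g cr])
  have gT: "integrable (leb_int L) (\<lambda>x. g x *\<^sub>R T x)" by (rule integrable_mult_continuous[OF integrable_g cT])
  have gG: "integrable (leb_int L) (\<lambda>x. g x * (G x - G a))"
    using integrable_mult_continuous[OF integrable_g continuous_on_diff[OF continuous_G continuous_on_const], of "G a"]
    by simp
  have gGc: "integrable (leb_int L) (\<lambda>x. (g x * (G x - G a)) *\<^sub>R c)" using gG by simp
  have gTa: "integrable (leb_int L) (\<lambda>x. g x *\<^sub>R T a)" using integrable_g by simp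
  have "(\<lambda>x. g x *\<^sub>R r x) = (\<lambda>x. (g x *\<^sub>R T x - g x *\<^sub>R T a) - (g x * (G x - G a)) *\<^sub>R c)"
    by (simp add: r_def scaleR_diff_right)
  then have pr: "prim L (\<lambda>x. g x *\<^sub>R r x) x
      = prim L (\<lambda>x. g x *\<^sub>R T x) x - G x *\<^sub>R T a - prim L (\<lambda>x. g x * (G x - G a)) x *\<^sub>R c" for x
    using prim_minus[OF Bochner_Integration.integrable_diff[OF gT gTa] gGc] prim_minus[OF gT gTa]
      prim_bounded_linear[OF bounded_linear_scaleR_left gG, of c] pgc[of "T a"] by simp
  have "prim L (\<lambda>x. g x *\<^sub>R r x) b - prim L (\<lambda>x. g x *\<^sub>R r x) a
     = prim L (\<lambda>x. g x *\<^sub>R T x) b - prim L (\<lambda>x. g x *\<^sub>R T x) a - \<eta> *\<^sub>R T a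
       - (prim L (\<lambda>x. g x * (G x - G a)) b - prim L (\<lambda>x. g x * (G x - G a)) a) *\<^sub>R c"
    unfolding pr \<eta>_def by (simp add: algebra_simps)
  moreover have pG: "prim L (\<lambda>x. g x * (G x - G a)) b - prim L (\<lambda>x. g x * (G x - G a)) a = \<eta>\<^sup>2 / 2"
    unfolding \<eta>_def by (rule prim_times_prim[OF integrable_g continuous_G ab(2,3)])
  moreover have "(\<eta> / 2) *\<^sub>R (T a + T b) = \<eta> *\<^sub>R T a + (\<eta>\<^sup>2 / 2) *\<^sub>R c + (\<eta> / 2) *\<^sub>R r b"
  proof -
    have "(\<eta> / 2) *\<^sub>R (T a + T b)
        = ((\<eta> / 2) *\<^sub>R T a + (\<eta> / 2) *\<^sub>R T a) + (\<eta> / 2) *\<^sub>R (\<eta> *\<^sub>R c) + (\<eta> / 2) *\<^sub>R r b"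
      unfolding rb by (simp only: scaleR_add_right add.assoc)
    also have "(\<eta> / 2) *\<^sub>R T a + (\<eta> / 2) *\<^sub>R T a = \<eta> *\<^sub>R T a"
      by (simp only: scaleR_add_left[symmetric] field_sum_of_halves)
    also have "(\<eta> / 2) *\<^sub>R (\<eta> *\<^sub>R c) = (\<eta>\<^sup>2 / 2) *\<^sub>R c" by (simp add: power2_eq_square)
    finally show ?thesis .
  qed
  ultimately have dr: "d = (prim L (\<lambda>x. g x *\<^sub>R r x) b - prim L (\<lambda>x. g x *\<^sub>R r x) a) - (\<eta> / 2) *\<^sub>R r b"
    unfolding d_def \<eta>_def[symmetric] pG by (simp add: algebra_simps)
  have "norm (prim L (\<lambda>x. g x *\<^sub>R r x) b - prim L (\<lambda>x. g x *\<^sub>R r x) a)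
     \<le> prim L (\<lambda>x. norm (g x *\<^sub>R r x)) b - prim L (\<lambda>x. norm (g x *\<^sub>R r x)) a"
    by (rule norm_prim_diff_le[OF gr ab(2)])
  also have "\<dots> \<le> prim L (\<lambda>x. \<rho> * g x) b - prim L (\<lambda>x. \<rho> * g x) a"
  proof (rule prim_diff_mono_AE)
    show "AE x in leb_int L. a < x \<longrightarrow> x \<le> b \<longrightarrow> norm (g x *\<^sub>R r x) \<le> \<rho> * g x"
    proof (rule AE_I2, intro impI)
      fix x assume x: "x \<in> space (leb_int L)" "a < x" "x \<le> b"
      then have "0 < g x" using g_pos by auto
      then show "norm (g x *\<^sub>R r x) \<le> \<rho> * g x" using r[of x] x by (simp add: mult.commute)
    qed
  qed (rule integrable_norm[OF gr], use integrable_g ab in auto)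
  also have "\<dots> = \<rho> * \<eta>" by (simp add: prim_mult[OF integrable_g] \<eta>_def right_diff_distrib)
  finally have 1: "norm (prim L (\<lambda>x. g x *\<^sub>R r x) b - prim L (\<lambda>x. g x *\<^sub>R r x) a) \<le> \<rho> * \<eta>" .
  have 2: "norm ((\<eta> / 2) *\<^sub>R r b) \<le> \<rho> * \<eta> / 2"
    using mult_left_mono[OF r[OF ab(2) order_refl], of "\<eta> / 2"] \<eta>0 by (simp add: mult.commute)
  \<comment> \<open>One \<rho> \<eta> comes from the integral of r, half of it from the value of r
    at b in the trapezoidal rule; squaring gives the factor 9 / 4.\<close>
  have "norm d \<le> 3 / 2 * \<eta> * \<rho>"
    using order_trans[OF norm_triangle_ineq4 add_mono[OF 1 2]] unfolding dr by (simp add: mult.commute mult.left_commute)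
  then have "(norm d)\<^sup>2 \<le> (3 / 2 * \<eta> * \<rho>)\<^sup>2" by (intro power_mono) auto
  also have "\<dots> = 9 / 4 * \<eta>\<^sup>2 * \<rho>\<^sup>2" by (simp add: power_mult_distrib power_divide)
  finally have 3: "(norm d)\<^sup>2 \<le> 9 / 4 * \<eta>\<^sup>2 * \<rho>\<^sup>2" .
  have "\<rho>\<^sup>2 \<le> (prim L q b - prim L q a) * \<eta>"
    unfolding \<rho>_def q_def f_def[symmetric] \<eta>_def
  proof (rule prim_Cauchy_Schwarz[OF _ integrable_g g_pos _ ab(2) integrable_norm[OF f]])
    show "integrable (leb_int L) (\<lambda>x. (norm (f x))\<^sup>2 / g x)"
    proof (rule Bochner_Integration.integrable_bound)
      show "integrable (leb_int L) (\<lambda>x. (4 * M)\<^sup>2 * g x)" using integrable_g by simp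
      show "AE x in leb_int L. norm ((norm (f x))\<^sup>2 / g x) \<le> norm ((4 * M)\<^sup>2 * g x)"
      proof (rule AE_I2)
        fix x assume "x \<in> space (leb_int L)"
        then have x: "0 < x" "x < L" by auto
        note gp = g_pos[OF x]
        have "norm (f x) \<le> norm (K x) + g x * norm c"
          unfolding f_def using norm_triangle_ineq4[of "K x" "g x *\<^sub>R c"] gp by simp
        also have "\<dots> \<le> 2 * M * g x + g x * (2 * M)"
          using KD_le[OF x] norm_ge_zero[of "D x"] mult_left_mono[OF c, of "g x"] gp by linarith
        finally have "(norm (f x))\<^sup>2 \<le> (4 * M * g x)\<^sup>2" by (intro power_mono) (auto simp: algebra_simps)
        then have "(norm (f x))\<^sup>2 / g x \<le> (4 * M)\<^sup>2 * g x"
          using gp by (simp add: divide_le_eq power_mult_distrib power2_eq_square[of "g x"] mult.assoc)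
        then show "norm ((norm (f x))\<^sup>2 / g x) \<le> norm ((4 * M)\<^sup>2 * g x)" using gp by simp
      qed
    qed measurable
  qed measurable
  then have "9 / 4 * \<eta>\<^sup>2 * \<rho>\<^sup>2 \<le> 9 / 4 * \<eta>\<^sup>2 * ((prim L q b - prim L q a) * \<eta>)"
    by (intro mult_left_mono) auto
  also have "\<dots> = 9 / 4 * \<eta>^3 * (prim L q b - prim L q a)"
    by (simp add: power2_eq_square power3_eq_cube)
  finally show ?thesis using 3 unfolding \<eta>_def by linarith
qed

text \<open>With \<eta> = G b - G a, the integral contributes 2 M \<eta>^2 and the trapezoidal rule
  M \<eta>^2, both by Lipschitz continuity in G. \<open>element_defect\<close> yields smallness only
  after summation; this bound holds on each element separately and controls the penalty
  terms.\<close>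

lemma element_defect_crude:
  assumes ab: "0 \<le> a" "a \<le> b" "b \<le> L"
  shows "norm (prim L (\<lambda>x. g x *\<^sub>R T x) b - prim L (\<lambda>x. g x *\<^sub>R T x) a - ((G b - G a) / 2) *\<^sub>R (T a + T b))
    \<le> 3 * M * (G b - G a)\<^sup>2"
proof -
  define \<eta> where "\<eta> = G b - G a"
  have \<eta>0: "0 \<le> \<eta>" using G_mono[OF ab] by (simp add: \<eta>_def)
  have cT: "continuous_on {0..L} T" by (rule is_prim_continuous[OF T])
  have gT: "integrable (leb_int L) (\<lambda>x. g x *\<^sub>R T x)" by (rule integrable_mult_continuous[OF integrable_g cT])
  have gTa: "integrable (leb_int L) (\<lambda>x. g x *\<^sub>R T a)" using integrable_g by simp
  have gd: "integrable (leb_int L) (\<lambda>x. g x *\<^sub>R T x - g x *\<^sub>R T a)" using gT gTa by simp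
  have pg: "prim L (\<lambda>x. g x *\<^sub>R T a) x = G x *\<^sub>R T a" for x
    using prim_bounded_linear[OF bounded_linear_scaleR_left integrable_g, of "T a" x] .
  have "norm (prim L (\<lambda>x. g x *\<^sub>R T x - g x *\<^sub>R T a) b - prim L (\<lambda>x. g x *\<^sub>R T x - g x *\<^sub>R T a) a)
    \<le> prim L (\<lambda>x. norm (g x *\<^sub>R T x - g x *\<^sub>R T a)) b - prim L (\<lambda>x. norm (g x *\<^sub>R T x - g x *\<^sub>R T a)) a"
    by (rule norm_prim_diff_le[OF gd ab(2)])
  also have "\<dots> \<le> prim L (\<lambda>x. (2 * M * \<eta>) * g x) b - prim L (\<lambda>x. (2 * M * \<eta>) * g x) a"
  proof (rule prim_diff_mono_AE)
    show "AE x in leb_int L. a < x \<longrightarrow> x \<le> b \<longrightarrow> norm (g x *\<^sub>R T x - g x *\<^sub>R T a) \<le> (2 * M * \<eta>) * g x"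
    proof (rule AE_I2, intro impI)
      fix x assume x: "x \<in> space (leb_int L)" "a < x" "x \<le> b"
      then have gp: "0 < g x" using g_pos by auto
      have "norm (T x - T a) \<le> 2 * M * (G x - G a)" using frame_Lipschitz(1)[of a x] ab x by simp
      also have "\<dots> \<le> 2 * M * \<eta>" using G_mono[of x b] x ab M by (simp add: \<eta>_def)
      finally have "g x * norm (T x - T a) \<le> g x * (2 * M * \<eta>)" using gp by simp
      moreover have "norm (g x *\<^sub>R T x - g x *\<^sub>R T a) = g x * norm (T x - T a)"
        using gp by (simp flip: scaleR_diff_right)
      ultimately show "norm (g x *\<^sub>R T x - g x *\<^sub>R T a) \<le> (2 * M * \<eta>) * g x" by (simp add: mult.commute)
    qed
  qed (use gd integrable_g ab in auto)
  also have "\<dots> = 2 * M * \<eta> * \<eta>" by (simp add: prim_mult[OF integrable_g] \<eta>_def right_diff_distrib)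
  finally have 1: "norm (prim L (\<lambda>x. g x *\<^sub>R T x) b - prim L (\<lambda>x. g x *\<^sub>R T x) a - \<eta> *\<^sub>R T a) \<le> 2 * M * \<eta> * \<eta>"
    unfolding prim_minus[OF gT gTa] pg by (simp add: \<eta>_def algebra_simps)
  have 2: "norm ((\<eta> / 2) *\<^sub>R (T b - T a)) \<le> M * \<eta> * \<eta>"
    using mult_left_mono[OF frame_Lipschitz(1)[OF ab], of "\<eta> / 2"] \<eta>0 by (simp add: \<eta>_def mult.commute mult.left_commute)
  have "prim L (\<lambda>x. g x *\<^sub>R T x) b - prim L (\<lambda>x. g x *\<^sub>R T x) a - (\<eta> / 2) *\<^sub>R (T a + T b)
    = (prim L (\<lambda>x. g x *\<^sub>R T x) b - prim L (\<lambda>x. g x *\<^sub>R T x) a - \<eta> *\<^sub>R T a) - (\<eta> / 2) *\<^sub>R (T b - T a)"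
  proof -
    have hh: "\<eta> *\<^sub>R T a = (\<eta> / 2) *\<^sub>R T a + (\<eta> / 2) *\<^sub>R T a"
      by (simp only: scaleR_add_left[symmetric] field_sum_of_halves)
    show ?thesis by (simp only: scaleR_add_right scaleR_diff_right hh) simp
  qed
  then have "norm (prim L (\<lambda>x. g x *\<^sub>R T x) b - prim L (\<lambda>x. g x *\<^sub>R T x) a - (\<eta> / 2) *\<^sub>R (T a + T b))
    \<le> 2 * M * \<eta> * \<eta> + M * \<eta> * \<eta>"
    using norm_triangle_ineq4 1 2 by (smt (verit))
  then show ?thesis by (simp add: \<eta>_def power2_eq_square)
qed

text \<open>As T x \<bullet> D x = 0 a.e., T a may be replaced by T a - T x, which is of order G b -
  G a; integrating D over the arc gives the second such factor. After division by the element length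
  an error of order h remains.\<close>

lemma element_orthogonality:
  assumes ab: "0 \<le> a" "a \<le> b" "b \<le> L"
  shows "\<bar>T a \<bullet> (B b - B a)\<bar> \<le> 4 * M\<^sup>2 * (G b - G a)\<^sup>2"
proof -
  define \<eta> where "\<eta> = G b - G a"
  have \<eta>0: "0 \<le> \<eta>" using G_mono[OF ab] by (simp add: \<eta>_def)
  have TD: "integrable (leb_int L) (\<lambda>x. T a \<bullet> D x)" using integrable_KD(2) by simp
  have "T a \<bullet> (B b - B a) = prim L (\<lambda>x. T a \<bullet> D x) b - prim L (\<lambda>x. T a \<bullet> D x) a"
    unfolding is_prim_diff[OF B ab] prim_bounded_linear[OF bounded_linear_inner_right integrable_KD(2)]
    by (simp add: inner_diff_right)
  then have "\<bar>T a \<bullet> (B b - B a)\<bar> \<le> prim L (\<lambda>x. norm (T a \<bullet> D x)) b - prim L (\<lambda>x. norm (T a \<bullet> D x)) a"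
    using norm_prim_diff_le[OF TD ab(2)] by simp
  also have "\<dots> \<le> prim L (\<lambda>x. (4 * M\<^sup>2 * \<eta>) * g x) b - prim L (\<lambda>x. (4 * M\<^sup>2 * \<eta>) * g x) a"
  proof (rule prim_diff_mono_AE)
    show "AE x in leb_int L. a < x \<longrightarrow> x \<le> b \<longrightarrow> norm (T a \<bullet> D x) \<le> (4 * M\<^sup>2 * \<eta>) * g x"
      using orth(2) AE_space
    proof (eventually_elim, intro impI)
      fix x assume o: "T x \<bullet> D x = 0" and x: "x \<in> space (leb_int L)" "a < x" "x \<le> b"
      have "norm (T x - T a) \<le> 2 * M * (G x - G a)" using frame_Lipschitz(1)[of a x] ab x by simp
      also have "\<dots> \<le> 2 * M * \<eta>" using G_mono[of x b] x ab M by (simp add: \<eta>_def)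
      finally have 1: "norm (T x - T a) \<le> 2 * M * \<eta>" .
      have "norm (K x) + norm (D x) \<le> 2 * M * g x" using KD_le[of x] x by simp
      then have 2: "norm (D x) \<le> 2 * M * g x" using norm_ge_zero[of "K x"] by linarith
      have "\<bar>T a \<bullet> D x\<bar> = \<bar>(T x - T a) \<bullet> D x\<bar>" using o by (simp add: inner_diff_left)
      also have "\<dots> \<le> norm (T x - T a) * norm (D x)" by (rule Cauchy_Schwarz_ineq2)
      also have "\<dots> \<le> (2 * M * \<eta>) * (2 * M * g x)" using 1 2 \<eta>0 M by (intro mult_mono) auto
      finally show "norm (T a \<bullet> D x) \<le> (4 * M\<^sup>2 * \<eta>) * g x" by (simp add: power2_eq_square algebra_simps)
    qed
  qed (use TD integrable_g ab in auto)
  also have "\<dots> = 4 * M\<^sup>2 * \<eta> * \<eta>" by (simp add: prim_mult[OF integrable_g] \<eta>_def right_diff_distrib)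
  finally show ?thesis by (simp add: \<eta>_def power2_eq_square algebra_simps)
qed

text \<open>The derivative K / g of T in the new parameter is bounded by 2 M, hence an a.e. limit of
  continuous functions with the same bound. The integral is its squared distance to k, weighted by
  g, and tends to 0 by domination. Continuity of k is what later allows freezing its value on a
  small element.\<close>

lemma density_approx:
  assumes "0 < \<epsilon>"
  obtains k :: "real \<Rightarrow> real^3" where "continuous_on UNIV k" "\<And>x. norm (k x) \<le> 2 * M"
    "integrable (leb_int L) (\<lambda>x. (norm (K x - g x *\<^sub>R k x))\<^sup>2 / g x)"
    "(\<integral>x. (norm (K x - g x *\<^sub>R k x))\<^sup>2 / g x \<partial>leb_int L) \<le> \<epsilon>"
proof -
  define R where "R = 2 * M"
  have R: "0 < R" using M by (simp add: R_def)
  define f where "f x = (1 / g x) *\<^sub>R K x" for x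
  have fR: "norm (f x) \<le> R" if "0 < x" "x < L" for x
  proof -
    have "norm (K x) \<le> 2 * M * g x" using KD_le[OF that] norm_ge_zero[of "D x"] by linarith
    then show ?thesis using g_pos[OF that] by (simp add: f_def R_def divide_le_eq)
  qed
  have [measurable]: "f \<in> borel_measurable (leb_int L)" unfolding f_def[abs_def] by measurable
  have "(\<lambda>x. if x \<in> {0<..<L} then f x else 0) \<in> borel_measurable lebesgue"
    by (rule borel_measurable_if_I) auto
  then have "(\<lambda>x. if x \<in> {0<..<L} then f x else 0) measurable_on UNIV"
    by (rule lebesgue_measurable_imp_measurable_on) auto
  then obtain N c where N: "negligible N" and cc: "\<And>n. continuous_on UNIV (c n)"
    and cl: "\<And>x. x \<notin> N \<Longrightarrow> (\<lambda>n. c n x) \<longlonglongrightarrow> (if x \<in> {0<..<L} then f x else 0)"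
    unfolding measurable_on_def by auto
  \<comment> \<open>The radial retraction onto the ball of radius R: continuous, the identity on the
    values of f in (0, L), and the source of a dominating function.\<close>
  define clip where "clip v = (R / max R (norm v)) *\<^sub>R v" for v :: "real^3"
  have clipR: "norm (clip v) \<le> R" for v
    using R by (auto simp: clip_def max_def divide_le_eq)
  have clip_id: "clip v = v" if "norm v \<le> R" for v using that R by (auto simp: clip_def max_def)
  have mx: "max R (norm v) \<noteq> 0" for v :: "real^3" using R by (auto simp: max_def)
  have clipc: "continuous_on UNIV clip" unfolding clip_def[abs_def] using mx by (intro continuous_intros) auto
  define k where "k n x = clip (c n x)" for n x
  have kc: "continuous_on UNIV (k n)" for n
    unfolding k_def[abs_def] using continuous_on_compose2[OF clipc cc] by auto
  have [measurable]: "k n \<in> borel_measurable (leb_int L)" for n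
    by (rule borel_measurable_leb_int_continuous[OF continuous_on_subset[OF kc]]) simp
  have ae: "AE x in leb_int L. x \<notin> N"
  proof (subst AE_restrict_space_iff)
    have "AE x in lebesgue. x \<notin> N" using N by (simp add: negligible_iff_null_sets AE_not_in)
    then show "AE x in lebesgue. x \<in> {0<..<L} \<longrightarrow> x \<notin> N" by eventually_elim simp
  qed auto
  have kl: "(\<lambda>n. k n x) \<longlonglongrightarrow> f x" if "x \<notin> N" "0 < x" "x < L" for x
  proof -
    have "(\<lambda>n. clip (c n x)) \<longlonglongrightarrow> clip (f x)"
      using cl[OF that(1)] that clipc by (intro isCont_tendsto_compose[of _ clip]) (auto simp: continuous_on_eq_continuous_at)
    then show ?thesis using clip_id[OF fR[OF that(2,3)]] by (simp add: k_def)
  qed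
  \<comment> \<open>The integrand is g |K / g - v|^2; the weight g is the density of the change of
    parameter.\<close>
  have rew: "(norm (K x - g x *\<^sub>R v))\<^sup>2 / g x = g x * (norm (f x - v))\<^sup>2" if "0 < x" "x < L" for x v
  proof -
    have gp: "0 < g x" by (rule g_pos[OF that])
    then have "K x - g x *\<^sub>R v = g x *\<^sub>R (f x - v)" by (simp add: f_def scaleR_diff_right)
    then have "norm (K x - g x *\<^sub>R v) = g x * norm (f x - v)" using gp by simp
    then show ?thesis using gp by (simp add: power2_eq_square)
  qed
  have bd: "\<bar>(norm (K x - g x *\<^sub>R k n x))\<^sup>2 / g x\<bar> \<le> (2 * R)\<^sup>2 * g x" if "0 < x" "x < L" for x n
  proof -
    have "norm (f x - k n x) \<le> 2 * R"
      using norm_triangle_ineq4[of "f x" "k n x"] fR[OF that] clipR[of "c n x"] by (simp add: k_def)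
    then have "(norm (f x - k n x))\<^sup>2 \<le> (2 * R)\<^sup>2" by (intro power_mono) auto
    then show ?thesis unfolding rew[OF that] using g_pos[OF that] by (simp add: abs_mult)
  qed
  have int: "integrable (leb_int L) (\<lambda>x. (norm (K x - g x *\<^sub>R k n x))\<^sup>2 / g x)" for n
  proof (rule Bochner_Integration.integrable_bound)
    show "integrable (leb_int L) (\<lambda>x. (2 * R)\<^sup>2 * g x)" using integrable_g by simp
    show "AE x in leb_int L. norm ((norm (K x - g x *\<^sub>R k n x))\<^sup>2 / g x) \<le> norm ((2 * R)\<^sup>2 * g x)"
      using bd by (intro AE_I2) (auto intro: order_trans[OF _ abs_ge_self])
  qed measurable
  have "(\<lambda>n. \<integral>x. (norm (K x - g x *\<^sub>R k n x))\<^sup>2 / g x \<partial>leb_int L) \<longlonglongrightarrow> (\<integral>x. 0 \<partial>leb_int L)"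
  proof (rule integral_dominated_convergence[where w = "\<lambda>x. (2 * R)\<^sup>2 * g x"])
    show "AE x in leb_int L. (\<lambda>n. (norm (K x - g x *\<^sub>R k n x))\<^sup>2 / g x) \<longlonglongrightarrow> 0"
      using ae AE_space
    proof eventually_elim
      case (elim x)
      then have x: "0 < x" "x < L" by auto
      have "(\<lambda>n. g x * (norm (f x - k n x))\<^sup>2) \<longlonglongrightarrow> g x * (norm (f x - f x))\<^sup>2"
        by (intro tendsto_intros kl[OF elim(1) x])
      then show ?case unfolding rew[OF x] by simp
    qed
    show "AE x in leb_int L. norm ((norm (K x - g x *\<^sub>R k n x))\<^sup>2 / g x) \<le> (2 * R)\<^sup>2 * g x" for n
      using bd by (intro AE_I2) auto
  qed (use integrable_g in auto)
  then have "\<forall>\<^sub>F n in sequentially. (\<integral>x. (norm (K x - g x *\<^sub>R k n x))\<^sup>2 / g x \<partial>leb_int L) < \<epsilon>"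
    using assms by (intro order_tendstoD) auto
  then obtain n where "(\<integral>x. (norm (K x - g x *\<^sub>R k n x))\<^sup>2 / g x \<partial>leb_int L) < \<epsilon>"
    by (auto simp: eventually_sequentially)
  then show ?thesis using that[OF kc[of n] _ int[of n]] clipR by (auto simp: k_def R_def)
qed

end

text \<open>The Gram operator A may be singular, as for a straight or a planar curve. Its kernel
  consists of the v with v \<bullet> w = 0 a.e., and the moment of any e against w is orthogonal to
  all of these, hence lies in the range. The right inverse J and its bound b depend on T alone, so M
  can be chosen afterwards, large enough to make e and with it the correction small.\<close>

lemma slowed_frame_exists:
  assumes L: "0 < L" and s: "0 < s" "s \<le> 1 / 2"
    and Y: "is_prim L Y T" and T: "is_prim L T K" and B: "is_prim L B D"
    and unit: "\<And>x. x \<in> {0..L} \<Longrightarrow> norm (T x) = 1" "\<And>x. x \<in> {0..L} \<Longrightarrow> norm (B x) = 1"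
    and orth: "\<And>x. x \<in> {0..L} \<Longrightarrow> T x \<bullet> B x = 0" "AE x in leb_int L. T x \<bullet> D x = 0"
  obtains M g where "slowed_frame L s M g Y T K B D"
proof -
  note sq = is_prim_sq[OF T] is_prim_sq[OF B]
  define \<beta> where "\<beta> x = norm (K x) + norm (D x)" for x
  have \<beta>: "sq_integrable L \<beta>" unfolding \<beta>_def by (intro sq_integrable_add sq_integrable_norm sq)
  have \<beta>0: "0 \<le> \<beta> x" for x by (simp add: \<beta>_def)
  note [measurable] = sq_integrableD(1)[OF \<beta>]
  define C where "C = (\<integral>x. (\<beta> x)\<^sup>2 \<partial>leb_int L)"
  have C0: "0 \<le> C" by (simp add: C_def)
  \<comment> \<open>Pairing 1 with T merges the two integral conditions into a single one in R x
    R^3.\<close>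
  define w where "w x = (1::real, T x)" for x
  have cT: "continuous_on {0..L} T" by (rule is_prim_continuous[OF T])
  have cw: "continuous_on {0..L} w" unfolding w_def by (intro continuous_intros cT)
  have nw: "norm (w x) \<le> 2" if "x \<in> {0..L}" for x
    using norm_Pair_le[of "1::real" "T x"] unit(1)[OF that] by (simp add: w_def)
  define A where "A v = (\<integral>x. (v \<bullet> w x) *\<^sub>R w x \<partial>leb_int L)" for v
  have Ai: "integrable (leb_int L) (\<lambda>x. (v \<bullet> w x) *\<^sub>R w x)" for v
    by (rule integrable_continuous_leb_int) (intro continuous_intros cw)
  have linA: "linear A"
  proof (rule linearI)
    show "A (u + v) = A u + A v" for u v
      unfolding A_def using Ai by (simp add: inner_add_left scaleR_add_left)
    show "A (r *\<^sub>R v) = r *\<^sub>R A v" for r v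
      unfolding A_def by (simp flip: scaleR_scaleR)
  qed
  have Aself: "v \<bullet> A v = (\<integral>x. (v \<bullet> w x)\<^sup>2 \<partial>leb_int L)" for v
    unfolding A_def integral_inner_right[OF Ai, symmetric] by (simp add: power2_eq_square)
  obtain J where J: "linear J" "\<And>v. v \<in> range A \<Longrightarrow> A (J v) = v"
    using linear_exists_right_inverse_on[OF linA subspace_UNIV] by metis
  obtain b where b: "0 < b" "\<And>v. norm (J v) \<le> b * norm v"
    using linear_bounded_pos[OF J(1)] by auto
  \<comment> \<open>The moment of e has norm at most 2 C / M and w has norm at most 2, so |v
    \<bullet> w| \<le> 4 b C / M, which is at most s by this choice. M \<ge> 1 is used to bound e by
    \<beta> and by \<beta>^2 / M.\<close>
  define M where "M = max 1 (4 * b * C / s)"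
  have M: "1 \<le> M" "4 * b * C \<le> s * M" using s by (auto simp: M_def max_def field_simps)
  \<comment> \<open>Arranged such that M (1 + e) \<ge> \<beta>, with e = 0 wherever \<beta> \<le> M;
    the inequality t - 1 \<le> t^2 makes e small in L1 for large M.\<close>
  define e where "e x = max 0 (\<beta> x / M - 1)" for x
  have e0: "0 \<le> e x" for x by (simp add: e_def)
  have e1: "e x \<le> (\<beta> x)\<^sup>2 / M" for x
  proof -
    have "\<beta> x / M - 1 \<le> (\<beta> x / M)\<^sup>2"
    proof -
      have "t - 1 \<le> t\<^sup>2" if "0 \<le> t" for t :: real
        using zero_le_power2[of "t - 1"] that by (simp add: power2_diff)
      then show ?thesis using \<beta>0[of x] M by simp
    qed
    also have "\<dots> = (\<beta> x)\<^sup>2 / M / M" by (simp add: power_divide power2_eq_square)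
    also have "\<dots> \<le> (\<beta> x)\<^sup>2 / M / 1" using M by (intro divide_left_mono) auto
    finally show ?thesis using M by (auto simp: e_def)
  qed
  have [measurable]: "e \<in> borel_measurable (leb_int L)" unfolding e_def[abs_def] by measurable
  have esq: "sq_integrable L e"
  proof (rule sq_integrable_domin[OF \<beta>, where C = 1])
    have "e x \<le> \<beta> x" for x
    proof -
      have "\<beta> x / M \<le> \<beta> x / 1" using M \<beta>0[of x] by (intro divide_left_mono) auto
      then show ?thesis using \<beta>0[of x] by (simp add: e_def)
    qed
    then show "AE x in leb_int L. norm (e x) \<le> 1 * norm (\<beta> x)" using e0 \<beta>0 by simp
  qed measurable
  note ei = sq_integrable_imp_integrable[OF esq]
  have ew: "integrable (leb_int L) (\<lambda>x. e x *\<^sub>R w x)" by (rule integrable_mult_continuous[OF ei cw])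
  define mom where "mom = (\<integral>x. e x *\<^sub>R w x \<partial>leb_int L)"
  have "norm mom \<le> (\<integral>x. norm (e x *\<^sub>R w x) \<partial>leb_int L)" unfolding mom_def by (rule integral_norm_bound)
  also have "\<dots> \<le> (\<integral>x. 2 / M * (\<beta> x)\<^sup>2 \<partial>leb_int L)"
  proof (rule integral_mono)
    show "integrable (leb_int L) (\<lambda>x. 2 / M * (\<beta> x)\<^sup>2)" using sq_integrableD(2)[OF \<beta>] by simp
    fix x assume "x \<in> space (leb_int L)"
    then have "norm (w x) \<le> 2" using nw[of x] by auto
    then have "e x * norm (w x) \<le> (\<beta> x)\<^sup>2 / M * 2" using e0[of x] e1[of x] by (intro mult_mono) auto
    then show "norm (e x *\<^sub>R w x) \<le> 2 / M * (\<beta> x)\<^sup>2" using e0[of x] by (simp add: mult.commute)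
  qed (rule integrable_norm[OF ew])
  also have "\<dots> = 2 / M * C" by (simp add: C_def)
  finally have momle: "norm mom \<le> 2 / M * C" .
  have "mom \<in> range A"
  proof -
    \<comment> \<open>The component z orthogonal to the range satisfies 0 = z \<bullet> A z =
      \<integral>(z \<bullet> w)^2, so it is orthogonal to the moment as well and vanishes.\<close>
    obtain y z where yz: "y \<in> span (range A)" "\<And>v. v \<in> span (range A) \<Longrightarrow> orthogonal z v" "mom = y + z"
      using orthogonal_subspace_decomp_exists[of "range A" mom] by metis
    have sp: "span (range A) = range A"
      using linear_subspace_image[OF linA subspace_UNIV] by (simp add: span_eq_iff)
    have "z \<bullet> A z = 0" using yz(2)[of "A z"] by (auto simp: orthogonal_def sp)
    moreover have "integrable (leb_int L) (\<lambda>x. (z \<bullet> w x)\<^sup>2)"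
      by (rule integrable_continuous_leb_int) (intro continuous_intros cw)
    ultimately have "AE x in leb_int L. (z \<bullet> w x)\<^sup>2 = 0"
      using integral_nonneg_eq_0_iff_AE[of "leb_int L" "\<lambda>x. (z \<bullet> w x)\<^sup>2"] Aself[of z] by simp
    then have "AE x in leb_int L. z \<bullet> (e x *\<^sub>R w x) = 0" by eventually_elim simp
    moreover have "z \<bullet> mom = (\<integral>x. z \<bullet> (e x *\<^sub>R w x) \<partial>leb_int L)"
      unfolding mom_def by (rule integral_inner_right[OF ew, symmetric])
    ultimately have "z \<bullet> mom = 0" by (simp add: integral_eq_zero_AE)
    moreover have "z \<bullet> y = 0" using yz(2)[OF yz(1)] by (simp add: orthogonal_def)
    ultimately have "z = 0" using yz(3) by (simp add: inner_add_right)
    then show ?thesis using yz sp by simp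
  qed
  then have AJ: "A (J mom) = mom" by (rule J(2))
  define v where "v = J mom"
  have vw: "\<bar>v \<bullet> w x\<bar> \<le> s" if "x \<in> {0..L}" for x
  proof -
    have "\<bar>v \<bullet> w x\<bar> \<le> norm v * norm (w x)" by (rule Cauchy_Schwarz_ineq2)
    also have "\<dots> \<le> (b * (2 / M * C)) * 2"
      using b(2)[of mom] mult_left_mono[OF momle, of b] b(1) nw[OF that] C0 M
      by (intro mult_mono) (auto simp: v_def)
    also have "\<dots> = 4 * b * C / M" by simp
    also have "\<dots> \<le> s" using M by (simp add: divide_le_eq)
    finally show ?thesis .
  qed
  define g where "g x = 1 + e x - v \<bullet> w x" for x
  have cvw: "continuous_on {0..L} (\<lambda>x. v \<bullet> w x)" by (intro continuous_intros cw)
  have g: "sq_integrable L g" unfolding g_def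
    by (intro sq_integrable_diff sq_integrable_add esq sq_integrable_continuous[OF cvw])
       (auto intro: sq_integrable_continuous)
  have gw: "(\<integral>x. g x *\<^sub>R w x \<partial>leb_int L) = (\<integral>x. w x \<partial>leb_int L)"
  proof -
    have "(\<lambda>x. g x *\<^sub>R w x) = (\<lambda>x. w x + e x *\<^sub>R w x - (v \<bullet> w x) *\<^sub>R w x)"
      by (simp add: g_def scaleR_add_left scaleR_diff_left)
    then have "(\<integral>x. g x *\<^sub>R w x \<partial>leb_int L) = (\<integral>x. w x \<partial>leb_int L) + mom - A v"
      using integrable_continuous_leb_int[OF cw] ew Ai[of v] by (simp add: mom_def A_def)
    then show ?thesis using AJ by (simp add: v_def)
  qed
  have gwi: "integrable (leb_int L) (\<lambda>x. g x *\<^sub>R w x)"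
    by (rule integrable_mult_continuous[OF sq_integrable_imp_integrable[OF g] cw])
  have "slowed_frame L s M g Y T K B D"
  proof
    show "0 < M" using M by simp
    show "1 - s \<le> g x" if "0 < x" "x < L" for x using vw[of x] e0[of x] that by (auto simp: g_def)
    show "norm (K x) + norm (D x) \<le> 2 * M * g x" if "0 < x" "x < L" for x
    proof -
      have "\<beta> x \<le> M * (1 + e x)" using M by (auto simp: e_def max_def field_simps)
      also have "\<dots> \<le> M * (2 * g x)"
      proof -
        \<comment> \<open>Here s \<le> 1 / 2 enters: the correction takes away at most half of the 1
          in g.\<close>
        have "1 + e x \<le> 2 * g x" using vw[of x] that e0[of x] s by (auto simp: g_def)
        then show ?thesis using M by simp
      qed
      finally show ?thesis by (simp add: \<beta>_def)
    qed
    show "(\<integral>x. g x \<partial>leb_int L) = L"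
    proof -
      have "(\<integral>x. fst (g x *\<^sub>R w x) \<partial>leb_int L) = (\<integral>x. fst (w x) \<partial>leb_int L)"
        using integral_bounded_linear[OF bounded_linear_fst gwi]
          integral_bounded_linear[OF bounded_linear_fst integrable_continuous_leb_int[OF cw]] gw by simp
      then show ?thesis using integral_const_leb_int[of L "1::real"] L by (simp add: w_def)
    qed
    show "(\<integral>x. g x *\<^sub>R T x \<partial>leb_int L) = (\<integral>x. T x \<partial>leb_int L)"
      using integral_bounded_linear[OF bounded_linear_snd gwi]
        integral_bounded_linear[OF bounded_linear_snd integrable_continuous_leb_int[OF cw]] gw by (simp add: w_def[abs_def])
  qed (use assms g in auto)
  then show ?thesis by (rule that)
qed

subsection \<open>Hermite interpolation\<close>

lemma is_prim_has_derivative: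
  fixes f g :: "real \<Rightarrow> 'a::euclidean_space"
  assumes fg: "is_prim L f g" and c: "continuous_on {0..L} g" and x: "x \<in> {0..L}"
  shows "(f has_vector_derivative g x) (at x within {0..L})"
proof -
  obtain F where F: "\<And>x. x \<in> {0..L} \<Longrightarrow> (F has_vector_derivative g x) (at x within {0..L})"
    using antiderivative_continuous[OF c] by metis
  have F': "is_prim L F g" by (rule is_prim_C1[OF F c])
  have "((\<lambda>x. (f 0 - F 0) + F x) has_vector_derivative g x) (at x within {0..L})"
    using F[OF x] by (auto intro!: derivative_eq_intros)
  then show ?thesis
  proof (rule has_vector_derivative_transform[OF x, rotated])
    fix y assume y: "y \<in> {0..L}"
    show "f y = (f 0 - F 0) + F y"
      using is_prim_eq[OF fg y] is_prim_eq[OF F' y] by simp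
  qed
qed

text \<open>\<open>spline_space\<close> asks for monomials in x, whereas the interpolant is built
  from powers of x - X j; the witness lists the coefficients of the re-expansion.\<close>

lemma cubic_shift:
  fixes c :: real
  shows "\<exists>a :: nat \<Rightarrow> real. \<forall>x. A0 + A1 * (x - c) + A2 * (x - c)^2 + A3 * (x - c)^3 = (\<Sum>i\<le>3. a i * x ^ i)"
proof (intro exI[of _ "(!) [A0 - A1 * c + A2 * c^2 - A3 * c^3, A1 - 2 * A2 * c + 3 * A3 * c^2, A2 - 3 * A3 * c, A3]"] allI)
  fix x
  show "A0 + A1 * (x - c) + A2 * (x - c)^2 + A3 * (x - c)^3
    = (\<Sum>i\<le>3. [A0 - A1 * c + A2 * c^2 - A3 * c^3, A1 - 2 * A2 * c + 3 * A3 * c^2, A2 - 3 * A3 * c, A3] ! i * x ^ i)"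
    by (simp add: numeral_eq_Suc algebra_simps power2_eq_square power3_eq_cube)
qed

text \<open>On an element, T is the affine interpolant of the nodal tangents plus the parabola 6
  \<mu> (1 - \<mu>) times \<open>dd j\<close>, where \<mu> is the local coordinate. The parabola
  vanishes at the nodes and has mean 1, so \<open>dd j\<close>, the mismatch between the difference
  quotient of y and the mean tangent, is exactly the coefficient that makes y match its data. In
  this form y'' is the difference quotient of T plus a multiple of a trapezoidal defect.\<close>

lemma hermite_spline:
  fixes Yd Td Bd :: "nat \<Rightarrow> real^3"
  assumes p: "is_partition L N X h" and L: "0 < L"
  defines "H \<equiv> (\<lambda>j. X (Suc j) - X j)"
  defines "dT \<equiv> (\<lambda>j. (1 / H j) *\<^sub>R (Td (Suc j) - Td j))"
    and "dd \<equiv> (\<lambda>j. (1 / H j) *\<^sub>R (Yd (Suc j) - Yd j) - (1 / 2) *\<^sub>R (Td j + Td (Suc j)))"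
    and "dB \<equiv> (\<lambda>j. (1 / H j) *\<^sub>R (Bd (Suc j) - Bd j))"
  obtains y T K b D where "rep L (y, b) y T K b D" "(y, b) \<in> V_h L N X"
    "\<And>j. j \<le> N \<Longrightarrow> y (X j) = Yd j" "\<And>j. j \<le> N \<Longrightarrow> T (X j) = Td j" "\<And>j. j \<le> N \<Longrightarrow> b (X j) = Bd j"
    "\<And>x. x \<in> {0..L} \<Longrightarrow> vector_derivative y (at x within {0..L}) = T x"
    "\<And>j x. j < N \<Longrightarrow> X j < x \<Longrightarrow> x < X (Suc j) \<Longrightarrow> K x = dT j + (6 / H j - 12 * (x - X j) / (H j)\<^sup>2) *\<^sub>R dd j"
    "\<And>j x. j < N \<Longrightarrow> X j < x \<Longrightarrow> x < X (Suc j) \<Longrightarrow>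
       T x = Td j + (x - X j) *\<^sub>R dT j + (6 * (x - X j) / H j - 6 * (x - X j)\<^sup>2 / (H j)\<^sup>2) *\<^sub>R dd j"
    "\<And>j x. j < N \<Longrightarrow> X j < x \<Longrightarrow> x < X (Suc j) \<Longrightarrow> b x = Bd j + (x - X j) *\<^sub>R dB j"
    "\<And>j x. j < N \<Longrightarrow> X j < x \<Longrightarrow> x < X (Suc j) \<Longrightarrow> D x = dB j"
proof -
  have H: "0 < H j" if "j < N" for j using partition_width(1)[OF p that] by (simp add: H_def)
  have X: "0 \<le> X j" "X j \<le> L" if "j \<le> N" for j using partition_bounds[OF p that] by auto
  have X0: "X 0 = 0" using p by (simp add: is_partition_def)
  define PK where "PK j x = dT j + (6 / H j - 12 * (x - X j) / (H j)\<^sup>2) *\<^sub>R dd j" for j x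
  define PT where "PT j x = Td j + (x - X j) *\<^sub>R dT j + (6 * (x - X j) / H j - 6 * (x - X j)\<^sup>2 / (H j)\<^sup>2) *\<^sub>R dd j" for j x
  define PY where "PY j x = Yd j + (x - X j) *\<^sub>R Td j + ((x - X j)\<^sup>2 / 2) *\<^sub>R dT j
     + (3 * (x - X j)\<^sup>2 / H j - 2 * (x - X j)^3 / (H j)\<^sup>2) *\<^sub>R dd j" for j x
  define PB where "PB j x = Bd j + (x - X j) *\<^sub>R dB j" for j x
  have rd: "((\<lambda>x. 6 * (x - c) / a - 6 * (x - c)\<^sup>2 / a\<^sup>2) has_real_derivative 6 / a - 12 * (x - c) / a\<^sup>2) (at x)"
    "((\<lambda>x. (x - c)\<^sup>2 / 2) has_real_derivative (x - c)) (at x)"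
    "((\<lambda>x. 3 * (x - c)\<^sup>2 / a - 2 * (x - c)^3 / a\<^sup>2) has_real_derivative 6 * (x - c) / a - 6 * (x - c)\<^sup>2 / a\<^sup>2) (at x)"
    for a c x :: real
    by (cases "a = 0"; auto intro!: derivative_eq_intros simp: field_simps power2_eq_square)+
  note rdv = rd[THEN has_real_derivative_iff_has_vector_derivative[THEN iffD1]]
  have lin: "((\<lambda>x. (x - c) *\<^sub>R v) has_vector_derivative v) (at x)" for c x and v :: "real^3"
    by (auto intro!: derivative_eq_intros)
  have sc: "((\<lambda>x. f x *\<^sub>R v) has_vector_derivative f' *\<^sub>R v) (at x)"
    if "(f has_vector_derivative f') (at x)" for f :: "real \<Rightarrow> real" and f' x and v :: "real^3"
    by (rule bounded_linear.has_vector_derivative[OF bounded_linear_scaleR_left that])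
  have dPT: "(PT j has_vector_derivative PK j x) (at x)" for j x
  proof -
    have "(PT j has_vector_derivative 0 + dT j + (6 / H j - 12 * (x - X j) / (H j)\<^sup>2) *\<^sub>R dd j) (at x)"
      unfolding PT_def[abs_def]
      by (intro has_vector_derivative_add has_vector_derivative_const lin sc rdv)
    then show ?thesis by (simp add: PK_def)
  qed
  have dPY: "(PY j has_vector_derivative PT j x) (at x)" for j x
  proof -
    have "(PY j has_vector_derivative 0 + Td j + (x - X j) *\<^sub>R dT j + (6 * (x - X j) / H j - 6 * (x - X j)\<^sup>2 / (H j)\<^sup>2) *\<^sub>R dd j) (at x)"
      unfolding PY_def[abs_def]
      by (intro has_vector_derivative_add has_vector_derivative_const lin sc rdv)
    then show ?thesis by (simp add: PT_def)
  qed
  have dPB: "(PB j has_vector_derivative dB j) (at x)" for j x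
  proof -
    have "(PB j has_vector_derivative 0 + dB j) (at x)"
      unfolding PB_def[abs_def] by (intro has_vector_derivative_add has_vector_derivative_const lin)
    then show ?thesis by simp
  qed
  have start: "PT j (X j) = Td j" "PY j (X j) = Yd j" "PB j (X j) = Bd j" for j
    by (simp_all add: PT_def PY_def PB_def)
  have fin: "PT j (X (Suc j)) = Td (Suc j)" "PY j (X (Suc j)) = Yd (Suc j)" "PB j (X (Suc j)) = Bd (Suc j)" if "j < N" for j
  proof -
    have Hj: "X (Suc j) - X j = H j" "H j \<noteq> 0" using H[OF that] by (simp_all add: H_def)
    show "PT j (X (Suc j)) = Td (Suc j)" "PB j (X (Suc j)) = Bd (Suc j)"
      unfolding PT_def PB_def Hj(1) using Hj(2) by (simp_all add: dT_def dB_def)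
    have "PY j (X (Suc j)) = Yd j + H j *\<^sub>R Td j + ((H j)\<^sup>2 / 2) *\<^sub>R dT j + H j *\<^sub>R dd j"
      unfolding PY_def Hj(1) using Hj(2) by (simp add: power2_eq_square power3_eq_cube)
    also have "((H j)\<^sup>2 / 2) *\<^sub>R dT j = (H j / 2) *\<^sub>R Td (Suc j) - (H j / 2) *\<^sub>R Td j"
      using Hj(2) by (simp add: dT_def power2_eq_square scaleR_diff_right)
    also have "H j *\<^sub>R dd j = Yd (Suc j) - Yd j - ((H j / 2) *\<^sub>R Td j + (H j / 2) *\<^sub>R Td (Suc j))"
      using Hj(2) by (simp add: dd_def scaleR_diff_right scaleR_add_right)
    also have "H j *\<^sub>R Td j = (H j / 2) *\<^sub>R Td j + (H j / 2) *\<^sub>R Td j"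
      by (simp only: scaleR_add_left[symmetric] field_sum_of_halves)
    finally show "PY j (X (Suc j)) = Yd (Suc j)" by simp
  qed
  have cPK: "continuous_on UNIV (PK j)" for j
    unfolding PK_def[abs_def] by (cases "H j = 0") (auto intro!: continuous_intros)
  \<comment> \<open>K and D are defined piecewise and then integrated up from the data at 0, so
    \<open>rep\<close> holds by construction; the nodal values follow by induction along the
    mesh.\<close>
  define K where "K = step_fun N X PK"
  define D where "D = step_fun N X (\<lambda>j x. dB j)"
  have K: "sq_integrable L K" unfolding K_def by (rule sq_integrable_step_fun[OF p cPK])
  have D: "sq_integrable L D" unfolding D_def by (rule sq_integrable_step_fun[OF p]) simp
  define T where "T x = Td 0 + prim L K x" for x
  define b where "b x = Bd 0 + prim L D x" for x
  have TK: "is_prim L T K" using K by (simp add: is_prim_def T_def prim_0)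
  have bD: "is_prim L b D" using D by (simp add: is_prim_def b_def prim_0)
  have Tc: "continuous_on {0..L} T" by (rule is_prim_continuous[OF TK])
  define y where "y x = Yd 0 + prim L T x" for x
  have yT: "is_prim L y T" using sq_integrable_continuous[OF Tc] by (simp add: is_prim_def y_def prim_0)
  have elem: "f x - f (X j) = P j x - P j (X j)"
    if fk: "is_prim L f k" and j: "j < N" and x: "X j \<le> x" "x \<le> X (Suc j)"
      and dP: "\<And>z. (P j has_vector_derivative P' j z) (at z)"
      and k: "\<And>z. X j < z \<Longrightarrow> z < X (Suc j) \<Longrightarrow> k z = P' j z"
    for f k :: "real \<Rightarrow> real^3" and j x and P P' :: "nat \<Rightarrow> real \<Rightarrow> real^3"
  proof -
    have b: "0 \<le> X j" "x \<le> L" using X[of j] X[of "Suc j"] j x by auto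
    have "prim L k x - prim L k (X j) = P j x - P j (X j)"
    proof (rule prim_FTC[of _ _ _ "{}"])
      show "(P j has_vector_derivative k z) (at z)" if "z \<in> {X j<..<x} - {}" for z
        using dP[of z] k[of z] that x by simp
      show "continuous_on {X j..x} (P j)"
        using dP by (auto intro!: continuous_at_imp_continuous_on has_vector_derivative_continuous)
    qed (use b x sq_integrable_imp_integrable[OF is_prim_sq[OF fk]] in auto)
    then show ?thesis using is_prim_diff[OF fk b(1) x(1) b(2)] by simp
  qed
  have elemT: "T x - T (X j) = PT j x - PT j (X j)" if "j < N" "X j \<le> x" "x \<le> X (Suc j)" for j x
    by (rule elem[OF TK that, where P = PT and P' = PK])
       (auto simp: dPT K_def intro!: step_fun_eq[OF p that(1)])
  have nT: "T (X j) = Td j" if "j \<le> N" for j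
    using that
  proof (induction j)
    case (Suc j)
    then show ?case using elemT[of j "X (Suc j)"] start[of j] fin[of j] H[of j] by (simp add: H_def)
  qed (simp add: T_def X0 prim_0)
  have Tx: "T x = PT j x" if "j < N" "X j \<le> x" "x \<le> X (Suc j)" for j x
    using elemT[OF that] nT[of j] start[of j] that by simp
  have elemY: "y x - y (X j) = PY j x - PY j (X j)" if "j < N" "X j \<le> x" "x \<le> X (Suc j)" for j x
    by (rule elem[OF yT that, where P = PY and P' = PT]) (auto simp: dPY intro!: Tx that(1))
  have nY: "y (X j) = Yd j" if "j \<le> N" for j
    using that
  proof (induction j)
    case (Suc j)
    then show ?case using elemY[of j "X (Suc j)"] start[of j] fin[of j] H[of j] by (simp add: H_def)
  qed (simp add: y_def X0 prim_0)
  have yx: "y x = PY j x" if "j < N" "X j \<le> x" "x \<le> X (Suc j)" for j x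
    using elemY[OF that] nY[of j] start[of j] that by simp
  have elemB: "b x - b (X j) = PB j x - PB j (X j)" if "j < N" "X j \<le> x" "x \<le> X (Suc j)" for j x
    by (rule elem[OF bD that, where P = PB and P' = "\<lambda>j x. dB j"])
       (auto simp: dPB D_def step_fun_eq[OF p that(1)])
  have nB: "b (X j) = Bd j" if "j \<le> N" for j
    using that
  proof (induction j)
    case (Suc j)
    then show ?case using elemB[of j "X (Suc j)"] start[of j] fin[of j] H[of j] by (simp add: H_def)
  qed (simp add: b_def X0 prim_0)
  have bx: "b x = PB j x" if "j < N" "X j \<le> x" "x \<le> X (Suc j)" for j x
    using elemB[OF that] nB[of j] start[of j] that by simp
  have yd: "(y has_vector_derivative T x) (at x within {0..L})" if "x \<in> {0..L}" for x
    by (rule is_prim_has_derivative[OF yT Tc that])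
  have Vh: "(y, b) \<in> V_h L N X"
    unfolding V_h_def mem_Collect_eq split_conv
  proof (intro allI conjI)
    fix i :: 3
    have comp: "bounded_linear (\<lambda>v :: real^3. v $ i)" by (rule bounded_linear_vec_nth)
    show "(\<lambda>x. y x $ i) \<in> spline_space 3 1 L N X"
      unfolding spline_space_def mem_Collect_eq
    proof (intro conjI allI impI)
      have "((\<lambda>x. y x $ i) has_vector_derivative T x $ i) (at x within {0..L})" if "x \<in> {0..L}" for x
        by (rule bounded_linear.has_vector_derivative[OF comp yd[OF that]])
      moreover have "continuous_on {0..L} (\<lambda>x. T x $ i)" by (intro continuous_intros Tc)
      ultimately show "Ck_on 1 {0..L} (\<lambda>x. y x $ i)" by (auto intro!: exI[of _ "\<lambda>x. T x $ i"])
      fix j assume j: "j < N"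
      obtain a where a: "\<And>x. Yd j $ i + Td j $ i * (x - X j) + (dT j $ i / 2 + 3 * dd j $ i / H j) * (x - X j)^2
          + (- 2 * dd j $ i / (H j)^2) * (x - X j)^3 = (\<Sum>k\<le>3. a k * x ^ k)"
        using cubic_shift by blast
      have "y x $ i = (\<Sum>k\<le>3. a k * x ^ k)" if "x \<in> {X j..X (Suc j)}" for x
      proof -
        have "y x = PY j x" using yx[OF j, of x] that by simp
        then have "y x $ i = PY j x $ i" by simp
        also have "\<dots> = Yd j $ i + Td j $ i * (x - X j) + (dT j $ i / 2 + 3 * dd j $ i / H j) * (x - X j)^2
          + (- 2 * dd j $ i / (H j)^2) * (x - X j)^3"
          by (simp add: PY_def algebra_simps)
        finally show ?thesis unfolding a .
      qed
      then show "\<exists>a. \<forall>x\<in>{X j..X (Suc j)}. y x $ i = (\<Sum>k\<le>3. a k * x ^ k)" by blast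
    qed
    show "(\<lambda>x. b x $ i) \<in> spline_space 1 0 L N X"
      unfolding spline_space_def mem_Collect_eq
    proof (intro conjI allI impI)
      have "continuous_on {0..L} (\<lambda>x. b x $ i)" by (intro continuous_intros is_prim_continuous[OF bD])
      then show "Ck_on 0 {0..L} (\<lambda>x. b x $ i)" by simp
      fix j assume j: "j < N"
      have "b x $ i = (\<Sum>k\<le>1. (if k = 0 then Bd j $ i - X j * dB j $ i else dB j $ i) * x ^ k)"
        if "x \<in> {X j..X (Suc j)}" for x
      proof -
        have "b x = PB j x" using bx[OF j, of x] that by simp
        then have "b x $ i = PB j x $ i" by simp
        then show ?thesis by (simp add: PB_def algebra_simps)
      qed
      then show "\<exists>a. \<forall>x\<in>{X j..X (Suc j)}. b x $ i = (\<Sum>k\<le>1. a k * x ^ k)"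
        by (intro exI[of _ "\<lambda>k. if k = 0 then Bd j $ i - X j * dB j $ i else dB j $ i"] ballI)
    qed
  qed
  show ?thesis
  proof (rule that[OF rep_V[OF yT TK bD] Vh nY nT nB])
    show "vector_derivative y (at x within {0..L}) = T x" if "x \<in> {0..L}" for x
      by (rule vector_derivative_within_closed_interval[OF L that yd[OF that]])
    show "K x = dT j + (6 / H j - 12 * (x - X j) / (H j)\<^sup>2) *\<^sub>R dd j" if "j < N" "X j < x" "x < X (Suc j)" for j x
      unfolding K_def step_fun_eq[OF p that] PK_def ..
    show "T x = Td j + (x - X j) *\<^sub>R dT j + (6 * (x - X j) / H j - 6 * (x - X j)\<^sup>2 / (H j)\<^sup>2) *\<^sub>R dd j"
      if "j < N" "X j < x" "x < X (Suc j)" for j x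
      using Tx[of j x] that by (simp add: PT_def)
    show "b x = Bd j + (x - X j) *\<^sub>R dB j" if "j < N" "X j < x" "x < X (Suc j)" for j x
      using bx[of j x] that by (simp add: PB_def)
    show "D x = dB j" if "j < N" "X j < x" "x < X (Suc j)" for j x
      unfolding D_def step_fun_eq[OF p that] ..
  qed (use L in auto)
qed

lemma AE_not_node:
  fixes X :: "nat \<Rightarrow> real"
  shows "AE x in leb_int L. x \<notin> X ` {..N}"
proof (subst AE_restrict_space_iff)
  have "negligible (X ` {..N})" by (intro negligible_finite) auto
  then have "AE x in lebesgue. x \<notin> X ` {..N}" by (simp add: negligible_iff_null_sets AE_not_in)
  then show "AE x in lebesgue. x \<in> {0<..<L} \<longrightarrow> x \<notin> X ` {..N}" by eventually_elim simp
qed auto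

text \<open>The integral is a telescoping sum of increments of the primitive, each of them computed
  by the fundamental theorem inside one element.\<close>

lemma integral_step_fun_const:
  fixes c :: "nat \<Rightarrow> real"
  assumes p: "is_partition L N X h"
  shows "integrable (leb_int L) (step_fun N X (\<lambda>j x. c j))"
    and "(\<integral>x. step_fun N X (\<lambda>j x. c j) x \<partial>leb_int L) = (\<Sum>j<N. (X (Suc j) - X j) * c j)"
proof -
  show i: "integrable (leb_int L) (step_fun N X (\<lambda>j x. c j))"
    by (rule sq_integrable_imp_integrable, rule sq_integrable_step_fun[OF p]) simp
  have "prim L (step_fun N X (\<lambda>j x. c j)) (X (Suc j)) - prim L (step_fun N X (\<lambda>j x. c j)) (X j)
      = (X (Suc j) - X j) * c j" if j: "j < N" for j
  proof -
    have "prim L (step_fun N X (\<lambda>j x. c j)) (X (Suc j)) - prim L (step_fun N X (\<lambda>j x. c j)) (X j)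
      = c j * X (Suc j) - c j * X j"
    proof (rule prim_FTC[of _ _ _ "{}"])
      show "((\<lambda>x. c j * x) has_vector_derivative step_fun N X (\<lambda>j x. c j) z) (at z)"
        if "z \<in> {X j<..<X (Suc j)} - {}" for z
        using that step_fun_eq[OF p j, of z "\<lambda>j x. c j"]
        by (auto intro!: derivative_eq_intros simp flip: has_real_derivative_iff_has_vector_derivative)
      show "continuous_on {X j..X (Suc j)} (\<lambda>x. c j * x)" by (intro continuous_intros)
    qed (use partition_bounds[OF p] partition_width[OF p j] j i in auto)
    then show ?thesis by (simp add: algebra_simps)
  qed
  then have "(\<Sum>j<N. (X (Suc j) - X j) * c j)
      = (\<Sum>j<N. prim L (step_fun N X (\<lambda>j x. c j)) (X (Suc j)) - prim L (step_fun N X (\<lambda>j x. c j)) (X j))"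
    by simp
  also have "\<dots> = prim L (step_fun N X (\<lambda>j x. c j)) (X N) - prim L (step_fun N X (\<lambda>j x. c j)) (X 0)"
    by (rule sum_lessThan_telescope)
  finally show "(\<integral>x. step_fun N X (\<lambda>j x. c j) x \<partial>leb_int L) = (\<Sum>j<N. (X (Suc j) - X j) * c j)"
    using p by (simp add: is_partition_def prim_0 prim_L)
qed

lemma sqrtQ_scale:
  assumes "0 < c" shows "sqrtQ (c * a) (c * b) = c * sqrtQ a b"
proof -
  have "max (c * \<bar>a\<bar>) (c * \<bar>b\<bar>) = c * max \<bar>a\<bar> \<bar>b\<bar>"
    using assms by (simp add: max_mult_distrib_left)
  then have "opt_k (c * a) (c * b) = opt_k a b" using assms by (simp add: opt_k_def abs_mult)
  then show ?thesis using assms by (simp add: sqrtQ_def abs_mult algebra_simps)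
qed

subsection \<open>Recovery of a frame by discrete frames\<close>

context slowed_frame
begin

text \<open>Preimages of the mesh under the new parameter: G maps [0, L] onto itself by continuity
  and is strictly increasing since g \<ge> 1 - s > 0, which also fixes the end points.\<close>

lemma nodes:
  assumes p: "is_partition L N X h"
  obtains \<xi> where "\<And>j. j \<le> N \<Longrightarrow> 0 \<le> \<xi> j \<and> \<xi> j \<le> L \<and> G (\<xi> j) = X j" "\<xi> 0 = 0" "\<xi> N = L"
    "\<And>j. j < N \<Longrightarrow> \<xi> j \<le> \<xi> (Suc j)"
proof -
  have "\<exists>x. 0 \<le> x \<and> x \<le> L \<and> G x = X j" if "j \<le> N" for j
    using IVT'[of G 0 "X j" L] partition_bounds[OF p that] G_ends continuous_G L by auto
  then obtain \<xi> where \<xi>: "\<And>j. j \<le> N \<Longrightarrow> 0 \<le> \<xi> j \<and> \<xi> j \<le> L \<and> G (\<xi> j) = X j" by metis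
  have le: "a \<le> b" if "0 \<le> a" "a \<le> L" "0 \<le> b" "b \<le> L" "G a \<le> G b" for a b
  proof (rule ccontr)
    assume "\<not> a \<le> b"
    then have "0 < (1 - s) * (a - b)" using s by simp
    then show False using G_diff_ge[of b a] that \<open>\<not> a \<le> b\<close> by simp
  qed
  have "\<xi> 0 = 0"
    using \<xi>[of 0] le[of "\<xi> 0" 0] G_ends L p by (simp add: is_partition_def)
  moreover have "\<xi> N = L"
    using \<xi>[of N] le[of L "\<xi> N"] G_ends L p by (simp add: is_partition_def)
  moreover have "\<xi> j \<le> \<xi> (Suc j)" if "j < N" for j
    using \<xi>[of j] \<xi>[of "Suc j"] le[of "\<xi> j" "\<xi> (Suc j)"] partition_width(1)[OF p that] that by simp
  ultimately show ?thesis using that \<xi> by blast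
qed

text \<open>On each element k is frozen at the left end of its preimage, which has length at most h
  / (1 - s) \<le> 2 h, so freezing costs at most \<omega> pointwise. The inequality (a + b)^2 \<le>
  2 a^2 + 2 b^2 separates this from the approximation error, and both bounds telescope.\<close>

lemma defect_sum:
  assumes \<xi>: "\<And>j. j \<le> N \<Longrightarrow> 0 \<le> \<xi> j \<and> \<xi> j \<le> L \<and> G (\<xi> j) = X j" "\<xi> 0 = 0" "\<xi> N = L"
    "\<And>j. j < N \<Longrightarrow> \<xi> j \<le> \<xi> (Suc j)"
    and p: "is_partition L N X h"
    and k: "continuous_on UNIV k" "\<And>x. norm (k x :: real^3) \<le> 2 * M"
    and ki: "integrable (leb_int L) (\<lambda>x. (norm (K x - g x *\<^sub>R k x))\<^sup>2 / g x)"
    and ke: "(\<integral>x. (norm (K x - g x *\<^sub>R k x))\<^sup>2 / g x \<partial>leb_int L) \<le> \<epsilon>"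
    and \<omega>: "\<And>x y. x \<in> {0..L} \<Longrightarrow> y \<in> {0..L} \<Longrightarrow> \<bar>x - y\<bar> \<le> 2 * h \<Longrightarrow> norm (k x - k y) \<le> \<omega>"
  defines "q \<equiv> (\<lambda>j x. (norm (K x - g x *\<^sub>R k (\<xi> j)))\<^sup>2 / g x)"
  shows "(\<Sum>j<N. prim L (q j) (\<xi> (Suc j)) - prim L (q j) (\<xi> j)) \<le> 2 * \<epsilon> + 2 * \<omega>\<^sup>2 * L"
proof -
  have [measurable]: "k \<in> borel_measurable (leb_int L)"
    by (rule borel_measurable_leb_int_continuous[OF continuous_on_subset[OF k(1)]]) simp
  define f where "f x = (norm (K x - g x *\<^sub>R k x))\<^sup>2 / g x" for x
  have fi: "integrable (leb_int L) f" using ki by (simp add: f_def[abs_def])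
  have step: "(norm (K x - g x *\<^sub>R c))\<^sup>2 / g x \<le> 2 * f x + 2 * a\<^sup>2 * g x"
    if "0 < x" "x < L" "norm (k x - c) \<le> a" for x c a
  proof -
    have gp: "0 < g x" by (rule g_pos[OF that(1,2)])
    have "norm (K x - g x *\<^sub>R c) = norm ((K x - g x *\<^sub>R k x) + g x *\<^sub>R (k x - c))"
      by (simp add: scaleR_diff_right)
    also have "\<dots> \<le> norm (K x - g x *\<^sub>R k x) + norm (g x *\<^sub>R (k x - c))" by (rule norm_triangle_ineq)
    also have "norm (g x *\<^sub>R (k x - c)) \<le> g x * a" using gp that(3) by simp
    finally have "(norm (K x - g x *\<^sub>R c))\<^sup>2 \<le> (norm (K x - g x *\<^sub>R k x) + g x * a)\<^sup>2"
      by (intro power_mono) auto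
    also have "\<dots> \<le> 2 * (norm (K x - g x *\<^sub>R k x))\<^sup>2 + 2 * (g x * a)\<^sup>2"
      using zero_le_power2[of "norm (K x - g x *\<^sub>R k x) - g x * a"] by (simp add: power2_sum power2_diff)
    finally have "(norm (K x - g x *\<^sub>R c))\<^sup>2 / g x \<le> (2 * (norm (K x - g x *\<^sub>R k x))\<^sup>2 + 2 * (g x * a)\<^sup>2) / g x"
      using gp by (intro divide_right_mono) auto
    also have "\<dots> = 2 * f x + 2 * a\<^sup>2 * g x"
      using gp by (simp add: f_def add_divide_distrib power2_eq_square)
    finally show ?thesis .
  qed
  have qi: "integrable (leb_int L) (q j)" for j
  proof (rule Bochner_Integration.integrable_bound)
    show "integrable (leb_int L) (\<lambda>x. 2 * f x + 2 * (4 * M)\<^sup>2 * g x)" using fi integrable_g by simp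
    show "q j \<in> borel_measurable (leb_int L)" unfolding q_def by measurable
    show "AE x in leb_int L. norm (q j x) \<le> norm (2 * f x + 2 * (4 * M)\<^sup>2 * g x)"
    proof (rule AE_I2)
      fix x assume "x \<in> space (leb_int L)"
      then have x: "0 < x" "x < L" by auto
      have "norm (k x - k (\<xi> j)) \<le> 4 * M"
        using norm_triangle_ineq4[of "k x" "k (\<xi> j)"] k(2)[of x] k(2)[of "\<xi> j"] by linarith
      then have "q j x \<le> 2 * f x + 2 * (4 * M)\<^sup>2 * g x" unfolding q_def by (rule step[OF x])
      moreover have "0 \<le> q j x" using g_pos[OF x] by (simp add: q_def)
      ultimately show "norm (q j x) \<le> norm (2 * f x + 2 * (4 * M)\<^sup>2 * g x)" by simp
    qed
  qed
  have fg: "integrable (leb_int L) (\<lambda>x. 2 * f x + 2 * \<omega>\<^sup>2 * g x)" using fi integrable_g by simp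
  have pfg: "prim L (\<lambda>x. 2 * f x + 2 * \<omega>\<^sup>2 * g x) y = 2 * prim L f y + 2 * \<omega>\<^sup>2 * G y" for y
    using fi integrable_g by (subst prim_add) (simp_all only: prim_mult integrable_mult_right)
  have each: "prim L (q j) (\<xi> (Suc j)) - prim L (q j) (\<xi> j)
      \<le> (2 * prim L f (\<xi> (Suc j)) + 2 * \<omega>\<^sup>2 * G (\<xi> (Suc j))) - (2 * prim L f (\<xi> j) + 2 * \<omega>\<^sup>2 * G (\<xi> j))" if j: "j < N" for j
    unfolding pfg[symmetric]
  proof (rule prim_diff_mono_AE[OF qi fg \<xi>(4)[OF j]])
    show "AE x in leb_int L. \<xi> j < x \<longrightarrow> x \<le> \<xi> (Suc j) \<longrightarrow> q j x \<le> 2 * f x + 2 * \<omega>\<^sup>2 * g x"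
    proof (rule AE_I2, intro impI)
      fix x assume "x \<in> space (leb_int L)" and xj: "\<xi> j < x" "x \<le> \<xi> (Suc j)"
      then have x: "0 < x" "x < L" by auto
      have b: "0 \<le> \<xi> j" "\<xi> j \<le> \<xi> (Suc j)" "\<xi> (Suc j) \<le> L" "G (\<xi> (Suc j)) - G (\<xi> j) \<le> h"
        using \<xi>(1)[of j] \<xi>(1)[of "Suc j"] \<xi>(4)[OF j] partition_width(2)[OF p j] j by auto
      have "(1 - s) * (\<xi> (Suc j) - \<xi> j) \<le> h" using G_diff_ge[OF b(1-3)] b(4) by linarith
      moreover have "1 / 2 * (\<xi> (Suc j) - \<xi> j) \<le> (1 - s) * (\<xi> (Suc j) - \<xi> j)"
        using s b by (intro mult_right_mono) auto
      ultimately have "1 / 2 * (\<xi> (Suc j) - \<xi> j) \<le> h" by (rule order_trans[rotated])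
      then have "\<bar>x - \<xi> j\<bar> \<le> 2 * h" using xj by simp
      then have "norm (k x - k (\<xi> j)) \<le> \<omega>" using x b by (intro \<omega>) auto
      then show "q j x \<le> 2 * f x + 2 * \<omega>\<^sup>2 * g x" unfolding q_def by (rule step[OF x])
    qed
  qed
  have "(\<Sum>j<N. prim L (q j) (\<xi> (Suc j)) - prim L (q j) (\<xi> j))
     \<le> (\<Sum>j<N. (2 * prim L f (\<xi> (Suc j)) + 2 * \<omega>\<^sup>2 * G (\<xi> (Suc j))) - (2 * prim L f (\<xi> j) + 2 * \<omega>\<^sup>2 * G (\<xi> j)))"
    by (intro sum_mono each) auto
  also have "\<dots> = (2 * prim L f (\<xi> N) + 2 * \<omega>\<^sup>2 * G (\<xi> N)) - (2 * prim L f (\<xi> 0) + 2 * \<omega>\<^sup>2 * G (\<xi> 0))"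
    by (rule sum_lessThan_telescope)
  also have "\<dots> = 2 * (\<integral>x. f x \<partial>leb_int L) + 2 * \<omega>\<^sup>2 * L"
    using \<xi>(2,3) G_ends by (simp add: prim_L prim_0)
  finally show ?thesis using ke by (simp add: f_def[abs_def])
qed

text \<open>The data at the node \<open>X j\<close> are those of the slowed frame at
  \<open>\<xi> j\<close>, so an element carries an arc whose length in the parameter G is that of
  the element. Young's inequality splits the energy into Jensen's part and the squared defects: the
  factor 162 is 36 times 9 / 4 from \<open>element_defect\<close>, times 2 from
  \<open>defect_sum\<close>. C collects the constants of the two penalty estimates.\<close>

lemma mesh_frame:
  assumes p: "is_partition L N X h" and \<theta>: "0 < \<theta>"
    and k: "continuous_on UNIV k" "\<And>x. norm (k x :: real^3) \<le> 2 * M"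
      "integrable (leb_int L) (\<lambda>x. (norm (K x - g x *\<^sub>R k x))\<^sup>2 / g x)"
      "(\<integral>x. (norm (K x - g x *\<^sub>R k x))\<^sup>2 / g x \<partial>leb_int L) \<le> \<epsilon>"
      "\<And>x y. x \<in> {0..L} \<Longrightarrow> y \<in> {0..L} \<Longrightarrow> \<bar>x - y\<bar> \<le> 2 * h \<Longrightarrow> norm (k x - k y) \<le> \<omega>"
  defines "C \<equiv> 9 * M + 14 * M\<^sup>2 * L + 18 * M\<^sup>2"
  obtains w where "w \<in> V_h L N X" "w \<in> V L"
    "\<And>j. j \<le> N \<Longrightarrow> norm (vector_derivative (fst w) (at (X j) within {0..L})) = 1 \<and> norm (snd w (X j)) = 1"
    "boundary_values L w = [Y 0, Y L, T 0, T L, B 0, B L]"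
    "energy L w \<le> (1 + \<theta>) / (1 - s) * (\<integral>x. Qbar (norm (K x)) (norm (D x)) \<partial>leb_int L)
       + (1 + 1 / \<theta>) * 162 * (\<epsilon> + \<omega>\<^sup>2 * L)"
    "(\<integral>x. (wderiv L (fst w) x \<bullet> snd w x)\<^sup>2 \<partial>leb_int L) \<le> L * (C * h)\<^sup>2"
    "(\<integral>x. (wderiv L (fst w) x \<bullet> wderiv L (snd w) x)\<^sup>2 \<partial>leb_int L) \<le> L * (C * h)\<^sup>2"
proof -
  obtain \<xi> where \<xi>: "\<And>j. j \<le> N \<Longrightarrow> 0 \<le> \<xi> j \<and> \<xi> j \<le> L \<and> G (\<xi> j) = X j" "\<xi> 0 = 0" "\<xi> N = L"
    "\<And>j. j < N \<Longrightarrow> \<xi> j \<le> \<xi> (Suc j)" using nodes[OF p] by blast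
  define H where "H j = X (Suc j) - X j" for j
  \<comment> \<open>The slowed curve has derivative T in the parameter G, so its position is the
    integral of g T in the old variable.\<close>
  define Yd where "Yd j = Y 0 + prim L (\<lambda>x. g x *\<^sub>R T x) (\<xi> j)" for j
  define Td where "Td j = T (\<xi> j)" for j
  define Bd where "Bd j = B (\<xi> j)" for j
  define dT where "dT j = (1 / H j) *\<^sub>R (Td (Suc j) - Td j)" for j
  define dd where "dd j = (1 / H j) *\<^sub>R (Yd (Suc j) - Yd j) - (1 / 2) *\<^sub>R (Td j + Td (Suc j))" for j
  define dB where "dB j = (1 / H j) *\<^sub>R (Bd (Suc j) - Bd j)" for j
  obtain y Tw Kw b Dw where r: "rep L (y, b) y Tw Kw b Dw" and Vh: "(y, b) \<in> V_h L N X"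
    and node: "\<And>j. j \<le> N \<Longrightarrow> y (X j) = Yd j" "\<And>j. j \<le> N \<Longrightarrow> Tw (X j) = Td j" "\<And>j. j \<le> N \<Longrightarrow> b (X j) = Bd j"
    and vd: "\<And>x. x \<in> {0..L} \<Longrightarrow> vector_derivative y (at x within {0..L}) = Tw x"
    and Kw: "\<And>j x. j < N \<Longrightarrow> X j < x \<Longrightarrow> x < X (Suc j) \<Longrightarrow> Kw x = dT j + (6 / H j - 12 * (x - X j) / (H j)\<^sup>2) *\<^sub>R dd j"
    and Tw: "\<And>j x. j < N \<Longrightarrow> X j < x \<Longrightarrow> x < X (Suc j) \<Longrightarrow>
       Tw x = Td j + (x - X j) *\<^sub>R dT j + (6 * (x - X j) / H j - 6 * (x - X j)\<^sup>2 / (H j)\<^sup>2) *\<^sub>R dd j"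
    and bw: "\<And>j x. j < N \<Longrightarrow> X j < x \<Longrightarrow> x < X (Suc j) \<Longrightarrow> b x = Bd j + (x - X j) *\<^sub>R dB j"
    and Dw: "\<And>j x. j < N \<Longrightarrow> X j < x \<Longrightarrow> x < X (Suc j) \<Longrightarrow> Dw x = dB j"
    unfolding dT_def dd_def dB_def H_def by (rule hermite_spline[OF p L, where Yd = Yd and Td = Td and Bd = Bd]) blast
  have XN: "X 0 = 0" "X N = L" "0 < N" using p by (auto simp: is_partition_def)
  have ab: "0 \<le> \<xi> j" "\<xi> j \<le> \<xi> (Suc j)" "\<xi> (Suc j) \<le> L" and \<eta>: "G (\<xi> (Suc j)) - G (\<xi> j) = H j" if "j < N" for j
    using \<xi>(1)[of j] \<xi>(1)[of "Suc j"] \<xi>(4)[OF that] that by (auto simp: H_def)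
  have H: "0 < H j" "H j \<le> h" "H j \<le> L" if "j < N" for j
    using partition_width[OF p that] partition_bounds[OF p, of j] partition_bounds[OF p, of "Suc j"] that
    by (auto simp: H_def)
  define d where "d j = (Yd (Suc j) - Yd j) - (H j / 2) *\<^sub>R (Td j + Td (Suc j))" for j
  have dd_d: "dd j = (1 / H j) *\<^sub>R d j" if "j < N" for j
    using H(1)[OF that] by (simp add: dd_def d_def scaleR_diff_right)
  have d_eq: "d j = prim L (\<lambda>x. g x *\<^sub>R T x) (\<xi> (Suc j)) - prim L (\<lambda>x. g x *\<^sub>R T x) (\<xi> j)
      - ((G (\<xi> (Suc j)) - G (\<xi> j)) / 2) *\<^sub>R (T (\<xi> j) + T (\<xi> (Suc j)))" if "j < N" for j
    unfolding \<eta>[OF that] by (simp add: d_def Yd_def Td_def)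
  have lipT: "norm (Td (Suc j) - Td j) \<le> 2 * M * H j" and lipB: "norm (Bd (Suc j) - Bd j) \<le> 2 * M * H j"
    and crude: "norm (d j) \<le> 3 * M * (H j)\<^sup>2" and ort: "\<bar>Td j \<bullet> (Bd (Suc j) - Bd j)\<bar> \<le> 4 * M\<^sup>2 * (H j)\<^sup>2"
    if "j < N" for j
    using frame_Lipschitz[OF ab[OF that]] element_defect_crude[OF ab[OF that]] element_orthogonality[OF ab[OF that]]
    unfolding d_eq[OF that] \<eta>[OF that] by (simp_all add: Td_def Bd_def)
  have unitd: "norm (Td j) = 1" "norm (Bd j) = 1" "Td j \<bullet> Bd j = 0" if "j \<le> N" for j
    using unit[of "\<xi> j"] orth(1)[of "\<xi> j"] \<xi>(1)[OF that] by (auto simp: Td_def Bd_def)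
  have ddle: "norm (dd j) \<le> 3 * M * H j" if "j < N" for j
    unfolding dd_d[OF that] using crude[OF that] H(1)[OF that] by (simp add: divide_le_eq power2_eq_square mult.assoc)
  have dBle: "norm (dB j) \<le> 2 * M" if "j < N" for j
    using lipB[OF that] H(1)[OF that] by (simp add: dB_def divide_le_eq)
  \<comment> \<open>The affine part moves by at most 2 M H j; the parabola is at most 3 / 2 and
    multiplies a vector of norm at most 3 M H j. The sum 13 / 2 is rounded up to 7.\<close>
  have Tdev: "norm (Tw x - Td j) \<le> 7 * M * H j" if j: "j < N" "X j < x" "x < X (Suc j)" for j x
  proof -
    define \<mu> where "\<mu> = (x - X j) / H j"
    have l: "0 \<le> \<mu>" "\<mu> \<le> 1" "x - X j = \<mu> * H j" using j H(1)[OF j(1)] by (auto simp: \<mu>_def H_def divide_le_eq)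
    have Hn: "H j \<noteq> 0" using H(1)[OF j(1)] by simp
    have "Tw x - Td j = \<mu> *\<^sub>R (Td (Suc j) - Td j) + (6 * \<mu> - 6 * \<mu>\<^sup>2) *\<^sub>R dd j"
      unfolding Tw[OF j] l(3) using Hn by (simp add: dT_def power2_eq_square)
    then have "norm (Tw x - Td j) \<le> norm (\<mu> *\<^sub>R (Td (Suc j) - Td j)) + norm ((6 * \<mu> - 6 * \<mu>\<^sup>2) *\<^sub>R dd j)"
      by (simp only: norm_triangle_ineq)
    also have "norm (\<mu> *\<^sub>R (Td (Suc j) - Td j)) \<le> 1 * (2 * M * H j)"
      using l lipT[OF j(1)] by (simp only: norm_scaleR) (intro mult_mono, auto)
    also have "norm ((6 * \<mu> - 6 * \<mu>\<^sup>2) *\<^sub>R dd j) \<le> 3 / 2 * (3 * M * H j)"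
    proof -
      have "0 \<le> \<mu> * (1 - \<mu>)" using l by simp
      moreover have "0 \<le> (2 * \<mu> - 1)\<^sup>2" by simp
      ultimately have "\<bar>6 * \<mu> - 6 * \<mu>\<^sup>2\<bar> \<le> 3 / 2" by (simp add: power2_eq_square algebra_simps abs_le_iff)
      then show ?thesis using ddle[OF j(1)] by (simp only: norm_scaleR real_norm_def) (intro mult_mono, auto)
    qed
    finally have e: "norm (Tw x - Td j) \<le> 13 / 2 * (M * H j)" by simp
    have "13 / 2 * (M * H j) \<le> 7 * (M * H j)" using mult_pos_pos[OF M H(1)[OF j(1)]] by linarith
    with e show ?thesis by simp
  qed
  have Bdev: "norm (b x - Bd j) \<le> 2 * M * H j" if j: "j < N" "X j < x" "x < X (Suc j)" for j x
  proof -
    have "norm (b x - Bd j) = (x - X j) * norm (dB j)" using bw[OF j] j by simp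
    also have "\<dots> \<le> H j * (2 * M)" using j dBle[OF j(1)] H(1)[OF j(1)] by (intro mult_mono) (auto simp: H_def)
    finally show ?thesis by (simp add: mult.commute)
  qed
  \<comment> \<open>The product vanishes at the left node, and both factors have moved by O(H j): 2
    M + 7 M (1 + 2 M L) gives the first two terms of C.\<close>
  have pen1: "\<bar>Tw x \<bullet> b x\<bar> \<le> C * h" if j: "j < N" "X j < x" "x < X (Suc j)" for j x
  proof -
    have Hj: "0 < H j" "H j \<le> h" "H j \<le> L" using H[OF j(1)] by auto
    have bn: "norm (b x) \<le> 1 + 2 * M * L"
    proof -
      have "norm (b x) \<le> norm (Bd j) + norm (b x - Bd j)" using norm_triangle_ineq[of "Bd j" "b x - Bd j"] by simp
      also have "\<dots> \<le> 1 + 2 * M * H j" using Bdev[OF j] unitd(2)[of j] j by simp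
      also have "\<dots> \<le> 1 + 2 * M * L" using M Hj by simp
      finally show ?thesis .
    qed
    have "Tw x \<bullet> b x = Td j \<bullet> (b x - Bd j) + (Tw x - Td j) \<bullet> b x"
      using unitd(3)[of j] j by (simp add: inner_diff_left inner_diff_right)
    then have "\<bar>Tw x \<bullet> b x\<bar> \<le> norm (Td j) * norm (b x - Bd j) + norm (Tw x - Td j) * norm (b x)"
      using Cauchy_Schwarz_ineq2[of "Td j" "b x - Bd j"] Cauchy_Schwarz_ineq2[of "Tw x - Td j" "b x"] by linarith
    also have "\<dots> \<le> 1 * (2 * M * H j) + (7 * M * H j) * (1 + 2 * M * L)"
      using unitd(1)[of j] j Bdev[OF j] Tdev[OF j] bn M Hj by (intro add_mono mult_mono) auto
    also have "\<dots> = (9 * M + 14 * M\<^sup>2 * L) * H j" by (simp add: algebra_simps power2_eq_square)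
    also have "\<dots> \<le> C * h"
      using M L Hj by (intro mult_mono) (auto simp: C_def)
    finally show ?thesis .
  qed
  \<comment> \<open>The product at the left node contributes 4 M^2, the deviation of the tangent
    times |b'| contributes 14 M^2; together they are the last term of C.\<close>
  have pen2: "\<bar>Tw x \<bullet> Dw x\<bar> \<le> C * h" if j: "j < N" "X j < x" "x < X (Suc j)" for j x
  proof -
    have Hj: "0 < H j" "H j \<le> h" "H j \<le> L" using H[OF j(1)] by auto
    have 1: "\<bar>Td j \<bullet> dB j\<bar> \<le> 4 * M\<^sup>2 * H j"
      using ort[OF j(1)] Hj by (simp add: dB_def abs_mult divide_le_eq power2_eq_square mult.assoc)
    have "\<bar>(Tw x - Td j) \<bullet> dB j\<bar> \<le> norm (Tw x - Td j) * norm (dB j)" by (rule Cauchy_Schwarz_ineq2)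
    also have "\<dots> \<le> (7 * M * H j) * (2 * M)" using Tdev[OF j] dBle[OF j(1)] M Hj by (intro mult_mono) auto
    finally have 2: "\<bar>(Tw x - Td j) \<bullet> dB j\<bar> \<le> 14 * M\<^sup>2 * H j" by (simp add: power2_eq_square algebra_simps)
    have "\<bar>Tw x \<bullet> Dw x\<bar> \<le> 18 * M\<^sup>2 * H j" using 1 2 unfolding Dw[OF j] by (simp add: inner_diff_left)
    also have "\<dots> \<le> C * h" using M L Hj by (intro mult_mono) (auto simp: C_def)
    finally show ?thesis .
  qed
  define Q where "Q x = Qbar (norm (K x)) (norm (D x))" for x
  define \<Delta>Q where "\<Delta>Q j = prim L Q (\<xi> (Suc j)) - prim L Q (\<xi> j)" for j
  define q where "q j x = (norm (K x - g x *\<^sub>R k (\<xi> j)))\<^sup>2 / g x" for j x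
  define \<Delta>q where "\<Delta>q j = prim L (q j) (\<xi> (Suc j)) - prim L (q j) (\<xi> j)" for j
  \<comment> \<open>The energy budget of an element, written with increments of primitives: summed
    over the mesh, the first part telescopes and the second is bounded by
    \<open>defect_sum\<close>.\<close>
  define \<rho> where "\<rho> j = (1 + \<theta>) / (1 - s) * \<Delta>Q j + (1 + 1 / \<theta>) * 81 * \<Delta>q j" for j
  have bound: "Qbar (norm (Kw x)) (norm (Dw x)) \<le> \<rho> j / H j" if j: "j < N" "X j < x" "x < X (Suc j)" for j x
  proof -
    have Hj: "0 < H j" using H[OF j(1)] by auto
    define S where "S = sqrtQ (norm (Td (Suc j) - Td j)) (norm (Bd (Suc j) - Bd j))"
    define m where "m = 6 * norm (d j) / (H j)\<^sup>2"
    have "sqrtQ (norm (Kw x)) (norm (Dw x)) \<le> sqrtQ (norm (dT j)) (norm (dB j))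
        + norm ((6 / H j - 12 * (x - X j) / (H j)\<^sup>2) *\<^sub>R dd j)"
      unfolding Kw[OF j] Dw[OF j] by (rule sqrtQ_add_le)
    also have "sqrtQ (norm (dT j)) (norm (dB j)) = S / H j"
      using sqrtQ_scale[of "1 / H j" "norm (Td (Suc j) - Td j)" "norm (Bd (Suc j) - Bd j)"] Hj
      by (simp add: dT_def dB_def S_def)
    \<comment> \<open>The coefficient is the derivative of the parabola, 6 / H j times 1 - 2 \<mu>,
      and |1 - 2 \<mu>| \<le> 1.\<close>
    also have "norm ((6 / H j - 12 * (x - X j) / (H j)\<^sup>2) *\<^sub>R dd j) \<le> m"
    proof -
      have "6 / H j - 12 * (x - X j) / (H j)\<^sup>2 = 6 / H j * (1 - 2 * ((x - X j) / H j))"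
        using Hj by (simp add: field_simps power2_eq_square)
      moreover have "\<bar>1 - 2 * ((x - X j) / H j)\<bar> \<le> 1"
        using j Hj by (auto simp: abs_le_iff H_def divide_simps)
      ultimately have "\<bar>6 / H j - 12 * (x - X j) / (H j)\<^sup>2\<bar> \<le> 6 / H j * 1"
        using Hj by (simp only: abs_mult) (intro mult_mono, auto)
      then have "norm ((6 / H j - 12 * (x - X j) / (H j)\<^sup>2) *\<^sub>R dd j) \<le> 6 / H j * norm (dd j)"
        by (simp only: norm_scaleR real_norm_def mult_1_right) (rule mult_right_mono, auto)
      also have "\<dots> = m" using Hj by (simp add: dd_d[OF j(1)] m_def power2_eq_square)
      finally show ?thesis .
    qed
    finally have 1: "sqrtQ (norm (Kw x)) (norm (Dw x)) \<le> S / H j + m" by simp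
    \<comment> \<open>The weight keeps the factor of the leading term close to 1; the large factor 1
      + 1 / \<theta> falls on the defect, which is made small afterwards.\<close>
    have young: "(u + w)\<^sup>2 \<le> (1 + \<theta>) * u\<^sup>2 + (1 + 1 / \<theta>) * w\<^sup>2" for u w :: real
    proof -
      have "0 \<le> (\<theta> * u - w)\<^sup>2 / \<theta>" using \<theta> by simp
      also have "\<dots> = \<theta> * u\<^sup>2 - 2 * u * w + w\<^sup>2 / \<theta>" using \<theta> by (simp add: power2_eq_square field_simps)
      finally show ?thesis by (simp add: power2_sum algebra_simps)
    qed
    have "Qbar (norm (Kw x)) (norm (Dw x)) \<le> (S / H j + m)\<^sup>2"
      unfolding Qbar_eq_sqrtQ using 1 by (intro power_mono) (auto simp: sqrtQ_bounds)
    also have "\<dots> \<le> (1 + \<theta>) * (S / H j)\<^sup>2 + (1 + 1 / \<theta>) * m\<^sup>2" by (rule young)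
    also have "(S / H j)\<^sup>2 \<le> (\<Delta>Q j / (1 - s)) / H j"
    proof -
      have "S\<^sup>2 \<le> H j * (\<Delta>Q j / (1 - s))"
        using element_density[OF ab[OF j(1)]] unfolding \<eta>[OF j(1)] S_def Td_def Bd_def \<Delta>Q_def Q_def .
      then have "S\<^sup>2 / (H j)\<^sup>2 \<le> H j * (\<Delta>Q j / (1 - s)) / (H j)\<^sup>2" by (intro divide_right_mono) auto
      then show ?thesis using Hj by (simp add: power_divide power2_eq_square)
    qed
    also have "m\<^sup>2 \<le> 81 * \<Delta>q j / H j"
    proof -
      have "(norm (d j))\<^sup>2 \<le> 9 / 4 * (H j)^3 * \<Delta>q j"
        unfolding d_eq[OF j(1)] \<eta>[OF j(1), symmetric] \<Delta>q_def q_def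
        by (rule element_defect[OF ab[OF j(1)] k(2)])
      then have "36 * (norm (d j))\<^sup>2 / (H j)^4 \<le> 36 * (9 / 4 * (H j)^3 * \<Delta>q j) / (H j)^4"
        by (intro divide_right_mono mult_left_mono) simp_all
      also have "\<dots> = 81 * \<Delta>q j / H j" using Hj by (simp add: field_simps power4_eq_xxxx power3_eq_cube)
      finally show ?thesis by (simp add: m_def power_divide power_mult_distrib flip: power_mult)
    qed
    finally have "Qbar (norm (Kw x)) (norm (Dw x))
        \<le> (1 + \<theta>) * (\<Delta>Q j / (1 - s) / H j) + (1 + 1 / \<theta>) * (81 * \<Delta>q j / H j)"
      using \<theta> by (simp add: mult_left_mono)
    also have "\<dots> = \<rho> j / H j"
    proof -
      have "a * (x / c / l) + b * (81 * y / l) = (a / c * x + b * 81 * y) / l" for a b c l x y :: real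
        by (simp add: add_divide_distrib)
      then show ?thesis unfolding \<rho>_def .
    qed
    finally show ?thesis .
  qed
  have pw: "is_prim L y Tw" "is_prim L Tw Kw" "is_prim L b Dw" using r by (auto simp: rep_def)
  note sqw = is_prim_sq_integrable[OF pw(2)] is_prim_sq_integrable[OF pw(3)]
  have elem_AE: "AE x in leb_int L. P x" if "\<And>j x. j < N \<Longrightarrow> X j < x \<Longrightarrow> x < X (Suc j) \<Longrightarrow> P x" for P
    using AE_not_node[of X N L] AE_space
  proof eventually_elim
    case (elim x)
    then obtain j where "j < N" "X j < x" "x < X (Suc j)" using partition_find_interior[OF p, of x] by auto
    then show ?case by (rule that)
  qed
  have "energy L (y, b) \<le> (\<integral>x. step_fun N X (\<lambda>j x. \<rho> j / H j) x \<partial>leb_int L)"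
    unfolding energy_rep(1)[OF r]
  proof (rule integral_mono_AE)
    show "integrable (leb_int L) (\<lambda>x. Qbar (norm (Kw x)) (norm (Dw x)))" by (rule integrable_Qbar[OF sqw(2,4)])
    show "integrable (leb_int L) (step_fun N X (\<lambda>j x. \<rho> j / H j))" by (rule integral_step_fun_const[OF p])
    show "AE x in leb_int L. Qbar (norm (Kw x)) (norm (Dw x)) \<le> step_fun N X (\<lambda>j x. \<rho> j / H j) x"
      by (rule elem_AE) (simp add: bound step_fun_eq[OF p])
  qed
  also have "\<dots> = (\<Sum>j<N. (X (Suc j) - X j) * (\<rho> j / H j))" by (rule integral_step_fun_const[OF p])
  also have "\<dots> = (\<Sum>j<N. \<rho> j)"
  proof (rule sum.cong)
    fix j assume "j \<in> {..<N}"
    then show "(X (Suc j) - X j) * (\<rho> j / H j) = \<rho> j" using H(1)[of j] by (simp flip: H_def)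
  qed simp
  also have "\<dots> = (1 + \<theta>) / (1 - s) * (\<Sum>j<N. \<Delta>Q j) + (1 + 1 / \<theta>) * 81 * (\<Sum>j<N. \<Delta>q j)"
    by (simp add: \<rho>_def sum.distrib sum_distrib_left)
  also have "(\<Sum>j<N. \<Delta>Q j) = (\<integral>x. Q x \<partial>leb_int L)"
    using sum_lessThan_telescope[of "\<lambda>j. prim L Q (\<xi> j)" N] \<xi>(2,3) by (simp add: \<Delta>Q_def prim_0 prim_L)
  also have "(\<Sum>j<N. \<Delta>q j) \<le> 2 * \<epsilon> + 2 * \<omega>\<^sup>2 * L"
    unfolding \<Delta>q_def q_def by (rule defect_sum[OF \<xi> p k])
  finally have en: "energy L (y, b) \<le> (1 + \<theta>) / (1 - s) * (\<integral>x. Q x \<partial>leb_int L)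
       + (1 + 1 / \<theta>) * 81 * (2 * \<epsilon> + 2 * \<omega>\<^sup>2 * L)"
    using \<theta> by (simp add: mult_left_mono)
  have pen: "(\<integral>x. (f x)\<^sup>2 \<partial>leb_int L) \<le> L * (C * h)\<^sup>2"
    if f: "\<And>j x. j < N \<Longrightarrow> X j < x \<Longrightarrow> x < X (Suc j) \<Longrightarrow> \<bar>f x\<bar> \<le> C * h" and m: "f \<in> borel_measurable (leb_int L)"
    for f :: "real \<Rightarrow> real"
  proof -
    have ae: "AE x in leb_int L. \<bar>f x\<bar> \<le> C * h" by (rule elem_AE) (rule f)
    have ae2: "AE x in leb_int L. (f x)\<^sup>2 \<le> (C * h)\<^sup>2"
      using ae
    proof eventually_elim
      case (elim x)
      then have "\<bar>f x\<bar>\<^sup>2 \<le> (C * h)\<^sup>2" by (intro power_mono) auto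
      then show ?case by simp
    qed
    have i: "integrable (leb_int L) (\<lambda>x. (f x)\<^sup>2)"
      by (rule finite_measure.integrable_const_bound[OF finite_leb_int, of _ "(C * h)\<^sup>2"]) (use ae2 m in auto)
    have "(\<integral>x. (f x)\<^sup>2 \<partial>leb_int L) \<le> (\<integral>x. (C * h)\<^sup>2 \<partial>leb_int L)"
      by (rule integral_mono_AE[OF i _ ae2]) simp
    also have "\<dots> = L * (C * h)\<^sup>2"
      unfolding integral_const_leb_int[OF less_imp_le[OF L]] by simp
    finally show ?thesis .
  qed
  note [measurable] = sqw[THEN sq_integrableD(1)]
  have P1: "(\<integral>x. (Tw x \<bullet> b x)\<^sup>2 \<partial>leb_int L) \<le> L * (C * h)\<^sup>2" by (rule pen[OF pen1]) auto
  have P2: "(\<integral>x. (Tw x \<bullet> Dw x)\<^sup>2 \<partial>leb_int L) \<le> L * (C * h)\<^sup>2" by (rule pen[OF pen2]) auto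
  \<comment> \<open>This is where the condition on \<integral>g T pays off: the slowed curve ends at
    the original end point, so the boundary values are met exactly.\<close>
  have YL: "Yd N = Y L"
    using is_prim_eq[OF Y, of L] \<xi>(3) g_int(2) L by (simp add: Yd_def prim_L)
  show ?thesis
  proof (rule that[of "(y, b)"])
    show "boundary_values L (y, b) = [Y 0, Y L, T 0, T L, B 0, B L]"
      unfolding boundary_values_rep[OF r L]
      using node(1)[of 0] node(1)[of N] node(2)[of 0] node(2)[of N] node(3)[of 0] node(3)[of N] XN \<xi>(2,3) YL
      by (simp add: Td_def Bd_def) (simp add: Yd_def prim_0)
    show "energy L (y, b) \<le> (1 + \<theta>) / (1 - s) * (\<integral>x. Qbar (norm (K x)) (norm (D x)) \<partial>leb_int L)
       + (1 + 1 / \<theta>) * 162 * (\<epsilon> + \<omega>\<^sup>2 * L)"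
    proof -
      have eq: "a * 81 * (2 * x + 2 * c * L) = a * 162 * (x + c * L)" for a c x :: real by (simp add: algebra_simps)
      show ?thesis using en unfolding Q_def eq .
    qed
    show "norm (vector_derivative (fst (y, b)) (at (X j) within {0..L})) = 1 \<and> norm (snd (y, b) (X j)) = 1" if "j \<le> N" for j
      using vd[of "X j"] partition_bounds[OF p that] node(2,3)[OF that] unitd[OF that] by simp
    show "(\<integral>x. (wderiv L (fst (y, b)) x \<bullet> snd (y, b) x)\<^sup>2 \<partial>leb_int L) \<le> L * (C * h)\<^sup>2"
      unfolding energy_rep(2)[OF r] by (rule P1)
    show "(\<integral>x. (wderiv L (fst (y, b)) x \<bullet> wderiv L (snd (y, b)) x)\<^sup>2 \<partial>leb_int L) \<le> L * (C * h)\<^sup>2"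
      unfolding energy_rep(3)[OF r] by (rule P2)
  qed (use Vh r in \<open>auto simp: rep_def\<close>)
qed

end

text \<open>For a given \<eta> the slowing parameter, M and the continuous function k are fixed
  before the mesh is refined. The constants in the penalty estimates are then independent of n, and
  what remains is a multiple of h^2 / \<epsilon>1 and of h^2 / \<epsilon>2.\<close>

lemma recovery_sequence:
  fixes Lbc :: "framing \<Rightarrow> 'c::real_normed_vector"
  assumes L: "0 < L" and bo: "boundary_operator L Lbc" and m: "regularized_modulus m c0 c1 c2 cuni"
    and p: "\<And>n. is_partition L (N n) (X n) (h n)"
    and pos: "\<And>n. 0 < \<delta> n" "\<And>n. 0 < \<epsilon>1 n" "\<And>n. 0 < \<epsilon>2 n"
    and h0: "h \<longlonglongrightarrow> 0" and \<delta>0: "\<delta> \<longlonglongrightarrow> 0"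
    and r1: "(\<lambda>n. (h n)\<^sup>2 / \<epsilon>1 n) \<longlonglongrightarrow> 0" and r2: "(\<lambda>n. (h n)\<^sup>2 / \<epsilon>2 n) \<longlonglongrightarrow> 0"
    and z: "z \<in> admissible L Lbc lbc" and "0 < \<eta>"
  obtains w where "\<And>n. w n \<in> discrete_admissible L Lbc lbc (N n) (X n)"
    "\<forall>\<^sub>F n in sequentially. discrete_energy L m (\<delta> n) (\<epsilon>1 n) (\<epsilon>2 n) (w n) \<le> energy L z + \<eta>"
proof -
  have zV: "z \<in> V L" using z by (auto simp: admissible_def A_frame_def)
  obtain Y T B where r: "rep L z Y T (wderiv L (wderiv L (fst z))) B (wderiv L (snd z))"
    using V_rep[OF zV L] .
  define K D where "K = wderiv L (wderiv L (fst z))" and "D = wderiv L (snd z)"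
  note r = r[folded K_def D_def]
  have P: "is_prim L Y T" "is_prim L T K" "is_prim L B D" using r by (auto simp: rep_def)
  have unit: "norm (T x) = 1" "norm (B x) = 1" "T x \<bullet> B x = 0" if "x \<in> {0..L}" for x
    using z that unfolding admissible_rep_iff[OF r L] by blast+
  have TD: "AE x in leb_int L. T x \<bullet> D x = 0" and zlbc: "Lbc z = lbc"
    using z unfolding admissible_rep_iff[OF r L] by blast+
  define E where "E = energy L z"
  have E0: "0 \<le> E" unfolding E_def energy_rep(1)[OF r] by (simp add: Qbar_bounds)
  \<comment> \<open>t serves both as slowing parameter and as weight in Young's inequality. For t
    \<le> 1 / 2 one has (1 + t) / (1 - t) \<le> 1 + 4 t, and 4 t E \<le> \<eta> / 3; E + 1 in the
    denominator covers E = 0.\<close>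
  define t where "t = min (1 / 2) (\<eta> / (12 * (E + 1)))"
  have "0 < t" using \<open>0 < \<eta>\<close> E0 by (auto simp: t_def)
  moreover have "t \<le> 1 / 2" unfolding t_def by (rule min.cobounded1)
  ultimately have t: "0 < t" "t \<le> 1 / 2" .
  have tE: "(1 + t) / (1 - t) * E \<le> E + \<eta> / 3"
  proof -
    have "(1 + 4 * t) * (1 - t) - (1 + t) = 2 * t * (1 - 2 * t)" by (simp add: algebra_simps)
    moreover have "0 \<le> 2 * t * (1 - 2 * t)" using t by (intro mult_nonneg_nonneg) auto
    ultimately have "1 + t \<le> (1 + 4 * t) * (1 - t)" by linarith
    then have "(1 + t) / (1 - t) \<le> 1 + 4 * t" using t by (simp add: divide_le_eq)
    then have "(1 + t) / (1 - t) * E \<le> (1 + 4 * t) * E" using E0 by (rule mult_right_mono)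
    moreover have "t * E \<le> \<eta> / (12 * (E + 1)) * (E + 1)"
      using t E0 \<open>0 < \<eta>\<close> by (intro mult_mono) (auto simp: t_def)
    moreover have "\<eta> / (12 * (E + 1)) * (E + 1) = \<eta> / 12" using E0 by (simp add: field_simps)
    moreover have "(1 + 4 * t) * E = E + 4 * (t * E)" by (simp add: algebra_simps)
    ultimately show ?thesis by linarith
  qed
  obtain M g where "slowed_frame L t M g Y T K B D"
    using slowed_frame_exists[OF L t P unit TD] by blast
  then interpret slowed_frame L t M g Y T K B D .
  define A where "A = (1 + 1 / t) * 162"
  have A: "0 < A" using t by (simp add: A_def add_pos_pos)
  obtain k where k: "continuous_on UNIV k" "\<And>x. norm (k x) \<le> 2 * M"
    "integrable (leb_int L) (\<lambda>x. (norm (K x - g x *\<^sub>R k x))\<^sup>2 / g x)"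
    "(\<integral>x. (norm (K x - g x *\<^sub>R k x))\<^sup>2 / g x \<partial>leb_int L) \<le> \<eta> / (6 * A)"
    using density_approx[of "\<eta> / (6 * A)"] A \<open>0 < \<eta>\<close> by auto
  \<comment> \<open>The defect term is split evenly: A times \<eta> / (6 A), taken twice, is the
    second third of \<eta>. The last third covers regularization and penalties.\<close>
  define \<omega> where "\<omega> = sqrt (\<eta> / (6 * A * L))"
  have \<omega>: "0 < \<omega>" "\<omega>\<^sup>2 * L = \<eta> / (6 * A)" using A L \<open>0 < \<eta>\<close> by (auto simp: \<omega>_def)
  have "uniformly_continuous_on {0..L} k"
    by (rule compact_uniformly_continuous[OF continuous_on_subset[OF k(1)]]) auto
  then obtain d where d: "0 < d" "\<And>x y. x \<in> {0..L} \<Longrightarrow> y \<in> {0..L} \<Longrightarrow> dist y x < d \<Longrightarrow> dist (k y) (k x) < \<omega>"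
    using \<omega>(1) unfolding uniformly_continuous_on_def by metis
  \<comment> \<open>\<open>mesh_frame\<close> is applied for every n, also on coarse meshes, where
    uniform continuity says nothing; there 4 M is a trivial bound because k is bounded by 2
    M.\<close>
  define \<omega>' where "\<omega>' n = (if 2 * h n < d then \<omega> else 4 * M)" for n
  have mod: "norm (k x - k y) \<le> \<omega>' n" if "x \<in> {0..L}" "y \<in> {0..L}" "\<bar>x - y\<bar> \<le> 2 * h n" for n x y
  proof (cases "2 * h n < d")
    case True
    then have "dist (k x) (k y) < \<omega>" using that by (intro d(2)) (auto simp: dist_real_def)
    then show ?thesis using True by (simp add: \<omega>'_def dist_norm)
  next
    case False
    then show ?thesis using norm_triangle_ineq4[of "k x" "k y"] k(2)[of x] k(2)[of y] by (simp add: \<omega>'_def)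
  qed
  define C where "C = 9 * M + 14 * M\<^sup>2 * L + 18 * M\<^sup>2"
  \<comment> \<open>One predicate for all properties, so that frames can be chosen for all n at
    once.\<close>
  define good where "good n w \<longleftrightarrow> w \<in> V_h L (N n) (X n) \<and> w \<in> V L \<and>
    (\<forall>j\<le>N n. norm (vector_derivative (fst w) (at (X n j) within {0..L})) = 1 \<and> norm (snd w (X n j)) = 1) \<and>
    boundary_values L w = [Y 0, Y L, T 0, T L, B 0, B L] \<and>
    energy L w \<le> (1 + t) / (1 - t) * E + A * (\<eta> / (6 * A) + (\<omega>' n)\<^sup>2 * L) \<and>
    (\<integral>x. (wderiv L (fst w) x \<bullet> snd w x)\<^sup>2 \<partial>leb_int L) \<le> L * (C * h n)\<^sup>2 \<and>
    (\<integral>x. (wderiv L (fst w) x \<bullet> wderiv L (snd w) x)\<^sup>2 \<partial>leb_int L) \<le> L * (C * h n)\<^sup>2" for n w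
  have "\<exists>w. good n w" for n
    unfolding good_def E_def energy_rep(1)[OF r] A_def C_def
    by (rule mesh_frame[OF p[of n] t(1) k[unfolded A_def] mod[of _ _ n]]; blast)
  then obtain w where W: "\<And>n. good n (w n)" by metis
  have w: "w n \<in> V_h L (N n) (X n)" "w n \<in> V L"
    "\<And>j. j \<le> N n \<Longrightarrow> norm (vector_derivative (fst (w n)) (at (X n j) within {0..L})) = 1 \<and> norm (snd (w n) (X n j)) = 1"
    "boundary_values L (w n) = [Y 0, Y L, T 0, T L, B 0, B L]"
    "energy L (w n) \<le> (1 + t) / (1 - t) * E + A * (\<eta> / (6 * A) + (\<omega>' n)\<^sup>2 * L)"
    "(\<integral>x. (wderiv L (fst (w n)) x \<bullet> snd (w n) x)\<^sup>2 \<partial>leb_int L) \<le> L * (C * h n)\<^sup>2"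
    "(\<integral>x. (wderiv L (fst (w n)) x \<bullet> wderiv L (snd (w n)) x)\<^sup>2 \<partial>leb_int L) \<le> L * (C * h n)\<^sup>2" for n
    using W[of n] unfolding good_def by blast+
  have "Lbc (w n) = lbc" for n
  proof -
    have "boundary_values L (w n) = boundary_values L z"
      using w(4) boundary_values_rep[OF r L] by simp
    then show ?thesis using bo w(2)[of n] zV zlbc unfolding boundary_operator_def by blast
  qed
  then have da: "w n \<in> discrete_admissible L Lbc lbc (N n) (X n)" for n
    using w(1)[of n] w(3)[of _ n] by (auto simp: discrete_admissible_def case_prod_unfold)
  define err where "err n = 3 / 2 * cuni * \<delta> n * L + (L * C\<^sup>2 / 2) * ((h n)\<^sup>2 / \<epsilon>1 n) + (L * C\<^sup>2 / 2) * ((h n)\<^sup>2 / \<epsilon>2 n)" for n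
  have "err \<longlonglongrightarrow> 3 / 2 * cuni * 0 * L + (L * C\<^sup>2 / 2) * 0 + (L * C\<^sup>2 / 2) * 0"
    unfolding err_def by (intro tendsto_intros \<delta>0 r1 r2)
  then have "\<forall>\<^sub>F n in sequentially. err n < \<eta> / 3"
    using \<open>0 < \<eta>\<close> by (intro order_tendstoD(2)[of err 0]) auto
  moreover have "\<forall>\<^sub>F n in sequentially. h n < d / 2"
    using h0 d(1) by (intro order_tendstoD(2)[of h 0]) auto
  ultimately have "\<forall>\<^sub>F n in sequentially. discrete_energy L m (\<delta> n) (\<epsilon>1 n) (\<epsilon>2 n) (w n) \<le> energy L z + \<eta>"
  proof eventually_elim
    case (elim n)
    have "\<omega>' n = \<omega>" using elim(2) by (simp add: \<omega>'_def)
    then have "energy L (w n) \<le> (E + \<eta> / 3) + A * (\<eta> / (6 * A) + \<eta> / (6 * A))"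
      using w(5)[of n] tE \<omega>(2) by simp
    also have "A * (\<eta> / (6 * A) + \<eta> / (6 * A)) = \<eta> / 3" using A by (simp add: field_simps)
    finally have e: "energy L (w n) \<le> E + \<eta> / 3 + \<eta> / 3" .
    have q: "1 / (2 * a) * x \<le> (L * C\<^sup>2 / 2) * ((h n)\<^sup>2 / a)" if "0 < a" "x \<le> L * (C * h n)\<^sup>2" for a x :: real
    proof -
      have "1 / (2 * a) * x \<le> 1 / (2 * a) * (L * (C * h n)\<^sup>2)" using that by (intro mult_left_mono) auto
      then show ?thesis by (simp add: power_mult_distrib)
    qed
    show ?case
      using discrete_energy_approx[OF m pos(1)[of n] w(2)[of n], of "\<epsilon>1 n" "\<epsilon>2 n"] L e elim(1)
        q[OF pos(2) w(6), of n] q[OF pos(3) w(7), of n]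
      unfolding err_def E_def by linarith
  qed
  then show ?thesis using that da by blast
qed

section \<open>Admissibility from smooth approximations, and the conclusion\<close>

lemma integral_zero_imp_AE_zero:
  fixes f :: "real \<Rightarrow> real"
  assumes f: "integrable (leb_int L) f" "\<And>x. 0 \<le> f x"
    and le: "\<And>n. (\<integral>x. f x \<partial>leb_int L) \<le> a n" and a: "a \<longlonglongrightarrow> 0"
  shows "AE x in leb_int L. f x = 0"
proof -
  have "(\<integral>x. f x \<partial>leb_int L) \<le> 0" by (rule LIMSEQ_le_const[OF a]) (use le in auto)
  moreover have "0 \<le> (\<integral>x. f x \<partial>leb_int L)" using f by simp
  ultimately have "(\<integral>x. f x \<partial>leb_int L) = 0" by (rule antisym)
  then show ?thesis using integral_nonneg_eq_0_iff_AE[OF f(1)] f(2) by simp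
qed

text \<open>Convergence in norm and the bound on y' \<bullet> b' carry every constraint to the
  limit: each is expressed by the integral of a nonnegative function that is bounded by a null
  sequence, and continuity makes those on T and B hold everywhere. The result supplies an admissible
  frame to compare with, hence an upper bound for the discrete energies.\<close>

lemma smooth_approx_limit_admissible:
  fixes Lbc :: "framing \<Rightarrow> 'c::real_normed_vector"
  assumes L: "0 < L" and bo: "boundary_operator L Lbc" and zV: "z \<in> V L" and \<sigma>: "\<sigma> \<longlonglongrightarrow> 0"
    and sm: "\<And>n. smooth_approx_frame L Lbc lbc z (\<sigma> n) (w n)"
  shows "z \<in> admissible L Lbc lbc"
proof -
  have wA: "w n \<in> A_frame L Lbc lbc" for n using sm[of n] by (simp add: smooth_approx_frame_def)
  have wV: "w n \<in> V L" for n using wA[of n] by (cases "w n") (auto simp: A_frame_def)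
  obtain Y T B where r: "rep L z Y T (wderiv L (wderiv L (fst z))) B (wderiv L (snd z))"
    using V_rep[OF zV L] .
  define K D where "K = wderiv L (wderiv L (fst z))" and "D = wderiv L (snd z)"
  note r = r[folded K_def D_def]
  have "\<forall>n. \<exists>Y T B. rep L (w n) Y T (wderiv L (wderiv L (fst (w n)))) B (wderiv L (snd (w n)))"
    using V_rep[OF wV L] by metis
  then obtain Yn Tn Bn where rn': "\<And>n. rep L (w n) (Yn n) (Tn n) (wderiv L (wderiv L (fst (w n)))) (Bn n) (wderiv L (snd (w n)))"
    by metis
  define Kn Dn where "Kn n = wderiv L (wderiv L (fst (w n)))" and "Dn n = wderiv L (snd (w n))" for n
  have rn: "rep L (w n) (Yn n) (Tn n) (Kn n) (Bn n) (Dn n)" for n using rn'[of n] by (simp add: Kn_def Dn_def)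
  have un: "norm (Tn n x) = 1" "norm (Bn n x) = 1" "Tn n x \<bullet> Bn n x = 0" if "x \<in> {0..L}" for n x
    using wA[of n] that unfolding A_frame_rep_iff[OF rn L] by blast+
  have P: "is_prim L T K" "is_prim L B D" using r by (auto simp: rep_def)
  have Pn: "is_prim L (Tn n) (Kn n)" "is_prim L (Bn n) (Dn n)" for n using rn[of n] by (auto simp: rep_def)
  note sq = is_prim_sq_integrable[OF P(1)] is_prim_sq_integrable[OF P(2)]
  note sqn = is_prim_sq_integrable[OF Pn(1)] is_prim_sq_integrable[OF Pn(2)]
  note [measurable] = sq[THEN sq_integrableD(1)] sqn[THEN sq_integrableD(1)]
  have dT: "sq_integrable L (\<lambda>x. T x - Tn n x)" and dB: "sq_integrable L (\<lambda>x. B x - Bn n x)"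
    and dD: "sq_integrable L (\<lambda>x. D x - Dn n x)" for n
    using sq sqn by (auto intro!: sq_integrable_diff)
  define dif :: "nat \<Rightarrow> framing" where "dif n = (\<lambda>x. fst z x - fst (w n) x, \<lambda>x. snd z x - snd (w n) x)" for n
  have zz: "(fst z, snd z) \<in> V L" and ww: "(fst (w n), snd (w n)) \<in> V L" for n using zV wV by auto
  have dif_eq: "dif n = (\<lambda>x. 1 *\<^sub>R fst z x + (-1) *\<^sub>R fst (w n) x, \<lambda>x. 1 *\<^sub>R snd z x + (-1) *\<^sub>R snd (w n) x)" for n
    by (simp add: dif_def)
  note l = V_lincomb[OF zz ww L, of 1 "-1"]
  have difV: "dif n \<in> V L" for n unfolding dif_eq by (rule l)
  have nrm: "Vnorm L (dif n) \<le> \<sigma> n" "L2norm L (\<lambda>x. wderiv L (fst (w n)) x \<bullet> wderiv L (snd (w n)) x) \<le> \<sigma> n" for n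
    using sm[of n] L2norm_nonneg[of L "\<lambda>x. wderiv L (fst (w n)) x \<bullet> wderiv L (snd (w n)) x"]
      Hnorm_nonneg[of 2 L "fst (dif n)"] Hnorm_nonneg[of 1 L "snd (dif n)"]
    unfolding smooth_approx_frame_def Vnorm_def dif_def fst_conv snd_conv by linarith+
  have comp: "L2norm L (wderiv L (fst (dif n))) \<le> \<sigma> n" "L2norm L (snd (dif n)) \<le> \<sigma> n" "L2norm L (wderiv L (snd (dif n))) \<le> \<sigma> n" for n
    using nrm(1)[of n] Hnorm_components(2)[of L "fst (dif n)"] Hnorm_components(4,5)[of L "snd (dif n)"]
      Hnorm_nonneg[of 2 L "fst (dif n)"] Hnorm_nonneg[of 1 L "snd (dif n)"]
    unfolding Vnorm_def by linarith+
  have ae: "AE x in leb_int L. wderiv L (fst z) x = T x" "AE x in leb_int L. snd z x = B x"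
    using r by (auto simp: rep_def)
  have aen: "AE x in leb_int L. wderiv L (fst (w n)) x = Tn n x" "AE x in leb_int L. snd (w n) x = Bn n x" for n
    using rn[of n] by (auto simp: rep_def)
  have TT: "L2norm L (\<lambda>x. T x - Tn n x) \<le> \<sigma> n" for n
  proof -
    have "AE x in leb_int L. wderiv L (fst (dif n)) x = T x - Tn n x"
      using l(2)[of n] ae(1) aen(1)[of n] unfolding dif_eq fst_conv by eventually_elim simp
    then have "L2norm L (wderiv L (fst (dif n))) = L2norm L (\<lambda>x. T x - Tn n x)"
      by (rule L2norm_cong_AE) (use V_D(2)[OF difV] dT in \<open>auto dest: sq_integrableD\<close>)
    then show ?thesis using comp(1)[of n] by simp
  qed
  have BB: "L2norm L (\<lambda>x. B x - Bn n x) \<le> \<sigma> n" for n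
  proof -
    have "AE x in leb_int L. snd (dif n) x = B x - Bn n x"
      using ae(2) aen(2)[of n] unfolding dif_def snd_conv by eventually_elim simp
    then have "L2norm L (snd (dif n)) = L2norm L (\<lambda>x. B x - Bn n x)"
      by (rule L2norm_cong_AE) (use V_D(4)[OF difV] dB in \<open>auto dest: sq_integrableD\<close>)
    then show ?thesis using comp(2)[of n] by simp
  qed
  have DD: "L2norm L (\<lambda>x. D x - Dn n x) \<le> \<sigma> n" for n
  proof -
    have "AE x in leb_int L. wderiv L (snd (dif n)) x = D x - Dn n x"
      using l(4)[of n] unfolding dif_eq snd_conv D_def Dn_def by eventually_elim simp
    then have "L2norm L (wderiv L (snd (dif n))) = L2norm L (\<lambda>x. D x - Dn n x)"
      by (rule L2norm_cong_AE) (use V_D(5)[OF difV] dD in \<open>auto dest: sq_integrableD\<close>)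
    then show ?thesis using comp(3)[of n] by simp
  qed
  have TDn: "sq_integrable L (\<lambda>x. Tn n x \<bullet> Dn n x)" for n
  proof (rule sq_integrable_domin[OF sqn(4)[of n], where C = 1])
    have "\<bar>Tn n x \<bullet> Dn n x\<bar> \<le> 1 * norm (Dn n x)" if "x \<in> {0..L}" for x
      using Cauchy_Schwarz_ineq2[of "Tn n x" "Dn n x"] un(1)[OF that] by simp
    then show "AE x in leb_int L. norm (Tn n x \<bullet> Dn n x) \<le> 1 * norm (Dn n x)" by (intro AE_I2) auto
  qed measurable
  have TDle: "L2norm L (\<lambda>x. Tn n x \<bullet> Dn n x) \<le> \<sigma> n" for n
  proof -
    have "AE x in leb_int L. wderiv L (fst (w n)) x \<bullet> wderiv L (snd (w n)) x = Tn n x \<bullet> Dn n x"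
      using aen(1)[of n] unfolding Dn_def by eventually_elim simp
    then have "L2norm L (\<lambda>x. wderiv L (fst (w n)) x \<bullet> wderiv L (snd (w n)) x) = L2norm L (\<lambda>x. Tn n x \<bullet> Dn n x)"
      by (rule L2norm_cong_AE)
        (use sq_integrableD(1)[OF V_D(2)[OF wV[of n]]] sq_integrableD(1)[OF V_D(5)[OF wV[of n]]] TDn[of n]
          in \<open>auto dest: sq_integrableD\<close>)
    then show ?thesis using nrm(2)[of n] by simp
  qed
  have s2: "(\<lambda>n. (\<sigma> n)\<^sup>2) \<longlonglongrightarrow> 0" using \<sigma> by (auto intro!: tendsto_eq_intros)
  have unit_lim: "norm (f x) = 1"
    if f: "continuous_on {0..L} f" and fn: "\<And>n. sq_integrable L (\<lambda>x. f x - F n x)"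
      "\<And>n x. x \<in> {0..L} \<Longrightarrow> norm (F n x) = 1" "\<And>n. L2norm L (\<lambda>x. f x - F n x) \<le> \<sigma> n" and x: "x \<in> {0..L}"
    for f :: "real \<Rightarrow> real^3" and F :: "nat \<Rightarrow> real \<Rightarrow> real^3" and x
  proof -
    have c: "continuous_on {0..L} (\<lambda>x. (norm (f x) - 1)\<^sup>2)" by (intro continuous_intros f)
    have "AE x in leb_int L. (norm (f x) - 1)\<^sup>2 = 0"
    proof (rule integral_zero_imp_AE_zero[OF integrable_continuous_leb_int[OF c] _ _ s2])
      fix n
      have "(\<integral>x. (norm (f x) - 1)\<^sup>2 \<partial>leb_int L) \<le> (\<integral>x. (norm (f x - F n x))\<^sup>2 \<partial>leb_int L)"
      proof (rule integral_mono[OF integrable_continuous_leb_int[OF c] sq_integrableD(2)[OF fn(1)]])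
        fix x assume "x \<in> space (leb_int L)"
        then have "norm (F n x) = 1" using fn(2)[of x n] by auto
        then have "\<bar>norm (f x) - 1\<bar> \<le> norm (f x - F n x)" using norm_triangle_ineq3[of "f x" "F n x"] by simp
        then have "\<bar>norm (f x) - 1\<bar>\<^sup>2 \<le> (norm (f x - F n x))\<^sup>2" by (intro power_mono) auto
        then show "(norm (f x) - 1)\<^sup>2 \<le> (norm (f x - F n x))\<^sup>2" by simp
      qed
      also have "\<dots> \<le> (\<sigma> n)\<^sup>2" unfolding L2norm_power2[symmetric] using fn(3) by (intro power_mono) auto
      finally show "(\<integral>x. (norm (f x) - 1)\<^sup>2 \<partial>leb_int L) \<le> (\<sigma> n)\<^sup>2" .
    qed auto
    then have "(norm (f x) - 1)\<^sup>2 = 0" using continuous_AE_eq[OF c continuous_on_const _ L x, of 0] by simp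
    then show ?thesis by simp
  qed
  have cT: "continuous_on {0..L} T" and cB: "continuous_on {0..L} B"
    using is_prim_continuous[OF P(1)] is_prim_continuous[OF P(2)] .
  have uT: "norm (T x) = 1" if "x \<in> {0..L}" for x by (rule unit_lim[OF cT dT un(1) TT that])
  have uB: "norm (B x) = 1" if "x \<in> {0..L}" for x by (rule unit_lim[OF cB dB un(2) BB that])
  have i1: "(\<integral>x. norm (f x) \<partial>leb_int L) \<le> sqrt L * \<sigma> n" if "sq_integrable L f" "L2norm L f \<le> \<sigma> n"
    for f :: "real \<Rightarrow> 'd::euclidean_space" and n
    using order_trans[OF integral_norm_le_L2norm[OF that(1)] mult_left_mono[OF that(2)]] L by simp
  have "AE x in leb_int L. \<bar>T x \<bullet> B x\<bar> = 0"
  proof (rule integral_zero_imp_AE_zero[where a = "\<lambda>n. sqrt L * \<sigma> n + sqrt L * \<sigma> n"])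
    show i: "integrable (leb_int L) (\<lambda>x. \<bar>T x \<bullet> B x\<bar>)" using sq_integrable_inner(1)[OF sq(1,3)] by simp
    fix n
    note j = integrable_norm[OF sq_integrable_imp_integrable[OF dT[of n]]] integrable_norm[OF sq_integrable_imp_integrable[OF dB[of n]]]
    have "(\<integral>x. \<bar>T x \<bullet> B x\<bar> \<partial>leb_int L) \<le> (\<integral>x. norm (T x - Tn n x) + norm (B x - Bn n x) \<partial>leb_int L)"
    proof (rule integral_mono[OF i Bochner_Integration.integrable_add[OF j]])
      fix x assume "x \<in> space (leb_int L)"
      then have x: "x \<in> {0..L}" by auto
      have "T x \<bullet> B x = (T x - Tn n x) \<bullet> B x + Tn n x \<bullet> (B x - Bn n x)"
        using un(3)[OF x, of n] by (simp add: inner_diff_left inner_diff_right)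
      then show "\<bar>T x \<bullet> B x\<bar> \<le> norm (T x - Tn n x) + norm (B x - Bn n x)"
        using Cauchy_Schwarz_ineq2[of "T x - Tn n x" "B x"] Cauchy_Schwarz_ineq2[of "Tn n x" "B x - Bn n x"]
          uB[OF x] un(1)[OF x, of n] by simp
    qed
    also have "\<dots> \<le> sqrt L * \<sigma> n + sqrt L * \<sigma> n"
      unfolding Bochner_Integration.integral_add[OF j] by (intro add_mono i1 dT dB TT BB)
    finally show "(\<integral>x. \<bar>T x \<bullet> B x\<bar> \<partial>leb_int L) \<le> sqrt L * \<sigma> n + sqrt L * \<sigma> n" .
  qed (use \<sigma> in \<open>auto intro!: tendsto_eq_intros\<close>)
  then have "T x \<bullet> B x = 0" if "x \<in> {0..L}" for x
    using continuous_AE_eq[of L "\<lambda>x. T x \<bullet> B x" "\<lambda>x. 0" x] cT cB L that by (auto intro: continuous_intros)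
  moreover have "AE x in leb_int L. \<bar>T x \<bullet> D x\<bar> = 0"
  proof (rule integral_zero_imp_AE_zero[where a = "\<lambda>n. \<sigma> n * L2norm L D + sqrt L * \<sigma> n + sqrt L * \<sigma> n"])
    show i: "integrable (leb_int L) (\<lambda>x. \<bar>T x \<bullet> D x\<bar>)" using sq_integrable_inner(1)[OF sq(1,4)] by simp
    fix n
    note j = sq_integrable_norm_mult[OF dT[of n] sq(4)] integrable_norm[OF sq_integrable_imp_integrable[OF dD[of n]]]
      integrable_norm[OF sq_integrable_imp_integrable[OF TDn[of n]]]
    have "(\<integral>x. \<bar>T x \<bullet> D x\<bar> \<partial>leb_int L)
        \<le> (\<integral>x. norm (T x - Tn n x) * norm (D x) + norm (D x - Dn n x) + norm (Tn n x \<bullet> Dn n x) \<partial>leb_int L)"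
    proof (rule integral_mono[OF i Bochner_Integration.integrable_add[OF Bochner_Integration.integrable_add[OF j(1,3)] j(4)]])
      fix x assume "x \<in> space (leb_int L)"
      then have x: "x \<in> {0..L}" by auto
      have "T x \<bullet> D x = (T x - Tn n x) \<bullet> D x + Tn n x \<bullet> (D x - Dn n x) + Tn n x \<bullet> Dn n x"
        by (simp add: inner_diff_left inner_diff_right)
      then show "\<bar>T x \<bullet> D x\<bar> \<le> norm (T x - Tn n x) * norm (D x) + norm (D x - Dn n x) + norm (Tn n x \<bullet> Dn n x)"
        using Cauchy_Schwarz_ineq2[of "T x - Tn n x" "D x"] Cauchy_Schwarz_ineq2[of "Tn n x" "D x - Dn n x"]
          un(1)[OF x, of n] by simp
    qed
    also have "\<dots> \<le> \<sigma> n * L2norm L D + sqrt L * \<sigma> n + sqrt L * \<sigma> n"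
      unfolding Bochner_Integration.integral_add[OF Bochner_Integration.integrable_add[OF j(1,3)] j(4)]
        Bochner_Integration.integral_add[OF j(1,3)]
      using order_trans[OF j(2) mult_right_mono[OF TT[of n] L2norm_nonneg]]
      by (intro add_mono i1 dD TDn DD TDle) auto
    finally show "(\<integral>x. \<bar>T x \<bullet> D x\<bar> \<partial>leb_int L) \<le> \<sigma> n * L2norm L D + sqrt L * \<sigma> n + sqrt L * \<sigma> n" .
  qed (use \<sigma> in \<open>auto intro!: tendsto_eq_intros\<close>)
  moreover have "Lbc z = lbc"
  proof -
    have bl: "bounded_linear_V L Lbc" using bo by (simp add: boundary_operator_def)
    then obtain A where A: "\<And>v. v \<in> V L \<Longrightarrow> norm (Lbc v) \<le> A * Vnorm L v"
      unfolding bounded_linear_V_def by blast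
    have wlbc: "Lbc (w n) = lbc" for n using wA[of n] by (auto simp: A_frame_def)
    have "Lbc (dif n) = 1 *\<^sub>R Lbc (fst z, snd z) + (-1) *\<^sub>R Lbc (fst (w n), snd (w n))" for n
      unfolding dif_eq using bl zz ww unfolding bounded_linear_V_def by blast
    then have "Lbc (dif n) = Lbc z - lbc" for n using wlbc by simp
    then have "norm (Lbc z - lbc) \<le> \<bar>A\<bar> * \<sigma> n" for n
    proof -
      have V0: "0 \<le> Vnorm L (dif n)" by (simp add: Vnorm_def)
      have "norm (Lbc z - lbc) \<le> A * Vnorm L (dif n)" using A[OF difV[of n]] \<open>\<And>n. Lbc (dif n) = Lbc z - lbc\<close> by simp
      also have "\<dots> \<le> \<bar>A\<bar> * \<sigma> n" using nrm(1)[of n] V0 by (intro mult_mono) auto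
      finally show ?thesis .
    qed
    moreover have "(\<lambda>n. \<bar>A\<bar> * \<sigma> n) \<longlonglongrightarrow> 0" using \<sigma> by (auto intro!: tendsto_eq_intros)
    ultimately have "norm (Lbc z - lbc) \<le> 0" by (intro LIMSEQ_le_const) auto
    then show ?thesis by simp
  qed
  ultimately show ?thesis
    unfolding admissible_rep_iff[OF r L] using uT uB by auto
qed

text \<open>The tangent has unit length, so its L2 norm alone is sqrt L. Thus the last term of the
  rate hypothesis dominates L h^2 / \<epsilon>2.\<close>

lemma frame_size_ge:
  assumes L: "0 < L" and w: "w \<in> A_frame L Lbc lbc"
  shows "sqrt L \<le> frame_size L w"
proof -
  have V: "w \<in> V L" using w by (auto simp: A_frame_def)
  have "AE x in leb_int L. rotation_matrix (frame_matrix (wderiv L (fst w) x) (snd w x))"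
    using w by (auto simp: A_frame_def)
  then have "AE x in leb_int L. (norm (wderiv L (fst w) x))\<^sup>2 = 1"
    by eventually_elim (simp add: rotation_frame_matrix_iff)
  then have "(\<integral>x. (norm (wderiv L (fst w) x))\<^sup>2 \<partial>leb_int L) = (\<integral>x. 1 \<partial>leb_int L)"
    using sq_integrableD(1)[OF V_D(2)[OF V]] by (intro integral_cong_AE) auto
  also have "\<dots> = L" using integral_const_leb_int[of L "1::real"] L by simp
  finally have "L2norm L (wderiv L (fst w)) = sqrt L" by (simp add: L2norm_def)
  moreover have "L2norm L (wderiv L (fst w)) \<le> Hnorm 3 L (fst w)" using Hnorm_ge[of 1 3 L "fst w"] by simp
  ultimately show ?thesis using Hnorm_nonneg[of 2 L "snd w"] unfolding frame_size_def by linarith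
qed

theorem corollary4p3:
  fixes L :: real
    and Lbc :: "framing \<Rightarrow> 'c::real_normed_vector" and lbc :: 'c
    and m :: "real \<Rightarrow> real \<Rightarrow> real" and c0 c1 c2 cuni :: real
    and N :: "nat \<Rightarrow> nat" and X :: "nat \<Rightarrow> nat \<Rightarrow> real"
    and h \<delta> \<epsilon>1 \<epsilon>2 tol :: "nat \<Rightarrow> real"
    and v :: "nat \<Rightarrow> framing"
  assumes "0 < L"
    and "boundary_operator L Lbc"
    and "regularized_modulus m c0 c1 c2 cuni"
    and "\<And>n. is_partition L (N n) (X n) (h n)"
    and "quasiuniform N X h"
    and "\<And>n. 0 < \<delta> n" and "\<And>n. 0 < \<epsilon>1 n" and "\<And>n. 0 < \<epsilon>2 n"
    and "h \<longlonglongrightarrow> 0" and "\<delta> \<longlonglongrightarrow> 0" and "\<epsilon>1 \<longlonglongrightarrow> 0" and "\<epsilon>2 \<longlonglongrightarrow> 0"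
    and "tol \<longlonglongrightarrow> 0"
    and "\<And>n. minimizer_up_to L Lbc lbc m (N n) (X n) (\<delta> n) (\<epsilon>1 n) (\<epsilon>2 n) (tol n) (v n)"
    and "\<exists>w. weak_accumulation_point L v w \<and>
           (\<exists>\<sigma> w\<sigma>. (\<forall>n. 0 < \<sigma> n) \<and> \<sigma> \<longlonglongrightarrow> 0 \<and>
              (\<forall>n. smooth_approx_frame L Lbc lbc w (\<sigma> n) (w\<sigma> n)) \<and>
              (\<lambda>n. (h n)\<^sup>2 / \<epsilon>1 n + (\<sigma> n)\<^sup>2 / \<epsilon>2 n
                    + (h n)\<^sup>2 * (frame_size L (w\<sigma> n))\<^sup>2 / \<epsilon>2 n) \<longlonglongrightarrow> 0)"
  shows "\<forall>u. weak_accumulation_point L v u \<longrightarrow> is_minimizer L Lbc lbc u"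
proof (intro allI impI)
  fix u assume u: "weak_accumulation_point L v u"
  note L = assms(1) and bo = assms(2) and m = assms(3) and p = assms(4)
  note pos = assms(6-8) and lim0 = assms(9-12)
  obtain z \<sigma> w\<sigma> where zV: "z \<in> V L" and \<sigma>: "\<sigma> \<longlonglongrightarrow> 0"
    and sm: "\<And>n. smooth_approx_frame L Lbc lbc z (\<sigma> n) (w\<sigma> n)"
    and rate: "(\<lambda>n. (h n)\<^sup>2 / \<epsilon>1 n + (\<sigma> n)\<^sup>2 / \<epsilon>2 n + (h n)\<^sup>2 * (frame_size L (w\<sigma> n))\<^sup>2 / \<epsilon>2 n) \<longlonglongrightarrow> 0"
    using assms(15) by (auto simp: weak_accumulation_point_def)
  have z: "z \<in> admissible L Lbc lbc" by (rule smooth_approx_limit_admissible[OF L bo zV \<sigma> sm])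
  define \<rho> where "\<rho> n = (h n)\<^sup>2 / \<epsilon>1 n + (\<sigma> n)\<^sup>2 / \<epsilon>2 n + (h n)\<^sup>2 * (frame_size L (w\<sigma> n))\<^sup>2 / \<epsilon>2 n" for n
  have \<rho>0: "\<rho> \<longlonglongrightarrow> 0" using rate by (simp add: \<rho>_def[abs_def])
  have n0: "0 \<le> (h n)\<^sup>2 / \<epsilon>1 n" "0 \<le> (\<sigma> n)\<^sup>2 / \<epsilon>2 n" "0 \<le> (h n)\<^sup>2 / \<epsilon>2 n"
    "0 \<le> (h n)\<^sup>2 * (frame_size L (w\<sigma> n))\<^sup>2 / \<epsilon>2 n" for n
    using pos(2,3)[of n] by auto
  have r1: "(\<lambda>n. (h n)\<^sup>2 / \<epsilon>1 n) \<longlonglongrightarrow> 0"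
  proof (rule real_tendsto_sandwich[OF _ _ tendsto_const \<rho>0])
    show "\<forall>\<^sub>F n in sequentially. (h n)\<^sup>2 / \<epsilon>1 n \<le> \<rho> n"
      unfolding \<rho>_def using n0(2,4) by (simp add: add_nonneg_nonneg add.assoc)
  qed (use n0 in auto)
  have r2: "(\<lambda>n. (h n)\<^sup>2 / \<epsilon>2 n) \<longlonglongrightarrow> 0"
  proof (rule real_tendsto_sandwich[OF _ _ tendsto_const])
    have "(h n)\<^sup>2 / \<epsilon>2 n \<le> \<rho> n / L" for n
    proof -
      have wA: "w\<sigma> n \<in> A_frame L Lbc lbc" using sm[of n] by (simp add: smooth_approx_frame_def)
      have "(sqrt L)\<^sup>2 \<le> (frame_size L (w\<sigma> n))\<^sup>2"
        using L by (intro power_mono frame_size_ge[OF L wA]) simp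
      then have "(h n)\<^sup>2 / \<epsilon>2 n * L \<le> (h n)\<^sup>2 / \<epsilon>2 n * (frame_size L (w\<sigma> n))\<^sup>2"
        using n0(3) L by (intro mult_left_mono) auto
      also have "\<dots> \<le> \<rho> n" unfolding \<rho>_def using n0(1,2)[of n] by simp
      finally show ?thesis using L by (simp add: pos_le_divide_eq)
    qed
    then show "\<forall>\<^sub>F n in sequentially. (h n)\<^sup>2 / \<epsilon>2 n \<le> \<rho> n / L" by simp
    show "(\<lambda>n. \<rho> n / L) \<longlonglongrightarrow> 0" using tendsto_divide[OF \<rho>0 tendsto_const, of L] L by simp
  qed (use n0 in auto)
  obtain r where uV: "u \<in> V L" and r: "strict_mono r" and weak: "weakly_tendsto_V L (v \<circ> r) u"
    using u by (auto simp: weak_accumulation_point_def)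
  \<comment> \<open>The competitor y is arbitrary. Its recovery frames have discrete energy at most
    \<open>energy L y\<close> + \<eta> / 2 eventually; near-minimality passes this bound to v, with
    the tolerance absorbing the other \<eta> / 2, and the weak limit inherits it.\<close>
  have key: "u \<in> admissible L Lbc lbc \<and> energy L u \<le> energy L y + \<eta>"
    if y: "y \<in> admissible L Lbc lbc" and \<eta>: "0 < \<eta>" for y \<eta>
  proof -
    obtain w where w: "\<And>n. w n \<in> discrete_admissible L Lbc lbc (N n) (X n)"
      and ew: "\<forall>\<^sub>F n in sequentially. discrete_energy L m (\<delta> n) (\<epsilon>1 n) (\<epsilon>2 n) (w n) \<le> energy L y + \<eta> / 2"
      using recovery_sequence[OF L bo m p pos lim0(1,2) r1 r2 y, of "\<eta> / 2"] \<eta> by auto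
    have "\<forall>\<^sub>F n in sequentially. tol n < \<eta> / 2" 
      by (rule order_tendstoD(2)[OF assms(13)]) (use \<eta> in simp)
    with ew have "\<forall>\<^sub>F n in sequentially. discrete_energy L m (\<delta> n) (\<epsilon>1 n) (\<epsilon>2 n) (v n) \<le> energy L y + \<eta>"
    proof eventually_elim
      case (elim n)
      have "discrete_energy L m (\<delta> n) (\<epsilon>1 n) (\<epsilon>2 n) (v n)
          \<le> discrete_energy L m (\<delta> n) (\<epsilon>1 n) (\<epsilon>2 n) (w n) + tol n"
        using assms(14)[of n] w[of n] by (simp add: minimizer_up_to_def)
      then show ?case using elim by simp
    qed
    then obtain n1 where n1: "\<And>n. n1 \<le> n \<Longrightarrow> discrete_energy L m (\<delta> n) (\<epsilon>1 n) (\<epsilon>2 n) (v n) \<le> energy L y + \<eta>"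
      by (auto simp: eventually_sequentially)
    \<comment> \<open>\<open>limit_of_discrete_frames\<close> wants the energy bound for every
      index, so the subsequence is shifted past \<open>n1\<close>.\<close>
    define s where "s n = r (n + n1)" for n
    have s: "strict_mono s" unfolding s_def using r by (simp add: strict_mono_def)
    have sn: "n1 \<le> s n" for n
      using seq_suble[OF r, of "n + n1"] by (simp add: s_def)
    have "weakly_tendsto_V L (\<lambda>n. v (s n)) u"
      unfolding weakly_tendsto_V_def
    proof (intro allI impI)
      fix F :: "framing \<Rightarrow> real" assume "bounded_linear_V L F"
      then have "(\<lambda>n. F ((v \<circ> r) n)) \<longlonglongrightarrow> F u" using weak by (simp add: weakly_tendsto_V_def)
      then show "(\<lambda>n. F (v (s n))) \<longlonglongrightarrow> F u" unfolding s_def o_def by (rule LIMSEQ_ignore_initial_segment)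
    qed
    note ss = LIMSEQ_subseq_LIMSEQ[OF _ s, unfolded o_def]
    have va: "v n \<in> discrete_admissible L Lbc lbc (N n) (X n)" for n
      using assms(14)[of n] by (simp add: minimizer_up_to_def)
    show ?thesis
      using limit_of_discrete_frames[OF L bo m p[of "s _"] pos(1)[of "s _"] pos(2)[of "s _"] pos(3)[of "s _"]
          ss[OF lim0(1)] ss[OF lim0(2)] ss[OF lim0(3)] ss[OF lim0(4)] va[of "s _"]
          \<open>weakly_tendsto_V L (\<lambda>n. v (s n)) u\<close> uV n1[OF sn]]
      by blast
  qed
  have "energy L u \<le> energy L y" if "y \<in> admissible L Lbc lbc" for y
    by (rule field_le_epsilon) (use key[OF that] in blast)
  \<comment> \<open>Admissibility of u is read off from the comparison with z, whose own
    admissibility rests on the smooth approximations; 1 is an arbitrary tolerance.\<close>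
  then show "is_minimizer L Lbc lbc u"
    using key[OF z, of 1] by (auto simp: is_minimizer_def)
qed


end
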